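(* Let a series $\sum_{j=0}^\infty u_j$ of distributions $u_j\in\mathcal{S}'(\mathbb{R}^n)$ be given together with numbers $s\in\mathbb{R}$ and $p,q\in\,]0,\infty]$, and consider $$B:=\Big(\sum_{j=0}^\infty 2^{sjq}\|u_j\|_{L_p}^q\Big)^{1/q}$$ as a constant in $[0,\infty]$ (with supremum over $j$ if $q=\infty$). Then the following assertion is valid: (i) If $s=0$, $1\le p\le\infty$ and $q\le1$, then $B<\infty$ implies that $\sum u_j$ converges in $L_p(\mathbb{R}^n)$ to a sum $u(x)$ for which $\|u\|_{L_p}\le B$ holds. In addition, suppose that for some $A>0$ the spectral condition $$\operatorname{supp}\mathcal{F}u_j\subset\{\xi\in\mathbb{R}^n\mid|\xi|\le A2^j\}\qquad( * )$$ is satisfied by each $u_j$, $j\ge0$. Then one has: (ii) If $s>\max(0,\frac np-n)$, then $B<\infty$ implies convergence of $\sum u_j$ in $\mathcal{S}'(\mathbb{R}^n)$ to a limit $u(x)$ in $B^s_{p,q}(\mathbb{R}^n)$ for which $\|u\|_{B^s_{p,q}}\le cB$ holds for some constant $c=c(n,s,p,q,A)$. (iii) If $s=\frac np-n$, $p\in\,]0,1[$ and $q\in\,]0,1]$, then $B<\infty$ implies convergence of $\sum u_j$ in $L_1(\mathbb{R}^n)$ to a limit $u(x)$ in $L_1$ for which $\|u\|_{L_1}\le cB$ holds for some constant $c=c(n,p,q,A)$. Moreover, there is then a constant $c=c(n,p,q,A)$ such that $$u\in B^{\frac np-n}_{p,\infty}(\mathbb{R}^n)\quad\text{and}\quad\|u\|_{B^{\frac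 np-n}_{p,\infty}}\le cB,\quad\text{when } q\le p<1,$$ $$u\in B^{\frac nq-n}_{q,\infty}(\mathbb{R}^n)\quad\text{and}\quad\|u\|_{B^{\frac nq-n}_{q,\infty}}\le cB,\quad\text{when } p<q\le1.$$ (iv) Furthermore, if, in addition to $( * )$ for $j\ge0$, the stronger condition $$\operatorname{supp}\mathcal{F}u_j\subset\{\xi\in\mathbb{R}^n\mid\tfrac1A2^j\le|\xi|\le A2^j\}$$ holds for every $j>0$, then the assertion in (ii) holds even for all $s\in\mathbb{R}$: that is, for every $s\in\mathbb{R}$ and $p,q\in\,]0,\infty]$, $B<\infty$ implies convergence of $\sum u_j$ in $\mathcal{S}'(\mathbb{R}^n)$ to a limit $u(x)$ in $B^s_{p,q}(\mathbb{R}^n)$ with $\|u\|_{B^s_{p,q}}\le cB$ for some constant $c=c(n,s,p,q,A)$.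
   Context: $n$ is a positive integer. $\mathcal{S}'(\mathbb{R}^n)$ is the space of tempered distributions, and $\mathcal{F}u=\hat u$ is the Fourier transform. $\|u_j\|_{L_p}$ is the (quasi-)norm in $L_p(\mathbb{R}^n)$, understood as $+\infty$ if $u_j\notin L_p(\mathbb{R}^n)$. Besov spaces: let $\Psi\colon\mathbb{R}\to\mathbb{R}$ be a $C^\infty$ function with $\Psi(t)=1$ for $t<11/10$ and $\Psi(t)=0$ for $t>13/10$. Put $\Psi_j(\xi)=\Psi(2^{-j}|\xi|)$ for $j\ge0$, $\Phi_0=\Psi_0$ and $\Phi_j=\Psi_j-\Psi_{j-1}$ for $j\ge1$, so that $1=\sum_{j\ge0}\Phi_j$ on $\mathbb{R}^n$. For $s\in\mathbb{R}$ and $p,q\in\,]0,\infty]$, $B^s_{p,q}(\mathbb{R}^n)$ is the set of $u\in\mathcal{S}'(\mathbb{R}^n)$ with $$\|u\|_{B^s_{p,q}}=\Big(\sum_{k=0}^\infty 2^{skq}\|\mathcal{F}^{-1}(\Phi_k\hat u)\|_{L_p}^q\Big)^{1/q}<\infty$$ (supremum over $k$ if $q=\infty$). *)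

theory Defs
  imports "HOL-Analysis.Analysis" "HOL-Probability.Essential_Supremum"
begin

section \<open>Schwartz functions and test functions on \<open>\<real>\<^sup>n\<close>\<close>

definition partial_deriv :: "'n::finite \<Rightarrow> ((real^'n) \<Rightarrow> complex) \<Rightarrow> (real^'n) \<Rightarrow> complex"
  where "partial_deriv i f x = frechet_derivative f (at x) (axis i 1)"

text \<open>The list \<open>I\<close> is a sequence of coordinate directions; it plays the role of a
  multi-index of order \<open>length I\<close>.\<close>

definition iter_deriv :: "'n::finite list \<Rightarrow> ((real^'n) \<Rightarrow> complex) \<Rightarrow> (real^'n) \<Rightarrow> complex"
  where "iter_deriv I f = fold partial_deriv I f"

definition smooth :: "((real^'n::finite) \<Rightarrow> complex) \<Rightarrow> bool"
  where "smooth f \<longleftrightarrow> (\<forall>I. iter_deriv I f differentiable_on UNIV)"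

definition schwartz :: "((real^'n::finite) \<Rightarrow> complex) set"
  where "schwartz = {\<phi>. smooth \<phi> \<and>
    (\<forall>I k. bounded (range (\<lambda>x. (1 + norm x) ^ k *\<^sub>R iter_deriv I \<phi> x)))}"

definition schwartz_norm :: "nat \<Rightarrow> ((real^'n::finite) \<Rightarrow> complex) \<Rightarrow> real"
  where "schwartz_norm N \<phi> =
    (SUP (I, x) \<in> {I. length I \<le> N} \<times> UNIV. (1 + norm x) ^ N * norm (iter_deriv I \<phi> x))"

definition test_functions :: "(real^'n::finite) set \<Rightarrow> ((real^'n) \<Rightarrow> complex) set"
  where "test_functions U = {\<phi>. smooth \<phi> \<and> compact (closure {x. \<phi> x \<noteq> 0}) \<and> closure {x. \<phi> x \<noteq> 0} \<subseteq> U}"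

section \<open>Tempered distributions\<close>

text \<open>A tempered distribution is represented by a functional on all functions, of which only the
  values on \<^const>\<open>schwartz\<close> matter. The norms \<^const>\<open>schwartz_norm\<close> increase with \<open>N\<close>, so
  an estimate by a single one of them is continuity for the usual topology of the Schwartz
  space.\<close>

type_synonym 'n functional = "((real^'n) \<Rightarrow> complex) \<Rightarrow> complex"

definition tempered :: "'n::finite functional \<Rightarrow> bool"
  where "tempered u \<longleftrightarrow>
    (\<forall>\<phi>\<in>schwartz. \<forall>\<psi>\<in>schwartz. \<forall>a b. u (\<lambda>x. a * \<phi> x + b * \<psi> x) = a * u \<phi> + b * u \<psi>) \<and>
    (\<exists>C N. \<forall>\<phi>\<in>schwartz. norm (u \<phi>) \<le> C * schwartz_norm N \<phi>)"

text \<open>Convergence of a series in the weak-star topology. For sequences this agrees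
  with convergence in the strong dual topology.\<close>

definition tempered_sums :: "(nat \<Rightarrow> 'n::finite functional) \<Rightarrow> 'n functional \<Rightarrow> bool"
  where "tempered_sums u v \<longleftrightarrow> (\<forall>\<phi>\<in>schwartz. (\<lambda>j. u j \<phi>) sums v \<phi>)"

definition dist_support :: "'n::finite functional \<Rightarrow> (real^'n) set"
  where "dist_support u = - \<Union>{U. open U \<and> (\<forall>\<phi>\<in>test_functions U. u \<phi> = 0)}"

definition fourier :: "((real^'n::finite) \<Rightarrow> complex) \<Rightarrow> (real^'n) \<Rightarrow> complex"
  where "fourier \<phi> \<xi> = (LINT x|lborel. exp (- \<i> * of_real (x \<bullet> \<xi>)) * \<phi> x)"

definition inv_fourier :: "((real^'n::finite) \<Rightarrow> complex) \<Rightarrow> (real^'n) \<Rightarrow> complex"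
  where "inv_fourier \<phi> x =
    (LINT \<xi>|lborel. exp (\<i> * of_real (x \<bullet> \<xi>)) * \<phi> \<xi>) / of_real ((2 * pi) ^ CARD('n))"

definition dist_fourier :: "'n::finite functional \<Rightarrow> 'n functional"
  where "dist_fourier u \<phi> = u (fourier \<phi>)"

definition dist_inv_fourier :: "'n::finite functional \<Rightarrow> 'n functional"
  where "dist_inv_fourier u \<phi> = u (inv_fourier \<phi>)"

definition dist_mult :: "((real^'n::finite) \<Rightarrow> real) \<Rightarrow> 'n functional \<Rightarrow> 'n functional"
  where "dist_mult m u \<phi> = u (\<lambda>x. of_real (m x) * \<phi> x)"

section \<open>\<open>L\<^sub>p\<close> quasi-norms of distributions\<close>

text \<open>\<open>x\<^sup>a\<close> on \<open>[0,\<infinity>]\<close> for real \<open>a > 0\<close>.\<close>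

definition epowr :: "ennreal \<Rightarrow> real \<Rightarrow> ennreal"
  where "epowr x a = (if x = \<infinity> then \<infinity> else ennreal (enn2real x powr a))"

definition fun_Lp_norm :: "ennreal \<Rightarrow> ((real^'n::finite) \<Rightarrow> complex) \<Rightarrow> ennreal"
  where "fun_Lp_norm p f =
    (if p = \<infinity> then esssup lborel (\<lambda>x. ennreal (norm (f x)))
     else epowr (\<integral>\<^sup>+ x. epowr (ennreal (norm (f x))) (enn2real p) \<partial>lborel) (1 / enn2real p))"

definition represents :: "((real^'n::finite) \<Rightarrow> complex) \<Rightarrow> 'n functional \<Rightarrow> bool"
  where "represents f u \<longleftrightarrow>
    f \<in> borel_measurable borel \<and> (\<forall>K. compact K \<longrightarrow> set_integrable lborel K f) \<and>
    (\<forall>\<phi>\<in>test_functions UNIV. u \<phi> = (LINT x|lborel. f x * \<phi> x))"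

text \<open>A locally integrable \<open>f\<close> representing \<open>u\<close> is unique almost everywhere, so the infimum is
  over at most one value; it is \<open>\<infinity>\<close> if there is no such \<open>f\<close>.\<close>

definition Lp_norm :: "ennreal \<Rightarrow> 'n::finite functional \<Rightarrow> ennreal"
  where "Lp_norm p u = (INF f \<in> {f. represents f u}. fun_Lp_norm p f)"

definition Lp_space :: "ennreal \<Rightarrow> 'n::finite functional set"
  where "Lp_space p = {u. tempered u \<and> Lp_norm p u < \<infinity>}"

definition Lp_sums :: "ennreal \<Rightarrow> (nat \<Rightarrow> 'n::finite functional) \<Rightarrow> 'n functional \<Rightarrow> bool"
  where "Lp_sums p u v \<longleftrightarrow>
    (\<forall>j. u j \<in> Lp_space p) \<and> v \<in> Lp_space p \<and>
    (\<lambda>N. Lp_norm p (\<lambda>\<phi>. (\<Sum>j<N. u j \<phi>) - v \<phi>)) \<longlonglongrightarrow> 0"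

section \<open>Besov spaces\<close>

definition weighted_lq :: "real \<Rightarrow> ennreal \<Rightarrow> (nat \<Rightarrow> ennreal) \<Rightarrow> ennreal"
  where "weighted_lq s q a =
    (if q = \<infinity> then (SUP j. ennreal (2 powr (s * real j)) * a j)
     else epowr (\<Sum>j. ennreal (2 powr (s * real j * enn2real q)) * epowr (a j) (enn2real q))
            (1 / enn2real q))"

text \<open>The constant \<open>B\<close> attached to a series \<open>\<Sum>j. u j\<close>.\<close>

definition series_bound :: "real \<Rightarrow> ennreal \<Rightarrow> ennreal \<Rightarrow> (nat \<Rightarrow> 'n::finite functional) \<Rightarrow> ennreal"
  where "series_bound s p q u = weighted_lq s q (\<lambda>j. Lp_norm p (u j))"

definition besov_cutoff :: "(real \<Rightarrow> real) \<Rightarrow> bool"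
  where "besov_cutoff \<Psi> \<longleftrightarrow>
    (\<forall>k. (deriv ^^ k) \<Psi> differentiable_on UNIV) \<and>
    (\<forall>t. t < 11/10 \<longrightarrow> \<Psi> t = 1) \<and> (\<forall>t. t > 13/10 \<longrightarrow> \<Psi> t = 0)"

definition dyadic :: "(real \<Rightarrow> real) \<Rightarrow> nat \<Rightarrow> (real^'n::finite) \<Rightarrow> real"
  where "dyadic \<Psi> k \<xi> =
    (if k = 0 then \<Psi> (norm \<xi>) else \<Psi> (norm \<xi> / 2 ^ k) - \<Psi> (norm \<xi> / 2 ^ (k - 1)))"

definition besov_norm :: "(real \<Rightarrow> real) \<Rightarrow> real \<Rightarrow> ennreal \<Rightarrow> ennreal \<Rightarrow> 'n::finite functional \<Rightarrow> ennreal"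
  where "besov_norm \<Psi> s p q u =
    weighted_lq s q (\<lambda>k. Lp_norm p (dist_inv_fourier (dist_mult (dyadic \<Psi> k) (dist_fourier u))))"

definition besov :: "(real \<Rightarrow> real) \<Rightarrow> real \<Rightarrow> ennreal \<Rightarrow> ennreal \<Rightarrow> 'n::finite functional set"
  where "besov \<Psi> s p q = {u. tempered u \<and> besov_norm \<Psi> s p q u < \<infinity>}"

text \<open>The real number \<open>1/p\<close> for \<open>p \<in> ]0,\<infinity>]\<close>, with \<open>1/\<infinity> = 0\<close>.\<close>

definition recip :: "ennreal \<Rightarrow> real"
  where "recip p = enn2real (1 / p)"

end

theory Submission
  imports Defs "HOL-Probability.Characteristic_Functions" "HOL-Probability.Sinc_Integral"
begin

text \<open>
  A distribution with finite \<open>L\<^sub>p\<close> quasi-norm and compact spectrum is a band-limited function. Peetre's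
  maximal inequality yields for such functions the Nikolskii inequality and a bound for Fourier
  multipliers living at a lower frequency \<open>2 ^ k \<le> A * 2 ^ j\<close>, with a loss of
  \<open>2 powr ((n / p - n) * (j - k))\<close> when \<open>p < 1\<close>. The spectral conditions leave in the \<open>k\<close>-th
  Littlewood--Paley piece of the sum only the terms with \<open>j \<ge> k - h\<close>, respectively
  \<open>\<bar>j - k\<bar> \<le> h\<close>, so that the Besov quasi-norm of the sum is that of a discrete convolution of the
  weighted norms of the terms; its kernel decays geometrically in (ii) and (iv), whereas in the
  limiting case (iii) it is only bounded, which forces the supremum over \<open>k\<close>. In (ii) and (iii) the
  series converges absolutely in \<open>L\<^sub>r\<close> with \<open>r = max 1 p\<close>, again by the Nikolskii inequality. In (iv)
  the term \<open>u\<^sub>j\<close> meets a test function only through its Fourier transform at frequencies of size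
  \<open>2 ^ j\<close>, which decays faster than any power of \<open>2 ^ j\<close>.
\<close>

section \<open>Powers of extended nonnegative reals\<close>

text \<open>For p < 1 no multiplier bound holds for arbitrary functions: a kernel estimate controls
  an L_1 quantity, and only the reproducing formula of a band-limited g turns it into an L_p
  quantity times the power 1 - p of a supremum. That supremum must be finite before it can be
  divided out, while a priori g only grows like (1 + |x|)^N, with N the order of the distribution.
  Hence the maximal inequality is run twice: with the weight exponent N, whose constant depends on
  g, just to learn that g is bounded; then with an exponent depending on n and p alone, which gives
  uniform constants. All shells and bands being dilates of fixed bumps, the constants are uniform in
  j and k too.

  A second obstacle is that \<open>Lp_norm\<close> is an infimum over locally integrable
  representatives. It can be computed from the band-limited function because representatives agree
  almost everywhere, which is shown by testing against smooth approximations of boxes built from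
  \<Psi> itself.

  In (iii) the two Besov claims are one statement with an auxiliary Lebesgue exponent t = max(p, q):
  the terms are first moved from L_p to L_t by the Nikolskii inequality.\<close>

lemma epowr_top [simp]: "epowr top a = top"
  by (simp add: epowr_def)

lemma epowr_zero [simp]: "epowr 0 a = 0"
  by (simp add: epowr_def)

lemma epowr_ennreal: "0 \<le> c \<Longrightarrow> epowr (ennreal c) a = ennreal (c powr a)"
  by (simp add: epowr_def)

lemma epowr_one [simp]: "epowr 1 a = 1"
  using epowr_ennreal[of 1 a] by simp

lemma epowr_exp_one [simp]: "epowr x 1 = x"
  by (cases x) (auto simp: epowr_ennreal)

lemma epowr_eq_top_iff [simp]: "epowr x a = top \<longleftrightarrow> x = top"
  by (auto simp: epowr_def)

lemma epowr_less_top_iff [simp]: "epowr x a < top \<longleftrightarrow> x < top"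
  by (auto simp: less_top[symmetric])

lemma epowr_eq_0_iff [simp]: "epowr x a = 0 \<longleftrightarrow> x = 0"
  by (cases x) (auto simp: epowr_ennreal)

lemma epowr_mono:
  assumes "0 \<le> a" "x \<le> y" shows "epowr x a \<le> epowr y a"
  using assms by (cases x; cases y) (auto simp: epowr_ennreal top_unique intro!: powr_mono2 ennreal_leI)

lemma epowr_mult:
  shows "epowr (x * y) a = epowr x a * epowr y a"
  by (cases x; cases y; cases "x = 0"; cases "y = 0")
    (auto simp: epowr_ennreal ennreal_mult_top ennreal_top_mult powr_mult ennreal_mult'[symmetric])

lemma epowr_epowr: "epowr (epowr x a) b = epowr x (a * b)"
  by (cases x) (auto simp: epowr_ennreal powr_powr)

text \<open>The conventions \<open>epowr 0 a = 0\<close> and \<open>epowr top a = top\<close> hold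
  for every exponent, zero and negative ones included. Hence exponents add without side conditions,
  and integrals that may vanish or be infinite can be factored freely.\<close>

lemma epowr_add: "epowr x (a + b) = epowr x a * epowr x b"
  by (cases x) (auto simp: epowr_ennreal powr_add ennreal_mult)

lemma epowr_inverse [simp]: "0 < a \<Longrightarrow> epowr (epowr x a) (1 / a) = x"
  "0 < a \<Longrightarrow> epowr (epowr x (1 / a)) a = x"
  by (auto simp: epowr_epowr)

lemma epowr_le_iff: "0 < a \<Longrightarrow> epowr x a \<le> y \<longleftrightarrow> x \<le> epowr y (1 / a)"
  by (metis epowr_inverse epowr_mono less_imp_le zero_less_divide_1_iff)

lemma epowr_mono_iff: "0 < a \<Longrightarrow> epowr x a \<le> epowr y a \<longleftrightarrow> x \<le> y"
  by (simp add: epowr_le_iff)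

lemma measurable_epowr [measurable]: "(\<lambda>x. epowr x a) \<in> borel_measurable borel"
  unfolding epowr_def by measurable

text \<open>Both sides are homogeneous of degree a, so one may divide by x + y; on [0,1] every z is
  at most z powr a.\<close>

lemma powr_add_le:
  fixes x y :: real
  assumes "0 < a" "a \<le> 1" "0 \<le> x" "0 \<le> y"
  shows "(x + y) powr a \<le> x powr a + y powr a"
proof (cases "x + y = 0")
  case False
  then have s: "0 < x + y" using assms by auto
  have le: "z \<le> z powr a" if "0 \<le> z" "z \<le> 1" for z :: real
    using powr_mono'[of a 1 z] that assms by (cases "z = 0") auto
  have "1 = x / (x + y) + y / (x + y)" using s by (simp add: add_divide_distrib[symmetric])
  also have "\<dots> \<le> (x / (x + y)) powr a + (y / (x + y)) powr a"
    using s assms by (intro add_mono le) (auto simp: divide_simps)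
  also have "\<dots> = (x powr a + y powr a) / (x + y) powr a"
    using s assms by (simp add: powr_divide add_divide_distrib)
  finally show ?thesis using s by (simp add: divide_simps)
qed (use assms in auto)

lemma epowr_plus_le:
  assumes "0 < a" "a \<le> 1"
  shows "epowr (x + y) a \<le> epowr x a + epowr y a"
  using assms
  by (cases x; cases y)
    (auto simp: epowr_ennreal powr_add_le ennreal_leI simp flip: ennreal_plus)

lemma epowr_sum_le:
  assumes "0 < a" "a \<le> 1"
  shows "epowr (\<Sum>i<(n::nat). f i) a \<le> (\<Sum>i<n. epowr (f i) a)"
  by (induction n) (auto intro: order_trans[OF epowr_plus_le[OF assms]] add_mono)

text \<open>Moving the exponent to the other side reduces the countable case to bounds on partial
  sums of the f i, so that no continuity of \<open>epowr\<close> enters.\<close>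

lemma epowr_suminf_le:
  assumes "0 < a" "a \<le> 1"
  shows "epowr (\<Sum>i. f i) a \<le> (\<Sum>i. epowr (f i) a)"
proof -
  have "(\<Sum>i. f i) \<le> epowr (\<Sum>i. epowr (f i) a) (1 / a)"
  proof (rule suminf_le_const[OF summableI])
    fix n
    have "epowr (\<Sum>i<n. f i) a \<le> (\<Sum>i. epowr (f i) a)"
      by (rule order_trans[OF epowr_sum_le[OF assms] sum_le_suminf]) auto
    then show "(\<Sum>i<n. f i) \<le> epowr (\<Sum>i. epowr (f i) a) (1 / a)"
      using assms by (simp add: epowr_le_iff)
  qed
  then show ?thesis using assms by (simp add: epowr_le_iff)
qed

text \<open>This is the tangent-line inequality for the convex function x powr a at the point t,
  solved for x. Integrating it with t left free is the route to Jensen's inequality below.\<close>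

lemma tangent_powr_le:
  fixes x t a :: real
  assumes "0 \<le> x" "0 < t" "1 \<le> a"
  shows "x \<le> t powr (1 - a) / a * x powr a + (1 - 1 / a) * t"
proof (cases "x = 0")
  case False
  then have x: "x > 0" using assms by auto
  have "(x powr a * t powr (1 - a)) powr (1 / a) * t powr (1 - 1 / a)
      \<le> (1 / a) * (x powr a * t powr (1 - a)) + (1 - 1 / a) * t"
    using assms x by (intro Youngs_inequality_0) auto
  also have "(x powr a * t powr (1 - a)) powr (1 / a) * t powr (1 - 1 / a) = x"
    using assms x by (simp add: powr_mult powr_powr field_simps flip: powr_add)
  finally show ?thesis using assms by (simp add: field_simps)
qed (use assms in auto)

text \<open>Jensen's inequality for the measure with density w, whose mass is at most c: the tangent
  inequality is integrated against w and then optimised in t. It replaces Hoelder's inequality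
  throughout, for integrals and, through the counting measure, for series.\<close>

lemma epowr_nn_integral_le:
  assumes [measurable]: "f \<in> borel_measurable M" "w \<in> borel_measurable M"
    and a: "1 \<le> a" and c: "0 < c" and w: "(\<integral>\<^sup>+x. w x \<partial>M) \<le> ennreal c"
  shows "epowr (\<integral>\<^sup>+x. w x * f x \<partial>M) a \<le> ennreal (c powr (a - 1)) * (\<integral>\<^sup>+x. w x * epowr (f x) a \<partial>M)"
proof -
  define I where "I = (\<integral>\<^sup>+x. w x * epowr (f x) a \<partial>M)"
  have est: "(\<integral>\<^sup>+x. w x * f x \<partial>M) \<le> ennreal (t powr (1 - a) / a) * I + ennreal ((1 - 1 / a) * t * c)"
    if t: "0 < t" for t
  proof -
    have "f x \<le> ennreal (t powr (1 - a) / a) * epowr (f x) a + ennreal ((1 - 1 / a) * t)" for x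
    proof (cases "f x")
      case (real r)
      then show ?thesis using tangent_powr_le[of r t a] a t
        by (auto simp: epowr_ennreal intro!: ennreal_leI simp flip: ennreal_mult ennreal_plus)
    qed (use a t in \<open>auto simp: ennreal_mult_top\<close>)
    then have "(\<integral>\<^sup>+x. w x * f x \<partial>M) \<le> (\<integral>\<^sup>+x. w x * (ennreal (t powr (1 - a) / a) * epowr (f x) a + ennreal ((1 - 1 / a) * t)) \<partial>M)"
      by (intro nn_integral_mono mult_left_mono) auto
    also have "\<dots> = ennreal (t powr (1 - a) / a) * I + ennreal ((1 - 1 / a) * t) * (\<integral>\<^sup>+x. w x \<partial>M)"
    proof -
      have "w x * (ennreal (t powr (1 - a) / a) * epowr (f x) a + ennreal ((1 - 1 / a) * t))
          = ennreal (t powr (1 - a) / a) * (w x * epowr (f x) a) + ennreal ((1 - 1 / a) * t) * w x" for x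
        by (simp add: distrib_left mult_ac)
      then show ?thesis
        unfolding I_def by (simp add: nn_integral_add nn_integral_cmult)
    qed
    also have "ennreal ((1 - 1 / a) * t) * (\<integral>\<^sup>+x. w x \<partial>M) \<le> ennreal ((1 - 1 / a) * t) * ennreal c"
      by (intro mult_left_mono w) auto
    also have "\<dots> = ennreal ((1 - 1 / a) * t * c)"
      using a t c by (simp add: ennreal_mult)
    finally show ?thesis by (simp add: add_left_mono)
  qed
  show ?thesis
  proof (cases I)
    case top
    then show ?thesis using c by (simp add: I_def[symmetric] ennreal_mult_top)
  next
    case (real r)
    show ?thesis
    proof (cases "r = 0")
      case True
      then have "(\<integral>\<^sup>+x. w x * epowr (f x) a \<partial>M) = 0" using real I_def by simp
      then have "AE x in M. w x * epowr (f x) a = 0"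
        by (subst (asm) nn_integral_0_iff_AE) auto
      then have "AE x in M. w x * f x = 0" by (auto simp: )
      then have "(\<integral>\<^sup>+x. w x * f x \<partial>M) = 0" by (subst nn_integral_0_iff_AE) auto
      then show ?thesis by simp
    next
      case False
      then have r: "r > 0" using real by auto
      \<comment> \<open>The optimal tangent point: the value of f if f were constant and w had mass
        exactly c. The two terms of the estimate then add up to c * t.\<close>
      define t where "t = (r / c) powr (1 / a)"
      have t: "t > 0" using r c by (simp add: t_def)
      have ta: "t powr a = r / c" using r c a by (simp add: t_def powr_powr)
      have "(\<integral>\<^sup>+x. w x * f x \<partial>M) \<le> ennreal (t powr (1 - a) / a * r + (1 - 1 / a) * t * c)"
      proof -
        have "0 \<le> t powr (1 - a) / a * r" "0 \<le> (1 - 1 / a) * t * c" using t a c r by auto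
        then have "ennreal (t powr (1 - a) / a * r + (1 - 1 / a) * t * c)
            = ennreal (t powr (1 - a) / a) * I + ennreal ((1 - 1 / a) * t * c)"
          using real a by (subst ennreal_plus) (auto simp only: ennreal_mult'' \<open>0 \<le> r\<close>)
        then show ?thesis using est[OF t] by simp
      qed
      also have "t powr (1 - a) / a * r + (1 - 1 / a) * t * c = c * t"
      proof -
        have "r = c * t powr a" using ta c by simp
        then have "t powr (1 - a) * r = c * t" using t by (simp flip: powr_add)
        then have "t powr (1 - a) / a * r = c * t / a" by (simp add: field_simps)
        then show ?thesis using a by (simp add: field_simps)
      qed
      finally have "epowr (\<integral>\<^sup>+x. w x * f x \<partial>M) a \<le> epowr (ennreal (c * t)) a"
        using a by (intro epowr_mono) auto
      also have "\<dots> = ennreal (c powr (a - 1) * r)"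
        using c t ta a by (simp add: epowr_ennreal powr_mult powr_diff)
      finally show ?thesis using real c by (simp add: I_def[symmetric] ennreal_mult)
    qed
  qed
qed

lemma epowr_suminf_weighted_le:
  assumes a: "1 \<le> a" and c: "0 < c" and w: "(\<Sum>i. w i) \<le> ennreal c"
  shows "epowr (\<Sum>i. w i * f i) a \<le> ennreal (c powr (a - 1)) * (\<Sum>i. w i * epowr (f i) a)"
  using epowr_nn_integral_le[of f "count_space UNIV" w a c] a c w
  by (simp add: nn_integral_count_space_nat)

section \<open>Lebesgue quasi-norms of nonnegative functions\<close>

text \<open>The same quasi-norm as \<open>fun_Lp_norm\<close>, for functions with values in [0,top].
  Sums of absolute values and kernel integrals, which may be infinite, can then be estimated before
  anything is known about convergence.\<close>

definition Lnorm :: "ennreal \<Rightarrow> ('a::euclidean_space \<Rightarrow> ennreal) \<Rightarrow> ennreal"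
  where "Lnorm p F =
    (if p = \<infinity> then esssup lborel F
     else epowr (\<integral>\<^sup>+ x. epowr (F x) (enn2real p) \<partial>lborel) (1 / enn2real p))"

lemma fun_Lp_norm_eq: "fun_Lp_norm p f = Lnorm p (\<lambda>x. ennreal (norm (f x)))"
  by (simp add: fun_Lp_norm_def Lnorm_def)

lemma Lnorm_top: "Lnorm top F = esssup lborel F"
  by (simp add: Lnorm_def)

lemma Lnorm_ennreal: "0 < p \<Longrightarrow> Lnorm (ennreal p) F = epowr (\<integral>\<^sup>+ x. epowr (F x) p \<partial>lborel) (1 / p)"
  by (simp add: Lnorm_def)

lemma epowr_Lnorm: "0 < p \<Longrightarrow> epowr (Lnorm (ennreal p) F) p = (\<integral>\<^sup>+ x. epowr (F x) p \<partial>lborel)"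
  by (simp add: Lnorm_ennreal)

lemma exponent_cases:
  assumes "0 < (p::ennreal)"
  obtains "p = top" | r where "p = ennreal r" "0 < r"
  using assms by (cases p) (auto simp: less_le)

lemma Lnorm_mono_AE:
  assumes p: "0 < p" and "F \<in> borel_measurable borel" and le: "AE x in lborel. F x \<le> G x"
  shows "Lnorm p F \<le> Lnorm p G"
proof (cases rule: exponent_cases[OF p])
  case 1
  then show ?thesis using assms esssup_AE_mono[of F lborel G] by (auto simp: Lnorm_top)
next
  case (2 r)
  have "(\<integral>\<^sup>+ x. epowr (F x) r \<partial>lborel) \<le> (\<integral>\<^sup>+ x. epowr (G x) r \<partial>lborel)"
    using le 2 by (intro nn_integral_mono_AE) (auto elim!: eventually_mono intro: epowr_mono)
  then show ?thesis using 2 by (auto simp: Lnorm_ennreal intro!: epowr_mono)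
qed

lemma Lnorm_mono:
  assumes "0 < p" "F \<in> borel_measurable borel" "\<And>x. F x \<le> G x"
  shows "Lnorm p F \<le> Lnorm p G"
  using assms by (intro Lnorm_mono_AE) auto

lemma Lnorm_cong_AE:
  assumes "0 < p" "F \<in> borel_measurable borel" "G \<in> borel_measurable borel" "AE x in lborel. F x = G x"
  shows "Lnorm p F = Lnorm p G"
proof (rule antisym)
  show "Lnorm p F \<le> Lnorm p G" using assms by (intro Lnorm_mono_AE) auto
  have "AE x in lborel. G x \<le> F x" using assms(4) by eventually_elim auto
  then show "Lnorm p G \<le> Lnorm p F" using assms by (intro Lnorm_mono_AE) auto
qed

lemma Lnorm_zero: assumes "0 < p" shows "Lnorm p (\<lambda>x::'b::euclidean_space. 0) = 0"
proof (cases rule: exponent_cases[OF assms])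
  case 1
  have "esssup lborel (\<lambda>x::'b. 0::ennreal) \<le> 0" by (rule esssup_I) auto
  with 1 show ?thesis by (simp add: Lnorm_top)
qed (auto simp: Lnorm_ennreal)

lemma Lnorm_AE_finite:
  assumes p: "0 < p" and [measurable]: "F \<in> borel_measurable borel" and fin: "Lnorm p F < top"
  shows "AE x in lborel. F x < top"
proof (cases rule: exponent_cases[OF p])
  case 1
  then show ?thesis using fin esssup_AE[of F lborel] by (auto simp: Lnorm_top elim!: eventually_mono)
next
  case (2 r)
  have "AE x in lborel. epowr (F x) r \<noteq> \<infinity>"
    using fin 2 by (intro nn_integral_PInf_AE) (auto simp: Lnorm_ennreal less_top)
  then show ?thesis by eventually_elim (auto simp: less_top)
qed

text \<open>Minkowski's inequality: the sum of the F j is an average, with weights m j, of the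
  normalised functions F j / m j, and Jensen's inequality applies pointwise. The m j are positive
  majorants of the norms rather than the norms themselves, so that the division makes sense when
  some F j vanishes.\<close>

lemma Lnorm_suminf_le_aux:
  fixes F :: "nat \<Rightarrow> 'a::euclidean_space \<Rightarrow> ennreal"
  assumes r: "1 \<le> r" and [measurable]: "\<And>j. F j \<in> borel_measurable borel"
    and m: "\<And>j. 0 < m j" "\<And>j. Lnorm (ennreal r) (F j) \<le> ennreal (m j)"
    and c: "(\<Sum>j. ennreal (m j)) = ennreal c" "0 < c"
  shows "Lnorm (ennreal r) (\<lambda>x. \<Sum>j. F j x) \<le> ennreal c"
proof -
  have int: "(\<integral>\<^sup>+ x. epowr (F j x / ennreal (m j)) r \<partial>lborel) \<le> 1" for j
  proof -
    have "(\<integral>\<^sup>+ x. epowr (F j x / ennreal (m j)) r \<partial>lborel)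
        = epowr (inverse (ennreal (m j))) r * epowr (Lnorm (ennreal r) (F j)) r"
      using r by (simp add: epowr_Lnorm divide_ennreal_def epowr_mult nn_integral_multc mult.commute)
    also have "\<dots> \<le> epowr (inverse (ennreal (m j))) r * epowr (ennreal (m j)) r"
      using r m by (intro mult_left_mono epowr_mono) auto
    also have "\<dots> = 1"
    proof -
      have "inverse (ennreal (m j)) * ennreal (m j) = 1"
        using m(1)[of j] by (simp add: inverse_ennreal flip: ennreal_mult)
      then show ?thesis by (simp flip: epowr_mult)
    qed
    finally show ?thesis .
  qed
  have "(\<integral>\<^sup>+ x. epowr (\<Sum>j. F j x) r \<partial>lborel)
      \<le> (\<integral>\<^sup>+ x. ennreal (c powr (r - 1)) * (\<Sum>j. ennreal (m j) * epowr (F j x / ennreal (m j)) r) \<partial>lborel)"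
  proof (rule nn_integral_mono)
    fix x :: 'a
    have "F j x = ennreal (m j) * (F j x / ennreal (m j))" for j
    proof -
      have "ennreal (m j) * inverse (ennreal (m j)) = 1"
        using m(1)[of j] by (simp add: inverse_ennreal flip: ennreal_mult)
      then show ?thesis by (simp add: divide_ennreal_def mult.left_commute[of "ennreal (m j)"])
    qed
    then have "(\<Sum>j. F j x) = (\<Sum>j. ennreal (m j) * (F j x / ennreal (m j)))" by simp
    then show "epowr (\<Sum>j. F j x) r \<le> ennreal (c powr (r - 1)) * (\<Sum>j. ennreal (m j) * epowr (F j x / ennreal (m j)) r)"
      using epowr_suminf_weighted_le[OF r c(2), of "\<lambda>j. ennreal (m j)" "\<lambda>j. F j x / ennreal (m j)"] c(1)
      by simp
  qed
  also have "\<dots> = ennreal (c powr (r - 1)) * (\<Sum>j. ennreal (m j) * (\<integral>\<^sup>+ x. epowr (F j x / ennreal (m j)) r \<partial>lborel))"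
    by (simp add: nn_integral_cmult nn_integral_suminf del: ennreal_suminf_cmult)
  also have "\<dots> \<le> ennreal (c powr (r - 1)) * (\<Sum>j. ennreal (m j) * 1)"
    by (intro mult_left_mono suminf_le int summableI) auto
  also have "\<dots> = ennreal (c powr r)"
    using c by (simp add: powr_diff ennreal_mult[symmetric])
  finally have "(\<integral>\<^sup>+ x. epowr (\<Sum>j. F j x) r \<partial>lborel) \<le> epowr (ennreal c) r"
    using c by (simp add: epowr_ennreal)
  then have "epowr (Lnorm (ennreal r) (\<lambda>x. \<Sum>j. F j x)) r \<le> epowr (ennreal c) r"
    using r by (simp add: epowr_Lnorm)
  then show ?thesis using r by (simp add: epowr_mono_iff)
qed

lemma Lnorm_suminf_le:
  fixes F :: "nat \<Rightarrow> 'a::euclidean_space \<Rightarrow> ennreal"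
  assumes p: "1 \<le> p" and [measurable]: "\<And>j. F j \<in> borel_measurable borel"
  shows "Lnorm p (\<lambda>x. \<Sum>j. F j x) \<le> (\<Sum>j. Lnorm p (F j))"
proof -
  have p0: "0 < p" by (rule less_le_trans[OF zero_less_one p])
  show ?thesis
  proof (cases rule: exponent_cases[OF p0])
    case 1
    have "AE x in lborel. \<forall>j. F j x \<le> esssup lborel (F j)"
      unfolding AE_all_countable by (intro allI esssup_AE)
    then have "AE x in lborel. (\<Sum>j. F j x) \<le> (\<Sum>j. esssup lborel (F j))"
      by eventually_elim (auto intro!: suminf_le summableI)
    then show ?thesis using 1 by (auto simp: Lnorm_top)
  next
    case (2 r)
    have r: "1 \<le> r" using p 2 by (simp add: ennreal_le_iff2 flip: ennreal_1)
    show ?thesis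
    proof (rule ennreal_le_epsilon)
      fix e :: real assume e: "0 < e" and fin: "(\<Sum>j. Lnorm p (F j)) < top"
      have "Lnorm p (F j) < top" for j using fin ennreal_suminf_lessD by blast
      define n where "n = (\<lambda>j. enn2real (Lnorm p (F j)))"
      have n: "\<And>j. Lnorm p (F j) = ennreal (n j)" "\<And>j. 0 \<le> n j"
        using \<open>\<And>j. Lnorm p (F j) < top\<close> by (auto simp: n_def)
      \<comment> \<open>Adding a geometric sequence of total mass e makes every weight positive; e
        is arbitrary.\<close>
      define m where "m = (\<lambda>j. n j + e * (1/2) ^ Suc j)"
      have sn: "summable n" using fin by (intro summable_suminf_not_top n(2)) (simp add: n(1) less_top)
      have sg: "(\<lambda>j. e * (1/2) ^ Suc j) sums (e * 1)"
        using power_half_series by (rule sums_mult)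
      have sm: "m sums (suminf n + e)"
        using sums_add[OF summable_sums[OF sn] sg] by (simp add: m_def)
      have N: "0 \<le> suminf n" using n by (intro suminf_nonneg sn)
      have "Lnorm p (\<lambda>x. \<Sum>j. F j x) \<le> ennreal (suminf n + e)"
        unfolding 2(1)
      proof (rule Lnorm_suminf_le_aux[OF r _ _ _ _])
        show "0 < m j" for j using n e by (auto simp: m_def intro!: add_nonneg_pos)
        show "Lnorm (ennreal r) (F j) \<le> ennreal (m j)" for j
          using n(1)[of j] e 2 by (auto simp: m_def intro!: ennreal_leI)
        have "\<And>j. 0 \<le> m j" using n e by (auto simp: m_def)
        then have "(\<lambda>j. ennreal (m j)) sums ennreal (suminf n + e)" using sm e N by (subst sums_ennreal) auto
        then show "(\<Sum>j. ennreal (m j)) = ennreal (suminf n + e)" by (simp add: sums_iff)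
      qed (use e N in auto)
      also have "\<dots> = (\<Sum>j. Lnorm p (F j)) + ennreal e"
        using n N e sn by (simp add: suminf_ennreal2)
      finally show "Lnorm p (\<lambda>x. \<Sum>j. F j x) \<le> (\<Sum>j. Lnorm p (F j)) + ennreal e" .
    qed
  qed
qed

lemma Lnorm_powr_suminf_le:
  fixes F :: "nat \<Rightarrow> 'a::euclidean_space \<Rightarrow> ennreal"
  assumes p: "0 < r" "r \<le> 1" and [measurable]: "\<And>j. F j \<in> borel_measurable borel"
  shows "epowr (Lnorm (ennreal r) (\<lambda>x. \<Sum>j. F j x)) r \<le> (\<Sum>j. epowr (Lnorm (ennreal r) (F j)) r)"
proof -
  have "(\<integral>\<^sup>+ x. epowr (\<Sum>j. F j x) r \<partial>lborel) \<le> (\<integral>\<^sup>+ x. (\<Sum>j. epowr (F j x) r) \<partial>lborel)"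
    using p by (intro nn_integral_mono epowr_suminf_le)
  also have "\<dots> = (\<Sum>j. \<integral>\<^sup>+ x. epowr (F j x) r \<partial>lborel)"
    by (rule nn_integral_suminf) measurable
  finally show ?thesis using p by (simp add: epowr_Lnorm)
qed

text \<open>Schur's test; it contains Young's inequality for convolutions.\<close>

lemma Lnorm_kernel_le:
  fixes F :: "'a::euclidean_space \<Rightarrow> ennreal" and k :: "'a \<Rightarrow> 'a \<Rightarrow> ennreal"
  assumes p: "1 \<le> p" and [measurable]: "F \<in> borel_measurable borel"
    and k [measurable]: "(\<lambda>(x, y). k x y) \<in> borel_measurable (borel \<Otimes>\<^sub>M borel)"
    and c: "0 < c" "\<And>y. (\<integral>\<^sup>+ x. k x y \<partial>lborel) \<le> ennreal c" "\<And>x. (\<integral>\<^sup>+ y. k x y \<partial>lborel) \<le> ennreal c"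
  shows "Lnorm p (\<lambda>y. \<integral>\<^sup>+ x. k x y * F x \<partial>lborel) \<le> ennreal c * Lnorm p F"
proof -
  have p0: "0 < p" by (rule less_le_trans[OF zero_less_one p])
  show ?thesis
  proof (cases rule: exponent_cases[OF p0])
    case 1
    have "(\<integral>\<^sup>+ x. k x y * F x \<partial>lborel) \<le> ennreal c * esssup lborel F" for y
    proof -
      have "(\<integral>\<^sup>+ x. k x y * F x \<partial>lborel) \<le> (\<integral>\<^sup>+ x. k x y * esssup lborel F \<partial>lborel)"
      proof (rule nn_integral_mono_AE)
        show "AE x in lborel. k x y * F x \<le> k x y * esssup lborel F"
          using esssup_AE[of F lborel] by eventually_elim (rule mult_left_mono, auto)
      qed
      also have "\<dots> = (\<integral>\<^sup>+ x. k x y \<partial>lborel) * esssup lborel F"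
        by (simp add: nn_integral_multc)
      also have "\<dots> \<le> ennreal c * esssup lborel F" by (intro mult_right_mono c) auto
      finally show ?thesis .
    qed
    then show ?thesis using 1 by (auto simp: Lnorm_top intro!: esssup_I)
  next
    case (2 r)
    have r: "1 \<le> r" using p 2 by (simp add: ennreal_le_iff2 flip: ennreal_1)
    have "(\<integral>\<^sup>+ y. epowr (\<integral>\<^sup>+ x. k x y * F x \<partial>lborel) r \<partial>lborel)
        \<le> (\<integral>\<^sup>+ y. ennreal (c powr (r - 1)) * (\<integral>\<^sup>+ x. k x y * epowr (F x) r \<partial>lborel) \<partial>lborel)"
      using c r by (intro nn_integral_mono epowr_nn_integral_le) auto
    also have "\<dots> = ennreal (c powr (r - 1)) * (\<integral>\<^sup>+ y. (\<integral>\<^sup>+ x. k x y * epowr (F x) r \<partial>lborel) \<partial>lborel)"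
      by (rule nn_integral_cmult) measurable
    also have "(\<integral>\<^sup>+ y. (\<integral>\<^sup>+ x. k x y * epowr (F x) r \<partial>lborel) \<partial>lborel)
        = (\<integral>\<^sup>+ x. (\<integral>\<^sup>+ y. k x y * epowr (F x) r \<partial>lborel) \<partial>lborel)"
      by (rule lborel_pair.Fubini') measurable
    also have "\<dots> = (\<integral>\<^sup>+ x. (\<integral>\<^sup>+ y. k x y \<partial>lborel) * epowr (F x) r \<partial>lborel)"
      by (intro nn_integral_cong nn_integral_multc) measurable
    also have "\<dots> \<le> (\<integral>\<^sup>+ x. ennreal c * epowr (F x) r \<partial>lborel)"
      by (intro nn_integral_mono mult_right_mono c) auto
    also have "\<dots> = ennreal c * epowr (Lnorm p F) r"
      using r 2 by (simp add: nn_integral_cmult epowr_Lnorm)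
    also have "ennreal (c powr (r - 1)) * (ennreal c * epowr (Lnorm p F) r) = epowr (ennreal c * Lnorm p F) r"
      using c by (simp add: epowr_mult epowr_ennreal powr_diff mult.assoc[symmetric] ennreal_mult[symmetric])
    finally have "epowr (Lnorm p (\<lambda>y. \<integral>\<^sup>+ x. k x y * F x \<partial>lborel)) r \<le> epowr (ennreal c * Lnorm p F) r"
      using 2 by (simp add: epowr_Lnorm mult_left_mono)
    then show ?thesis using r by (simp add: epowr_mono_iff)
  qed
qed

text \<open>A weight that is bounded by c and has integral at most c lies in every dual space with
  norm at most c. Jensen's inequality with the weight G gives this for all p at once, without dual
  exponents.\<close>

lemma nn_integral_mult_le_Lnorm:
  fixes F G :: "'a::euclidean_space \<Rightarrow> ennreal"
  assumes p: "1 \<le> p" and [measurable]: "F \<in> borel_measurable borel" "G \<in> borel_measurable borel"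
    and c: "0 < c" "(\<integral>\<^sup>+ x. G x \<partial>lborel) \<le> ennreal c" "\<And>x. G x \<le> ennreal c"
  shows "(\<integral>\<^sup>+ x. G x * F x \<partial>lborel) \<le> ennreal c * Lnorm p F"
proof -
  have p0: "0 < p" by (rule less_le_trans[OF zero_less_one p])
  show ?thesis
  proof (cases rule: exponent_cases[OF p0])
    case 1
    have "(\<integral>\<^sup>+ x. G x * F x \<partial>lborel) \<le> (\<integral>\<^sup>+ x. G x * esssup lborel F \<partial>lborel)"
    proof (rule nn_integral_mono_AE)
      show "AE x in lborel. G x * F x \<le> G x * esssup lborel F"
        using esssup_AE[of F lborel] by eventually_elim (rule mult_left_mono, auto)
    qed
    also have "\<dots> = (\<integral>\<^sup>+ x. G x \<partial>lborel) * esssup lborel F"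
      by (simp add: nn_integral_multc)
    also have "\<dots> \<le> ennreal c * esssup lborel F" by (intro mult_right_mono c) auto
    finally show ?thesis using 1 by (simp add: Lnorm_top)
  next
    case (2 r)
    have r: "1 \<le> r" using p 2 by (simp add: ennreal_le_iff2 flip: ennreal_1)
    have "epowr (\<integral>\<^sup>+ x. G x * F x \<partial>lborel) r \<le> ennreal (c powr (r - 1)) * (\<integral>\<^sup>+ x. G x * epowr (F x) r \<partial>lborel)"
      using c r by (intro epowr_nn_integral_le) auto
    also have "\<dots> \<le> ennreal (c powr (r - 1)) * (\<integral>\<^sup>+ x. ennreal c * epowr (F x) r \<partial>lborel)"
      by (intro mult_left_mono nn_integral_mono mult_right_mono c) auto
    also have "\<dots> = ennreal (c powr (r - 1)) * (ennreal c * epowr (Lnorm p F) r)"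
      using r 2 by (simp add: nn_integral_cmult epowr_Lnorm)
    also have "\<dots> = epowr (ennreal c * Lnorm p F) r"
      using c by (simp add: epowr_mult epowr_ennreal powr_diff mult.assoc[symmetric] ennreal_mult[symmetric])
    finally show ?thesis using r by (simp add: epowr_mono_iff)
  qed
qed

section \<open>Weighted sequence quasi-norms\<close>

lemma weighted_lq_shift:
  assumes "0 < q"
  shows "weighted_lq s q a = weighted_lq 0 q (\<lambda>j. ennreal (2 powr (s * real j)) * a j)"
proof (cases rule: exponent_cases[OF assms])
  case (2 r)
  have "ennreal (2 powr (s * real j * r)) * epowr (a j) r = epowr (ennreal (2 powr (s * real j)) * a j) r" for j
    by (simp add: epowr_mult epowr_ennreal powr_powr)
  then show ?thesis using 2 by (simp add: weighted_lq_def)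
qed (simp add: weighted_lq_def)

lemma weighted_lq_0_ennreal: "0 < r \<Longrightarrow> weighted_lq 0 (ennreal r) a = epowr (\<Sum>j. epowr (a j) r) (1 / r)"
  by (simp add: weighted_lq_def)

lemma weighted_lq_0_top: "weighted_lq 0 top a = (SUP j. a j)"
  by (simp add: weighted_lq_def)

lemma weighted_lq_0_upper:
  assumes "0 < q" shows "a j \<le> weighted_lq 0 q a"
proof (cases rule: exponent_cases[OF assms])
  case 1
  then show ?thesis by (simp add: weighted_lq_0_top SUP_upper)
next
  case (2 r)
  have "epowr (a j) r \<le> (\<Sum>j. epowr (a j) r)"
    using sum_le_suminf[of "\<lambda>j. epowr (a j) r" "{j}"] by simp
  then show ?thesis using 2 by (simp add: weighted_lq_0_ennreal epowr_le_iff)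
qed

text \<open>The embedding of l_q into l_t for q <= t, from the subadditivity of the power r / t <=
  1. It is used with t = 1 for absolute convergence, and with a general t in the limiting Besov
  bound.\<close>

lemma suminf_le_weighted_lq:
  assumes "0 < q" "q \<le> ennreal t" "0 < t"
  shows "(\<Sum>j. epowr (a j) t) \<le> epowr (weighted_lq 0 q a) t"
proof (cases rule: exponent_cases[OF assms(1)])
  case (2 r)
  then have r: "r \<le> t" using assms by simp
  have "epowr (\<Sum>j. epowr (a j) t) (r / t) \<le> (\<Sum>j. epowr (epowr (a j) t) (r / t))"
    using r 2 assms by (intro epowr_suminf_le) auto
  also have "\<dots> = (\<Sum>j. epowr (a j) r)" using assms by (simp add: epowr_epowr)
  finally show ?thesis using 2 r by (simp add: weighted_lq_0_ennreal epowr_le_iff epowr_epowr)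
qed (use assms in \<open>simp add: top_unique\<close>)

lemma suminf_geometric_dist_le:
  assumes "0 < \<delta>"
  shows "\<exists>c>0. \<forall>k. (\<Sum>j. ennreal (2 powr (- \<delta> * \<bar>real j - real k\<bar>))) \<le> ennreal c"
proof -
  define x where "x = 2 powr (- \<delta>)"
  have x: "0 < x" "x < 1" using assms by (auto simp: x_def powr_minus field_simps)
  have xp: "2 powr (- \<delta> * real i) = x ^ i" for i
    by (simp add: x_def powr_powr flip: powr_realpow)
  have "(\<Sum>j. ennreal (2 powr (- \<delta> * \<bar>real j - real k\<bar>))) \<le> ennreal (1 / (1 - x) + 1 / (1 - x))" for k :: nat
  proof -
    have s: "(\<lambda>i. ennreal (x ^ i)) sums ennreal (1 / (1 - x))"
      using x geometric_sums[of x] by (subst sums_ennreal) auto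
    have e1: "(\<Sum>j. ennreal (2 powr (- \<delta> * \<bar>real j - real k\<bar>)))
        = (\<Sum>j. ennreal (2 powr (- \<delta> * \<bar>real (j + k) - real k\<bar>))) + (\<Sum>j<k. ennreal (2 powr (- \<delta> * \<bar>real j - real k\<bar>)))"
      by (rule suminf_offset[OF summableI])
    have e2: "(\<Sum>j. ennreal (2 powr (- \<delta> * \<bar>real (j + k) - real k\<bar>))) = ennreal (1 / (1 - x))"
      using s by (simp add: xp[simplified] sums_iff)
    have e3: "(\<Sum>j<k. ennreal (2 powr (- \<delta> * \<bar>real j - real k\<bar>))) \<le> ennreal (1 / (1 - x))"
    proof -
      have "(\<Sum>j<k. ennreal (2 powr (- \<delta> * \<bar>real j - real k\<bar>))) = (\<Sum>j<k. ennreal (x ^ Suc (k - Suc j)))"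
      proof (rule sum.cong)
        fix j assume "j \<in> {..<k}"
        then have "\<bar>real j - real k\<bar> = real (Suc (k - Suc j))" by (auto simp: of_nat_diff)
        then show "ennreal (2 powr (- \<delta> * \<bar>real j - real k\<bar>)) = ennreal (x ^ Suc (k - Suc j))"
          by (simp only: xp)
      qed simp
      also have "\<dots> = (\<Sum>j<k. ennreal (x ^ Suc j))"
        by (rule sum.nat_diff_reindex[of "\<lambda>j. ennreal (x ^ Suc j)"])
      also have "\<dots> \<le> (\<Sum>j<k. ennreal (x ^ j))"
        using x by (intro sum_mono ennreal_leI) (auto simp: mult_le_cancel_right1)
      also have "\<dots> \<le> ennreal (1 / (1 - x))"
        using s sum_le_suminf[of "\<lambda>j. ennreal (x ^ j)" "{..<k}"] by (simp add: sums_iff)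
      finally show ?thesis .
    qed
    show ?thesis
      unfolding e1 e2 using x e3 by (subst ennreal_plus) (auto intro!: add_left_mono)
  qed
  moreover have "0 < 1 / (1 - x) + 1 / (1 - x)" using x by (intro add_pos_pos) auto
  ultimately show ?thesis by blast
qed

lemma suminf_swap_ennreal:
  fixes f :: "nat \<Rightarrow> nat \<Rightarrow> ennreal"
  shows "(\<Sum>k. \<Sum>j. f k j) = (\<Sum>j. \<Sum>k. f k j)"
proof -
  have "(\<integral>\<^sup>+ k. (\<Sum>j. f k j) \<partial>count_space UNIV) = (\<Sum>j. \<integral>\<^sup>+ k. f k j \<partial>count_space UNIV)"
    by (rule nn_integral_suminf) simp
  then show ?thesis by (simp add: nn_integral_count_space_nat)
qed

text \<open>Young's inequality for the two-sided geometric kernel, applied to the powers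
  \<open>epowr (b j) \<rho>\<close> in the space with exponent t = r / \<rho>. For t >= 1 it is
  Jensen's inequality with the kernel as weight; for t < 1 it is the subadditivity of the power t,
  which lowers the decay rate from \<delta> to \<delta> * t. Either way the new kernel is symmetric
  and has uniformly bounded row sums, so the order of summation can be exchanged.\<close>

lemma weighted_lq_convolution_le:
  assumes q: "0 < q" and \<rho>: "0 < \<rho>" and \<delta>: "0 < \<delta>" and C: "0 < C"
  shows "\<exists>c. \<forall>a b. (\<forall>k. epowr (a k) \<rho> \<le> ennreal C * (\<Sum>j. ennreal (2 powr (- \<delta> * \<bar>real j - real k\<bar>)) * epowr (b j) \<rho>))
    \<longrightarrow> weighted_lq 0 q a \<le> ennreal c * weighted_lq 0 q b"
proof (cases rule: exponent_cases[OF q])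
  case 1
  obtain S where S: "S > 0" "\<And>k. (\<Sum>j. ennreal (2 powr (- \<delta> * \<bar>real j - real k\<bar>))) \<le> ennreal S"
    using suminf_geometric_dist_le[OF \<delta>] by blast
  have "weighted_lq 0 q a \<le> ennreal ((C * S) powr (1 / \<rho>)) * weighted_lq 0 q b"
    if a: "\<And>k. epowr (a k) \<rho> \<le> ennreal C * (\<Sum>j. ennreal (2 powr (- \<delta> * \<bar>real j - real k\<bar>)) * epowr (b j) \<rho>)" for a b
  proof -
    define B where "B = (SUP j. b j)"
    have "a k \<le> ennreal ((C * S) powr (1 / \<rho>)) * B" for k
    proof -
      have "(\<Sum>j. ennreal (2 powr (- \<delta> * \<bar>real j - real k\<bar>)) * epowr (b j) \<rho>)
          \<le> (\<Sum>j. ennreal (2 powr (- \<delta> * \<bar>real j - real k\<bar>)) * epowr B \<rho>)"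
        using \<rho> by (intro suminf_le mult_left_mono epowr_mono summableI) (auto simp: B_def intro: SUP_upper)
      also have "\<dots> \<le> ennreal S * epowr B \<rho>"
        unfolding ennreal_suminf_multc by (intro mult_right_mono S) auto
      finally have "epowr (a k) \<rho> \<le> ennreal C * (ennreal S * epowr B \<rho>)"
        using a[of k] by (meson mult_left_mono order_trans zero_le)
      then have "a k \<le> epowr (ennreal (C * S) * epowr B \<rho>) (1 / \<rho>)"
        using \<rho> C S by (simp add: epowr_le_iff ennreal_mult mult.assoc)
      then show ?thesis using \<rho> C S by (simp add: epowr_mult epowr_ennreal)
    qed
    then show ?thesis using 1 by (simp add: weighted_lq_0_top B_def SUP_le_iff)
  qed
  then show ?thesis by blast
next
  case (2 r)
  define t where "t = r / \<rho>"
  have t: "t > 0" using 2 \<rho> by (simp add: t_def)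
  obtain \<epsilon> K where \<epsilon>: "\<epsilon> > 0" and K: "K > 0"
    and le: "\<And>k y. epowr (\<Sum>j. ennreal (2 powr (- \<delta> * \<bar>real j - real k\<bar>)) * y j) t
      \<le> ennreal K * (\<Sum>j. ennreal (2 powr (- \<epsilon> * \<bar>real j - real k\<bar>)) * epowr (y j) t)"
  proof (cases "1 \<le> t")
    case True
    obtain S where S: "S > 0" "\<And>k. (\<Sum>j. ennreal (2 powr (- \<delta> * \<bar>real j - real k\<bar>))) \<le> ennreal S"
      using suminf_geometric_dist_le[OF \<delta>] by blast
    show ?thesis
      using S by (intro that[of \<delta> "S powr (t - 1)"] epowr_suminf_weighted_le True \<delta>) auto
  next
    case False
    have "epowr (\<Sum>j. ennreal (2 powr (- \<delta> * \<bar>real j - real k\<bar>)) * y j) t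
      \<le> ennreal 1 * (\<Sum>j. ennreal (2 powr (- (\<delta> * t) * \<bar>real j - real k\<bar>)) * epowr (y j) t)" for k :: nat and y
    proof -
      have "epowr (ennreal (2 powr (- \<delta> * \<bar>real j - real k\<bar>)) * y j) t
          = ennreal (2 powr (- (\<delta> * t) * \<bar>real j - real k\<bar>)) * epowr (y j) t" for j
        by (simp add: epowr_mult epowr_ennreal powr_powr mult_ac)
      then show ?thesis
        using epowr_suminf_le[of t "\<lambda>j. ennreal (2 powr (- \<delta> * \<bar>real j - real k\<bar>)) * y j"] False t by simp
    qed
    then show ?thesis using \<delta> t that[of "\<delta> * t" 1] by simp
  qed
  obtain S where S: "S > 0" "\<And>k. (\<Sum>j. ennreal (2 powr (- \<epsilon> * \<bar>real j - real k\<bar>))) \<le> ennreal S"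
    using suminf_geometric_dist_le[OF \<epsilon>] by blast
  define D where "D = C powr t * K * S"
  have D: "D > 0" using C K S by (simp add: D_def)
  have "weighted_lq 0 q a \<le> ennreal (D powr (1 / r)) * weighted_lq 0 q b"
    if a: "\<And>k. epowr (a k) \<rho> \<le> ennreal C * (\<Sum>j. ennreal (2 powr (- \<delta> * \<bar>real j - real k\<bar>)) * epowr (b j) \<rho>)" for a b
  proof -
    have "epowr (a k) r \<le> ennreal (C powr t * K) * (\<Sum>j. ennreal (2 powr (- \<epsilon> * \<bar>real j - real k\<bar>)) * epowr (b j) r)" for k
    proof -
      have "epowr (a k) r = epowr (epowr (a k) \<rho>) t" using \<rho> by (simp add: epowr_epowr t_def)
      also have "\<dots> \<le> epowr (ennreal C * (\<Sum>j. ennreal (2 powr (- \<delta> * \<bar>real j - real k\<bar>)) * epowr (b j) \<rho>)) t"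
        using a t by (intro epowr_mono) auto
      also have "\<dots> = ennreal (C powr t) * epowr (\<Sum>j. ennreal (2 powr (- \<delta> * \<bar>real j - real k\<bar>)) * epowr (b j) \<rho>) t"
        using C by (simp add: epowr_mult epowr_ennreal)
      also have "\<dots> \<le> ennreal (C powr t) * (ennreal K * (\<Sum>j. ennreal (2 powr (- \<epsilon> * \<bar>real j - real k\<bar>)) * epowr (epowr (b j) \<rho>) t))"
        by (intro mult_left_mono le) auto
      finally show ?thesis using \<rho> K by (simp add: epowr_epowr t_def ennreal_mult mult.assoc)
    qed
    then have "(\<Sum>k. epowr (a k) r) \<le> (\<Sum>k. ennreal (C powr t * K) * (\<Sum>j. ennreal (2 powr (- \<epsilon> * \<bar>real j - real k\<bar>)) * epowr (b j) r))"
      by (intro suminf_le summableI)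
    also have "\<dots> = ennreal (C powr t * K) * (\<Sum>k. \<Sum>j. ennreal (2 powr (- \<epsilon> * \<bar>real j - real k\<bar>)) * epowr (b j) r)"
      by (rule ennreal_suminf_cmult)
    also have "(\<Sum>k. \<Sum>j. ennreal (2 powr (- \<epsilon> * \<bar>real j - real k\<bar>)) * epowr (b j) r)
        = (\<Sum>j. \<Sum>k. ennreal (2 powr (- \<epsilon> * \<bar>real j - real k\<bar>)) * epowr (b j) r)"
      by (rule suminf_swap_ennreal)
    also have "ennreal (C powr t * K) * \<dots> \<le> ennreal (C powr t * K) * (\<Sum>j. ennreal S * epowr (b j) r)"
    proof (intro mult_left_mono suminf_le summableI)
      fix j
      have "(\<Sum>k. ennreal (2 powr (- \<epsilon> * \<bar>real j - real k\<bar>))) \<le> ennreal S"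
        using S(2)[of j] by (simp add: abs_minus_commute)
      then show "(\<Sum>k. ennreal (2 powr (- \<epsilon> * \<bar>real j - real k\<bar>)) * epowr (b j) r) \<le> ennreal S * epowr (b j) r"
        unfolding ennreal_suminf_multc by (rule mult_right_mono) simp
    qed simp
    also have "\<dots> = ennreal D * (\<Sum>j. epowr (b j) r)"
      using S K by (simp add: D_def ennreal_mult mult.assoc)
    finally have "epowr (\<Sum>k. epowr (a k) r) (1 / r) \<le> epowr (ennreal D * (\<Sum>j. epowr (b j) r)) (1 / r)"
      using 2 by (intro epowr_mono) auto
    then show ?thesis using 2 D by (simp add: weighted_lq_0_ennreal epowr_mult epowr_ennreal)
  qed
  then show ?thesis by blast
qed

section \<open>Calculus of smooth functions\<close>

text \<open>Derivatives along lists of directions do not split over products. Counting only the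
  order leaves f general, and sums of products can be fed back into the induction on k.\<close>

primrec Ck :: "nat \<Rightarrow> ((real^'n::finite) \<Rightarrow> complex) \<Rightarrow> bool" where
  "Ck 0 f \<longleftrightarrow> f differentiable_on UNIV"
| "Ck (Suc k) f \<longleftrightarrow> f differentiable_on UNIV \<and> (\<forall>i. Ck k (partial_deriv i f))"

lemma iter_deriv_Nil [simp]: "iter_deriv [] f = f"
  by (simp add: iter_deriv_def)

lemma iter_deriv_Cons [simp]: "iter_deriv (i # I) f = iter_deriv I (partial_deriv i f)"
  by (simp add: iter_deriv_def)

lemma Ck_iff: "Ck k f \<longleftrightarrow> (\<forall>I. length I \<le> k \<longrightarrow> iter_deriv I f differentiable_on UNIV)"
proof (induction k arbitrary: f)
  case (Suc k)
  have "(\<forall>I. length I \<le> Suc k \<longrightarrow> P I) \<longleftrightarrow> P [] \<and> (\<forall>i I. length I \<le> k \<longrightarrow> P (i # I))" for P :: "'a list \<Rightarrow> bool"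
    by (metis Suc_le_mono length_Cons list.exhaust list.size(3) zero_le)
  from this[of "\<lambda>I. iter_deriv I f differentiable_on UNIV"] show ?case
    by (auto simp: Suc.IH)
qed auto

lemma smooth_iff_Ck: "smooth f \<longleftrightarrow> (\<forall>k. Ck k f)"
  by (auto simp: smooth_def Ck_iff)

lemma smooth_partial_deriv: "smooth f \<Longrightarrow> smooth (partial_deriv i f)"
  by (metis iter_deriv_Cons smooth_def)

lemma smooth_iter_deriv: "smooth f \<Longrightarrow> smooth (iter_deriv I f)"
  by (induction I arbitrary: f) (auto intro: smooth_partial_deriv)

lemma smooth_differentiable: "smooth f \<Longrightarrow> f differentiable (at x)"
  by (auto simp: smooth_def differentiable_on_def dest: spec[of _ "[]"])

lemma smooth_has_derivative:
  "smooth f \<Longrightarrow> (f has_derivative frechet_derivative f (at x)) (at x)"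
  by (simp add: frechet_derivative_works[symmetric] smooth_differentiable)

lemma smooth_continuous_on: "smooth f \<Longrightarrow> continuous_on S f"
  by (meson continuous_at_imp_continuous_on differentiable_imp_continuous_within smooth_differentiable)

lemma smooth_borel_measurable: "smooth f \<Longrightarrow> f \<in> borel_measurable borel"
  by (intro borel_measurable_continuous_onI smooth_continuous_on)

lemma partial_derivI: "(f has_derivative D) (at x) \<Longrightarrow> partial_deriv i f x = D (axis i 1)"
  by (metis frechet_derivative_at partial_deriv_def)

lemma Ck_differentiable: "Ck k f \<Longrightarrow> f differentiable (at x)"
  by (cases k) (auto simp: differentiable_on_def)

lemma Ck_Suc: "Ck (Suc k) f \<Longrightarrow> Ck k f"
  by (auto simp: Ck_iff)

lemma partial_deriv_add:
  assumes "f differentiable (at x)" "g differentiable (at x)"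
  shows "partial_deriv i (\<lambda>x. f x + g x) x = partial_deriv i f x + partial_deriv i g x"
  using has_derivative_add[of f "frechet_derivative f (at x)" "at x" g "frechet_derivative g (at x)"] assms
  by (subst partial_derivI) (auto simp: partial_deriv_def frechet_derivative_works[symmetric])

lemma partial_deriv_mult:
  assumes "f differentiable (at x)" "g differentiable (at x)"
  shows "partial_deriv i (\<lambda>x. f x * g x) x = partial_deriv i f x * g x + f x * partial_deriv i g x"
  using partial_derivI[OF has_derivative_mult[of f "frechet_derivative f (at x)" x UNIV g "frechet_derivative g (at x)"]] assms
  by (simp add: partial_deriv_def frechet_derivative_works[symmetric] add.commute)

lemma partial_deriv_const [simp]: "partial_deriv i (\<lambda>x. c) = (\<lambda>x. 0)"
  by (rule ext, subst partial_derivI, rule has_derivative_const) simp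

lemma Ck_const: "Ck k (\<lambda>x. c)"
  by (induction k arbitrary: c) auto

lemma Ck_add: "Ck k f \<Longrightarrow> Ck k g \<Longrightarrow> Ck k (\<lambda>x. f x + g x)"
proof (induction k arbitrary: f g)
  case (Suc k)
  have "partial_deriv i (\<lambda>x. f x + g x) = (\<lambda>x. partial_deriv i f x + partial_deriv i g x)" for i
    using Suc.prems by (intro ext partial_deriv_add Ck_differentiable)
  then show ?case using Suc by (auto intro: differentiable_on_add)
qed (auto intro: differentiable_on_add)

lemma Ck_mult: "Ck k f \<Longrightarrow> Ck k g \<Longrightarrow> Ck k (\<lambda>x. f x * g x)"
proof (induction k arbitrary: f g)
  case (Suc k)
  have "partial_deriv i (\<lambda>x. f x * g x) = (\<lambda>x. partial_deriv i f x * g x + f x * partial_deriv i g x)" for i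
    using Suc.prems by (intro ext partial_deriv_mult Ck_differentiable)
  then show ?case using Suc Ck_Suc[OF Suc.prems(1)] Ck_Suc[OF Suc.prems(2)]
    by (auto intro!: differentiable_on_mult Ck_add)
qed (auto intro: differentiable_on_mult)

lemma smooth_const: "smooth (\<lambda>x. c)"
  by (simp add: smooth_iff_Ck Ck_const)

lemma smooth_add: "smooth f \<Longrightarrow> smooth g \<Longrightarrow> smooth (\<lambda>x. f x + g x)"
  by (simp add: smooth_iff_Ck Ck_add)

lemma smooth_mult: "smooth f \<Longrightarrow> smooth g \<Longrightarrow> smooth (\<lambda>x. f x * g x)"
  by (simp add: smooth_iff_Ck Ck_mult)

lemma smooth_diff: "smooth f \<Longrightarrow> smooth g \<Longrightarrow> smooth (\<lambda>x. f x - g x)"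
  using smooth_add[of f "\<lambda>x. (- 1) * g x"] smooth_mult[OF smooth_const, of g "-1"] by simp

lemma iter_deriv_add:
  "smooth f \<Longrightarrow> smooth g \<Longrightarrow> iter_deriv I (\<lambda>x. f x + g x) = (\<lambda>x. iter_deriv I f x + iter_deriv I g x)"
proof (induction I arbitrary: f g)
  case (Cons i I)
  have "partial_deriv i (\<lambda>x. f x + g x) = (\<lambda>x. partial_deriv i f x + partial_deriv i g x)"
    using Cons.prems by (intro ext partial_deriv_add smooth_differentiable)
  then show ?case using Cons by (simp add: smooth_partial_deriv)
qed auto

lemma iter_deriv_const: "iter_deriv I (\<lambda>x. c) = (if I = [] then (\<lambda>x. c) else (\<lambda>x. 0))"
  by (induction I arbitrary: c) auto

lemma iter_deriv_cmult:
  "smooth f \<Longrightarrow> iter_deriv I (\<lambda>x. c * f x) = (\<lambda>x. c * iter_deriv I f x)"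
proof (induction I arbitrary: f)
  case (Cons i I)
  have "partial_deriv i (\<lambda>x. c * f x) = (\<lambda>x. c * partial_deriv i f x)"
    using partial_deriv_mult[of "\<lambda>x. c" _ f i] smooth_differentiable[OF Cons.prems] by (auto simp: fun_eq_iff)
  then show ?case using Cons by (simp add: smooth_partial_deriv)
qed auto

lemma iter_deriv_diff:
  "smooth f \<Longrightarrow> smooth g \<Longrightarrow> iter_deriv I (\<lambda>x. f x - g x) = (\<lambda>x. iter_deriv I f x - iter_deriv I g x)"
  using iter_deriv_add[of f "\<lambda>x. (- 1) * g x" I] smooth_mult[OF smooth_const, of g "-1"] iter_deriv_cmult[of g I "-1"]
  by simp

lemma partial_deriv_affine:
  assumes "f differentiable (at (c *\<^sub>R x + a))"
  shows "partial_deriv i (\<lambda>x. f (c *\<^sub>R x + a)) x = of_real c * partial_deriv i f (c *\<^sub>R x + a)"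
proof -
  have "((\<lambda>x. c *\<^sub>R x + a) has_derivative (\<lambda>h. c *\<^sub>R h)) (at x)"
    by (auto intro!: derivative_eq_intros)
  from has_derivative_compose[OF this] assms
  have "((\<lambda>x. f (c *\<^sub>R x + a)) has_derivative (\<lambda>h. frechet_derivative f (at (c *\<^sub>R x + a)) (c *\<^sub>R h))) (at x)"
    by (auto simp: frechet_derivative_works)
  moreover have "linear (frechet_derivative f (at (c *\<^sub>R x + a)))"
    using assms by (simp add: linear_frechet_derivative)
  ultimately show ?thesis
    by (subst partial_derivI) (auto simp: linear_cmul partial_deriv_def scaleR_conv_of_real[where 'a=complex])
qed

lemma iter_deriv_affine:
  fixes f :: "real^'n::finite \<Rightarrow> complex"
  shows "smooth f \<Longrightarrow> smooth (\<lambda>x. f (c *\<^sub>R x + a)) \<and>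
    iter_deriv I (\<lambda>x. f (c *\<^sub>R x + a)) = (\<lambda>x. of_real c ^ length I * iter_deriv I f (c *\<^sub>R x + a))"
proof -
  have pd: "partial_deriv i (\<lambda>x. g (c *\<^sub>R x + a)) = (\<lambda>x. of_real c * partial_deriv i g (c *\<^sub>R x + a))"
    if "g differentiable_on UNIV" for i and g :: "real^'n \<Rightarrow> complex"
    using that by (intro ext partial_deriv_affine) (auto simp: differentiable_on_def)
  have da: "(\<lambda>x. g (c *\<^sub>R x + a)) differentiable_on UNIV" if "g differentiable_on UNIV" for g :: "real^'n \<Rightarrow> complex"
  proof -
    have "(g \<circ> (\<lambda>x. c *\<^sub>R x + a)) differentiable at x" for x
      using that by (intro differentiable_chain_at) (auto simp: differentiable_on_def)
    then show ?thesis by (simp add: o_def differentiable_on_def)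
  qed
  have ck: "Ck k g \<Longrightarrow> Ck k (\<lambda>x. g (c *\<^sub>R x + a))" for k and g :: "real^'n \<Rightarrow> complex"
  proof (induction k arbitrary: g)
    case (Suc k)
    then show ?case by (auto simp: pd intro!: da Ck_mult Ck_const)
  qed (auto intro: da)
  then have sm: "smooth g \<Longrightarrow> smooth (\<lambda>x. g (c *\<^sub>R x + a))" for g :: "real^'n \<Rightarrow> complex"
    by (simp add: smooth_iff_Ck)
  show "smooth f \<Longrightarrow> smooth (\<lambda>x. f (c *\<^sub>R x + a)) \<and>
    iter_deriv I (\<lambda>x. f (c *\<^sub>R x + a)) = (\<lambda>x. of_real c ^ length I * iter_deriv I f (c *\<^sub>R x + a))"
  proof (induction I arbitrary: f)
    case (Cons i I)
    have d: "f differentiable_on UNIV" using Cons.prems by (metis iter_deriv_Nil smooth_def)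
    have "smooth (\<lambda>x. partial_deriv i f (c *\<^sub>R x + a))" using Cons.prems by (intro sm smooth_partial_deriv)
    then show ?case
      using Cons.IH[OF smooth_partial_deriv[OF Cons.prems]] sm[OF Cons.prems]
      by (simp add: pd[OF d] iter_deriv_cmult mult.assoc)
  qed (auto intro: sm)
qed

lemmas smooth_affine = iter_deriv_affine[THEN conjunct1]

lemma iter_deriv_cong_open:
  assumes "open S" "\<And>x. x \<in> S \<Longrightarrow> f x = g x" "x \<in> S"
  shows "iter_deriv I f x = iter_deriv I g x"
  using assms(2,3)
proof (induction I arbitrary: f g x)
  case (Cons i I)
  have "partial_deriv i f y = partial_deriv i g y" if "y \<in> S" for y
  proof -
    have "frechet_derivative f (at y) = frechet_derivative g (at y)"
      unfolding frechet_derivative_def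
    \<comment> \<open>\<open>frechet_derivative\<close> is a choice among all D that are
      derivatives. Equality of the two predicates settles it even at points where neither function
      is differentiable.\<close>
    proof (rule arg_cong[where f=Eps], rule ext)
      fix D
      show "(f has_derivative D) (at y) = (g has_derivative D) (at y)"
        using has_derivative_transform_within_open[OF _ assms(1) that, of f D UNIV g]
          has_derivative_transform_within_open[OF _ assms(1) that, of g D UNIV f] Cons.prems(1) by auto
    qed
    then show ?thesis by (simp add: partial_deriv_def)
  qed
  from Cons.IH[OF this Cons.prems(2)] show ?case unfolding iter_deriv_Cons .
qed auto

lemma iter_deriv_zero_open:
  assumes "open S" "\<And>x. x \<in> S \<Longrightarrow> f x = 0" "x \<in> S"
  shows "iter_deriv I f x = 0"
  using iter_deriv_cong_open[of S f "\<lambda>x. 0" x I] assms by (simp add: iter_deriv_const split: if_splits)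

text \<open>A crude Leibniz rule: each differentiation doubles the number of products, and every
  product is at most U * V. All bounds are taken at one point x, so that U and V may depend on
  x.\<close>

lemma iter_deriv_mult_bound:
  assumes "smooth f" "smooth g"
    and "\<And>J. length J \<le> length I \<Longrightarrow> norm (iter_deriv J f x) \<le> U"
    and "\<And>J. length J \<le> length I \<Longrightarrow> norm (iter_deriv J g x) \<le> V"
  shows "norm (iter_deriv I (\<lambda>x. f x * g x) x) \<le> 2 ^ length I * (U * V)"
  using assms
proof (induction I arbitrary: f g)
  case Nil
  from Nil.prems(3)[of "[]"] Nil.prems(4)[of "[]"] have "norm (f x) \<le> U" "norm (g x) \<le> V" by auto
  then show ?case by (auto simp: norm_mult intro!: mult_mono order_trans[OF norm_ge_zero])
next
  case (Cons i I)
  have "partial_deriv i (\<lambda>x. f x * g x) = (\<lambda>x. partial_deriv i f x * g x + f x * partial_deriv i g x)"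
    using Cons.prems by (intro ext partial_deriv_mult smooth_differentiable)
  then have "iter_deriv (i # I) (\<lambda>x. f x * g x) x
      = iter_deriv I (\<lambda>x. partial_deriv i f x * g x) x + iter_deriv I (\<lambda>x. f x * partial_deriv i g x) x"
    using Cons.prems by (simp add: iter_deriv_add smooth_mult smooth_partial_deriv)
  moreover have "norm (iter_deriv I (\<lambda>x. partial_deriv i f x * g x) x) \<le> 2 ^ length I * (U * V)"
    using Cons.prems(3)[of "i # _"] Cons.prems(4)
    by (intro Cons.IH smooth_partial_deriv Cons.prems) auto
  moreover have "norm (iter_deriv I (\<lambda>x. f x * partial_deriv i g x) x) \<le> 2 ^ length I * (U * V)"
    using Cons.prems(3) Cons.prems(4)[of "i # _"]
    by (intro Cons.IH smooth_partial_deriv Cons.prems) auto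
  ultimately show ?case
    using norm_triangle_ineq[of "iter_deriv I (\<lambda>x. partial_deriv i f x * g x) x" "iter_deriv I (\<lambda>x. f x * partial_deriv i g x) x"]
    by simp
qed

section \<open>The Schwartz space\<close>

lemma finite_multi_indices: "finite {I :: 'n::finite list. length I \<le> N}"
  using finite_lists_length_le[of "UNIV :: 'n set" N] by simp

lemma schwartzD: "\<phi> \<in> schwartz \<Longrightarrow> smooth \<phi>"
  by (simp add: schwartz_def)

lemma schwartzI:
  assumes "smooth \<phi>" "\<And>I k. \<exists>C. \<forall>x. (1 + norm x) ^ k * norm (iter_deriv I \<phi> x) \<le> C"
  shows "\<phi> \<in> schwartz"
proof -
  have "bounded (range (\<lambda>x. (1 + norm x) ^ k *\<^sub>R iter_deriv I \<phi> x))" for I k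
  proof -
    obtain C where "\<And>x. (1 + norm x) ^ k * norm (iter_deriv I \<phi> x) \<le> C" using assms(2) by blast
    then show ?thesis by (auto simp: bounded_iff intro!: exI[of _ C])
  qed
  then show ?thesis using assms(1) by (simp add: schwartz_def)
qed

lemma schwartz_bdd_above:
  assumes "\<phi> \<in> schwartz"
  shows "bdd_above ((\<lambda>(I, x). (1 + norm x) ^ N * norm (iter_deriv I \<phi> x)) ` ({I. length I \<le> N} \<times> UNIV))"
proof -
  have "\<exists>C. \<forall>x. (1 + norm x) ^ N * norm (iter_deriv I \<phi> x) \<le> C" for I
  proof -
    have "bounded (range (\<lambda>x. (1 + norm x) ^ N *\<^sub>R iter_deriv I \<phi> x))"
      using assms by (simp add: schwartz_def)
    then show ?thesis by (auto simp: bounded_iff)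
  qed
  then obtain C where C: "\<And>I x. (1 + norm x) ^ N * norm (iter_deriv I \<phi> x) \<le> C I" by metis
  show ?thesis
  proof (rule bdd_aboveI, clarify)
    fix I :: "'a list" and x :: "real^'a" assume "length I \<le> N"
    then have "C I \<le> Max (C ` {I. length I \<le> N})"
      by (intro Max_ge) (auto simp: finite_multi_indices)
    then show "(1 + norm x) ^ N * norm (iter_deriv I \<phi> x) \<le> Max (C ` {I. length I \<le> N})"
      using C[of x I] by linarith
  qed
qed

lemma schwartz_norm_upper:
  assumes "\<phi> \<in> schwartz" "length I \<le> N"
  shows "(1 + norm x) ^ N * norm (iter_deriv I \<phi> x) \<le> schwartz_norm N \<phi>"
  unfolding schwartz_norm_def
  using cSUP_upper[OF _ schwartz_bdd_above[OF assms(1), of N], of "(I, x)"] assms(2) by auto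

lemma schwartz_norm_least:
  assumes "\<And>I x. length I \<le> N \<Longrightarrow> (1 + norm x) ^ N * norm (iter_deriv I \<phi> x) \<le> C"
  shows "schwartz_norm N \<phi> \<le> C"
  unfolding schwartz_norm_def
  by (rule cSUP_least) (use assms in \<open>auto intro!: exI[of _ "[]"]\<close>)

lemma schwartz_norm_nonneg: "\<phi> \<in> schwartz \<Longrightarrow> 0 \<le> schwartz_norm N \<phi>"
  using schwartz_norm_upper[of \<phi> "[]" N 0] by (auto intro: order_trans[rotated])

lemma schwartz_norm_bound:
  assumes "\<phi> \<in> schwartz" "length I \<le> N"
  shows "norm (iter_deriv I \<phi> x) \<le> schwartz_norm N \<phi> / (1 + norm x) ^ N"
proof -
  have "0 < (1 + norm x) ^ N" by (simp add: add_pos_nonneg)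
  then show ?thesis using schwartz_norm_upper[OF assms, of x] by (simp add: field_simps)
qed

lemma schwartz_norm_mono:
  assumes "\<phi> \<in> schwartz" "M \<le> N"
  shows "schwartz_norm M \<phi> \<le> schwartz_norm N \<phi>"
proof (rule schwartz_norm_least)
  fix I :: "'a list" and x :: "real^'a" assume "length I \<le> M"
  have "(1 + norm x) ^ M * norm (iter_deriv I \<phi> x) \<le> (1 + norm x) ^ N * norm (iter_deriv I \<phi> x)"
    using assms(2) by (intro mult_right_mono power_increasing) auto
  also have "\<dots> \<le> schwartz_norm N \<phi>"
    using assms \<open>length I \<le> M\<close> by (intro schwartz_norm_upper) auto
  finally show "(1 + norm x) ^ M * norm (iter_deriv I \<phi> x) \<le> schwartz_norm N \<phi>" .
qed

lemma schwartz_partial_deriv: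
  assumes "\<phi> \<in> schwartz"
  shows "partial_deriv i \<phi> \<in> schwartz" "schwartz_norm N (partial_deriv i \<phi>) \<le> schwartz_norm (Suc N) \<phi>"
proof -
  show *: "partial_deriv i \<phi> \<in> schwartz"
  proof (rule schwartzI)
    fix I k
    have "length (i # I) \<le> max k (length (i # I))" by simp
    show "\<exists>C. \<forall>x. (1 + norm x) ^ k * norm (iter_deriv I (partial_deriv i \<phi>) x) \<le> C"
    proof (intro exI allI)
      fix x
      let ?N = "max k (length (i # I))"
      have "(1 + norm x) ^ k * norm (iter_deriv (i # I) \<phi> x) \<le> (1 + norm x) ^ ?N * norm (iter_deriv (i # I) \<phi> x)"
        by (intro mult_right_mono power_increasing) auto
      then show "(1 + norm x) ^ k * norm (iter_deriv I (partial_deriv i \<phi>) x) \<le> schwartz_norm ?N \<phi>"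
        using schwartz_norm_upper[OF assms, of "i # I" ?N x] by simp
    qed
  qed (use assms schwartzD smooth_partial_deriv in auto)
  show "schwartz_norm N (partial_deriv i \<phi>) \<le> schwartz_norm (Suc N) \<phi>"
  proof (rule schwartz_norm_least)
    fix I :: "'a list" and x :: "real^'a" assume I: "length I \<le> N"
    have "(1 + norm x) ^ N * norm (iter_deriv (i # I) \<phi> x) \<le> (1 + norm x) ^ Suc N * norm (iter_deriv (i # I) \<phi> x)"
      by (intro mult_right_mono power_increasing) auto
    also have "\<dots> \<le> schwartz_norm (Suc N) \<phi>"
      using I by (intro schwartz_norm_upper assms) auto
    finally show "(1 + norm x) ^ N * norm (iter_deriv I (partial_deriv i \<phi>) x) \<le> schwartz_norm (Suc N) \<phi>" by simp
  qed
qed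

text \<open>The multipliers of the Schwartz space; the degree L of polynomial growth may increase
  with the order N of the derivatives.\<close>

definition slowly_growing :: "((real^'n::finite) \<Rightarrow> complex) \<Rightarrow> bool" where
  "slowly_growing m \<longleftrightarrow> smooth m \<and>
    (\<forall>N. \<exists>M L. 0 \<le> M \<and> (\<forall>I x. length I \<le> N \<longrightarrow> norm (iter_deriv I m x) \<le> M * (1 + norm x) ^ L))"

text \<open>The growth (1 + |x|)^L of the multiplier is paid for by a seminorm of order N + L. The
  constant is kept proportional to M because, for complements of truncations, M carries a power of
  the truncation parameter.\<close>

lemma schwartz_mult_aux:
  assumes m: "smooth m" "0 \<le> M" "\<And>I x. length I \<le> N \<Longrightarrow> norm (iter_deriv I m x) \<le> M * (1 + norm x) ^ L"
    and \<phi>: "\<phi> \<in> schwartz" and I: "length I \<le> N"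
  shows "(1 + norm x) ^ N * norm (iter_deriv I (\<lambda>x. m x * \<phi> x) x) \<le> 2 ^ N * M * schwartz_norm (N + L) \<phi>"
proof -
  have p: "0 < (1 + norm x) ^ k" for k by (simp add: add_pos_nonneg)
  have "norm (iter_deriv I (\<lambda>x. m x * \<phi> x) x)
      \<le> 2 ^ length I * ((M * (1 + norm x) ^ L) * (schwartz_norm (N + L) \<phi> / (1 + norm x) ^ (N + L)))"
    using I by (intro iter_deriv_mult_bound m schwartzD \<phi> schwartz_norm_bound) auto
  also have "\<dots> \<le> 2 ^ N * ((M * (1 + norm x) ^ L) * (schwartz_norm (N + L) \<phi> / (1 + norm x) ^ (N + L)))"
    using I m(2) schwartz_norm_nonneg[OF \<phi>] by (intro mult_right_mono power_increasing) auto
  also have "\<dots> = 2 ^ N * M * schwartz_norm (N + L) \<phi> / (1 + norm x) ^ N"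
  proof -
    have "M * (a * (b / (c * a))) = M * b / c" if "0 < a" "0 < c" for a b c :: real
      using that by (simp add: field_simps)
    from this[OF p[of L] p[of N], of "schwartz_norm (N + L) \<phi>"] p[of 1] show ?thesis
      by (simp add: power_add mult.assoc)
  qed
  finally show ?thesis using p[of N] by (simp add: field_simps)
qed

lemma schwartz_norm_mult:
  assumes "smooth m" "0 \<le> M" "\<And>I x. length I \<le> N \<Longrightarrow> norm (iter_deriv I m x) \<le> M * (1 + norm x) ^ L"
    and "\<phi> \<in> schwartz"
  shows "schwartz_norm N (\<lambda>x. m x * \<phi> x) \<le> 2 ^ N * M * schwartz_norm (N + L) \<phi>"
  by (intro schwartz_norm_least schwartz_mult_aux assms)

lemma schwartz_mult:
  assumes "slowly_growing m" "\<phi> \<in> schwartz"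
  shows "(\<lambda>x. m x * \<phi> x) \<in> schwartz"
proof (rule schwartzI)
  show "smooth (\<lambda>x. m x * \<phi> x)" using assms by (auto simp: slowly_growing_def intro: smooth_mult schwartzD)
  fix I :: "'a list" and k :: nat
  let ?N = "max k (length I)"
  obtain M L where bnd: "0 \<le> M" "\<And>I x. length I \<le> ?N \<Longrightarrow> norm (iter_deriv I m x) \<le> M * (1 + norm x) ^ L"
    using assms(1) unfolding slowly_growing_def by blast
  show "\<exists>C. \<forall>x. (1 + norm x) ^ k * norm (iter_deriv I (\<lambda>x. m x * \<phi> x) x) \<le> C"
  proof (intro exI allI)
    fix x
    have "(1 + norm x) ^ k * norm (iter_deriv I (\<lambda>x. m x * \<phi> x) x)
        \<le> (1 + norm x) ^ ?N * norm (iter_deriv I (\<lambda>x. m x * \<phi> x) x)"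
      by (intro mult_right_mono power_increasing) auto
    also have "\<dots> \<le> 2 ^ ?N * M * schwartz_norm (?N + L) \<phi>"
      using assms by (intro schwartz_mult_aux bnd) (auto simp: slowly_growing_def)
    finally show "(1 + norm x) ^ k * norm (iter_deriv I (\<lambda>x. m x * \<phi> x) x) \<le> 2 ^ ?N * M * schwartz_norm (?N + L) \<phi>" .
  qed
qed

lemma slowly_growing_const: "slowly_growing (\<lambda>x. c)"
  unfolding slowly_growing_def
proof (intro conjI allI)
  show "\<exists>M L. 0 \<le> M \<and> (\<forall>I x. length I \<le> N \<longrightarrow> norm (iter_deriv I (\<lambda>x. c) x) \<le> M * (1 + norm x) ^ L)" for N
    by (rule exI[of _ "norm c"], rule exI[of _ 0]) (auto simp: iter_deriv_const)
qed (rule smooth_const)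

lemma schwartz_slowly_growing:
  assumes "\<phi> \<in> schwartz" shows "slowly_growing \<phi>"
  unfolding slowly_growing_def
proof (intro conjI allI exI impI)
  fix N I x assume "length (I::'a list) \<le> N"
  then show "norm (iter_deriv I \<phi> x) \<le> schwartz_norm N \<phi> * (1 + norm x) ^ 0"
    using schwartz_norm_upper[OF assms, of I N x] mult_right_mono[of 1 "(1 + norm x) ^ N" "norm (iter_deriv I \<phi> x)"]
    by (auto intro: order_trans[rotated])
qed (use assms schwartzD schwartz_norm_nonneg in auto)

lemma schwartz_cmult: "\<phi> \<in> schwartz \<Longrightarrow> (\<lambda>x. c * \<phi> x) \<in> schwartz"
  by (rule schwartz_mult[OF slowly_growing_const])

lemma schwartz_norm_cmult: "\<phi> \<in> schwartz \<Longrightarrow> schwartz_norm N (\<lambda>x. c * \<phi> x) \<le> norm c * schwartz_norm N \<phi>"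
proof (rule schwartz_norm_least)
  fix I :: "'a list" and x :: "real^'a" assume \<phi>: "\<phi> \<in> schwartz" and I: "length I \<le> N"
  show "(1 + norm x) ^ N * norm (iter_deriv I (\<lambda>x. c * \<phi> x) x) \<le> norm c * schwartz_norm N \<phi>"
    using mult_left_mono[OF schwartz_norm_upper[OF \<phi> I, of x], of "norm c"]
    by (simp add: iter_deriv_cmult schwartzD[OF \<phi>] norm_mult mult.left_commute)
qed

lemma schwartz_add:
  assumes "\<phi> \<in> schwartz" "\<psi> \<in> schwartz" shows "(\<lambda>x. \<phi> x + \<psi> x) \<in> schwartz"
proof (rule schwartzI)
  fix I :: "'a list" and k :: nat
  let ?N = "max k (length I)"
  show "\<exists>C. \<forall>x. (1 + norm x) ^ k * norm (iter_deriv I (\<lambda>x. \<phi> x + \<psi> x) x) \<le> C"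
  proof (intro exI allI)
    fix x
    have "(1 + norm x) ^ k * norm (iter_deriv I (\<lambda>x. \<phi> x + \<psi> x) x)
        \<le> (1 + norm x) ^ ?N * (norm (iter_deriv I \<phi> x) + norm (iter_deriv I \<psi> x))"
      using assms by (intro mult_mono power_increasing)
        (auto simp: iter_deriv_add schwartzD norm_triangle_ineq)
    also have "\<dots> \<le> schwartz_norm ?N \<phi> + schwartz_norm ?N \<psi>"
      using assms by (simp add: distrib_left add_mono schwartz_norm_upper)
    finally show "(1 + norm x) ^ k * norm (iter_deriv I (\<lambda>x. \<phi> x + \<psi> x) x) \<le> schwartz_norm ?N \<phi> + schwartz_norm ?N \<psi>" .
  qed
qed (use assms in \<open>auto intro: smooth_add schwartzD\<close>)

lemma schwartz_diff: "\<phi> \<in> schwartz \<Longrightarrow> \<psi> \<in> schwartz \<Longrightarrow> (\<lambda>x. \<phi> x - \<psi> x) \<in> schwartz"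
  using schwartz_add[of \<phi> "\<lambda>x. (- 1) * \<psi> x"] schwartz_cmult[of \<psi> "-1"] by simp

lemma schwartz_zero: "(\<lambda>x. 0) \<in> schwartz"
  by (rule schwartzI) (auto simp: smooth_const iter_deriv_const)

section \<open>Dilations and translations of Schwartz functions\<close>

lemma one_plus_norm_affine:
  assumes "c \<noteq> 0"
  shows "1 + norm (x::'a::real_normed_vector) \<le> (1 + 1 / \<bar>c\<bar>) * (1 + norm a) * (1 + norm (c *\<^sub>R x + a))"
proof -
  have "norm x = norm ((c *\<^sub>R x + a) - a) / \<bar>c\<bar>" using assms by simp
  also have "\<dots> \<le> (norm (c *\<^sub>R x + a) + norm a) / \<bar>c\<bar>"
    by (intro divide_right_mono norm_triangle_ineq4) auto
  finally have "norm x \<le> 1 / \<bar>c\<bar> * (norm (c *\<^sub>R x + a) + norm a)" by simp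
  also have "\<dots> \<le> 1 / \<bar>c\<bar> * ((1 + norm a) * (1 + norm (c *\<^sub>R x + a)))"
    by (intro mult_left_mono) (auto simp: algebra_simps)
  finally have 1: "norm x \<le> 1 / \<bar>c\<bar> * ((1 + norm a) * (1 + norm (c *\<^sub>R x + a)))" .
  have 2: "1 \<le> (1 + norm a) * (1 + norm (c *\<^sub>R x + a))"
    using mult_mono[of 1 "1 + norm a" 1 "1 + norm (c *\<^sub>R x + a)"] by simp
  have "(1 + 1 / \<bar>c\<bar>) * (1 + norm a) * (1 + norm (c *\<^sub>R x + a))
      = (1 + norm a) * (1 + norm (c *\<^sub>R x + a)) + 1 / \<bar>c\<bar> * ((1 + norm a) * (1 + norm (c *\<^sub>R x + a)))"
    by (simp add: ring_distribs)
  then show ?thesis using add_mono[OF 2 1] by linarith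
qed

lemma schwartz_affine_aux:
  assumes \<phi>: "\<phi> \<in> schwartz" and c: "c \<noteq> 0" and I: "length I \<le> N"
  shows "(1 + norm x) ^ N * norm (iter_deriv I (\<lambda>x. \<phi> (c *\<^sub>R x + a)) x)
    \<le> ((1 + 1 / \<bar>c\<bar>) * (1 + norm a) * (1 + \<bar>c\<bar>)) ^ N * schwartz_norm N \<phi>"
proof -
  let ?y = "c *\<^sub>R x + a"
  have "\<bar>c\<bar> ^ length I \<le> (1 + \<bar>c\<bar>) ^ length I" by (intro power_mono) auto
  also have "\<dots> \<le> (1 + \<bar>c\<bar>) ^ N" using I by (intro power_increasing) auto
  finally have ci: "\<bar>c\<bar> ^ length I \<le> (1 + \<bar>c\<bar>) ^ N" .
  have "(1 + norm x) ^ N * norm (iter_deriv I (\<lambda>x. \<phi> (c *\<^sub>R x + a)) x)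
      = (1 + norm x) ^ N * (\<bar>c\<bar> ^ length I * norm (iter_deriv I \<phi> ?y))"
    by (simp add: iter_deriv_affine[OF schwartzD[OF \<phi>]] norm_mult norm_power)
  also have "\<dots> \<le> ((1 + 1 / \<bar>c\<bar>) * (1 + norm a) * (1 + norm ?y)) ^ N * ((1 + \<bar>c\<bar>) ^ N * norm (iter_deriv I \<phi> ?y))"
    by (intro mult_mono power_mono one_plus_norm_affine c ci) (auto intro!: mult_nonneg_nonneg)
  also have "\<dots> = ((1 + 1 / \<bar>c\<bar>) * (1 + norm a) * (1 + \<bar>c\<bar>)) ^ N * ((1 + norm ?y) ^ N * norm (iter_deriv I \<phi> ?y))"
    by (simp add: power_mult_distrib mult_ac)
  also have "\<dots> \<le> ((1 + 1 / \<bar>c\<bar>) * (1 + norm a) * (1 + \<bar>c\<bar>)) ^ N * schwartz_norm N \<phi>"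
    by (intro mult_left_mono schwartz_norm_upper \<phi> I) auto
  finally show ?thesis .
qed

text \<open>The polynomial dependence on the translation a is what makes a tempered distribution,
  applied to the translates of a fixed Schwartz function, a function of polynomial growth.\<close>

lemma schwartz_norm_affine:
  assumes "\<phi> \<in> schwartz" "c \<noteq> 0"
  shows "schwartz_norm N (\<lambda>x. \<phi> (c *\<^sub>R x + a)) \<le> ((1 + 1 / \<bar>c\<bar>) * (1 + norm a) * (1 + \<bar>c\<bar>)) ^ N * schwartz_norm N \<phi>"
  by (intro schwartz_norm_least schwartz_affine_aux assms)

lemma schwartz_affine:
  assumes "\<phi> \<in> schwartz" "c \<noteq> 0"
  shows "(\<lambda>x. \<phi> (c *\<^sub>R x + a)) \<in> schwartz"
proof (rule schwartzI)
  fix I :: "'a list" and k :: nat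
  let ?N = "max k (length I)"
  show "\<exists>C. \<forall>x. (1 + norm x) ^ k * norm (iter_deriv I (\<lambda>x. \<phi> (c *\<^sub>R x + a)) x) \<le> C"
  proof (intro exI allI)
    fix x
    have "(1 + norm x) ^ k * norm (iter_deriv I (\<lambda>x. \<phi> (c *\<^sub>R x + a)) x)
        \<le> (1 + norm x) ^ ?N * norm (iter_deriv I (\<lambda>x. \<phi> (c *\<^sub>R x + a)) x)"
      by (intro mult_right_mono power_increasing) auto
    also have "\<dots> \<le> ((1 + 1 / \<bar>c\<bar>) * (1 + norm a) * (1 + \<bar>c\<bar>)) ^ ?N * schwartz_norm ?N \<phi>"
      using assms by (intro schwartz_affine_aux) auto
    finally show "(1 + norm x) ^ k * norm (iter_deriv I (\<lambda>x. \<phi> (c *\<^sub>R x + a)) x) \<le> \<dots>" .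
  qed
qed (use assms in \<open>auto intro: smooth_affine schwartzD\<close>)

lemma partial_deriv_coord: "partial_deriv j (\<lambda>x. complex_of_real (x $ i)) = (\<lambda>x. if i = j then 1 else 0)"
proof
  fix x :: "real^'a"
  have "((\<lambda>x::real^'a. complex_of_real (x $ i)) has_derivative (\<lambda>h. complex_of_real (h $ i))) (at x)"
    by (intro bounded_linear_imp_has_derivative bounded_linear_compose[OF bounded_linear_of_real bounded_linear_vec_nth])
  from partial_derivI[OF this, of j]
  show "partial_deriv j (\<lambda>x. complex_of_real (x $ i)) x = (if i = j then 1 else 0)"
    by (auto simp: axis_def)
qed

lemma smooth_coord: "smooth (\<lambda>x. complex_of_real (x $ i))"
proof -
  have d: "(\<lambda>x::real^'a. complex_of_real (x $ i)) differentiable_on UNIV"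
    by (auto simp: differentiable_on_def intro!: bounded_linear_imp_differentiable
        bounded_linear_compose[OF bounded_linear_of_real bounded_linear_vec_nth])
  have "Ck k (\<lambda>x. complex_of_real (x $ i))" for k
    by (cases k) (auto simp: d partial_deriv_coord Ck_const)
  then show ?thesis by (simp add: smooth_iff_Ck)
qed

lemma iter_deriv_coord_bound: "norm (iter_deriv I (\<lambda>x. complex_of_real (x $ i)) x) \<le> 1 * (1 + norm x) ^ 1"
  using component_le_norm_cart[of x i]
  by (cases I) (auto simp: partial_deriv_coord iter_deriv_const add_increasing2)

lemma slowly_growing_coord: "slowly_growing (\<lambda>x. complex_of_real (x $ i))"
  unfolding slowly_growing_def using iter_deriv_coord_bound smooth_coord zero_le_one by blast

lemma schwartz_norm_coord:
  "\<phi> \<in> schwartz \<Longrightarrow> schwartz_norm N (\<lambda>x. complex_of_real (x $ i) * \<phi> x) \<le> 2 ^ N * 1 * schwartz_norm (N + 1) \<phi>"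
  by (rule schwartz_norm_mult[OF smooth_coord _ iter_deriv_coord_bound]) auto

lemma test_functions_schwartz:
  assumes "\<phi> \<in> test_functions U" shows "\<phi> \<in> schwartz"
proof (rule schwartzI)
  let ?K = "closure {x. \<phi> x \<noteq> 0}"
  from assms show s: "smooth \<phi>" by (simp add: test_functions_def)
  fix I :: "'a list" and k :: nat
  have "continuous_on ?K (\<lambda>x. (1 + norm x) ^ k * norm (iter_deriv I \<phi> x))"
    by (intro continuous_intros smooth_continuous_on smooth_iter_deriv s)
  then have "compact ((\<lambda>x. (1 + norm x) ^ k * norm (iter_deriv I \<phi> x)) ` ?K)"
    using assms by (intro compact_continuous_image) (auto simp: test_functions_def)
  then obtain C where C: "\<And>x. x \<in> ?K \<Longrightarrow> (1 + norm x) ^ k * norm (iter_deriv I \<phi> x) \<le> C"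
    by (meson bdd_above.unfold bounded_imp_bdd_above compact_imp_bounded imageI)
  have "iter_deriv I \<phi> x = 0" if "x \<notin> ?K" for x
    using that closure_subset[of "{x. \<phi> x \<noteq> 0}"]
    by (intro iter_deriv_zero_open[of "- ?K"]) auto
  then have "(1 + norm x) ^ k * norm (iter_deriv I \<phi> x) \<le> max C 0" for x
    using C[of x] by (cases "x \<in> ?K") auto
  then show "\<exists>C. \<forall>x. (1 + norm x) ^ k * norm (iter_deriv I \<phi> x) \<le> C" by blast
qed

lemma test_functionsI:
  assumes "smooth \<phi>" "closed K" "bounded K" "K \<subseteq> U" "\<And>x. x \<notin> K \<Longrightarrow> \<phi> x = 0"
  shows "\<phi> \<in> test_functions U"
proof -
  have "closure {x. \<phi> x \<noteq> 0} \<subseteq> K" using assms by (intro closure_minimal) auto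
  then show ?thesis
    using assms by (auto simp: test_functions_def compact_eq_bounded_closed intro: bounded_subset)
qed

section \<open>Radial cut-off functions\<close>

primrec Ck1 :: "nat \<Rightarrow> (real \<Rightarrow> real) \<Rightarrow> bool" where
  "Ck1 0 h \<longleftrightarrow> h differentiable_on UNIV"
| "Ck1 (Suc k) h \<longleftrightarrow> h differentiable_on UNIV \<and> Ck1 k (deriv h)"

lemma Ck1_iff: "Ck1 k h \<longleftrightarrow> (\<forall>i\<le>k. (deriv ^^ i) h differentiable_on UNIV)"
proof (induction k arbitrary: h)
  case (Suc k)
  have "(\<forall>i\<le>Suc k. P i) \<longleftrightarrow> P 0 \<and> (\<forall>i\<le>k. P (Suc i))" for P
    by (metis Suc_le_mono not0_implies_Suc zero_le)
  from this[of "\<lambda>i. (deriv ^^ i) h differentiable_on UNIV"] show ?case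
    by (simp add: Suc.IH funpow_swap1)
qed auto

lemma Ck1_Suc: "Ck1 (Suc k) h \<Longrightarrow> Ck1 k h"
  by (auto simp: Ck1_iff simp del: Ck1.simps)

lemma Ck1_DERIV: "Ck1 k h \<Longrightarrow> DERIV h t :> deriv h t"
  by (cases k) (auto simp: differentiable_on_def intro!: DERIV_deriv_iff_real_differentiable[THEN iffD2])

lemma Ck1_const: "Ck1 k (\<lambda>t. c)"
  by (induction k arbitrary: c) auto

lemma Ck1_affine_image:
  "Ck1 k g \<Longrightarrow> Ck1 k h \<Longrightarrow> Ck1 k (\<lambda>t. a * g t + b * h t)"
proof (induction k arbitrary: g h)
  case (Suc k)
  have "deriv (\<lambda>t. a * g t + b * h t) = (\<lambda>t. a * deriv g t + b * deriv h t)"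
  proof
    fix t
    have "DERIV (\<lambda>t. a * g t + b * h t) t :> a * deriv g t + b * deriv h t"
      using Ck1_DERIV[OF Suc.prems(1), of t] Ck1_DERIV[OF Suc.prems(2), of t]
      by (auto intro!: derivative_eq_intros)
    then show "deriv (\<lambda>t. a * g t + b * h t) t = a * deriv g t + b * deriv h t" by (rule DERIV_imp_deriv)
  qed
  then show ?case using Suc by (auto intro!: differentiable_on_add differentiable_on_mult)
qed (auto intro!: differentiable_on_add differentiable_on_mult)

lemma Ck1_affine: "Ck1 k h \<Longrightarrow> Ck1 k (\<lambda>t. h (a * t + b))"
proof (induction k arbitrary: h)
  case 0
  then have "(h \<circ> (\<lambda>t. a * t + b)) differentiable_on UNIV"
    by (auto simp: differentiable_on_def intro!: differentiable_chain_at)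
  then show ?case by (simp add: o_def)
next
  case (Suc k)
  then have "(h \<circ> (\<lambda>t. a * t + b)) differentiable_on UNIV"
    by (auto simp: differentiable_on_def intro!: differentiable_chain_at)
  moreover have "deriv (\<lambda>t. h (a * t + b)) = (\<lambda>t. a * deriv h (a * t + b) + 0 * 0)"
  proof
    fix t
    have "DERIV (\<lambda>t. h (a * t + b)) t :> deriv h (a * t + b) * a"
      by (rule DERIV_chain2[of h]) (auto intro!: derivative_eq_intros Ck1_DERIV[OF Suc.prems])
    then show "deriv (\<lambda>t. h (a * t + b)) t = a * deriv h (a * t + b) + 0 * 0"
      by (simp add: DERIV_imp_deriv mult.commute)
  qed
  ultimately show ?case
    using Suc Ck1_affine_image[of k "\<lambda>t. deriv h (a * t + b)" "\<lambda>t. 0" a 0] by (simp add: o_def Ck1_const)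
qed

text \<open>Since h vanishes below r > 0, the singularity of 1 / t is never seen. The derivative of
  the quotient is again something divided by t, with a numerator that vanishes below r, so the
  induction on k closes.\<close>

lemma Ck1_divide:
  assumes "0 < r" "\<And>t. t < r \<Longrightarrow> h t = 0" "Ck1 k h"
  shows "Ck1 k (\<lambda>t. h t / t)" "\<And>t. DERIV (\<lambda>t. h t / t) t :> (deriv h t - h t / t) / t"
proof -
  have z: "deriv h t = 0" if h: "\<And>t. t < r \<Longrightarrow> h t = 0" and t: "t < r" for t and h :: "real \<Rightarrow> real"
  proof (rule DERIV_imp_deriv)
    show "DERIV h t :> 0"
      by (rule has_field_derivative_transform_within_open[of "\<lambda>_. 0" 0 t "{..<r}" h]) (use h t in simp_all)
  qed
  have D: "DERIV (\<lambda>t. h t / t) t :> (deriv h t - h t / t) / t"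
    if h: "\<And>t. t < r \<Longrightarrow> h t = 0" and Ck: "Ck1 k h" for t k and h :: "real \<Rightarrow> real"
  proof (cases "t < r")
    case True
    have "DERIV (\<lambda>t. h t / t) t :> 0"
      by (rule has_field_derivative_transform_within_open[of "\<lambda>_. 0" 0 t "{..<r}"]) (use h True in simp_all)
    then show ?thesis by (simp only: z[OF h True] h[OF True]) simp
  next
    case False
    then have "t \<noteq> 0" using assms(1) by auto
    then have "DERIV (\<lambda>t. h t / t) t :> (deriv h t * t - h t * 1) / (t * t)"
      by (intro DERIV_divide Ck1_DERIV[OF Ck] DERIV_ident)
    moreover have "(deriv h t * t - h t * 1) / (t * t) = (deriv h t - h t / t) / t"
      using \<open>t \<noteq> 0\<close> by (simp add: field_simps)
    ultimately show ?thesis by simp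
  qed
  show "DERIV (\<lambda>t. h t / t) t :> (deriv h t - h t / t) / t" for t by (rule D[OF assms(2,3)])
  show "Ck1 k (\<lambda>t. h t / t)" using assms(2,3)
  proof (induction k arbitrary: h)
    case 0
    then show ?case using D[OF 0]
      by (auto simp: differentiable_on_def intro!: differentiableI[OF has_field_derivative_imp_has_derivative])
  next
    case (Suc k)
    have "(\<lambda>t. h t / t) differentiable_on UNIV" using D[OF Suc.prems]
      by (auto simp: differentiable_on_def intro!: differentiableI[OF has_field_derivative_imp_has_derivative])
    moreover have "deriv (\<lambda>t. h t / t) = (\<lambda>t. (1 * deriv h t + (- 1) * (h t / t)) / t)"
      using D[OF Suc.prems] by (auto intro!: ext DERIV_imp_deriv)
    moreover have "Ck1 k (\<lambda>t. (1 * deriv h t + (- 1) * (h t / t)) / t)"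
    proof (rule Suc.IH)
      show "1 * deriv h t + - 1 * (h t / t) = 0" if "t < r" for t
        using z[OF Suc.prems(1) that] Suc.prems(1)[OF that] by simp
      have "Ck1 k (\<lambda>t. h t / t)" by (rule Suc.IH[OF Suc.prems(1) Ck1_Suc[OF Suc.prems(2)]])
      moreover have "Ck1 k (deriv h)" using Suc.prems(2) by simp
      ultimately show "Ck1 k (\<lambda>t. 1 * deriv h t + - 1 * (h t / t))"
        by (intro Ck1_affine_image)
    qed
    ultimately show ?case by (simp only: Ck1.simps simp_thms)
  qed
qed

text \<open>A partial derivative of h(|x|) is h'(|x|)/|x| times a coordinate: again radial, with
  profile h'(t)/t, times a smooth function. That h vanishes near 0 keeps the norm away from its
  singularity.\<close>

lemma Ck_radial:
  assumes r: "0 < r" and "\<And>t. t < r \<Longrightarrow> h t = 0" "Ck1 k h"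
  shows "Ck k (\<lambda>x::real^'n::finite. complex_of_real (h (norm x)))"
proof -
  have D: "((\<lambda>x::real^'n. complex_of_real (h (norm x))) has_derivative
      (\<lambda>v. complex_of_real (deriv h (norm x) / norm x * (v \<bullet> x)))) (at x)"
    if h: "\<And>t. t < r \<Longrightarrow> h t = 0" "Ck1 k h" for h k x
  proof (cases "norm x < r")
    case True
    have "deriv h (norm x) = 0"
    proof -
      have "DERIV h (norm x) :> 0"
        using True h by (intro has_field_derivative_transform_within_open[of "\<lambda>_. 0" 0 "norm x" "{..<r}" h]) auto
      then show ?thesis by (rule DERIV_imp_deriv)
    qed
    moreover have "((\<lambda>x::real^'n. complex_of_real (h (norm x))) has_derivative (\<lambda>v. 0)) (at x)"
      by (rule has_derivative_transform_within_open[of "\<lambda>_. 0" _ _ UNIV "ball 0 r"])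
        (use True h in auto)
    ultimately show ?thesis by simp
  next
    case False
    then have x: "x \<noteq> 0" using r by auto
    have "((\<lambda>x. h (norm x)) has_derivative (\<lambda>v. deriv h (norm x) * (v \<bullet> sgn x))) (at x)"
      using has_derivative_compose[OF has_derivative_norm[OF x] has_field_derivative_imp_has_derivative[OF Ck1_DERIV[OF h(2), of "norm x"]]]
      by (simp add: o_def)
    from has_derivative_of_real[OF this]
    have "((\<lambda>x. complex_of_real (h (norm x))) has_derivative (\<lambda>v. complex_of_real (deriv h (norm x) * (v \<bullet> sgn x)))) (at x)" .
    moreover have "deriv h (norm x) * (v \<bullet> sgn x) = deriv h (norm x) / norm x * (v \<bullet> x)" for v
      by (simp add: sgn_div_norm divide_inverse)
    ultimately show ?thesis by simp
  qed
  show ?thesis using assms(2,3)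
  proof (induction k arbitrary: h)
    case 0
    then show ?case using D[OF 0] by (auto simp: differentiable_on_def intro!: differentiableI)
  next
    case (Suc k)
    have "(\<lambda>x::real^'n. complex_of_real (h (norm x))) differentiable_on UNIV"
      using D[OF Suc.prems] by (auto simp: differentiable_on_def intro!: differentiableI)
    moreover have "partial_deriv i (\<lambda>x::real^'n. complex_of_real (h (norm x)))
        = (\<lambda>x. complex_of_real (deriv h (norm x) / norm x) * complex_of_real (x $ i))" for i
      by (rule ext, subst partial_derivI[OF D[OF Suc.prems]]) (auto simp: inner_axis' )
    moreover have "Ck k (\<lambda>x::real^'n. complex_of_real (deriv h (norm x) / norm x))"
    proof (rule Suc.IH)
      have z: "deriv h t = 0" if "t < r" for t
        using that Suc.prems(1)
        by (intro DERIV_imp_deriv has_field_derivative_transform_within_open[of "\<lambda>_. 0" 0 t "{..<r}" h]) auto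
      then show "deriv h t / t = 0" if "t < r" for t using that by simp
      show "Ck1 k (\<lambda>t. deriv h t / t)" using Suc.prems z by (intro Ck1_divide[OF r]) auto
    qed
    moreover have "Ck k (\<lambda>x::real^'n. complex_of_real (x $ i))" for i
      using smooth_coord[of i] by (auto simp: smooth_iff_Ck)
    ultimately show ?case by (simp only: Ck.simps Ck_mult) simp
  qed
qed

lemma smooth_radial:
  assumes "0 < r" "\<And>t. t < r \<Longrightarrow> h t = 1" "\<And>k. Ck1 k h"
  shows "smooth (\<lambda>x::real^'n::finite. complex_of_real (h (norm x)))"
proof -
  \<comment> \<open>The profile h - 1 vanishes below r, as \<open>Ck_radial\<close> requires; the
    constant is added back afterwards.\<close>
  have "Ck1 k (\<lambda>t. 1 * h t + (- 1) * 1)" for k by (intro Ck1_affine_image Ck1_const assms)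
  then have "smooth (\<lambda>x::real^'n. complex_of_real (1 * h (norm x) + (- 1) * 1))"
    using assms unfolding smooth_iff_Ck by (intro allI Ck_radial[of r]) auto
  from smooth_add[OF this smooth_const[of 1]] show ?thesis by simp
qed

section \<open>Truncations by dilated cut-offs\<close>

lemma besov_cutoff_Ck1: "besov_cutoff \<Psi> \<Longrightarrow> Ck1 k \<Psi>"
  by (auto simp: besov_cutoff_def Ck1_iff)

text \<open>The parameter t is a reciprocal radius: the function is 1 for t|x| < 11/10 and 0 for
  t|x| > 13/10. In space it is used with t tending to 0, to approximate by test functions; in
  frequency with t = 1 / R, to single out a ball.\<close>

definition cut :: "(real \<Rightarrow> real) \<Rightarrow> real \<Rightarrow> (real^'n::finite) \<Rightarrow> complex"
  where "cut \<Psi> t x = complex_of_real (\<Psi> (t * norm x))"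

context
  fixes \<Psi> :: "real \<Rightarrow> real"
  assumes \<Psi>: "besov_cutoff \<Psi>"
begin

lemma cut_eq_1: "t * norm x < 11/10 \<Longrightarrow> cut \<Psi> t x = 1"
  using \<Psi> by (simp add: cut_def besov_cutoff_def)

lemma cut_eq_0: "t * norm x > 13/10 \<Longrightarrow> cut \<Psi> t x = 0"
  using \<Psi> by (simp add: cut_def besov_cutoff_def)

lemma smooth_cut: "0 < t \<Longrightarrow> smooth (cut \<Psi> t)"
proof -
  assume t: "0 < t"
  have "Ck1 k (\<lambda>s. \<Psi> (t * s + 0))" for k by (intro Ck1_affine besov_cutoff_Ck1 \<Psi>)
  then show ?thesis
    using t \<Psi> unfolding cut_def
    by (intro smooth_radial[of "11/10 / t" "\<lambda>s. \<Psi> (t * s)"]) (auto simp: besov_cutoff_def field_simps)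
qed

lemma cut_test: "0 < t \<Longrightarrow> cut \<Psi> t \<in> test_functions UNIV"
  by (rule test_functionsI[OF smooth_cut, of _ "cball 0 (13/10 / t)"])
    (auto intro: cut_eq_0 simp: field_simps)

lemma cut_schwartz: "0 < t \<Longrightarrow> cut \<Psi> t \<in> schwartz"
  by (rule test_functions_schwartz[OF cut_test])

text \<open>The complement vanishes where t|x| < 11/10, and elsewhere 1 <= t(1 + |x|). Hence any
  number L of powers of t can be gained at the price of as many powers of 1 + |x|. Derivatives only
  contribute further factors t <= 1.\<close>

lemma cut_complement_bound:
  "\<exists>M\<ge>0. \<forall>t I (x::real^'n::finite). 0 < t \<longrightarrow> t \<le> 1 \<longrightarrow> length I \<le> N \<longrightarrow>
    norm (iter_deriv I (\<lambda>x. 1 - cut \<Psi> t x) x) \<le> (M * t ^ L) * (1 + norm x) ^ L"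
proof -
  let ?h = "\<lambda>x::real^'n. 1 - cut \<Psi> 1 x"
  have sm: "smooth ?h" by (intro smooth_diff smooth_const smooth_cut) auto
  define M where "M = 1 + schwartz_norm N (cut \<Psi> 1 :: real^'n \<Rightarrow> complex)"
  have S: "(cut \<Psi> 1 :: real^'n \<Rightarrow> complex) \<in> schwartz" by (intro cut_schwartz) simp
  have M: "0 \<le> M" using schwartz_norm_nonneg[OF S] by (simp add: M_def)
  have b: "norm (iter_deriv I ?h x) \<le> M" if "length I \<le> N" for I and x :: "real^'n"
  proof -
    have "norm (iter_deriv I (cut \<Psi> 1) x) \<le> (1 + norm x) ^ N * norm (iter_deriv I (cut \<Psi> 1) x)"
      using mult_right_mono[of 1 "(1 + norm x) ^ N"] by simp
    also have "\<dots> \<le> schwartz_norm N (cut \<Psi> 1 :: real^'n \<Rightarrow> complex)"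
      by (rule schwartz_norm_upper[OF S that])
    finally have "norm (iter_deriv I (cut \<Psi> 1) x) \<le> M - 1" by (simp add: M_def)
    moreover have "iter_deriv I ?h x = (if I = [] then 1 else 0) - iter_deriv I (cut \<Psi> 1) x"
      by (subst iter_deriv_diff[OF smooth_const smooth_cut]) (auto simp: iter_deriv_const)
    ultimately show ?thesis
      using norm_triangle_ineq4[of "if I = [] then 1 else 0" "iter_deriv I (cut \<Psi> 1) x"] by (auto split: if_splits)
  qed
  have "norm (iter_deriv I (\<lambda>x. 1 - cut \<Psi> t x) x) \<le> (M * t ^ L) * (1 + norm x) ^ L"
    if t: "0 < t" "t \<le> 1" and I: "length I \<le> N" for t I and x :: "real^'n"
  proof -
    have "(\<lambda>x::real^'n. 1 - cut \<Psi> t x) = (\<lambda>x. ?h (t *\<^sub>R x + 0))" using t by (simp add: cut_def)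
    then have eq: "iter_deriv I (\<lambda>x. 1 - cut \<Psi> t x) x = of_real t ^ length I * iter_deriv I ?h (t *\<^sub>R x)"
      using iter_deriv_affine[OF sm, of t 0 I] by simp
    show ?thesis
    proof (cases "t * norm x < 11/10")
      case True
      then have "iter_deriv I ?h (t *\<^sub>R x) = 0"
        using t by (intro iter_deriv_zero_open[of "ball 0 (11/10)"]) (auto simp: cut_eq_1)
      then show ?thesis using M t by (simp add: eq)
    next
      case False
      have "1 \<le> t * (1 + norm x)" using False t by (simp add: algebra_simps)
      then have "1 \<le> (t * (1 + norm x)) ^ L" by (rule one_le_power)
      have "norm (iter_deriv I (\<lambda>x. 1 - cut \<Psi> t x) x) \<le> 1 * M"
        unfolding eq norm_mult norm_power using t b[OF I] by (intro mult_mono) (auto simp: power_le_one)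
      also have "\<dots> \<le> M * (t * (1 + norm x)) ^ L"
        using M \<open>1 \<le> (t * (1 + norm x)) ^ L\<close> mult_left_mono[of 1 _ M] by simp
      finally show ?thesis by (simp add: power_mult_distrib mult.assoc)
    qed
  qed
  then show ?thesis using M by blast
qed

lemma slowly_growing_cut_complement: "0 < t \<Longrightarrow> slowly_growing (\<lambda>x. 1 - cut \<Psi> t x)"
proof -
  assume t: "0 < t"
  have "slowly_growing (\<lambda>x. c + \<phi> x)" if "\<phi> \<in> schwartz" for c and \<phi> :: "real^'n \<Rightarrow> complex"
    unfolding slowly_growing_def
  proof (intro conjI allI exI impI)
    fix N I x assume I: "length (I::'n list) \<le> N"
    have "norm (iter_deriv I \<phi> x) \<le> (1 + norm x) ^ N * norm (iter_deriv I \<phi> x)"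
      using mult_right_mono[of 1 "(1 + norm x) ^ N"] by simp
    then have "norm (iter_deriv I \<phi> x) \<le> schwartz_norm N \<phi>"
      using schwartz_norm_upper[OF that I, of x] by linarith
    moreover have "iter_deriv I (\<lambda>x. c + \<phi> x) x = (if I = [] then c else 0) + iter_deriv I \<phi> x"
      by (subst iter_deriv_add[OF smooth_const schwartzD[OF that]]) (auto simp: iter_deriv_const)
    ultimately show "norm (iter_deriv I (\<lambda>x. c + \<phi> x) x) \<le> (norm c + schwartz_norm N \<phi>) * (1 + norm x) ^ 0"
      using norm_triangle_ineq[of "if I = [] then c else 0" "iter_deriv I \<phi> x"]
      by (cases "I = []") (auto intro: add_increasing)
  qed (use that in \<open>auto intro!: smooth_add smooth_const add_nonneg_nonneg schwartz_norm_nonneg dest: schwartzD\<close>)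
  from this[of "\<lambda>x. (- 1) * cut \<Psi> t x" 1] show ?thesis
    using t by (simp add: schwartz_cmult[OF cut_schwartz, of t "-1", simplified])
qed

text \<open>With L = 1 this is the density of test functions, with the explicit rate t. With large
  L, applied on the Fourier side, it yields the arbitrarily fast decay of high-frequency
  pairings.\<close>

lemma schwartz_norm_cut_complement:
  "\<exists>M\<ge>0. \<forall>t (\<phi>::real^'n::finite \<Rightarrow> complex). 0 < t \<longrightarrow> t \<le> 1 \<longrightarrow> \<phi> \<in> schwartz \<longrightarrow>
    schwartz_norm N (\<lambda>x. (1 - cut \<Psi> t x) * \<phi> x) \<le> M * t ^ L * schwartz_norm (N + L) \<phi>"
proof -
  obtain M where M: "M \<ge> 0" "\<And>t I (x::real^'n). 0 < t \<Longrightarrow> t \<le> 1 \<Longrightarrow> length I \<le> N \<Longrightarrow>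
    norm (iter_deriv I (\<lambda>x. 1 - cut \<Psi> t x) x) \<le> (M * t ^ L) * (1 + norm x) ^ L"
    using cut_complement_bound[of N L, where 'n='n] by blast
  have "schwartz_norm N (\<lambda>x. (1 - cut \<Psi> t x) * \<phi> x) \<le> 2 ^ N * (M * t ^ L) * schwartz_norm (N + L) \<phi>"
    if "0 < t" "t \<le> 1" "\<phi> \<in> schwartz" for t and \<phi> :: "real^'n \<Rightarrow> complex"
    using that M by (intro schwartz_norm_mult smooth_diff smooth_const smooth_cut M(2)) auto
  then show ?thesis using M(1) by (intro exI[of _ "2 ^ N * M"]) (auto simp: mult.assoc)
qed

end

section \<open>Integration of Schwartz functions\<close>

definition decay :: "real^'n::finite \<Rightarrow> real"
  where "decay x = 1 / (1 + norm x) ^ (2 * CARD('n))"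

lemma decay_pos: "0 < decay x"
  by (simp add: decay_def add_pos_nonneg)

lemma decay_le_1: "decay x \<le> 1"
  by (simp add: decay_def divide_le_eq_1 add_pos_nonneg)

lemma decay_measurable [measurable]: "decay \<in> borel_measurable borel"
  unfolding decay_def by measurable

text \<open>Each of the n coordinates satisfies 1 + (x . b)^2 <= (1 + |x|)^2. The exponent 2n is
  therefore exactly what a comparison with a product of one-dimensional functions 1 / (1 + t^2) asks
  for.\<close>

lemma integrable_decay: "integrable lborel (decay :: real^'n::finite \<Rightarrow> real)"
proof (rule integrableI_bounded)
  have one: "(\<integral>\<^sup>+ t. ennreal (inverse (1 + t\<^sup>2)) \<partial>lborel) < \<infinity>"
  proof -
    have "integrable lborel (\<lambda>t::real. inverse (1 + t\<^sup>2))"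
      using integrable_inverse_1_plus_square by (simp add: set_integrable_def)
    then show ?thesis by (simp add: integrable_iff_bounded)
  qed
  have "(\<integral>\<^sup>+ x. ennreal (norm (decay x)) \<partial>(lborel :: (real^'n) measure))
      \<le> (\<integral>\<^sup>+ x. (\<Prod>b\<in>Basis. ennreal (inverse (1 + (x \<bullet> b)\<^sup>2))) \<partial>(lborel :: (real^'n) measure))"
  proof (rule nn_integral_mono)
    fix x :: "real^'n"
    have "(\<Prod>b\<in>(Basis :: (real^'n) set). 1 + (x \<bullet> b)\<^sup>2) \<le> (\<Prod>b\<in>(Basis :: (real^'n) set). (1 + norm x)\<^sup>2)"
    proof (rule prod_mono)
      fix b :: "real^'n" assume b: "b \<in> Basis"
      have "(x \<bullet> b)\<^sup>2 \<le> (norm x)\<^sup>2"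
        using Basis_le_norm[OF b, of x] by (metis abs_norm_cancel power2_le_iff_abs_le norm_ge_zero power2_abs)
      also have "\<dots> \<le> (1 + norm x)\<^sup>2 - 1" by (simp add: power2_eq_square algebra_simps)
      finally show "0 \<le> 1 + (x \<bullet> b)\<^sup>2 \<and> 1 + (x \<bullet> b)\<^sup>2 \<le> (1 + norm x)\<^sup>2" by auto
    qed
    also have "\<dots> = (1 + norm x) ^ (2 * CARD('n))"
      by (simp add: power_mult)
    finally have "inverse ((1 + norm x) ^ (2 * CARD('n))) \<le> inverse (\<Prod>b\<in>(Basis :: (real^'n) set). 1 + (x \<bullet> b)\<^sup>2)"
      by (intro le_imp_inverse_le) (auto intro!: prod_pos add_pos_nonneg)
    then have "decay x \<le> (\<Prod>b\<in>(Basis :: (real^'n) set). inverse (1 + (x \<bullet> b)\<^sup>2))"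
      by (simp add: decay_def inverse_eq_divide prod_dividef)
    then show "ennreal (norm (decay x)) \<le> (\<Prod>b\<in>Basis. ennreal (inverse (1 + (x \<bullet> b)\<^sup>2)))"
      using decay_pos[of x] by (simp add: prod_ennreal ennreal_leI less_imp_le)
  qed
  also have "\<dots> = (\<Prod>b\<in>(Basis :: (real^'n) set). (\<integral>\<^sup>+ t. ennreal (inverse (1 + t\<^sup>2)) \<partial>lborel))"
    by (rule nn_integral_lborel_prod) auto
  also have "\<dots> < \<infinity>" using one by (simp add: less_top[symmetric] power_eq_top_ennreal)
  finally show "(\<integral>\<^sup>+ x. ennreal (norm (decay x)) \<partial>(lborel :: (real^'n) measure)) < \<infinity>" .
qed auto

definition decay_mass :: "'n::finite itself \<Rightarrow> real"
  where "decay_mass _ = (LINT x|lborel. decay (x :: real^'n))"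

lemma decay_mass_nonneg: "0 \<le> decay_mass TYPE('n::finite)"
  unfolding decay_mass_def by (intro integral_nonneg_AE) (auto intro: less_imp_le decay_pos)

lemma nn_integral_decay: "(\<integral>\<^sup>+ x. ennreal (decay (x :: real^'n::finite)) \<partial>lborel) = ennreal (decay_mass TYPE('n))"
  unfolding decay_mass_def
  by (rule nn_integral_eq_integral[OF integrable_decay]) (auto intro: less_imp_le decay_pos)

lemma integrable_decay_bound:
  fixes f :: "real^'n::finite \<Rightarrow> 'b::{banach, second_countable_topology}"
  assumes "f \<in> borel_measurable borel" "\<And>x. norm (f x) \<le> C * decay x"
  shows "integrable lborel f" "(LINT x|lborel. norm (f x)) \<le> C * decay_mass TYPE('n)"
proof -
  show i: "integrable lborel f"
    using assms by (intro Bochner_Integration.integrable_bound[OF integrable_mult_right[OF integrable_decay, of C]])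
      (auto intro: order_trans[OF _ abs_ge_self])
  show "(LINT x|lborel. norm (f x)) \<le> C * decay_mass TYPE('n)"
    unfolding decay_mass_def integral_mult_right_zero[symmetric]
    using assms by (intro integral_mono integrable_norm i integrable_mult_right integrable_decay) auto
qed

lemma schwartz_decay:
  fixes \<phi> :: "real^'n::finite \<Rightarrow> complex"
  assumes "\<phi> \<in> schwartz"
  shows "norm (\<phi> x) \<le> schwartz_norm (2 * CARD('n)) \<phi> * decay x"
  using schwartz_norm_bound[OF assms, of "[]" "2 * CARD('n)" x] by (simp add: decay_def)

lemma schwartz_measurable: "\<phi> \<in> schwartz \<Longrightarrow> \<phi> \<in> borel_measurable borel"
  by (intro smooth_borel_measurable schwartzD)

lemma schwartz_integrable: "\<phi> \<in> schwartz \<Longrightarrow> integrable lborel \<phi>"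
  by (rule integrable_decay_bound(1)[OF schwartz_measurable schwartz_decay])

lemma schwartz_integral_norm:
  fixes \<phi> :: "real^'n::finite \<Rightarrow> complex"
  assumes "\<phi> \<in> schwartz"
  shows "(LINT x|lborel. norm (\<phi> x)) \<le> schwartz_norm (2 * CARD('n)) \<phi> * decay_mass TYPE('n)"
  by (rule integrable_decay_bound(2)[OF schwartz_measurable schwartz_decay]) (use assms in auto)

lemma integral_fubini_dominated:
  fixes F :: "'a::euclidean_space \<Rightarrow> 'b::euclidean_space \<Rightarrow> complex"
  assumes [measurable]: "(\<lambda>(x, y). F x y) \<in> borel_measurable (borel \<Otimes>\<^sub>M borel)"
    and a: "integrable lborel a" and b: "integrable lborel b"
    and le: "\<And>x y. norm (F x y) \<le> a x * b y"
  shows "(LINT x|lborel. LINT y|lborel. F x y) = (LINT y|lborel. LINT x|lborel. F x y)"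
    and "integrable lborel (\<lambda>x. LINT y|lborel. F x y)"
    and "integrable lborel (\<lambda>y. LINT x|lborel. F x y)"
proof -
  have [measurable]: "a \<in> borel_measurable borel" "b \<in> borel_measurable borel"
    using a b by (auto dest: borel_measurable_integrable)
  have meas: "(\<lambda>(x, y). F x y) \<in> borel_measurable (lborel \<Otimes>\<^sub>M lborel)" by measurable
  have iF: "integrable lborel (\<lambda>y. F x y)" for x
    by (rule Bochner_Integration.integrable_bound[OF integrable_mult_right[OF b, of "a x"]])
      (auto intro: order_trans[OF le] abs_ge_self)
  have fin: "(\<integral>\<^sup>+ z. ennreal (norm (case z of (x, y) \<Rightarrow> F x y)) \<partial>(lborel \<Otimes>\<^sub>M lborel)) < \<infinity>"
  proof -
    have "(\<integral>\<^sup>+ z. ennreal (norm (case z of (x, y) \<Rightarrow> F x y)) \<partial>(lborel \<Otimes>\<^sub>M lborel))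
        \<le> (\<integral>\<^sup>+ z. (case z of (x, y) \<Rightarrow> ennreal \<bar>a x\<bar> * ennreal \<bar>b y\<bar>) \<partial>(lborel \<Otimes>\<^sub>M lborel))"
      using le by (intro nn_integral_mono)
        (auto simp: ennreal_mult[symmetric] abs_mult[symmetric] intro!: ennreal_leI intro: order_trans[OF _ abs_ge_self])
    also have "\<dots> = (\<integral>\<^sup>+ x. \<integral>\<^sup>+ y. ennreal \<bar>a x\<bar> * ennreal \<bar>b y\<bar> \<partial>lborel \<partial>lborel)"
      by (subst lborel.nn_integral_fst[symmetric]) auto
    also have "\<dots> = (\<integral>\<^sup>+ x. ennreal \<bar>a x\<bar> \<partial>lborel) * (\<integral>\<^sup>+ y. ennreal \<bar>b y\<bar> \<partial>lborel)"
      by (simp add: nn_integral_cmult nn_integral_multc)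
    also have "\<dots> < \<infinity>"
      using a b by (auto simp: integrable_iff_bounded ennreal_mult_less_top)
    finally show ?thesis .
  qed
  have int: "integrable (lborel \<Otimes>\<^sub>M lborel) (\<lambda>(x, y). F x y)"
    by (rule integrableI_bounded[OF meas fin])
  show "(LINT x|lborel. LINT y|lborel. F x y) = (LINT y|lborel. LINT x|lborel. F x y)"
    using lborel_pair.Fubini_integral[OF int] by simp
  show "integrable lborel (\<lambda>x. LINT y|lborel. F x y)"
    using lborel_pair.integrable_fst'[OF int] by simp
  show "integrable lborel (\<lambda>y. LINT x|lborel. F x y)"
    using lborel_pair.integrable_fst'[OF lborel_pair.integrable_product_swap[OF int]] by simp
qed

lemma nn_integral_affine:
  fixes f :: "real^'n::finite \<Rightarrow> ennreal"
  assumes c: "c \<noteq> 0" and [measurable]: "f \<in> borel_measurable borel"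
  shows "(\<integral>\<^sup>+ x. f x \<partial>lborel) = ennreal (\<bar>c\<bar> ^ CARD('n)) * (\<integral>\<^sup>+ x. f (t + c *\<^sub>R x) \<partial>lborel)"
  by (subst lborel_affine[OF c, of t]) (simp add: nn_integral_density nn_integral_distr nn_integral_cmult)

lemma integral_affine:
  fixes f :: "real^'n::finite \<Rightarrow> complex"
  assumes c: "c \<noteq> 0" and f: "integrable lborel f"
  shows "(LINT x|lborel. f x) = \<bar>c\<bar> ^ CARD('n) *\<^sub>R (LINT x|lborel. f (t + c *\<^sub>R x))"
    and "integrable lborel (\<lambda>x. f (t + c *\<^sub>R x))"
proof -
  have [measurable]: "f \<in> borel_measurable borel" using f by auto
  show "integrable lborel (\<lambda>x. f (t + c *\<^sub>R x))"
  proof (rule integrableI_bounded)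
    show "(\<integral>\<^sup>+ x. ennreal (norm (f (t + c *\<^sub>R x))) \<partial>lborel) < \<infinity>"
      using f nn_integral_affine[OF c, of "\<lambda>x. ennreal (norm (f x))" t] c
      by (auto simp: integrable_iff_bounded ennreal_mult_less_top)
  qed auto
  then show "(LINT x|lborel. f x) = \<bar>c\<bar> ^ CARD('n) *\<^sub>R (LINT x|lborel. f (t + c *\<^sub>R x))"
    by (subst lborel_affine[OF c, of t]) (simp add: integral_density integral_distr)
qed

section \<open>The Fourier transform on the Schwartz space\<close>

definition char_exp :: "real^'n::finite \<Rightarrow> real^'n \<Rightarrow> complex"
  where "char_exp x \<xi> = exp (- \<i> * of_real (x \<bullet> \<xi>))"

lemma fourier_eq: "fourier \<phi> \<xi> = (LINT x|lborel. char_exp x \<xi> * \<phi> x)"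
  by (simp add: fourier_def char_exp_def)

lemma norm_char_exp [simp]: "norm (char_exp x \<xi>) = 1"
  using norm_exp_i_times[of "- (x \<bullet> \<xi>)"] by (simp add: char_exp_def)

lemma char_exp_measurable [measurable]:
  "(\<lambda>x. char_exp x \<xi>) \<in> borel_measurable borel" "(\<lambda>\<xi>. char_exp x \<xi>) \<in> borel_measurable borel"
  "(\<lambda>(x, \<xi>). char_exp x \<xi>) \<in> borel_measurable (borel \<Otimes>\<^sub>M borel)"
  unfolding char_exp_def by measurable

lemma char_exp_add_left: "char_exp (x + y) \<xi> = char_exp x \<xi> * char_exp y \<xi>"
  by (simp add: char_exp_def inner_add_left exp_add[symmetric] algebra_simps)

lemma char_exp_add_right: "char_exp x (\<xi> + \<eta>) = char_exp x \<xi> * char_exp x \<eta>"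
  by (simp add: char_exp_def inner_add_right exp_add[symmetric] algebra_simps)

lemma char_exp_zero [simp]: "char_exp 0 \<xi> = 1" "char_exp x 0 = 1"
  by (simp_all add: char_exp_def)

lemma integrable_char_exp:
  assumes "integrable lborel \<phi>"
  shows "integrable lborel (\<lambda>x. char_exp x \<xi> * \<phi> x)"
proof (rule Bochner_Integration.integrable_bound[OF assms])
  have [measurable]: "\<phi> \<in> borel_measurable borel" using assms by auto
  show "(\<lambda>x. char_exp x \<xi> * \<phi> x) \<in> borel_measurable lborel" by measurable
qed (simp add: norm_mult)

lemma norm_fourier_le: "norm (fourier \<phi> \<xi>) \<le> (LINT x|lborel. norm (\<phi> x))"
  using integral_norm_bound[of lborel "\<lambda>x. char_exp x \<xi> * \<phi> x"] by (simp add: fourier_eq norm_mult)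

lemma fourier_add:
  "integrable lborel \<phi> \<Longrightarrow> integrable lborel \<psi> \<Longrightarrow> fourier (\<lambda>x. \<phi> x + \<psi> x) \<xi> = fourier \<phi> \<xi> + fourier \<psi> \<xi>"
  by (simp add: fourier_eq distrib_left integrable_char_exp)

lemma fourier_cmult: "fourier (\<lambda>x. c * \<phi> x) \<xi> = c * fourier \<phi> \<xi>"
  by (simp add: fourier_eq mult.left_commute[of _ c])

lemma iexp_linear_error: "norm (exp (- \<i> * of_real t) - 1 + \<i> * of_real t) \<le> t\<^sup>2 / 2"
  using iexp_approx1[of "- t" 1] by (simp add: power2_eq_square fact_numeral algebra_simps)

text \<open>Differentiation under the integral through a second-order estimate: the exponential
  differs from its linearisation by at most half the square of its argument, so the remainder is at
  most half the second moment of \<phi> times the squared increment.\<close>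

lemma fourier_has_derivative:
  assumes \<phi>: "integrable lborel \<phi>" "integrable lborel (\<lambda>x. norm x * norm (\<phi> x))"
    "integrable lborel (\<lambda>x. (norm x)\<^sup>2 * norm (\<phi> x))"
  shows "(fourier \<phi> has_derivative (\<lambda>h. LINT x|lborel. char_exp x \<xi> * (- \<i> * of_real (x \<bullet> h) * \<phi> x))) (at \<xi>)"
proof -
  have [measurable]: "\<phi> \<in> borel_measurable borel" using \<phi>(1) by auto
  let ?D = "\<lambda>h. LINT x|lborel. char_exp x \<xi> * (- \<i> * of_real (x \<bullet> h) * \<phi> x)"
  have iD: "integrable lborel (\<lambda>x. char_exp x \<xi> * (- \<i> * of_real (x \<bullet> h) * \<phi> x))" for h
    by (rule Bochner_Integration.integrable_bound[OF integrable_mult_right[OF \<phi>(2), of "norm h"]])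
      (auto simp: norm_mult mult.assoc[symmetric] intro!: AE_I2 mult_right_mono Cauchy_Schwarz_ineq2[THEN order_trans])
  have lin: "bounded_linear ?D"
  proof (rule bounded_linear_intro)
    show "?D (g + h) = ?D g + ?D h" for g h
      using Bochner_Integration.integral_add[OF iD[of g] iD[of h]] by (simp add: inner_add_right algebra_simps)
    show "?D (r *\<^sub>R h) = r *\<^sub>R ?D h" for r h
    proof -
      have "char_exp x \<xi> * (- \<i> * of_real (x \<bullet> (r *\<^sub>R h)) * \<phi> x) = r *\<^sub>R (char_exp x \<xi> * (- \<i> * of_real (x \<bullet> h) * \<phi> x))" for x
        by (simp add: scaleR_conv_of_real[where 'a=complex])
      then show ?thesis by (simp only: integral_scaleR_right)
    qed
    show "norm (?D h) \<le> norm h * (LINT x|lborel. norm x * norm (\<phi> x))" for h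
    proof -
      have "norm (?D h) \<le> (LINT x|lborel. norm (char_exp x \<xi> * (- \<i> * of_real (x \<bullet> h) * \<phi> x)))"
        by (rule integral_norm_bound)
      also have "\<dots> \<le> (LINT x|lborel. norm h * (norm x * norm (\<phi> x)))"
        by (intro integral_mono integrable_norm iD integrable_mult_right \<phi>)
          (auto simp: norm_mult mult.assoc[symmetric] intro!: AE_I2 mult_right_mono Cauchy_Schwarz_ineq2[THEN order_trans])
      finally show ?thesis by simp
    qed
  qed
  define K where "K = (LINT x|lborel. (norm x)\<^sup>2 * norm (\<phi> x)) / 2"
  have est: "norm (fourier \<phi> \<eta> - fourier \<phi> \<xi> - ?D (\<eta> - \<xi>)) \<le> K * (norm (\<eta> - \<xi>))\<^sup>2" for \<eta>
  proof -
    let ?h = "\<eta> - \<xi>"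
    have eq: "char_exp x \<eta> * \<phi> x - char_exp x \<xi> * \<phi> x - char_exp x \<xi> * (- \<i> * of_real (x \<bullet> ?h) * \<phi> x)
        = char_exp x \<xi> * \<phi> x * (exp (- \<i> * of_real (x \<bullet> ?h)) - 1 + \<i> * of_real (x \<bullet> ?h))" for x
    proof -
      have "char_exp x \<eta> = char_exp x \<xi> * exp (- \<i> * of_real (x \<bullet> ?h))"
        by (simp add: char_exp_def exp_add[symmetric] inner_diff_right algebra_simps)
      then show ?thesis by (simp only:) (simp add: algebra_simps)
    qed
    have "fourier \<phi> \<eta> - fourier \<phi> \<xi> - ?D ?h
        = (LINT x|lborel. char_exp x \<xi> * \<phi> x * (exp (- \<i> * of_real (x \<bullet> ?h)) - 1 + \<i> * of_real (x \<bullet> ?h)))"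
      unfolding fourier_eq eq[symmetric]
      using integrable_char_exp[OF \<phi>(1)] iD[of ?h] by (simp del: minus_mult_left)
    also have "norm \<dots> \<le> (LINT x|lborel. norm (char_exp x \<xi> * \<phi> x * (exp (- \<i> * of_real (x \<bullet> ?h)) - 1 + \<i> * of_real (x \<bullet> ?h))))"
      by (rule integral_norm_bound)
    also have "\<dots> \<le> (LINT x|lborel. (norm ?h)\<^sup>2 / 2 * ((norm x)\<^sup>2 * norm (\<phi> x)))"
    proof (rule integral_mono)
      show "integrable lborel (\<lambda>x. norm (char_exp x \<xi> * \<phi> x * (exp (- \<i> * of_real (x \<bullet> ?h)) - 1 + \<i> * of_real (x \<bullet> ?h))))"
        unfolding eq[symmetric]
        by (intro integrable_norm Bochner_Integration.integrable_diff integrable_char_exp \<phi>(1) iD)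
      show "integrable lborel (\<lambda>x. (norm ?h)\<^sup>2 / 2 * ((norm x)\<^sup>2 * norm (\<phi> x)))"
        by (intro integrable_mult_right \<phi>)
      fix x
      have "\<bar>x \<bullet> ?h\<bar> \<le> norm x * norm ?h" by (rule Cauchy_Schwarz_ineq2)
      then have "(x \<bullet> ?h)\<^sup>2 \<le> (norm x * norm ?h)\<^sup>2" by (rule power2_le_iff_abs_le[THEN iffD2, rotated]) simp
      then have "norm (exp (- \<i> * of_real (x \<bullet> ?h)) - 1 + \<i> * of_real (x \<bullet> ?h)) \<le> (norm x * norm ?h)\<^sup>2 / 2"
        using iexp_linear_error[of "x \<bullet> ?h"] by linarith
      from mult_left_mono[OF this, of "norm (\<phi> x)"]
      show "norm (char_exp x \<xi> * \<phi> x * (exp (- \<i> * of_real (x \<bullet> ?h)) - 1 + \<i> * of_real (x \<bullet> ?h)))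
          \<le> (norm ?h)\<^sup>2 / 2 * ((norm x)\<^sup>2 * norm (\<phi> x))"
        unfolding norm_mult norm_char_exp by (simp add: power_mult_distrib mult_ac)
    qed
    also have "\<dots> = K * (norm ?h)\<^sup>2" unfolding integral_mult_right_zero K_def by simp
    finally show ?thesis .
  qed
  show ?thesis
  proof (rule has_derivativeI_sandwich[of 1 _ _ _ _ "\<lambda>\<eta>. K * norm (\<eta> - \<xi>)"])
    show "((\<lambda>\<eta>. K * norm (\<eta> - \<xi>)) \<longlongrightarrow> 0) (at \<xi>)"
      by (auto intro!: tendsto_eq_intros)
    fix \<eta> assume "\<eta> \<noteq> \<xi>"
    then show "norm (fourier \<phi> \<eta> - fourier \<phi> \<xi> - ?D (\<eta> - \<xi>)) / norm (\<eta> - \<xi>) \<le> K * norm (\<eta> - \<xi>)"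
      using est[of \<eta>] by (simp add: divide_le_eq power2_eq_square mult_ac del: minus_mult_left)
  qed (use lin in auto)
qed

lemma schwartz_moment_integrable:
  assumes "\<phi> \<in> schwartz"
  shows "integrable lborel (\<lambda>x::real^'n::finite. (norm x) ^ k * norm (\<phi> x))"
proof (rule integrable_decay_bound(1))
  note [measurable] = schwartz_measurable[OF assms]
  show "(\<lambda>x. norm x ^ k * norm (\<phi> x)) \<in> borel_measurable borel" by measurable
  fix x :: "real^'n"
  have "norm x ^ k \<le> (1 + norm x) ^ k" by (intro power_mono) auto
  then have "norm x ^ k * norm (\<phi> x) \<le> (1 + norm x) ^ k * (schwartz_norm (2 * CARD('n) + k) \<phi> / (1 + norm x) ^ (2 * CARD('n) + k))"
    using schwartz_norm_bound[OF assms, of "[]" "2 * CARD('n) + k" x] by (intro mult_mono) auto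
  also have "\<dots> = schwartz_norm (2 * CARD('n) + k) \<phi> * decay x"
    using add_pos_nonneg[of 1 "norm x"] by (simp add: decay_def power_add)
  finally show "norm (norm x ^ k * norm (\<phi> x)) \<le> schwartz_norm (2 * CARD('n) + k) \<phi> * decay x" by simp
qed

lemma partial_deriv_fourier:
  assumes "\<phi> \<in> schwartz"
  shows "fourier \<phi> differentiable_on UNIV"
    and "partial_deriv i (fourier \<phi>) = fourier (\<lambda>x. - \<i> * (of_real (x $ i) * \<phi> x))"
proof -
  note D = fourier_has_derivative[OF schwartz_integrable[OF assms], OF schwartz_moment_integrable[OF assms, of 1, simplified]
      schwartz_moment_integrable[OF assms, of 2]]
  from D show "fourier \<phi> differentiable_on UNIV"
    unfolding differentiable_on_def by (auto intro: differentiableI)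
  show "partial_deriv i (fourier \<phi>) = fourier (\<lambda>x. - \<i> * (of_real (x $ i) * \<phi> x))"
    using partial_derivI[OF D, of i] by (auto simp: fourier_eq inner_axis mult_ac)
qed

text \<open>The mean value inequality along a segment of length at most 1, on which 1 + |x| changes
  at most by a factor 2; this is the origin of 2 ^ (2n). The bound is integrable in x and
  proportional to t, so it dominates the difference quotients when the limit is taken under the
  integral.\<close>

lemma translation_difference_bound:
  fixes x :: "real^'n::finite"
  assumes \<phi>: "\<phi> \<in> schwartz" and t: "0 \<le> t" "t \<le> 1"
  shows "norm (\<phi> (x + t *\<^sub>R axis i 1) - \<phi> x) \<le> (2 ^ (2 * CARD('n)) * schwartz_norm (2 * CARD('n) + 1) \<phi> * decay x) * t"
    (is "_ \<le> ?B * t")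
proof -
  let ?N = "2 * CARD('n)"
  let ?e = "axis i 1 :: real^'n"
  have "norm ((\<lambda>s. \<phi> (x + s *\<^sub>R ?e)) t - (\<lambda>s. \<phi> (x + s *\<^sub>R ?e)) 0) \<le> ?B * norm (t - 0)"
  proof (rule differentiable_bound[where S="{0..1}"])
    fix s :: real assume s: "s \<in> {0..1}"
    let ?y = "x + s *\<^sub>R ?e"
    have lin: "linear (frechet_derivative \<phi> (at ?y))"
      by (intro linear_frechet_derivative smooth_differentiable schwartzD \<phi>)
    have "((\<lambda>s. x + s *\<^sub>R ?e) has_derivative (\<lambda>h. h *\<^sub>R ?e)) (at s within {0..1})"
      by (auto intro!: derivative_eq_intros)
    from has_derivative_compose[OF this smooth_has_derivative[OF schwartzD[OF \<phi>]]]
    show "((\<lambda>s. \<phi> (x + s *\<^sub>R ?e)) has_derivative (\<lambda>h. h *\<^sub>R partial_deriv i \<phi> ?y)) (at s within {0..1})"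
      by (simp add: linear_cmul[OF lin] partial_deriv_def)
    have "norm ?e = 1" by simp
    have "norm x = norm (?y - s *\<^sub>R ?e)" by simp
    also have "\<dots> \<le> norm ?y + norm (s *\<^sub>R ?e)" by (rule norm_triangle_ineq4)
    finally have "1 + norm x \<le> 2 * (1 + norm ?y)" using s norm_ge_zero[of ?y] by (simp del: norm_ge_zero)
    then have "(1 + norm x) ^ ?N \<le> (2 * (1 + norm ?y)) ^ ?N" by (intro power_mono) auto
    also have "\<dots> = 2 ^ ?N * (1 + norm ?y) ^ ?N" by (rule power_mult_distrib)
    finally have le: "(1 + norm x) ^ ?N \<le> 2 ^ ?N * (1 + norm ?y) ^ ?N" .
    have "norm (partial_deriv i \<phi> ?y) \<le> schwartz_norm ?N (partial_deriv i \<phi>) / (1 + norm ?y) ^ ?N"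
      using schwartz_norm_bound[OF schwartz_partial_deriv(1)[OF \<phi>], of "[]"] by simp
    also have "\<dots> \<le> schwartz_norm (?N + 1) \<phi> / (1 + norm ?y) ^ ?N"
      using schwartz_partial_deriv(2)[OF \<phi>, of ?N i] by (intro divide_right_mono) auto
    also have "\<dots> \<le> ?B"
    proof -
      have "S / b \<le> 2 ^ ?N * S * (1 / a)" if "0 < a" "0 < b" "a \<le> 2 ^ ?N * b" "0 \<le> S" for a b S :: real
        using that by (simp add: field_simps mult_left_mono)
      from this[OF _ _ le, of "schwartz_norm (?N + 1) \<phi>"] show ?thesis
        using schwartz_norm_nonneg[OF \<phi>] by (simp add: decay_def add_pos_nonneg)
    qed
    finally have "norm (partial_deriv i \<phi> ?y) \<le> ?B" .
    then show "onorm (\<lambda>h. h *\<^sub>R partial_deriv i \<phi> ?y) \<le> ?B"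
      by (intro onorm_le) (simp add: mult.commute mult_left_mono)
  qed (use t in auto)
  then show ?thesis using t by simp
qed

text \<open>Instead of integrating by parts, the derivative is taken as a limit of difference
  quotients along translations. Translation invariance of Lebesgue measure turns each translate into
  a factor exp(i t \<xi>_i), and dominated convergence gives the derivative of that factor at t =
  0.\<close>

lemma fourier_partial_deriv:
  fixes \<phi> :: "real^'n::finite \<Rightarrow> complex"
  assumes \<phi>: "\<phi> \<in> schwartz"
  shows "fourier (partial_deriv i \<phi>) \<xi> = \<i> * of_real (\<xi> $ i) * fourier \<phi> \<xi>"
proof -
  note [measurable] = schwartz_measurable[OF \<phi>] schwartz_measurable[OF schwartz_partial_deriv(1)[OF \<phi>]]
  let ?e = "axis i 1 :: real^'n"
  let ?B = "2 ^ (2 * CARD('n)) * schwartz_norm (2 * CARD('n) + 1) \<phi>"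
  define t where "t = (\<lambda>m. inverse (real (Suc m)))"
  have t: "0 < t m" "t m \<le> 1" for m by (auto simp: t_def divide_simps)
  have t0: "t \<longlonglongrightarrow> 0" unfolding t_def by (rule LIMSEQ_inverse_real_of_nat)
  have t0': "filterlim t (at 0) sequentially"
    using t0 t by (auto simp: filterlim_at less_imp_neq[symmetric])
  define G where "G = (\<lambda>m x. char_exp x \<xi> * ((\<phi> (x + t m *\<^sub>R ?e) - \<phi> x) / of_real (t m)))"
  have "(\<lambda>m. LINT x|lborel. G m x) \<longlonglongrightarrow> (LINT x|lborel. char_exp x \<xi> * partial_deriv i \<phi> x)"
  proof (rule integral_dominated_convergence[where w="\<lambda>x. ?B * decay x"])
    show "integrable lborel (\<lambda>x. ?B * decay x)" by (intro integrable_mult_right integrable_decay)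
    show "AE x in lborel. norm (G m x) \<le> ?B * decay x" for m
    proof (rule AE_I2)
      fix x :: "real^'n"
      have "norm (G m x) = norm (\<phi> (x + t m *\<^sub>R ?e) - \<phi> x) / t m"
        using t[of m] unfolding G_def norm_mult norm_char_exp by (simp add: norm_divide)
      also have "\<dots> \<le> ?B * decay x"
        using translation_difference_bound[OF \<phi>, of "t m" x i] t[of m] by (simp add: divide_le_eq)
      finally show "norm (G m x) \<le> ?B * decay x" .
    qed
    show "AE x in lborel. (\<lambda>m. G m x) \<longlonglongrightarrow> char_exp x \<xi> * partial_deriv i \<phi> x"
    proof (rule AE_I2)
      fix x :: "real^'n"
      have lin: "linear (frechet_derivative \<phi> (at x))"
        by (intro linear_frechet_derivative smooth_differentiable schwartzD \<phi>)
      have "((\<lambda>s. x + s *\<^sub>R ?e) has_derivative (\<lambda>h. h *\<^sub>R ?e)) (at 0)"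
        by (auto intro!: derivative_eq_intros)
      from has_derivative_compose[OF this, of \<phi> "frechet_derivative \<phi> (at x)"] smooth_has_derivative[OF schwartzD[OF \<phi>], of x]
      have "((\<lambda>s. \<phi> (x + s *\<^sub>R ?e)) has_derivative (\<lambda>h. h *\<^sub>R partial_deriv i \<phi> x)) (at 0)"
        by (simp add: linear_cmul[OF lin] partial_deriv_def)
      then have "((\<lambda>s. norm (\<phi> (x + s *\<^sub>R ?e) - \<phi> x - s *\<^sub>R partial_deriv i \<phi> x) / norm s) \<longlongrightarrow> 0) (at 0)"
        by (simp add: has_derivative_at)
      moreover have "\<forall>\<^sub>F s in at 0. norm (\<phi> (x + s *\<^sub>R ?e) - \<phi> x - s *\<^sub>R partial_deriv i \<phi> x) / norm s
          = norm ((\<phi> (x + s *\<^sub>R ?e) - \<phi> x) /\<^sub>R s - partial_deriv i \<phi> x)"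
      proof (rule eventually_at_filter[THEN iffD2], rule always_eventually, intro allI impI)
        fix s :: real assume "s \<noteq> 0"
        then have "\<phi> (x + s *\<^sub>R ?e) - \<phi> x - s *\<^sub>R partial_deriv i \<phi> x
            = s *\<^sub>R ((\<phi> (x + s *\<^sub>R ?e) - \<phi> x) /\<^sub>R s - partial_deriv i \<phi> x)"
          by (simp add: scaleR_diff_right)
        then show "norm (\<phi> (x + s *\<^sub>R ?e) - \<phi> x - s *\<^sub>R partial_deriv i \<phi> x) / norm s
          = norm ((\<phi> (x + s *\<^sub>R ?e) - \<phi> x) /\<^sub>R s - partial_deriv i \<phi> x)"
          using \<open>s \<noteq> 0\<close> by (simp only: norm_scaleR) simp
      qed
      ultimately have "((\<lambda>s. norm ((\<phi> (x + s *\<^sub>R ?e) - \<phi> x) /\<^sub>R s - partial_deriv i \<phi> x)) \<longlongrightarrow> 0) (at 0)"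
        by (rule Lim_transform_eventually)
      then have "((\<lambda>s. (\<phi> (x + s *\<^sub>R ?e) - \<phi> x) /\<^sub>R s) \<longlongrightarrow> partial_deriv i \<phi> x) (at 0)"
        by (subst LIM_zero_iff[symmetric]) (simp only: tendsto_norm_zero_iff)
      then have "(\<lambda>m. (\<phi> (x + t m *\<^sub>R ?e) - \<phi> x) /\<^sub>R t m) \<longlonglongrightarrow> partial_deriv i \<phi> x"
        by (rule filterlim_compose[OF _ t0'])
      then show "(\<lambda>m. G m x) \<longlonglongrightarrow> char_exp x \<xi> * partial_deriv i \<phi> x"
        unfolding G_def by (intro tendsto_mult tendsto_const) (simp add: scaleR_conv_of_real divide_inverse mult.commute)
    qed
  qed (auto simp: G_def)
  moreover have "(LINT x|lborel. G m x) = (exp (\<i> * of_real (t m * (\<xi> $ i))) - 1) / of_real (t m) * fourier \<phi> \<xi>" for m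
  proof -
    have i1: "integrable lborel (\<lambda>x. char_exp x \<xi> * \<phi> x)" by (intro integrable_char_exp schwartz_integrable \<phi>)
    have "exp (\<i> * of_real (t m * (\<xi> $ i))) * char_exp (t m *\<^sub>R ?e) \<xi> = 1"
      by (simp add: char_exp_def inner_axis' exp_add[symmetric])
    then have eq: "char_exp x \<xi> * \<phi> (x + t m *\<^sub>R ?e)
        = exp (\<i> * of_real (t m * (\<xi> $ i))) * (char_exp (t m *\<^sub>R ?e + 1 *\<^sub>R x) \<xi> * \<phi> (t m *\<^sub>R ?e + 1 *\<^sub>R x))" for x
      by (simp add: char_exp_add_left add.commute[of x] mult.assoc[symmetric])
    have i2: "integrable lborel (\<lambda>x. char_exp x \<xi> * \<phi> (x + t m *\<^sub>R ?e))"
      unfolding eq by (intro integrable_mult_right integral_affine(2)[OF _ i1]) auto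
    have "(LINT x|lborel. char_exp x \<xi> * \<phi> (x + t m *\<^sub>R ?e)) = exp (\<i> * of_real (t m * (\<xi> $ i))) * fourier \<phi> \<xi>"
      unfolding eq using integral_affine(1)[OF _ i1, of 1 "t m *\<^sub>R ?e"] by (simp add: fourier_eq)
    moreover have "G m x = (char_exp x \<xi> * \<phi> (x + t m *\<^sub>R ?e) - char_exp x \<xi> * \<phi> x) / of_real (t m)" for x
      by (simp add: G_def right_diff_distrib)
    ultimately show ?thesis
      using i1 i2 by (simp add: fourier_eq left_diff_distrib)
  qed
  moreover have "(\<lambda>m. (exp (\<i> * of_real (t m * (\<xi> $ i))) - 1) / of_real (t m) * fourier \<phi> \<xi>)
      \<longlonglongrightarrow> \<i> * of_real (\<xi> $ i) * fourier \<phi> \<xi>"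
  proof (intro tendsto_mult tendsto_const)
    let ?c = "\<i> * of_real (\<xi> $ i)"
    have "((\<lambda>z. exp (?c * z)) has_field_derivative ?c * exp (?c * 0)) (at 0)"
      by (auto intro!: derivative_eq_intros)
    then have "((\<lambda>z. (exp (?c * z) - 1) / z) \<longlongrightarrow> ?c) (at 0)"
      by (simp add: has_field_derivative_iff)
    moreover have "filterlim (\<lambda>m. complex_of_real (t m)) (at 0) sequentially"
      using tendsto_of_real[OF t0, where 'a=complex] t
      by (auto simp: filterlim_at less_imp_neq[symmetric])
    ultimately have "(\<lambda>m. (exp (?c * of_real (t m)) - 1) / of_real (t m)) \<longlonglongrightarrow> ?c"
      by (rule filterlim_compose)
    then show "(\<lambda>m. (exp (\<i> * of_real (t m * (\<xi> $ i))) - 1) / of_real (t m)) \<longlonglongrightarrow> ?c"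
      by (simp add: mult_ac)
  qed
  ultimately show ?thesis by (auto simp: fourier_eq intro: LIMSEQ_unique)
qed

section \<open>Continuity of the Fourier transforms on the Schwartz space\<close>

definition schwartz_op :: "(((real^'n::finite) \<Rightarrow> complex) \<Rightarrow> (real^'n) \<Rightarrow> complex) \<Rightarrow> bool" where
  "schwartz_op T \<longleftrightarrow> (\<forall>\<phi>\<in>schwartz. T \<phi> \<in> schwartz) \<and>
    (\<forall>N. \<exists>C M. 0 \<le> C \<and> (\<forall>\<phi>\<in>schwartz. schwartz_norm N (T \<phi>) \<le> C * schwartz_norm M \<phi>))"

lemma schwartz_op_compose:
  assumes "schwartz_op S" "schwartz_op T" shows "schwartz_op (\<lambda>\<phi>. S (T \<phi>))"
  unfolding schwartz_op_def
proof (intro conjI ballI allI)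
  fix N
  obtain C M where C: "0 \<le> C" "\<And>\<phi>. \<phi> \<in> schwartz \<Longrightarrow> schwartz_norm N (S \<phi>) \<le> C * schwartz_norm M \<phi>"
    using assms(1) unfolding schwartz_op_def by blast
  obtain C' M' where C': "0 \<le> C'" "\<And>\<phi>. \<phi> \<in> schwartz \<Longrightarrow> schwartz_norm M (T \<phi>) \<le> C' * schwartz_norm M' \<phi>"
    using assms(2) unfolding schwartz_op_def by blast
  have "schwartz_norm N (S (T \<phi>)) \<le> C * C' * schwartz_norm M' \<phi>" if "\<phi> \<in> schwartz" for \<phi>
  proof -
    have "T \<phi> \<in> schwartz" using assms(2) that by (auto simp: schwartz_op_def)
    then have "schwartz_norm N (S (T \<phi>)) \<le> C * schwartz_norm M (T \<phi>)" by (rule C)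
    also have "\<dots> \<le> C * (C' * schwartz_norm M' \<phi>)" by (intro mult_left_mono C' C that)
    finally show ?thesis by (simp add: mult.assoc)
  qed
  then show "\<exists>C M. 0 \<le> C \<and> (\<forall>\<phi>\<in>schwartz. schwartz_norm N (S (T \<phi>)) \<le> C * schwartz_norm M \<phi>)"
    using C C' by (intro exI[of _ "C * C'"] exI[of _ M']) auto
qed (use assms in \<open>auto simp: schwartz_op_def\<close>)

text \<open>One more factor 1 + |\<xi>| is at most 1 plus the sum of the |\<xi>_i|, and each
  |\<xi>_i| is absorbed by passing from \<phi> to a partial derivative, at the cost of one seminorm
  order.\<close>

lemma fourier_decay:
  "\<exists>C N. 0 \<le> C \<and> (\<forall>\<phi>\<in>schwartz. \<forall>\<xi>::real^'n::finite. (1 + norm \<xi>) ^ k * norm (fourier \<phi> \<xi>) \<le> C * schwartz_norm N \<phi>)"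
proof (induction k)
  case 0
  have "norm (fourier \<phi> \<xi>) \<le> decay_mass TYPE('n) * schwartz_norm (2 * CARD('n)) \<phi>" if "\<phi> \<in> schwartz" for \<phi> and \<xi> :: "real^'n"
    using norm_fourier_le[of \<phi> \<xi>] schwartz_integral_norm[OF that] by (simp add: mult.commute)
  then show ?case using decay_mass_nonneg by (intro exI[of _ "decay_mass TYPE('n)"] exI[of _ "2 * CARD('n)"]) auto
next
  case (Suc k)
  then obtain C N where C: "0 \<le> C"
    "\<And>\<phi> (\<xi>::real^'n). \<phi> \<in> schwartz \<Longrightarrow> (1 + norm \<xi>) ^ k * norm (fourier \<phi> \<xi>) \<le> C * schwartz_norm N \<phi>"
    by blast
  have "(1 + norm \<xi>) ^ Suc k * norm (fourier \<phi> \<xi>) \<le> (C * (1 + real CARD('n))) * schwartz_norm (Suc N) \<phi>"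
    if \<phi>: "\<phi> \<in> schwartz" for \<phi> and \<xi> :: "real^'n"
  proof -
    let ?w = "(1 + norm \<xi>) ^ k"
    have "norm \<xi> \<le> (\<Sum>i\<in>UNIV. \<bar>\<xi> $ i\<bar>)" by (rule norm_le_l1_cart)
    then have "?w * norm (fourier \<phi> \<xi>) * (1 + norm \<xi>) \<le> ?w * norm (fourier \<phi> \<xi>) * (1 + (\<Sum>i\<in>UNIV. \<bar>\<xi> $ i\<bar>))"
      by (intro mult_left_mono) auto
    also have "\<dots> = ?w * norm (fourier \<phi> \<xi>) + (\<Sum>i\<in>UNIV. ?w * norm (fourier (partial_deriv i \<phi>) \<xi>))"
      by (simp add: fourier_partial_deriv[OF \<phi>] norm_mult distrib_left sum_distrib_left mult_ac)
    also have "\<dots> \<le> C * schwartz_norm (Suc N) \<phi> + (\<Sum>i\<in>(UNIV::'n set). C * schwartz_norm (Suc N) \<phi>)"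
    proof (intro add_mono sum_mono)
      have "?w * norm (fourier \<phi> \<xi>) \<le> C * schwartz_norm N \<phi>" by (rule C(2)[OF \<phi>])
      also have "\<dots> \<le> C * schwartz_norm (Suc N) \<phi>" by (intro mult_left_mono schwartz_norm_mono \<phi> C) simp
      finally show "?w * norm (fourier \<phi> \<xi>) \<le> C * schwartz_norm (Suc N) \<phi>" .
      fix i
      have "?w * norm (fourier (partial_deriv i \<phi>) \<xi>) \<le> C * schwartz_norm N (partial_deriv i \<phi>)"
        by (intro C schwartz_partial_deriv \<phi>)
      also have "\<dots> \<le> C * schwartz_norm (Suc N) \<phi>" by (intro mult_left_mono schwartz_partial_deriv \<phi> C)
      finally show "?w * norm (fourier (partial_deriv i \<phi>) \<xi>) \<le> C * schwartz_norm (Suc N) \<phi>" .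
    qed
    finally show ?thesis by (simp add: algebra_simps)
  qed
  then show ?case using C(1) by (intro exI[of _ "C * (1 + real CARD('n))"] exI[of _ "Suc N"]) auto
qed

lemma schwartz_coord: "\<phi> \<in> schwartz \<Longrightarrow> (\<lambda>x. - \<i> * (of_real (x $ i) * \<phi> x)) \<in> schwartz"
  by (intro schwartz_cmult schwartz_mult slowly_growing_coord)

text \<open>The dual induction: a derivative of the transform is the transform of \<phi> multiplied
  by a coordinate, which again costs one seminorm order.\<close>

lemma fourier_iter_deriv_decay:
  "\<exists>C N. 0 \<le> C \<and> (\<forall>\<phi>\<in>schwartz. \<forall>I \<xi>. length I \<le> m \<longrightarrow>
    (1 + norm \<xi>) ^ k * norm (iter_deriv I (fourier \<phi>) (\<xi>::real^'n::finite)) \<le> C * schwartz_norm N \<phi>)"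
proof (induction m)
  case 0
  then show ?case using fourier_decay[of k, where 'n='n] by auto
next
  case (Suc m)
  then obtain C N where C: "0 \<le> C" "\<And>\<phi> I \<xi>. \<phi> \<in> schwartz \<Longrightarrow> length I \<le> m \<Longrightarrow>
    (1 + norm \<xi>) ^ k * norm (iter_deriv I (fourier \<phi>) (\<xi>::real^'n)) \<le> C * schwartz_norm N \<phi>" by blast
  have "(1 + norm \<xi>) ^ k * norm (iter_deriv I (fourier \<phi>) \<xi>) \<le> (C * 2 ^ N) * schwartz_norm (N + 1) \<phi>"
    if \<phi>: "\<phi> \<in> schwartz" and I: "length I \<le> Suc m" for \<phi> I and \<xi> :: "real^'n"
  proof (cases I)
    case Nil
    have "(1 + norm \<xi>) ^ k * norm (iter_deriv [] (fourier \<phi>) \<xi>) \<le> C * schwartz_norm N \<phi>" by (rule C(2)[OF \<phi>]) simp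
    also have "\<dots> \<le> C * (2 ^ N * schwartz_norm (N + 1) \<phi>)"
      using schwartz_norm_mono[OF \<phi>, of N "N + 1"] schwartz_norm_nonneg[OF \<phi>, of "N + 1"] C(1)
        mult_right_mono[of 1 "2 ^ N" "schwartz_norm (N + 1) \<phi>"]
      by (intro mult_left_mono) auto
    finally show ?thesis using Nil by (simp add: mult.assoc)
  next
    case (Cons i J)
    let ?\<psi> = "\<lambda>x. - \<i> * (complex_of_real (x $ i) * \<phi> x)"
    have "(1 + norm \<xi>) ^ k * norm (iter_deriv J (fourier ?\<psi>) \<xi>) \<le> C * schwartz_norm N ?\<psi>"
      using I Cons by (intro C(2) schwartz_coord \<phi>) auto
    also have "schwartz_norm N ?\<psi> \<le> norm (- \<i>) * schwartz_norm N (\<lambda>x. complex_of_real (x $ i) * \<phi> x)"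
      by (intro schwartz_norm_cmult schwartz_mult slowly_growing_coord \<phi>)
    also have "norm (- \<i>) * schwartz_norm N (\<lambda>x. complex_of_real (x $ i) * \<phi> x) \<le> 2 ^ N * schwartz_norm (N + 1) \<phi>"
      using schwartz_norm_coord[OF \<phi>, of N i] by simp
    finally show ?thesis
      using Cons C(1) by (simp add: partial_deriv_fourier[OF \<phi>] mult.assoc mult_left_mono)
  qed
  then show ?case using C(1) by (intro exI[of _ "C * 2 ^ N"] exI[of _ "N + 1"]) auto
qed

lemma smooth_fourier:
  fixes \<phi> :: "real^'n::finite \<Rightarrow> complex"
  assumes "\<phi> \<in> schwartz" shows "smooth (fourier \<phi>)"
proof -
  have "\<phi> \<in> schwartz \<Longrightarrow> Ck k (fourier \<phi>)" for k and \<phi> :: "real^'n \<Rightarrow> complex"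
  proof (induction k arbitrary: \<phi>)
    case (Suc k)
    then show ?case by (simp only: Ck.simps partial_deriv_fourier schwartz_coord simp_thms)
  qed (simp add: partial_deriv_fourier)
  then show ?thesis using assms by (simp add: smooth_iff_Ck)
qed

lemma fourier_schwartz_op: "schwartz_op fourier"
  unfolding schwartz_op_def
proof (intro conjI ballI allI)
  fix \<phi> :: "real^'n \<Rightarrow> complex" assume \<phi>: "\<phi> \<in> schwartz"
  show "fourier \<phi> \<in> schwartz"
  proof (rule schwartzI[OF smooth_fourier[OF \<phi>]])
    fix I :: "'n list" and k
    show "\<exists>C. \<forall>x. (1 + norm x) ^ k * norm (iter_deriv I (fourier \<phi>) x) \<le> C"
      using fourier_iter_deriv_decay[of "length I" k, where 'n='n] \<phi> by blast
  qed
next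
  fix N
  obtain C M where C: "0 \<le> C" "\<And>\<phi> I \<xi>. \<phi> \<in> schwartz \<Longrightarrow> length I \<le> N \<Longrightarrow>
    (1 + norm \<xi>) ^ N * norm (iter_deriv I (fourier \<phi>) (\<xi>::real^'n)) \<le> C * schwartz_norm M \<phi>"
    using fourier_iter_deriv_decay[of N N, where 'n='n] by blast
  then show "\<exists>C M. 0 \<le> C \<and> (\<forall>\<phi>\<in>schwartz. schwartz_norm N (fourier \<phi> :: real^'n \<Rightarrow> complex) \<le> C * schwartz_norm M \<phi>)"
    by (intro exI[of _ C] exI[of _ M]) (auto intro: schwartz_norm_least)
qed

lemma inv_fourier_eq:
  fixes \<phi> :: "real^'n::finite \<Rightarrow> complex"
  shows "inv_fourier \<phi> x = 1 / of_real ((2 * pi) ^ CARD('n)) * fourier \<phi> ((- 1) *\<^sub>R x + 0)"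
  by (simp add: inv_fourier_def fourier_def inner_commute)

lemma inv_fourier_schwartz_op: "schwartz_op (inv_fourier :: (real^'n::finite \<Rightarrow> complex) \<Rightarrow> _)"
proof -
  let ?c = "1 / of_real ((2 * pi) ^ CARD('n)) :: complex"
  have "schwartz_op (\<lambda>\<phi> x. ?c * \<phi> ((- 1) *\<^sub>R x + 0 :: real^'n))"
    unfolding schwartz_op_def
  proof (intro conjI ballI allI)
    fix N
    have "schwartz_norm N (\<lambda>x. ?c * \<phi> ((- 1) *\<^sub>R x + 0)) \<le> norm ?c * (4 ^ N * schwartz_norm N \<phi>)"
      if \<phi>: "\<phi> \<in> schwartz" for \<phi> :: "real^'n \<Rightarrow> complex"
    proof -
      have "schwartz_norm N (\<lambda>x. ?c * \<phi> ((- 1) *\<^sub>R x + 0)) \<le> norm ?c * schwartz_norm N (\<lambda>x. \<phi> ((- 1) *\<^sub>R x + 0))"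
        by (intro schwartz_norm_cmult schwartz_affine \<phi>) auto
      also have "\<dots> \<le> norm ?c * (4 ^ N * schwartz_norm N \<phi>)"
        using schwartz_norm_affine[OF \<phi>, of "-1" N 0] by (intro mult_left_mono) auto
      finally show ?thesis .
    qed
    then show "\<exists>C M. 0 \<le> C \<and> (\<forall>\<phi>\<in>schwartz. schwartz_norm N (\<lambda>x. ?c * \<phi> ((- 1) *\<^sub>R x + 0 :: real^'n)) \<le> C * schwartz_norm M \<phi>)"
      by (intro exI[of _ "norm ?c * 4 ^ N"] exI[of _ N]) (auto simp: mult.assoc)
  qed (intro schwartz_cmult schwartz_affine, auto)
  from schwartz_op_compose[OF this fourier_schwartz_op] show ?thesis
    by (simp add: inv_fourier_eq[abs_def])
qed

lemma fourier_schwartz: "\<phi> \<in> schwartz \<Longrightarrow> fourier \<phi> \<in> schwartz"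
  using fourier_schwartz_op by (auto simp: schwartz_op_def)

lemma inv_fourier_schwartz: "\<phi> \<in> schwartz \<Longrightarrow> inv_fourier \<phi> \<in> schwartz"
  using inv_fourier_schwartz_op by (auto simp: schwartz_op_def)

section \<open>Fourier inversion and convolution\<close>

lemma integral_lborel_prod:
  fixes h :: "'a::euclidean_space \<Rightarrow> real \<Rightarrow> complex"
  assumes h: "\<And>b. b \<in> Basis \<Longrightarrow> integrable lborel (h b)"
  shows "(LINT x|lborel. (\<Prod>b\<in>Basis. h b (x \<bullet> b))) = (\<Prod>b\<in>Basis. LINT t|lborel. h b t)"
    and "integrable lborel (\<lambda>x. \<Prod>b\<in>Basis. h b (x \<bullet> b))"
proof -
  interpret product_sigma_finite "\<lambda>_::'a. lborel :: real measure" ..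
  have m: "(\<lambda>x. \<Prod>b\<in>Basis. h b (x \<bullet> b)) \<in> borel_measurable borel"
  proof (rule borel_measurable_prod)
    fix b :: 'a assume "b \<in> Basis"
    then have "h b \<in> borel_measurable borel"
      using borel_measurable_integrable[OF h] by simp
    then show "(\<lambda>x. h b (x \<bullet> b)) \<in> borel_measurable borel"
      by (rule measurable_compose[rotated]) measurable
  qed
  have "(LINT x|lborel. (\<Prod>b\<in>Basis. h b (x \<bullet> b)))
      = (LINT f|(\<Pi>\<^sub>M b\<in>(Basis::'a set). lborel). (\<Prod>b\<in>Basis. h b ((\<Sum>b\<in>Basis. f b *\<^sub>R b) \<bullet> b)))"
    by (subst lborel_eq, subst integral_distr) (use m in auto)
  also have "\<dots> = (LINT f|(\<Pi>\<^sub>M b\<in>(Basis::'a set). lborel). (\<Prod>b\<in>Basis. h b (f b)))"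
    by simp
  also have "\<dots> = (\<Prod>b\<in>Basis. LINT t|lborel. h b t)"
    by (rule product_integral_prod) (use h in auto)
  finally show "(LINT x|lborel. (\<Prod>b\<in>Basis. h b (x \<bullet> b))) = (\<Prod>b\<in>Basis. LINT t|lborel. h b t)" .
  have "integrable (\<Pi>\<^sub>M b\<in>(Basis::'a set). lborel) (\<lambda>f. \<Prod>b\<in>Basis. h b (f b))"
    by (rule product_integrable_prod) (use h in auto)
  then show "integrable lborel (\<lambda>x. \<Prod>b\<in>Basis. h b (x \<bullet> b))"
    by (subst lborel_eq, subst integrable_distr_eq) (use m in auto)
qed

text \<open>Read off from the characteristic function of the standard normal distribution, evaluated
  at - t.\<close>

lemma gaussian_1d:
  fixes t :: real
  shows "(LINT s|lborel. exp (- \<i> * of_real (s * t)) * of_real (exp (- s\<^sup>2 / 2))) = of_real (sqrt (2 * pi) * exp (- t\<^sup>2 / 2))"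
    and "integrable lborel (\<lambda>s. exp (- \<i> * of_real (s * t)) * complex_of_real (exp (- s\<^sup>2 / 2)))"
proof -
  have "integrable lborel (\<lambda>s. std_normal_density s * \<bar>s\<bar> ^ 0)" by (rule integrable_std_normal_moment_abs)
  then have "integrable lborel (\<lambda>s. sqrt (2 * pi) * std_normal_density s)" by simp
  then have *: "integrable lborel (\<lambda>s::real. exp (- s\<^sup>2 / 2))" by (simp add: std_normal_density_def)
  show "integrable lborel (\<lambda>s. exp (- \<i> * of_real (s * t)) * complex_of_real (exp (- s\<^sup>2 / 2)))"
  proof (rule Bochner_Integration.integrable_bound[OF *])
    show "AE s in lborel. norm (exp (- \<i> * of_real (s * t)) * complex_of_real (exp (- s\<^sup>2 / 2))) \<le> norm (exp (- s\<^sup>2 / 2))"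
    proof (rule AE_I2)
      fix s
      have "norm (exp (- \<i> * complex_of_real (s * t))) = 1"
        using norm_exp_i_times[of "- (s * t)"] by simp
      then show "norm (exp (- \<i> * of_real (s * t)) * complex_of_real (exp (- s\<^sup>2 / 2))) \<le> norm (exp (- s\<^sup>2 / 2))"
        unfolding norm_mult by (simp del: of_real_mult of_real_exp)
    qed
  qed measurable
  have "char std_normal_distribution (- t) = (LINT s|lborel. std_normal_density s *\<^sub>R iexp (- t * s))"
    unfolding char_def by (subst integral_density) auto
  also have "\<dots> = (LINT s|lborel. of_real (1 / sqrt (2 * pi)) * (exp (- \<i> * of_real (s * t)) * of_real (exp (- s\<^sup>2 / 2))))"
    by (intro Bochner_Integration.integral_cong refl) (simp add: std_normal_density_def scaleR_conv_of_real[where 'a=complex] mult_ac)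
  also have "\<dots> = of_real (1 / sqrt (2 * pi)) * (LINT s|lborel. exp (- \<i> * of_real (s * t)) * of_real (exp (- s\<^sup>2 / 2)))"
    by (rule integral_mult_right_zero)
  finally have "(LINT s|lborel. exp (- \<i> * of_real (s * t)) * of_real (exp (- s\<^sup>2 / 2)))
      = of_real (sqrt (2 * pi)) * char std_normal_distribution (- t)"
    by (simp add: field_simps del: of_real_exp)
  then show "(LINT s|lborel. exp (- \<i> * of_real (s * t)) * of_real (exp (- s\<^sup>2 / 2))) = of_real (sqrt (2 * pi) * exp (- t\<^sup>2 / 2))"
    by (simp add: char_std_normal_distribution)
qed

definition gaussian :: "real^'n::finite \<Rightarrow> complex"
  where "gaussian x = of_real (exp (- (norm x)\<^sup>2 / 2))"

lemma fourier_gaussian: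
  shows "fourier gaussian (x::real^'n::finite) = of_real (sqrt (2 * pi) ^ CARD('n)) * gaussian x"
    and "integrable lborel (gaussian :: real^'n \<Rightarrow> complex)"
proof -
  have gp: "gaussian y = (\<Prod>b\<in>Basis. of_real (exp (- (y \<bullet> b)\<^sup>2 / 2)))" for y :: "real^'n"
  proof -
    have "(norm y)\<^sup>2 = (\<Sum>b\<in>Basis. (y \<bullet> b)\<^sup>2)"
      unfolding power2_norm_eq_inner by (subst euclidean_inner) (simp add: power2_eq_square)
    then have "- (norm y)\<^sup>2 / 2 = (\<Sum>b\<in>Basis. - (y \<bullet> b)\<^sup>2 / 2)"
      by (simp add: sum_negf sum_divide_distrib)
    then show ?thesis by (simp add: gaussian_def exp_sum del: of_real_exp)
  qed
  have cp: "char_exp y x * gaussian y = (\<Prod>b\<in>Basis. exp (- \<i> * of_real ((y \<bullet> b) * (x \<bullet> b))) * of_real (exp (- (y \<bullet> b)\<^sup>2 / 2)))" for x y :: "real^'n"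
  proof -
    have "char_exp y x = (\<Prod>b\<in>Basis. exp (- \<i> * of_real ((y \<bullet> b) * (x \<bullet> b))))"
      by (simp add: char_exp_def euclidean_inner[of y x] sum_distrib_left exp_sum[symmetric] sum_negf)
    then show ?thesis by (simp add: gp prod.distrib del: of_real_exp)
  qed
  show "fourier gaussian x = of_real (sqrt (2 * pi) ^ CARD('n)) * gaussian x"
  proof -
    have "fourier gaussian x = (\<Prod>b\<in>Basis. LINT t|lborel. exp (- \<i> * of_real (t * (x \<bullet> b))) * of_real (exp (- t\<^sup>2 / 2)))"
      unfolding fourier_eq cp by (rule integral_lborel_prod(1)) (rule gaussian_1d(2))
    also have "\<dots> = (\<Prod>b\<in>(Basis :: (real^'n) set). of_real (sqrt (2 * pi) * exp (- (x \<bullet> b)\<^sup>2 / 2)))"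
      by (simp only: gaussian_1d(1))
    also have "\<dots> = of_real (sqrt (2 * pi) ^ CARD('n)) * gaussian x"
      by (simp add: gp prod.distrib del: of_real_exp)
    finally show ?thesis .
  qed
  have "integrable lborel (\<lambda>y. char_exp y (0::real^'n) * gaussian y)"
    unfolding cp by (rule integral_lborel_prod(2)) (rule gaussian_1d(2))
  then show "integrable lborel (gaussian :: real^'n \<Rightarrow> complex)" by simp
qed

lemma gaussian_measurable [measurable]: "gaussian \<in> borel_measurable borel"
  unfolding gaussian_def by measurable

lemma norm_gaussian_le: "norm (gaussian x) \<le> 1"
  by (simp add: gaussian_def del: of_real_exp)

lemma fourier_scale:
  fixes m :: "real^'n::finite \<Rightarrow> complex"
  assumes m: "integrable lborel m" and t: "0 < t"
  shows "fourier (\<lambda>\<xi>. m ((1 / t) *\<^sub>R \<xi>)) x = of_real (t ^ CARD('n)) * fourier m (t *\<^sub>R x)"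
proof -
  have "integrable lborel (\<lambda>\<xi>. m (0 + (1 / t) *\<^sub>R \<xi>))"
    using t by (intro integral_affine(2) m) auto
  then have i: "integrable lborel (\<lambda>\<xi>. char_exp \<xi> x * m ((1 / t) *\<^sub>R \<xi>))"
    by (intro integrable_char_exp) simp
  have "char_exp (t *\<^sub>R \<xi>) x = char_exp \<xi> (t *\<^sub>R x)" for \<xi> by (simp add: char_exp_def)
  then show ?thesis
    using integral_affine(1)[OF _ i, of t 0] t by (simp add: fourier_eq scaleR_conv_of_real[where 'a=complex])
qed

lemma inv_fourier_char_exp:
  fixes \<phi> :: "real^'n::finite \<Rightarrow> complex"
  shows "inv_fourier \<phi> \<xi> = 1 / of_real ((2 * pi) ^ CARD('n)) * (LINT y|lborel. char_exp \<xi> (- y) * \<phi> y)"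
  by (simp add: inv_fourier_def char_exp_def)

text \<open>Both the inversion formula and the multiplier formula come from this exchange of integrals.\<close>

lemma fourier_mult_inv_fourier:
  fixes m \<phi> :: "real^'n::finite \<Rightarrow> complex"
  assumes m: "integrable lborel m" and \<phi>: "integrable lborel \<phi>"
  shows "fourier (\<lambda>\<xi>. m \<xi> * inv_fourier \<phi> \<xi>) x
    = (LINT y|lborel. \<phi> y * (fourier m (x - y) / of_real ((2 * pi) ^ CARD('n))))"
proof -
  have [measurable]: "m \<in> borel_measurable borel" "\<phi> \<in> borel_measurable borel"
    using m \<phi> by auto
  let ?c = "1 / of_real ((2 * pi) ^ CARD('n)) :: complex"
  have e: "char_exp \<xi> x * (m \<xi> * inv_fourier \<phi> \<xi>) = ?c * (LINT y|lborel. char_exp \<xi> (x - y) * (m \<xi> * \<phi> y))" for \<xi>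
  proof -
    have "(LINT y|lborel. char_exp \<xi> (x - y) * (m \<xi> * \<phi> y)) = (LINT y|lborel. (char_exp \<xi> x * m \<xi>) * (char_exp \<xi> (- y) * \<phi> y))"
      using char_exp_add_right[of \<xi> x "- _"] by (simp add: mult_ac)
    also have "\<dots> = (char_exp \<xi> x * m \<xi>) * (LINT y|lborel. char_exp \<xi> (- y) * \<phi> y)"
      by (rule integral_mult_right_zero)
    finally show ?thesis by (simp add: inv_fourier_char_exp)
  qed
  have [measurable]: "(\<lambda>(\<xi>, y). char_exp \<xi> (x - y)) \<in> borel_measurable (borel \<Otimes>\<^sub>M borel)"
    unfolding char_exp_def by measurable
  have "fourier (\<lambda>\<xi>. m \<xi> * inv_fourier \<phi> \<xi>) x = ?c * (LINT \<xi>|lborel. LINT y|lborel. char_exp \<xi> (x - y) * (m \<xi> * \<phi> y))"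
    unfolding fourier_eq e by (rule integral_mult_right_zero)
  also have "(LINT \<xi>|lborel. LINT y|lborel. char_exp \<xi> (x - y) * (m \<xi> * \<phi> y)) = (LINT y|lborel. LINT \<xi>|lborel. char_exp \<xi> (x - y) * (m \<xi> * \<phi> y))"
    by (rule integral_fubini_dominated(1)[of _ "\<lambda>\<xi>. norm (m \<xi>)" "\<lambda>y. norm (\<phi> y)"])
      (use m \<phi> in \<open>auto simp: norm_mult\<close>)
  also have "\<dots> = (LINT y|lborel. \<phi> y * fourier m (x - y))"
  proof (rule Bochner_Integration.integral_cong[OF refl])
    fix y
    have "(LINT \<xi>|lborel. char_exp \<xi> (x - y) * (m \<xi> * \<phi> y)) = (LINT \<xi>|lborel. \<phi> y * (char_exp \<xi> (x - y) * m \<xi>))"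
      by (simp add: mult_ac)
    then show "(LINT \<xi>|lborel. char_exp \<xi> (x - y) * (m \<xi> * \<phi> y)) = \<phi> y * fourier m (x - y)"
      by (simp add: fourier_eq)
  qed
  also have "?c * \<dots> = (LINT y|lborel. ?c * (\<phi> y * fourier m (x - y)))" by simp
  finally show ?thesis by (simp add: mult_ac)
qed

text \<open>A Gaussian factor gaussian(t \<xi>) is inserted and removed as t tends to 0. On one side
  it disappears by dominated convergence; on the other, \<open>fourier_mult_inv_fourier\<close>
  turns the integral into a Gaussian average of \<phi> over the points x + t z, which tends to
  \<phi> x. The Gaussian has mass sqrt(2 pi)^n and its own transform brings the same factor, which
  together cancel (2 pi)^n.\<close>

lemma fourier_inversion:
  fixes \<phi> :: "real^'n::finite \<Rightarrow> complex"
  assumes \<phi>: "\<phi> \<in> schwartz"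
  shows "fourier (inv_fourier \<phi>) = \<phi>"
proof
  fix x :: "real^'n"
  note [measurable] = schwartz_measurable[OF \<phi>] schwartz_measurable[OF inv_fourier_schwartz[OF \<phi>]]
  define t where "t = (\<lambda>m. inverse (real (Suc m)))"
  have t: "0 < t m" "t m \<le> 1" for m by (auto simp: t_def divide_simps)
  have t0: "t \<longlonglongrightarrow> 0" unfolding t_def by (rule LIMSEQ_inverse_real_of_nat)
  let ?s = "sqrt (2 * pi) ^ CARD('n)"
  let ?c = "of_real ((2 * pi) ^ CARD('n)) :: complex"
  have "?s * ?s = (2 * pi) ^ CARD('n)"
    unfolding power_mult_distrib[symmetric] by simp
  then have cs: "complex_of_real ?s * of_real ?s = ?c"
    by (simp only: of_real_mult[symmetric])
  define L where "L = (\<lambda>m. fourier (\<lambda>\<xi>. gaussian (t m *\<^sub>R \<xi>) * inv_fourier \<phi> \<xi>) x)"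
  have L1: "L \<longlonglongrightarrow> fourier (inv_fourier \<phi>) x"
    unfolding L_def fourier_eq
  proof (rule integral_dominated_convergence[where w="\<lambda>\<xi>. norm (inv_fourier \<phi> \<xi>)"])
    show "integrable lborel (\<lambda>\<xi>. norm (inv_fourier \<phi> \<xi>))"
      by (intro integrable_norm schwartz_integrable inv_fourier_schwartz \<phi>)
    show "AE \<xi> in lborel. (\<lambda>m. char_exp \<xi> x * (gaussian (t m *\<^sub>R \<xi>) * inv_fourier \<phi> \<xi>)) \<longlonglongrightarrow> char_exp \<xi> x * inv_fourier \<phi> \<xi>"
    proof (rule AE_I2)
      fix \<xi> :: "real^'n"
      have "(\<lambda>m. gaussian (t m *\<^sub>R \<xi>)) \<longlonglongrightarrow> of_real (exp (- (norm (0 *\<^sub>R \<xi>))\<^sup>2 / 2))"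
        unfolding gaussian_def by (intro tendsto_intros t0) simp
      then have "(\<lambda>m. gaussian (t m *\<^sub>R \<xi>)) \<longlonglongrightarrow> 1" by simp
      from tendsto_mult[OF tendsto_const[of "char_exp \<xi> x"] tendsto_mult[OF this tendsto_const[of "inv_fourier \<phi> \<xi>"]]]
      show "(\<lambda>m. char_exp \<xi> x * (gaussian (t m *\<^sub>R \<xi>) * inv_fourier \<phi> \<xi>)) \<longlonglongrightarrow> char_exp \<xi> x * inv_fourier \<phi> \<xi>" by simp
    qed
    show "AE \<xi> in lborel. norm (char_exp \<xi> x * (gaussian (t m *\<^sub>R \<xi>) * inv_fourier \<phi> \<xi>)) \<le> norm (inv_fourier \<phi> \<xi>)" for m
      by (auto simp: norm_mult intro!: mult_left_le_one_le norm_gaussian_le)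
  qed measurable
  have L2: "L m = of_real ?s / ?c * (LINT z|lborel. gaussian z * \<phi> (x + t m *\<^sub>R z))" for m
  proof -
    have im: "integrable lborel (\<lambda>\<xi>::real^'n. gaussian (t m *\<^sub>R \<xi>))"
      using integral_affine(2)[OF _ fourier_gaussian(2), of "t m" 0] t[of m] by simp
    have "fourier (\<lambda>\<xi>::real^'n. gaussian (t m *\<^sub>R \<xi>)) z = of_real ((1 / t m) ^ CARD('n)) * (of_real ?s * gaussian ((1 / t m) *\<^sub>R z))" for z
      using fourier_scale[OF fourier_gaussian(2), of "1 / t m" z] t[of m] by (simp add: fourier_gaussian(1))
    then have "L m = (LINT y|lborel. \<phi> y * (of_real ((1 / t m) ^ CARD('n)) * (of_real ?s * gaussian ((1 / t m) *\<^sub>R (x - y))) / ?c))"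
      unfolding L_def by (subst fourier_mult_inv_fourier[OF im schwartz_integrable[OF \<phi>]]) simp
    also have "\<dots> = (LINT y|lborel. (of_real ((1 / t m) ^ CARD('n)) * of_real ?s / ?c) * (gaussian ((1 / t m) *\<^sub>R (x - y)) * \<phi> y))"
      by (simp add: mult_ac)
    also have "\<dots> = (of_real ((1 / t m) ^ CARD('n)) * of_real ?s / ?c) * (LINT y|lborel. gaussian ((1 / t m) *\<^sub>R (x - y)) * \<phi> y)"
      by (rule integral_mult_right_zero)
    also have "(LINT y|lborel. gaussian ((1 / t m) *\<^sub>R (x - y)) * \<phi> y)
        = (t m) ^ CARD('n) *\<^sub>R (LINT z|lborel. gaussian ((1 / t m) *\<^sub>R (x - (x + t m *\<^sub>R z))) * \<phi> (x + t m *\<^sub>R z))"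
    proof -
      have i: "integrable lborel (\<lambda>y. gaussian ((1 / t m) *\<^sub>R (x - y)) * \<phi> y)"
        by (rule Bochner_Integration.integrable_bound[OF schwartz_integrable[OF \<phi>]])
          (auto simp: norm_mult intro!: mult_left_le_one_le norm_gaussian_le)
      have "t m \<noteq> 0" "\<bar>t m\<bar> = t m" using t[of m] by auto
      from integral_affine(1)[OF this(1) i, of x] this(2) show ?thesis by (simp only:)
    qed
    also have "\<dots> = of_real ((t m) ^ CARD('n)) * (LINT z|lborel. gaussian z * \<phi> (x + t m *\<^sub>R z))"
      using t[of m] by (simp add: scaleR_conv_of_real[where 'a=complex] gaussian_def)
    finally show ?thesis using t[of m] by (simp add: power_divide)
  qed
  have L3: "(\<lambda>m. of_real ?s / ?c * (LINT z|lborel. gaussian z * \<phi> (x + t m *\<^sub>R z))) \<longlonglongrightarrow> of_real ?s / ?c * (LINT z|lborel. gaussian (z::real^'n) * \<phi> x)"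
  proof (rule tendsto_mult[OF tendsto_const], rule integral_dominated_convergence[where w="\<lambda>z::real^'n. norm (gaussian z) * schwartz_norm 0 \<phi>"])
    show "integrable lborel (\<lambda>z::real^'n. norm (gaussian z) * schwartz_norm 0 \<phi>)"
      by (intro integrable_mult_left integrable_norm fourier_gaussian(2))
    show "AE z in lborel. (\<lambda>m. gaussian z * \<phi> (x + t m *\<^sub>R z)) \<longlonglongrightarrow> gaussian z * \<phi> x"
    proof (rule AE_I2)
      fix z :: "real^'n"
      have "(\<lambda>m. x + t m *\<^sub>R z) \<longlonglongrightarrow> x + 0 *\<^sub>R z" by (intro tendsto_intros t0)
      moreover have "isCont \<phi> (x + 0 *\<^sub>R z)"
        by (intro differentiable_imp_continuous_within smooth_differentiable schwartzD \<phi>)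
      ultimately have "(\<lambda>m. \<phi> (x + t m *\<^sub>R z)) \<longlonglongrightarrow> \<phi> (x + 0 *\<^sub>R z)" by (rule isCont_tendsto_compose[rotated])
      then show "(\<lambda>m. gaussian z * \<phi> (x + t m *\<^sub>R z)) \<longlonglongrightarrow> gaussian z * \<phi> x"
        by (intro tendsto_mult tendsto_const) simp
    qed
    show "AE z in lborel. norm (gaussian z * \<phi> (x + t m *\<^sub>R z)) \<le> norm (gaussian z) * schwartz_norm 0 \<phi>" for m
      using schwartz_norm_bound[OF \<phi>, of "[]" 0] by (auto simp: norm_mult intro!: mult_left_mono)
  qed measurable
  have L4: "of_real ?s / ?c * (LINT z|lborel. gaussian (z::real^'n) * \<phi> x) = \<phi> x"
  proof -
    have "(LINT z|lborel. gaussian (z::real^'n)) = of_real ?s"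
      using fourier_gaussian(1)[of "0 :: real^'n"] by (simp add: fourier_eq gaussian_def)
    then have "(LINT z|lborel. gaussian (z::real^'n) * \<phi> x) = of_real ?s * \<phi> x"
      by (simp only: integral_mult_left_zero)
    then have "of_real ?s / ?c * (LINT z|lborel. gaussian (z::real^'n) * \<phi> x) = (of_real ?s * of_real ?s) / ?c * \<phi> x"
      by (simp only:) simp
    also have "\<dots> = \<phi> x" unfolding cs by simp
    finally show ?thesis .
  qed
  from L3 have "L \<longlonglongrightarrow> \<phi> x" unfolding L2[symmetric] L4 .
  with L1 show "fourier (inv_fourier \<phi>) x = \<phi> x" by (rule LIMSEQ_unique)
qed

text \<open>This is the inverse Fourier transform of m at - z. The reflection arises because
  multipliers reach distributions by duality: \<open>conv (kern m)\<close> acts on the test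
  function, so on a function g the same kernel appears as \<open>kern m (x - y)\<close> with x the
  variable of integration.\<close>

definition kern :: "((real^'n::finite) \<Rightarrow> complex) \<Rightarrow> (real^'n) \<Rightarrow> complex"
  where "kern m z = 1 / of_real ((2 * pi) ^ CARD('n)) * fourier m z"

definition conv :: "((real^'n::finite) \<Rightarrow> complex) \<Rightarrow> ((real^'n) \<Rightarrow> complex) \<Rightarrow> (real^'n) \<Rightarrow> complex"
  where "conv a \<phi> x = (LINT y|lborel. \<phi> y * a (x - y))"

lemma kern_schwartz: "m \<in> schwartz \<Longrightarrow> kern m \<in> schwartz"
  unfolding kern_def[abs_def] by (intro schwartz_cmult fourier_schwartz)

lemma fourier_mult_inv_fourier_conv:
  "m \<in> schwartz \<Longrightarrow> \<phi> \<in> schwartz \<Longrightarrow> fourier (\<lambda>\<xi>. m \<xi> * inv_fourier \<phi> \<xi>) = conv (kern m) \<phi>"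
  by (auto simp: fourier_mult_inv_fourier schwartz_integrable conv_def kern_def)

lemma kern_scale:
  fixes m :: "real^'n::finite \<Rightarrow> complex"
  shows "m \<in> schwartz \<Longrightarrow> 0 < t \<Longrightarrow> kern (\<lambda>\<xi>. m ((1 / t) *\<^sub>R \<xi>)) z = of_real (t ^ CARD('n)) * kern m (t *\<^sub>R z)"
  by (simp add: kern_def fourier_scale schwartz_integrable)

lemma conv_schwartz_eq:
  fixes a \<phi> :: "real^'n::finite \<Rightarrow> complex"
  assumes "a \<in> schwartz" "\<phi> \<in> schwartz"
  shows "conv a \<phi> = fourier (\<lambda>\<xi>. inv_fourier \<phi> \<xi> * (of_real ((2 * pi) ^ CARD('n)) * inv_fourier a \<xi>))"
proof -
  let ?c = "of_real ((2 * pi) ^ CARD('n)) :: complex"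
  have "kern (\<lambda>\<xi>. ?c * inv_fourier a \<xi>) = a"
    by (rule ext) (simp only: kern_def fourier_cmult fourier_inversion[OF assms(1)], simp)
  moreover have "(\<lambda>\<xi>. ?c * inv_fourier a \<xi>) \<in> schwartz"
    using assms by (intro schwartz_cmult inv_fourier_schwartz)
  ultimately show ?thesis using fourier_mult_inv_fourier_conv[of "\<lambda>\<xi>. ?c * inv_fourier a \<xi>" \<phi>] assms
    by (simp add: mult.commute)
qed

lemma mult_schwartz_op:
  assumes "slowly_growing m" shows "schwartz_op (\<lambda>\<phi> x. m x * \<phi> x)"
  unfolding schwartz_op_def
proof (intro conjI ballI allI schwartz_mult assms)
  fix N
  obtain M L where "0 \<le> M" "\<And>I x. length I \<le> N \<Longrightarrow> norm (iter_deriv I m x) \<le> M * (1 + norm x) ^ L"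
    using assms unfolding slowly_growing_def by blast
  then show "\<exists>C L. 0 \<le> C \<and> (\<forall>\<phi>\<in>schwartz. schwartz_norm N (\<lambda>x. m x * \<phi> x) \<le> C * schwartz_norm L \<phi>)"
    using assms
    by (intro exI[of _ "2 ^ N * M"] exI[of _ "N + L"]) (auto simp: slowly_growing_def intro!: schwartz_norm_mult)
qed

text \<open>On the Fourier side convolution is a product, so it is continuous in the kernel a as
  well. This is what allows a kernel to be replaced by its truncations.\<close>

lemma conv_schwartz_op:
  fixes \<phi> :: "real^'n::finite \<Rightarrow> complex"
  assumes \<phi>: "\<phi> \<in> schwartz"
  obtains T where "schwartz_op T" "\<And>a. a \<in> schwartz \<Longrightarrow> conv a \<phi> = T a"
proof
  let ?c = "of_real ((2 * pi) ^ CARD('n)) :: complex"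
  let ?T = "\<lambda>a. fourier (\<lambda>\<xi>. inv_fourier \<phi> \<xi> * (?c * inv_fourier a \<xi>))"
  show "schwartz_op ?T"
    by (intro schwartz_op_compose[OF fourier_schwartz_op] schwartz_op_compose[OF mult_schwartz_op]
        schwartz_slowly_growing inv_fourier_schwartz \<phi> slowly_growing_const inv_fourier_schwartz_op)
  show "conv a \<phi> = ?T a" if "a \<in> schwartz" for a
    by (rule conv_schwartz_eq[OF that \<phi>])
qed

lemma conv_schwartz: "a \<in> schwartz \<Longrightarrow> \<phi> \<in> schwartz \<Longrightarrow> conv a \<phi> \<in> schwartz"
  using conv_schwartz_op[of \<phi>] by (metis schwartz_op_def)

section \<open>Tempered distributions\<close>

lemma tempered_linear:
  "tempered u \<Longrightarrow> \<phi> \<in> schwartz \<Longrightarrow> \<psi> \<in> schwartz \<Longrightarrow> u (\<lambda>x. a * \<phi> x + b * \<psi> x) = a * u \<phi> + b * u \<psi>"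
  by (simp add: tempered_def)

lemma tempered_add:
  "tempered u \<Longrightarrow> \<phi> \<in> schwartz \<Longrightarrow> \<psi> \<in> schwartz \<Longrightarrow> u (\<lambda>x. \<phi> x + \<psi> x) = u \<phi> + u \<psi>"
  using tempered_linear[of u \<phi> \<psi> 1 1] by simp

lemma tempered_bound:
  assumes "tempered u"
  obtains C N where "0 \<le> C" "\<And>\<phi>. \<phi> \<in> schwartz \<Longrightarrow> norm (u \<phi>) \<le> C * schwartz_norm N \<phi>"
proof -
  have "\<exists>C N. \<forall>\<phi>\<in>schwartz. norm (u \<phi>) \<le> C * schwartz_norm N \<phi>" using assms by (simp add: tempered_def)
  then obtain C N where C: "\<And>\<phi>. \<phi> \<in> schwartz \<Longrightarrow> norm (u \<phi>) \<le> C * schwartz_norm N \<phi>" by blast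
  have "norm (u \<phi>) \<le> \<bar>C\<bar> * schwartz_norm N \<phi>" if "\<phi> \<in> schwartz" for \<phi>
    using C[OF that] mult_right_mono[OF abs_ge_self[of C] schwartz_norm_nonneg[OF that, of N]] by linarith
  then show ?thesis by (intro that[of "\<bar>C\<bar>" N]) auto
qed

lemma tempered_compose:
  assumes u: "tempered u" and T: "schwartz_op T"
    and lin: "\<And>\<phi> \<psi> a b. \<phi> \<in> schwartz \<Longrightarrow> \<psi> \<in> schwartz \<Longrightarrow> T (\<lambda>x. a * \<phi> x + b * \<psi> x) = (\<lambda>x. a * T \<phi> x + b * T \<psi> x)"
  shows "tempered (\<lambda>\<phi>. u (T \<phi>))"
  unfolding tempered_def
proof (intro conjI ballI allI)
  have TS: "T \<phi> \<in> schwartz" if "\<phi> \<in> schwartz" for \<phi> using T that by (auto simp: schwartz_op_def)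
  show "u (T (\<lambda>x. a * \<phi> x + b * \<psi> x)) = a * u (T \<phi>) + b * u (T \<psi>)" if "\<phi> \<in> schwartz" "\<psi> \<in> schwartz" for \<phi> \<psi> a b
    using lin[OF that] tempered_linear[OF u TS TS] that by simp
  obtain C N where C: "0 \<le> C" "\<And>\<phi>. \<phi> \<in> schwartz \<Longrightarrow> norm (u \<phi>) \<le> C * schwartz_norm N \<phi>"
    by (rule tempered_bound[OF u]) blast
  obtain C' M where C': "\<And>\<phi>. \<phi> \<in> schwartz \<Longrightarrow> schwartz_norm N (T \<phi>) \<le> C' * schwartz_norm M \<phi>"
    using T unfolding schwartz_op_def by blast
  have "norm (u (T \<phi>)) \<le> (C * C') * schwartz_norm M \<phi>" if "\<phi> \<in> schwartz" for \<phi>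
    using C(2)[OF TS[OF that]] mult_left_mono[OF C'[OF that] C(1)] by (simp add: mult.assoc)
  then show "\<exists>C N. \<forall>\<phi>\<in>schwartz. norm (u (T \<phi>)) \<le> C * schwartz_norm N \<phi>" by blast
qed

lemma tempered_dist_fourier: "tempered u \<Longrightarrow> tempered (dist_fourier u)"
  unfolding dist_fourier_def[abs_def]
  by (rule tempered_compose[OF _ fourier_schwartz_op])
    (auto simp: fourier_add fourier_cmult schwartz_integrable)

lemma test_functions_mono: "U \<subseteq> V \<Longrightarrow> test_functions U \<subseteq> test_functions V"
  by (auto simp: test_functions_def)

section \<open>Vanishing of a distribution off its support\<close>

context
  fixes \<Psi> :: "real \<Rightarrow> real"
  assumes \<Psi>: "besov_cutoff \<Psi>"
begin

text \<open>A partition of unity made one ball at a time. The bump \<eta> is 1 on the ball of radius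
  r and 0 outside radius 13/10 * r, within the ball of radius 2 * r where w vanishes. Hence \<eta>
  \<theta> is killed, while the rest is supported off the smaller ball and is covered by the
  remaining ones.\<close>

lemma dist_vanishes_finite_cover:
  assumes w: "tempered w" and "finite F"
    and "\<And>x. x \<in> F \<Longrightarrow> 0 < r x \<and> (\<forall>\<phi>\<in>test_functions (ball x (2 * r x)). w \<phi> = 0)"
    and "\<theta> \<in> test_functions UNIV" "closure {x. \<theta> x \<noteq> 0} \<subseteq> (\<Union>x\<in>F. ball x (r x))"
  shows "w \<theta> = 0"
  using assms(2-5)
proof (induction F arbitrary: \<theta>)
  case empty
  then have "closure {x. \<theta> x \<noteq> 0} = {}" by simp
  then have "{x. \<theta> x \<noteq> 0} = {}" using closure_subset by fast
  then have "\<theta> = (\<lambda>x. 0)" by auto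
  then show ?case using tempered_linear[OF w schwartz_zero schwartz_zero, of 0 0] by simp
next
  case (insert x F)
  let ?K = "closure {x. \<theta> x \<noteq> 0}"
  have r: "0 < r x" and wx: "\<And>\<phi>. \<phi> \<in> test_functions (ball x (2 * r x)) \<Longrightarrow> w \<phi> = 0"
    using insert.prems(1)[of x] by auto
  define \<eta> where "\<eta> = (\<lambda>y. cut \<Psi> (1 / r x) (1 *\<^sub>R y + (- x)))"
  have \<eta>: "smooth \<eta>" unfolding \<eta>_def using r by (intro smooth_affine smooth_cut[OF \<Psi>]) auto
  have one: "\<eta> y = 1" if "y \<in> ball x (r x)" for y
    unfolding \<eta>_def using that r
    by (intro cut_eq_1[OF \<Psi>]) (auto simp: dist_norm norm_minus_commute divide_simps intro: less_trans)
  have zero: "\<eta> y = 0" if "y \<notin> cball x (13/10 * r x)" for y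
    unfolding \<eta>_def using that r
    by (intro cut_eq_0[OF \<Psi>]) (auto simp: dist_norm norm_minus_commute divide_simps)
  have s: "smooth \<theta>" and K: "compact ?K"
    using insert.prems(2) by (auto simp: test_functions_def)
  have \<theta>0: "\<theta> y = 0" if "y \<notin> ?K" for y using that closure_subset[of "{x. \<theta> x \<noteq> 0}"] by auto
  have t1: "(\<lambda>y. \<eta> y * \<theta> y) \<in> test_functions (ball x (2 * r x))"
  proof (rule test_functionsI[OF smooth_mult[OF \<eta> s], of "cball x (13/10 * r x)"])
    show "cball x (13/10 * r x) \<subseteq> ball x (2 * r x)" using r by auto
  qed (use zero in auto)
  have sub: "?K - ball x (r x) \<subseteq> (\<Union>x\<in>F. ball x (r x))" using insert.prems(3) by auto
  have t2: "(\<lambda>y. (1 - \<eta> y) * \<theta> y) \<in> test_functions UNIV"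
    and t2': "closure {y. (1 - \<eta> y) * \<theta> y \<noteq> 0} \<subseteq> ?K - ball x (r x)"
  proof -
    have cl: "closed (?K - ball x (r x))" by (intro closed_Diff) auto
    have z: "(1 - \<eta> y) * \<theta> y = 0" if "y \<notin> ?K - ball x (r x)" for y
      using that one[of y] \<theta>0[of y] by auto
    show "(\<lambda>y. (1 - \<eta> y) * \<theta> y) \<in> test_functions UNIV"
    proof (rule test_functionsI[OF smooth_mult[OF smooth_diff[OF smooth_const \<eta>] s] cl])
      show "bounded (?K - ball x (r x))" using compact_imp_bounded[OF K] by (rule bounded_subset) auto
    qed (simp, rule z)
    have "{y. (1 - \<eta> y) * \<theta> y \<noteq> 0} \<subseteq> ?K - ball x (r x)"
    proof
      fix y assume "y \<in> {y. (1 - \<eta> y) * \<theta> y \<noteq> 0}"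
      then have "(1 - \<eta> y) * \<theta> y \<noteq> 0" by simp
      then show "y \<in> ?K - ball x (r x)" by (rule contrapos_np) (rule z)
    qed
    then show "closure {y. (1 - \<eta> y) * \<theta> y \<noteq> 0} \<subseteq> ?K - ball x (r x)"
      by (rule closure_minimal[OF _ cl])
  qed
  have "w (\<lambda>y. (1 - \<eta> y) * \<theta> y) = 0"
    by (rule insert.IH[OF insert.prems(1) t2]) (use t2' sub in auto)
  moreover have "w (\<lambda>y. \<eta> y * \<theta> y) = 0" by (rule wx[OF t1])
  moreover have "w (\<lambda>y. \<eta> y * \<theta> y + (1 - \<eta> y) * \<theta> y) = w (\<lambda>y. \<eta> y * \<theta> y) + w (\<lambda>y. (1 - \<eta> y) * \<theta> y)"
    by (rule tempered_add[OF w test_functions_schwartz[OF t1] test_functions_schwartz[OF t2]])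
  ultimately show ?case by (simp add: algebra_simps)
qed

lemma dist_support_test_eq_0:
  assumes w: "tempered w" and \<theta>: "\<theta> \<in> test_functions UNIV"
    and disj: "closure {x. \<theta> x \<noteq> 0} \<inter> dist_support w = {}"
  shows "w \<theta> = 0"
proof -
  let ?K = "closure {x. \<theta> x \<noteq> 0}"
  have "\<exists>r>0. \<forall>\<phi>\<in>test_functions (ball x (2 * r)). w \<phi> = 0" if "x \<in> ?K" for x
  proof -
    have "x \<notin> dist_support w" using that disj by blast
    then obtain U where U: "open U" "x \<in> U" "\<forall>\<phi>\<in>test_functions U. w \<phi> = 0"
      unfolding dist_support_def by blast
    then obtain e where e: "e > 0" "ball x e \<subseteq> U" using openE by blast
    then show ?thesis using U(3) test_functions_mono[OF e(2)]
      by (intro exI[of _ "e / 2"]) auto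
  qed
  then obtain r where r: "\<And>x. x \<in> ?K \<Longrightarrow> 0 < r x \<and> (\<forall>\<phi>\<in>test_functions (ball x (2 * r x)). w \<phi> = 0)"
    by metis
  have "compact ?K" using \<theta> by (simp add: test_functions_def)
  then obtain F where F: "F \<subseteq> ?K" "finite F" "?K \<subseteq> (\<Union>x\<in>F. ball x (r x))"
  proof (rule compactE_image)
    show "open (ball x (r x))" for x by simp
    show "?K \<subseteq> (\<Union>x\<in>?K. ball x (r x))"
    proof
      fix x assume "x \<in> ?K"
      then show "x \<in> (\<Union>x\<in>?K. ball x (r x))" using r by (intro UN_I[of x]) auto
    qed
  qed
  show ?thesis
    by (rule dist_vanishes_finite_cover[OF w F(2) _ \<theta> F(3)]) (use r F(1) in auto)
qed

lemma norm_le_all_epsilon: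
  fixes z :: complex
  assumes "\<And>t. 0 < t \<Longrightarrow> t \<le> 1 \<Longrightarrow> norm z \<le> B * t"
  shows "z = 0"
proof (rule ccontr)
  assume "z \<noteq> 0"
  then have z: "0 < norm z" by simp
  define D where "D = \<bar>B\<bar> + 1"
  have D: "0 < D" "B \<le> D" by (auto simp: D_def)
  define t where "t = min 1 (norm z / (2 * D))"
  have t: "0 < t" "t \<le> 1" using z D by (auto simp: t_def)
  have "norm z \<le> B * t" by (rule assms[OF t])
  also have "\<dots> \<le> D * t" using t D by (intro mult_right_mono) auto
  also have "\<dots> \<le> D * (norm z / (2 * D))" using D by (intro mult_left_mono) (auto simp: t_def)
  also have "\<dots> = norm z / 2" using D by simp
  finally show False using z by simp
qed

lemma cut_mult_test:
  assumes "smooth \<theta>" "0 < t"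
  shows "(\<lambda>x. cut \<Psi> t x * \<theta> x) \<in> test_functions UNIV"
  by (rule test_functionsI[OF smooth_mult[OF smooth_cut[OF \<Psi> assms(2)] assms(1)], of "cball 0 (13/10 / t)"])
    (use assms in \<open>auto simp: cut_eq_0[OF \<Psi>] field_simps\<close>)

text \<open>Here K may be unbounded. The truncation \<open>cut \<Psi> t\<close> times \<theta> is a
  test function still supported in K, hence killed by w, and the remainder is of size t in every
  seminorm.\<close>

lemma dist_support_schwartz_eq_0:
  assumes w: "tempered w" and \<theta>: "\<theta> \<in> schwartz" and K: "closed K" "\<And>x. x \<notin> K \<Longrightarrow> \<theta> x = 0"
    and disj: "K \<inter> dist_support w = {}"
  shows "w \<theta> = 0"
proof -
  obtain C N where C: "0 \<le> C" "\<And>\<phi>. \<phi> \<in> schwartz \<Longrightarrow> norm (w \<phi>) \<le> C * schwartz_norm N \<phi>"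
    by (rule tempered_bound[OF w]) blast
  obtain M where M: "\<And>t (\<phi>::real^'a \<Rightarrow> complex). 0 < t \<Longrightarrow> t \<le> 1 \<Longrightarrow> \<phi> \<in> schwartz \<Longrightarrow>
    schwartz_norm N (\<lambda>x. (1 - cut \<Psi> t x) * \<phi> x) \<le> M * t ^ 1 * schwartz_norm (N + 1) \<phi>"
    using schwartz_norm_cut_complement[OF \<Psi>, of N 1] by blast
  show ?thesis
  proof (rule norm_le_all_epsilon)
    fix t :: real assume t: "0 < t" "t \<le> 1"
    have test: "(\<lambda>x. cut \<Psi> t x * \<theta> x) \<in> test_functions UNIV"
      by (rule cut_mult_test[OF schwartzD[OF \<theta>] t(1)])
    have "closure {x. cut \<Psi> t x * \<theta> x \<noteq> 0} \<subseteq> K" using K by (intro closure_minimal) auto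
    then have z: "w (\<lambda>x. cut \<Psi> t x * \<theta> x) = 0"
      using disj by (intro dist_support_test_eq_0[OF w test]) auto
    have comp: "(\<lambda>x. (1 - cut \<Psi> t x) * \<theta> x) \<in> schwartz"
      by (intro schwartz_mult slowly_growing_cut_complement[OF \<Psi>] t \<theta>)
    have "w \<theta> = w (\<lambda>x. cut \<Psi> t x * \<theta> x + (1 - cut \<Psi> t x) * \<theta> x)" by (simp add: algebra_simps)
    also have "\<dots> = w (\<lambda>x. (1 - cut \<Psi> t x) * \<theta> x)"
      using tempered_add[OF w test_functions_schwartz[OF test] comp] z by simp
    also have "norm \<dots> \<le> C * schwartz_norm N (\<lambda>x. (1 - cut \<Psi> t x) * \<theta> x)" by (rule C(2)[OF comp])
    also have "\<dots> \<le> C * (M * t ^ 1 * schwartz_norm (N + 1) \<theta>)" by (intro mult_left_mono M t \<theta> C(1))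
    finally show "norm (w \<theta>) \<le> (C * M * schwartz_norm (N + 1) \<theta>) * t" by (simp add: mult_ac)
  qed
qed

section \<open>Uniqueness of representing functions\<close>

lemma smooth_coord_fun:
  assumes "\<And>k. Ck1 k h" shows "smooth (\<lambda>x::real^'n::finite. complex_of_real (h (x $ i)))"
proof -
  have D: "((\<lambda>x::real^'n. complex_of_real (h (x $ i))) has_derivative (\<lambda>v. complex_of_real (deriv h (x $ i) * v $ i))) (at x)"
    if "Ck1 k h" for h k x
  proof -
    have "((\<lambda>x::real^'n. x $ i) has_derivative (\<lambda>v. v $ i)) (at x)"
      by (intro bounded_linear_imp_has_derivative bounded_linear_vec_nth)
    from has_derivative_compose[OF this has_field_derivative_imp_has_derivative[OF Ck1_DERIV[OF that]]]
    have "((\<lambda>x::real^'n. h (x $ i)) has_derivative (\<lambda>v. deriv h (x $ i) * v $ i)) (at x)" .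
    from has_derivative_of_real[OF this] show ?thesis .
  qed
  have "Ck k (\<lambda>x::real^'n. complex_of_real (h (x $ i)))" if "Ck1 k h" for h k
    using that
  proof (induction k arbitrary: h)
    case 0
    then show ?case using D[OF 0] by (auto simp: differentiable_on_def intro!: differentiableI)
  next
    case (Suc k)
    have "(\<lambda>x::real^'n. complex_of_real (h (x $ i))) differentiable_on UNIV"
      using D[OF Suc.prems] by (auto simp: differentiable_on_def intro!: differentiableI)
    moreover have "partial_deriv j (\<lambda>x::real^'n. complex_of_real (h (x $ i)))
        = (\<lambda>x. complex_of_real (deriv h (x $ i)) * (if i = j then 1 else 0))" for j
      by (rule ext, subst partial_derivI[OF D[OF Suc.prems]]) (auto simp: axis_def)
    moreover have "Ck k (\<lambda>x::real^'n. complex_of_real (deriv h (x $ i)))"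
      by (rule Suc.IH) (use Suc.prems in simp)
    ultimately show ?case by (simp only: Ck.simps Ck_mult[OF _ Ck_const] simp_thms)
  qed
  then show ?thesis using assms by (simp add: smooth_iff_Ck)
qed

lemma smooth_prod: "finite A \<Longrightarrow> (\<And>i. i \<in> A \<Longrightarrow> smooth (f i)) \<Longrightarrow> smooth (\<lambda>x. \<Prod>i\<in>A. f i x)"
  by (induction A rule: finite_induct) (auto intro: smooth_const smooth_mult)

text \<open>On the transition interval from 11/10 to 13/10 the values of \<Psi> are restricted by
  smoothness only, so a bound comes from compactness.\<close>

lemma cutoff_bounded: obtains B where "1 \<le> B" "\<And>t. \<bar>\<Psi> t\<bar> \<le> B"
proof -
  have "continuous_on {11/10..13/10} \<Psi>"
    using besov_cutoff_Ck1[OF \<Psi>, of 0] by (auto intro: differentiable_imp_continuous_on differentiable_on_subset)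
  then have "bounded (\<Psi> ` {11/10..13/10})"
    by (intro compact_imp_bounded compact_continuous_image) auto
  then obtain B where "\<forall>y\<in>\<Psi> ` {11/10..13/10}. norm y \<le> B"
    unfolding bounded_iff by blast
  then have B: "\<bar>\<Psi> t\<bar> \<le> B" if "t \<in> {11/10..13/10}" for t
    using that by auto
  have "\<bar>\<Psi> t\<bar> \<le> max 1 B" for t
  proof (cases "t \<in> {11/10..13/10}")
    case False
    then consider "t < 11/10" | "t > 13/10" by fastforce
    then show ?thesis using \<Psi> by cases (auto simp: besov_cutoff_def)
  qed (use B in fastforce)
  then show ?thesis by (intro that[of "max 1 B"]) auto
qed

text \<open>A smooth approximation of the indicator of the open box with corners a and b. For t < 0
  the argument 2 + m t eventually drops below 11/10, where \<Psi> is 1; for t >= 0 it stays at least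
  2, beyond 13/10, where \<Psi> is 0.\<close>

definition box_bump :: "real^'n::finite \<Rightarrow> real^'n \<Rightarrow> nat \<Rightarrow> real^'n \<Rightarrow> complex"
  where "box_bump a b m x = (\<Prod>i\<in>UNIV. of_real (\<Psi> (2 + real m * (x $ i - b $ i))) * of_real (\<Psi> (2 + real m * (a $ i - x $ i))))"

lemma smooth_box_bump: "smooth (box_bump a b m)"
proof -
  have "smooth (\<lambda>x::real^'a. complex_of_real (\<Psi> (2 + real m * (x $ i - b $ i))) * of_real (\<Psi> (2 + real m * (a $ i - x $ i))))" for i
  proof (rule smooth_mult)
    have "Ck1 k (\<lambda>s. \<Psi> (real m * s + (2 - real m * b $ i)))" for k by (intro Ck1_affine besov_cutoff_Ck1 \<Psi>)
    from smooth_coord_fun[OF this] show "smooth (\<lambda>x::real^'a. complex_of_real (\<Psi> (2 + real m * (x $ i - b $ i))))"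
      by (simp add: algebra_simps)
    have "Ck1 k (\<lambda>s. \<Psi> (- real m * s + (2 + real m * a $ i)))" for k by (intro Ck1_affine besov_cutoff_Ck1 \<Psi>)
    from smooth_coord_fun[OF this] show "smooth (\<lambda>x::real^'a. complex_of_real (\<Psi> (2 + real m * (a $ i - x $ i))))"
      by (simp add: algebra_simps)
  qed
  then show ?thesis unfolding box_bump_def by (intro smooth_prod) auto
qed

lemma cutoff_tendsto_indicator:
  "(\<lambda>m. \<Psi> (2 + real m * t)) \<longlonglongrightarrow> (if t < 0 then 1 else 0)"
proof (rule tendsto_eventually)
  show "\<forall>\<^sub>F m in sequentially. \<Psi> (2 + real m * t) = (if t < 0 then 1 else 0)"
  proof (cases "t < 0")
    case True
    obtain M :: nat where M: "1 / (- t) < real M" using reals_Archimedean2 by blast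
    have M': "2 + real m * t < 11/10" if "m \<ge> M" for m
    proof -
      have "1 < real M * (- t)" using M True by (simp add: divide_simps)
      also have "\<dots> \<le> real m * (- t)" using that True by (intro mult_right_mono) auto
      finally show ?thesis by simp
    qed
    have "\<Psi> (2 + real m * t) = 1" if "m \<ge> M" for m
      using M'[OF that] \<Psi> by (simp add: besov_cutoff_def)
    then show ?thesis using True by (auto intro: eventually_sequentiallyI)
  next
    case False
    then have "2 + real m * t > 13/10" for m by (auto intro: add_pos_nonneg less_le_trans[of _ 2])
    then show ?thesis using False \<Psi> by (auto simp: besov_cutoff_def)
  qed
qed

lemma box_bump_tendsto: "(\<lambda>m. box_bump a b m x) \<longlonglongrightarrow> indicator (box a b) x"
proof -
  have "(\<lambda>m. box_bump a b m x) \<longlonglongrightarrow> (\<Prod>i\<in>UNIV. of_real (if x $ i - b $ i < 0 then 1 else 0) * of_real (if a $ i - x $ i < 0 then 1 else 0))"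
    unfolding box_bump_def by (intro tendsto_prod tendsto_mult tendsto_of_real cutoff_tendsto_indicator)
  moreover have "(\<Prod>i\<in>UNIV. complex_of_real (if x $ i - b $ i < 0 then 1 else 0) * of_real (if a $ i - x $ i < 0 then 1 else 0)) = indicator (box a b) x"
    by (auto simp: indicator_def mem_box_cart split: if_splits)
  ultimately show ?thesis by simp
qed

lemma integral_zero_borel_imp_AE:
  fixes k :: "'a::euclidean_space \<Rightarrow> real"
  assumes k: "integrable lborel k" and z: "\<And>A. A \<in> sets borel \<Longrightarrow> (LINT x|lborel. indicator A x * k x) = 0"
  shows "AE x in lborel. k x = 0"
proof -
  have [measurable]: "k \<in> borel_measurable borel" using borel_measurable_integrable[OF k] by simp
  have pos: "AE x in lborel. l x \<le> 0"
    if l: "integrable lborel l" and zl: "\<And>A. A \<in> sets borel \<Longrightarrow> (LINT x|lborel. indicator A x * l x) = 0" for l :: "'a \<Rightarrow> real"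
  proof -
    have [measurable]: "l \<in> borel_measurable borel" using borel_measurable_integrable[OF l] by simp
    have A: "{x. 0 < l x} \<in> sets borel" by measurable
    have "integrable lborel (\<lambda>x. indicator {x. 0 < l x} x * l x)"
      by (rule Bochner_Integration.integrable_bound[OF l]) (auto simp: indicator_def)
    then have "AE x in lborel. indicator {x. 0 < l x} x * l x = 0"
      using zl[OF A] integral_nonneg_eq_0_iff_AE[of lborel "\<lambda>x. indicator {x. 0 < l x} x * l x"]
      by (auto simp: indicator_def)
    then show ?thesis by eventually_elim (auto simp: indicator_def split: if_splits)
  qed
  have "AE x in lborel. k x \<le> 0" by (rule pos[OF k z])
  moreover have "AE x in lborel. - k x \<le> 0"
    by (rule pos) (use k z in auto)
  ultimately show ?thesis by eventually_elim auto
qed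

text \<open>The lemma of du Bois-Reymond. Truncation makes h integrable; box bumps times the
  truncation are test functions and converge boundedly to indicators of boxes, which form an
  intersection-stable generator. So the truncated h integrates to 0 over every Borel set and
  vanishes almost everywhere, and countably many truncations exhaust the space.\<close>

lemma represents_0_imp_AE:
  fixes h :: "real^'n::finite \<Rightarrow> complex"
  assumes h [measurable]: "h \<in> borel_measurable borel"
    and int: "\<And>K. compact K \<Longrightarrow> set_integrable lborel K h"
    and z: "\<And>\<phi>. \<phi> \<in> test_functions UNIV \<Longrightarrow> (LINT x|lborel. h x * \<phi> x) = 0"
  shows "AE x in lborel. h x = 0"
proof -
  obtain B where B: "1 \<le> B" "\<And>t. \<bar>\<Psi> t\<bar> \<le> B" by (rule cutoff_bounded) blast
  have loc: "AE x in lborel. h x * cut \<Psi> t x = 0" if t: "0 < t" for t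
  proof -
    define k where "k = (\<lambda>x. h x * cut \<Psi> t x)"
    note [measurable] = schwartz_measurable[OF cut_schwartz[OF \<Psi> t]]
    have [measurable]: "k \<in> borel_measurable borel" unfolding k_def by measurable
    have ki: "integrable lborel k"
    proof (rule Bochner_Integration.integrable_bound)
      show "integrable lborel (\<lambda>x. B *\<^sub>R (indicator (cball 0 (13/10 / t)) x *\<^sub>R h x))"
        using int[of "cball 0 (13/10 / t)"] by (intro integrable_scaleR_right) (simp add: set_integrable_def)
      show "AE x in lborel. norm (k x) \<le> norm (B *\<^sub>R (indicator (cball 0 (13/10 / t)) x *\<^sub>R h x))"
      proof (rule AE_I2)
        fix x :: "real^'n"
        show "norm (k x) \<le> norm (B *\<^sub>R (indicator (cball 0 (13/10 / t)) x *\<^sub>R h x))"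
        proof (cases "x \<in> cball 0 (13/10 / t)")
          case True
          have "norm (k x) = norm (h x) * \<bar>\<Psi> (t * norm x)\<bar>" by (simp add: k_def cut_def norm_mult)
          also have "\<dots> \<le> norm (h x) * B" by (intro mult_left_mono B) auto
          finally show ?thesis using True B(1) by (simp add: mult.commute)
        next
          case False
          then have "cut \<Psi> t x = 0" using t by (intro cut_eq_0[OF \<Psi>]) (auto simp: field_simps)
          then show ?thesis by (simp add: k_def)
        qed
      qed
    qed measurable
    have bnd: "norm (box_bump a b m x) \<le> (B * B) ^ CARD('n)" for a b x :: "real^'n" and m
    proof -
      have "norm (box_bump a b m x) \<le> (\<Prod>i\<in>(UNIV::'n set). B * B)"
        unfolding box_bump_def prod_norm[symmetric] norm_mult
        using B by (intro prod_mono) (auto intro!: mult_mono order_trans[OF abs_ge_zero B(2)])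
      then show ?thesis by simp
    qed
    have sets: "(LINT x|lborel. indicator A x *\<^sub>R k x) = 0" if A: "A \<in> sets borel" for A
    proof -
      have ind: "integrable lborel (\<lambda>x. indicator A x *\<^sub>R k x)" if "A \<in> sets borel" for A
        using integrable_mult_indicator[OF _ ki, of A] that by simp
      let ?G = "range (\<lambda>(a, b). box a b :: (real^'n) set)"
      have "Int_stable ?G" by (auto simp: Int_stable_def box_Int_box)
      moreover have "?G \<subseteq> Pow UNIV" by auto
      moreover have "A \<in> sigma_sets UNIV ?G" using A unfolding borel_eq_box by simp
      ultimately show ?thesis
      proof (induction rule: sigma_sets_induct_disjoint)
        case (basic A)
        then obtain a b where A: "A = box a b" by auto
        have "(\<lambda>m. LINT x|lborel. box_bump a b m x * k x) \<longlonglongrightarrow> (LINT x|lborel. indicator A x *\<^sub>R k x)"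
        proof (rule integral_dominated_convergence[where w="\<lambda>x. (B * B) ^ CARD('n) * norm (k x)"])
          note [measurable] = smooth_borel_measurable[OF smooth_box_bump]
          show "(\<lambda>x. box_bump a b m x * k x) \<in> borel_measurable lborel" for m by measurable
          show "(\<lambda>x. indicator A x *\<^sub>R k x) \<in> borel_measurable lborel" unfolding A by measurable
          show "integrable lborel (\<lambda>x. (B * B) ^ CARD('n) * norm (k x))" using ki by simp
          show "AE x in lborel. (\<lambda>m. box_bump a b m x * k x) \<longlonglongrightarrow> indicator A x *\<^sub>R k x"
          proof (rule AE_I2)
            fix x
            have "(\<lambda>m. box_bump a b m x * k x) \<longlonglongrightarrow> indicator (box a b) x * k x"
              by (intro tendsto_mult tendsto_const box_bump_tendsto)
            then show "(\<lambda>m. box_bump a b m x * k x) \<longlonglongrightarrow> indicator A x *\<^sub>R k x"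
              by (cases "x \<in> box a b") (simp_all add: A)
          qed
          show "AE x in lborel. norm (box_bump a b m x * k x) \<le> (B * B) ^ CARD('n) * norm (k x)" for m
            unfolding norm_mult by (intro AE_I2 mult_right_mono bnd) auto
        qed
        moreover have "(LINT x|lborel. box_bump a b m x * k x) = 0" for m
          using z[OF cut_mult_test[OF smooth_box_bump[of a b m] t]] by (simp add: k_def mult_ac)
        ultimately show ?case by (simp add: LIMSEQ_const_iff)
      next
        case empty
        then show ?case by simp
      next
        case (compl A)
        have A: "A \<in> sets borel" using compl(1) by (simp add: borel_eq_box)
        have "(LINT x|lborel. indicator (UNIV - A) x *\<^sub>R k x) = (LINT x|lborel. k x - indicator A x *\<^sub>R k x)"
          by (intro Bochner_Integration.integral_cong) (auto simp: indicator_def)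
        also have "\<dots> = (LINT x|lborel. k x) - (LINT x|lborel. indicator A x *\<^sub>R k x)"
          by (intro Bochner_Integration.integral_diff ki ind A)
        also have "(LINT x|lborel. k x) = 0" using z[OF cut_test[OF \<Psi> t]] by (simp add: k_def)
        finally show ?case using compl by simp
      next
        case (union f)
        have f: "\<And>i. f i \<in> sets borel" using union(2) by (auto simp: borel_eq_box)
        have "(LINT x:(\<Union>i. f i)|lborel. k x) = (\<Sum>i. LINT x:f i|lborel. k x)"
        proof (rule lebesgue_integral_countable_add)
          show "f i \<inter> f j = {}" if "i \<noteq> j" for i j
            using union(1) that by (auto simp: disjoint_family_on_def)
          show "set_integrable lborel (\<Union>i. f i) k" unfolding set_integrable_def using f by (intro ind) auto
        qed (use f in auto)
        then show ?case using union(3) by (simp add: set_lebesgue_integral_def)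
      qed
    qed
    have "AE x in lborel. Re (k x) = 0"
    proof (rule integral_zero_borel_imp_AE)
      fix A :: "(real^'n) set" assume A: "A \<in> sets borel"
      have "integrable lborel (\<lambda>x. indicator A x *\<^sub>R k x)"
        using integrable_mult_indicator[OF _ ki, of A] A by simp
      from integral_Re[OF this] show "(LINT x|lborel. indicator A x * Re (k x)) = 0"
        using sets[OF A] by simp
    qed (use ki in auto)
    moreover have "AE x in lborel. Im (k x) = 0"
    proof (rule integral_zero_borel_imp_AE)
      fix A :: "(real^'n) set" assume A: "A \<in> sets borel"
      have "integrable lborel (\<lambda>x. indicator A x *\<^sub>R k x)"
        using integrable_mult_indicator[OF _ ki, of A] A by simp
      from integral_Im[OF this] show "(LINT x|lborel. indicator A x * Im (k x)) = 0"
        using sets[OF A] by simp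
    qed (use ki in auto)
    ultimately show ?thesis by eventually_elim (auto simp: k_def complex_eq_iff)
  qed
  have "AE x in lborel. \<forall>m. h x * cut \<Psi> (1 / real (Suc m)) x = 0"
    unfolding AE_all_countable by (intro allI loc) auto
  then show ?thesis
  proof eventually_elim
    case (elim x)
    obtain m :: nat where "norm x < real m" using reals_Archimedean2 by blast
    then have "1 / real (Suc m) * norm x < 11/10" by (simp add: divide_simps)
    then have "cut \<Psi> (1 / real (Suc m)) x = 1" by (rule cut_eq_1[OF \<Psi>])
    then show ?case using elim by (metis mult.right_neutral)
  qed
qed

lemma set_integrable_test_mult:
  fixes f :: "real^'n::finite \<Rightarrow> complex"
  assumes [measurable]: "f \<in> borel_measurable borel" and "\<And>K. compact K \<Longrightarrow> set_integrable lborel K f"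
    and \<phi>: "\<phi> \<in> test_functions UNIV"
  shows "integrable lborel (\<lambda>x. f x * \<phi> x)"
proof (rule Bochner_Integration.integrable_bound)
  let ?K = "closure {x. \<phi> x \<noteq> 0}"
  note S = test_functions_schwartz[OF \<phi>]
  note [measurable] = schwartz_measurable[OF S]
  have "compact ?K" using \<phi> by (simp add: test_functions_def)
  then show "integrable lborel (\<lambda>x. schwartz_norm 0 \<phi> *\<^sub>R (indicator ?K x *\<^sub>R f x))"
    using assms(2)[of ?K] by (intro integrable_scaleR_right) (simp add: set_integrable_def)
  show "AE x in lborel. norm (f x * \<phi> x) \<le> norm (schwartz_norm 0 \<phi> *\<^sub>R (indicator ?K x *\<^sub>R f x))"
  proof (rule AE_I2)
    fix x
    show "norm (f x * \<phi> x) \<le> norm (schwartz_norm 0 \<phi> *\<^sub>R (indicator ?K x *\<^sub>R f x))"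
    proof (cases "\<phi> x = 0")
      case False
      then have "x \<in> ?K" using closure_subset[of "{x. \<phi> x \<noteq> 0}"] by auto
      then show ?thesis
        using schwartz_norm_bound[OF S, of "[]" 0 x] schwartz_norm_nonneg[OF S, of 0]
        by (auto simp: norm_mult mult.commute[of "norm (f x)"] intro!: mult_right_mono)
    qed simp
  qed
  show "(\<lambda>x. f x * \<phi> x) \<in> borel_measurable lborel" by measurable
qed

section \<open>Quasi-norms computed from any representative\<close>

lemma represents_measurable: "represents f u \<Longrightarrow> f \<in> borel_measurable borel"
  by (simp add: represents_def)

lemma represents_unique:
  assumes f: "represents f u" and g: "represents g u"
  shows "AE x in lborel. f x = g x"
proof -
  have "AE x in lborel. f x - g x = 0"
  proof (rule represents_0_imp_AE)
    show "(\<lambda>x. f x - g x) \<in> borel_measurable borel" using f g by (auto simp: represents_def)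
    show "set_integrable lborel K (\<lambda>x. f x - g x)" if "compact K" for K
      using f g that by (intro set_integral_diff) (auto simp: represents_def)
    fix \<phi> :: "real^'a \<Rightarrow> complex" assume \<phi>: "\<phi> \<in> test_functions UNIV"
    have "integrable lborel (\<lambda>x. f x * \<phi> x)" "integrable lborel (\<lambda>x. g x * \<phi> x)"
      using f g by (auto simp: represents_def intro!: set_integrable_test_mult \<phi>)
    then show "(LINT x|lborel. (f x - g x) * \<phi> x) = 0"
      using f g \<phi> by (auto simp: represents_def left_diff_distrib)
  qed
  then show ?thesis by eventually_elim simp
qed

lemma Lp_norm_eq:
  assumes p: "0 < p" and f: "represents f u"
  shows "Lp_norm p u = fun_Lp_norm p f"
proof -
  have "fun_Lp_norm p g = fun_Lp_norm p f" if "represents g u" for g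
    unfolding fun_Lp_norm_eq
  proof (rule Lnorm_cong_AE[OF p])
    show "AE x in lborel. ennreal (norm (g x)) = ennreal (norm (f x))"
      using represents_unique[OF that f] by eventually_elim simp
    note [measurable] = represents_measurable[OF that] represents_measurable[OF f]
    show "(\<lambda>x. ennreal (norm (g x))) \<in> borel_measurable borel" "(\<lambda>x. ennreal (norm (f x))) \<in> borel_measurable borel"
      by measurable
  qed
  then show ?thesis unfolding Lp_norm_def by (intro INF_eq_const) (use f in blast)+
qed

end

lemma Lp_norm_le: "represents f u \<Longrightarrow> Lp_norm p u \<le> fun_Lp_norm p f"
  unfolding Lp_norm_def by (rule INF_lower) simp

lemma Lp_norm_finite_represents:
  assumes "Lp_norm p u < \<infinity>" obtains f where "represents f u"
proof -
  have "{f. represents f u} \<noteq> {}"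
  proof
    assume "{f. represents f u} = {}"
    then have "Lp_norm p u = top" unfolding Lp_norm_def by simp
    then show False using assms by simp
  qed
  then show ?thesis using that by blast
qed

section \<open>Band-limited distributions are functions of polynomial growth\<close>

definition poly_growth :: "((real^'n::finite) \<Rightarrow> complex) \<Rightarrow> bool"
  where "poly_growth g \<longleftrightarrow> g \<in> borel_measurable borel \<and> (\<exists>C N. 0 \<le> C \<and> (\<forall>y. norm (g y) \<le> C * (1 + norm y) ^ N))"

lemma slow_mult_decay:
  fixes g \<phi> :: "real^'n::finite \<Rightarrow> complex"
  assumes g: "0 \<le> C" "\<And>y. norm (g y) \<le> C * (1 + norm y) ^ N" and \<phi>: "\<phi> \<in> schwartz"
  shows "norm (g y * \<phi> y) \<le> C * schwartz_norm (2 * CARD('n) + N) \<phi> * decay y"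
proof -
  have p: "0 < (1 + norm y) ^ k" for k by (simp add: add_pos_nonneg)
  have "norm (g y * \<phi> y) \<le> (C * (1 + norm y) ^ N) * (schwartz_norm (2 * CARD('n) + N) \<phi> / (1 + norm y) ^ (2 * CARD('n) + N))"
    unfolding norm_mult using schwartz_norm_bound[OF \<phi>, of "[]"] g by (intro mult_mono) auto
  also have "\<dots> = C * schwartz_norm (2 * CARD('n) + N) \<phi> * decay y"
    using p[of N] p[of 1] by (simp add: decay_def power_add)
  finally show ?thesis .
qed

lemma poly_growth_mult_integrable:
  assumes g: "poly_growth g" and \<phi>: "\<phi> \<in> schwartz"
  shows "integrable lborel (\<lambda>y. g y * \<phi> y)"
proof -
  obtain C N where C: "0 \<le> C" "\<And>y. norm (g y) \<le> C * (1 + norm y) ^ N"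
    using g by (auto simp: poly_growth_def)
  have [measurable]: "g \<in> borel_measurable borel" using g by (simp add: poly_growth_def)
  note [measurable] = schwartz_measurable[OF \<phi>]
  show ?thesis
    by (rule integrable_decay_bound(1)[OF _ slow_mult_decay[OF C \<phi>]]) measurable
qed

lemma poly_growth_set_integrable:
  fixes g :: "real^'n::finite \<Rightarrow> complex"
  assumes g: "poly_growth g" and K: "compact K"
  shows "set_integrable lborel K g"
proof -
  obtain C N where C: "0 \<le> C" "\<And>y. norm (g y) \<le> C * (1 + norm y) ^ N"
    using g by (auto simp: poly_growth_def)
  have [measurable]: "g \<in> borel_measurable borel" using g by (simp add: poly_growth_def)
  have [measurable]: "K \<in> sets borel" using K by (simp add: borel_compact)
  obtain B where B: "\<And>y. y \<in> K \<Longrightarrow> norm y \<le> B"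
    using compact_imp_bounded[OF K] by (auto simp: bounded_iff)
  show ?thesis unfolding set_integrable_def
  proof (rule Bochner_Integration.integrable_bound)
    show "integrable lborel (\<lambda>y. (C * (1 + B) ^ N) * indicator K y :: real)"
      using emeasure_compact_finite[OF K] by (intro integrable_mult_right) simp
    show "AE y in lborel. norm (indicator K y *\<^sub>R g y) \<le> norm ((C * (1 + B) ^ N) * indicator K y :: real)"
    proof (rule AE_I2)
      fix y
      have "norm (g y) \<le> C * (1 + B) ^ N" if "y \<in> K"
      proof -
        have "norm (g y) \<le> C * (1 + norm y) ^ N" by (rule C)
        also have "\<dots> \<le> C * (1 + B) ^ N" using B[OF that] C(1) by (intro mult_left_mono power_mono) auto
        finally show ?thesis .
      qed
      then show "norm (indicator K y *\<^sub>R g y) \<le> norm ((C * (1 + B) ^ N) * indicator K y :: real)"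
        by (auto simp: indicator_def)
    qed
  qed measurable
qed

lemma poly_growth_represents:
  assumes "poly_growth g" "\<And>\<phi>. \<phi> \<in> test_functions UNIV \<Longrightarrow> u \<phi> = (LINT x|lborel. g x * \<phi> x)"
  shows "represents g u"
  using assms poly_growth_set_integrable[OF assms(1)] by (auto simp: represents_def poly_growth_def)

lemma test_function_ball:
  assumes "\<phi> \<in> test_functions U"
  obtains \<rho> where "0 \<le> \<rho>" "\<And>x. norm x > \<rho> \<Longrightarrow> \<phi> x = 0"
proof -
  have "bounded (closure {x. \<phi> x \<noteq> 0})"
    using assms by (intro compact_imp_bounded) (simp add: test_functions_def)
  then obtain B where B: "\<forall>x\<in>closure {x. \<phi> x \<noteq> 0}. norm x \<le> B" unfolding bounded_iff by blast
  have "\<phi> x = 0" if x: "norm x > \<bar>B\<bar>" for x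
  proof (rule ccontr)
    assume "\<phi> x \<noteq> 0"
    then have "x \<in> closure {x. \<phi> x \<noteq> 0}" using closure_subset[of "{x. \<phi> x \<noteq> 0}"] by auto
    then show False using B x by fastforce
  qed
  then show ?thesis by (intro that[of "\<bar>B\<bar>"]) auto
qed

lemma test_functions_ballI:
  "smooth \<phi> \<Longrightarrow> (\<And>x. norm x > \<rho> \<Longrightarrow> \<phi> x = 0) \<Longrightarrow> \<phi> \<in> test_functions UNIV"
  by (rule test_functionsI[of \<phi> "cball 0 \<rho>"]) auto

lemma schwartz_conv_integrable:
  assumes "a \<in> schwartz" "\<phi> \<in> schwartz"
  shows "integrable lborel (\<lambda>y. \<phi> y * a (x - y))"
proof -
  have "(\<lambda>y. a ((- 1) *\<^sub>R y + x)) \<in> schwartz" by (rule schwartz_affine[OF assms(1)]) simp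
  then have "(\<lambda>y. \<phi> y * a ((- 1) *\<^sub>R y + x)) \<in> schwartz"
    by (intro schwartz_mult schwartz_slowly_growing assms)
  from schwartz_integrable[OF this] show ?thesis by simp
qed

lemma conv_add:
  "a \<in> schwartz \<Longrightarrow> b \<in> schwartz \<Longrightarrow> \<phi> \<in> schwartz \<Longrightarrow> conv (\<lambda>z. a z + b z) \<phi> = (\<lambda>x. conv a \<phi> x + conv b \<phi> x)"
  unfolding conv_def by (auto simp: distrib_left schwartz_conv_integrable)

lemma one_plus_norm_diff_le:
  fixes x y :: "'a::real_normed_vector"
  shows "1 + norm x \<le> (1 + norm (x - y)) * (1 + norm y)"
proof -
  have "norm x \<le> norm (x - y) + norm y" using norm_triangle_ineq[of "x - y" y] by simp
  moreover have "0 \<le> norm (x - y) * norm y" by (rule mult_nonneg_nonneg) auto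
  moreover have "(1 + norm (x - y)) * (1 + norm y) = 1 + norm (x - y) + norm y + norm (x - y) * norm y"
    by (simp add: algebra_simps)
  ultimately show ?thesis by linarith
qed

section \<open>Spectral localisation and reproducing kernels\<close>

context
  fixes \<Psi> :: "real \<Rightarrow> real"
  assumes \<Psi>: "besov_cutoff \<Psi>"
begin

lemma dist_fourier_mult_eq_0:
  assumes u: "tempered u" and \<Phi>: "slowly_growing \<Phi>" and \<phi>: "\<phi> \<in> schwartz"
    and K: "closed K" "\<And>\<xi>. \<xi> \<notin> K \<Longrightarrow> \<Phi> \<xi> = 0" "K \<inter> dist_support (dist_fourier u) = {}"
  shows "u (fourier (\<lambda>\<xi>. \<Phi> \<xi> * inv_fourier \<phi> \<xi>)) = 0"
proof -
  have "dist_fourier u (\<lambda>\<xi>. \<Phi> \<xi> * inv_fourier \<phi> \<xi>) = 0"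
    by (rule dist_support_schwartz_eq_0[OF \<Psi> tempered_dist_fourier[OF u] _ K(1) _ K(3)])
      (use K(2) in \<open>auto intro!: schwartz_mult \<Phi> inv_fourier_schwartz \<phi>\<close>)
  then show ?thesis by (simp add: dist_fourier_def)
qed

lemma dist_fourier_mult_eq_self:
  assumes u: "tempered u" and m: "m \<in> schwartz" and \<phi>: "\<phi> \<in> schwartz"
    and K: "closed K" "\<And>\<xi>. \<xi> \<notin> K \<Longrightarrow> m \<xi> = 1" "K \<inter> dist_support (dist_fourier u) = {}"
    and sl: "slowly_growing (\<lambda>\<xi>. 1 - m \<xi>)"
  shows "u \<phi> = u (fourier (\<lambda>\<xi>. m \<xi> * inv_fourier \<phi> \<xi>))"
proof -
  have S: "(\<lambda>\<xi>. m \<xi> * inv_fourier \<phi> \<xi>) \<in> schwartz" "(\<lambda>\<xi>. (1 - m \<xi>) * inv_fourier \<phi> \<xi>) \<in> schwartz"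
    by (intro schwartz_mult schwartz_slowly_growing m sl inv_fourier_schwartz \<phi>)+
  have "\<phi> = fourier (\<lambda>\<xi>. m \<xi> * inv_fourier \<phi> \<xi> + (1 - m \<xi>) * inv_fourier \<phi> \<xi>)"
    using fourier_inversion[OF \<phi>] by (simp add: algebra_simps)
  also have "\<dots> = (\<lambda>x. fourier (\<lambda>\<xi>. m \<xi> * inv_fourier \<phi> \<xi>) x + fourier (\<lambda>\<xi>. (1 - m \<xi>) * inv_fourier \<phi> \<xi>) x)"
    by (rule ext, rule fourier_add) (intro schwartz_integrable S)+
  finally have "u \<phi> = u (\<lambda>x. fourier (\<lambda>\<xi>. m \<xi> * inv_fourier \<phi> \<xi>) x + fourier (\<lambda>\<xi>. (1 - m \<xi>) * inv_fourier \<phi> \<xi>) x)"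
    by simp
  also have "\<dots> = u (fourier (\<lambda>\<xi>. m \<xi> * inv_fourier \<phi> \<xi>)) + u (fourier (\<lambda>\<xi>. (1 - m \<xi>) * inv_fourier \<phi> \<xi>))"
    by (intro tempered_add u fourier_schwartz S)
  also have "u (fourier (\<lambda>\<xi>. (1 - m \<xi>) * inv_fourier \<phi> \<xi>)) = 0"
    by (rule dist_fourier_mult_eq_0[OF u sl \<phi> K(1) _ K(3)]) (simp add: K(2))
  finally show ?thesis by simp
qed

text \<open>The spectrum does not occur: all that the estimates use of it is this reproducing
  formula, which comes from a bump equal to 1 for |\<xi>| < 11/10 * R, together with polynomial
  growth.\<close>

definition band_limited :: "real \<Rightarrow> ((real^'n::finite) \<Rightarrow> complex) \<Rightarrow> bool"
  where "band_limited R g \<longleftrightarrow> poly_growth g \<and> (\<forall>y. g y = (LINT x|lborel. g x * kern (cut \<Psi> (1 / R)) (x - y)))"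

text \<open>Since both the kernel and \<phi> have compact support, local integrability of f is
  enough to exchange the integrals. For a general Schwartz kernel this is not yet available, as f
  may grow arbitrarily at infinity.\<close>

lemma represents_test_conv:
  fixes f a \<phi> :: "real^'n::finite \<Rightarrow> complex"
  assumes f: "represents f u" and a: "a \<in> test_functions UNIV" and \<phi>: "\<phi> \<in> test_functions UNIV"
  shows "u (conv a \<phi>) = (LINT y|lborel. \<phi> y * u (\<lambda>x. a (1 *\<^sub>R x + (- y))))"
    and "(\<lambda>y. u (\<lambda>x. a (1 *\<^sub>R x + (- y)))) \<in> borel_measurable borel"
proof -
  have fm [measurable]: "f \<in> borel_measurable borel" and fi: "\<And>K. compact K \<Longrightarrow> set_integrable lborel K f"
    and fu: "\<And>\<phi>. \<phi> \<in> test_functions UNIV \<Longrightarrow> u \<phi> = (LINT x|lborel. f x * \<phi> x)"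
    using f by (auto simp: represents_def)
  have aS: "a \<in> schwartz" and \<phi>S: "\<phi> \<in> schwartz" using a \<phi> by (auto intro: test_functions_schwartz)
  note [measurable] = schwartz_measurable[OF aS] schwartz_measurable[OF \<phi>S]
  obtain \<rho> where \<rho>: "0 \<le> \<rho>" "\<And>x. norm x > \<rho> \<Longrightarrow> a x = 0" by (rule test_function_ball[OF a]) blast
  obtain \<sigma> where \<sigma>: "0 \<le> \<sigma>" "\<And>x. norm x > \<sigma> \<Longrightarrow> \<phi> x = 0" by (rule test_function_ball[OF \<phi>]) blast
  have z: "\<phi> y * a (x - y) = 0" if "norm x > \<rho> + \<sigma>" for x y :: "real^'n"
  proof (cases "norm y > \<sigma>")
    case False
    then have "norm (x - y) > \<rho>" using that norm_triangle_ineq2[of x y] by linarith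
    then show ?thesis using \<rho> by simp
  qed (use \<sigma> in simp)
  have tr: "(\<lambda>x. a (1 *\<^sub>R x + (- y))) \<in> test_functions UNIV" for y
  proof (rule test_functions_ballI[of _ "\<rho> + norm y"])
    show "smooth (\<lambda>x. a (1 *\<^sub>R x + (- y)))" by (intro smooth_affine schwartzD aS)
    fix x :: "real^'n" assume "norm x > \<rho> + norm y"
    then have "norm (x - y) > \<rho>" using norm_triangle_ineq2[of x y] by linarith
    then show "a (1 *\<^sub>R x + (- y)) = 0" using \<rho> by simp
  qed
  have G: "u (\<lambda>x. a (1 *\<^sub>R x + (- y))) = (LINT x|lborel. f x * a (x - y))" for y
    using fu[OF tr, of y] by simp
  show "(\<lambda>y. u (\<lambda>x. a (1 *\<^sub>R x + (- y)))) \<in> borel_measurable borel"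
    unfolding G by measurable
  have ct: "conv a \<phi> \<in> test_functions UNIV"
    by (rule test_functions_ballI[OF schwartzD[OF conv_schwartz[OF aS \<phi>S]], of "\<rho> + \<sigma>"]) (simp add: conv_def z)
  have "u (conv a \<phi>) = (LINT x|lborel. LINT y|lborel. f x * (\<phi> y * a (x - y)))"
    unfolding fu[OF ct] conv_def by simp
  also have "\<dots> = (LINT y|lborel. LINT x|lborel. f x * (\<phi> y * a (x - y)))"
  proof (rule integral_fubini_dominated(1))
    let ?K = "cball 0 (\<rho> + \<sigma>) :: (real^'n) set"
    show "integrable lborel (\<lambda>x. norm (indicator ?K x *\<^sub>R f x))"
      using fi[of ?K] by (intro integrable_norm) (simp add: set_integrable_def)
    show "integrable lborel (\<lambda>y. schwartz_norm 0 a * norm (\<phi> y))"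
      by (intro integrable_mult_right integrable_norm schwartz_integrable \<phi>S)
    show "norm (f x * (\<phi> y * a (x - y))) \<le> norm (indicator ?K x *\<^sub>R f x) * (schwartz_norm 0 a * norm (\<phi> y))" for x y
    proof (cases "x \<in> ?K")
      case True
      have "norm (a (x - y)) \<le> schwartz_norm 0 a" using schwartz_norm_bound[OF aS, of "[]" 0] by simp
      then show ?thesis using True
        by (auto simp: norm_mult mult.commute[of "schwartz_norm 0 a"] intro!: mult_left_mono)
    next
      case False
      then show ?thesis using z[of x y] by simp
    qed
  qed measurable
  also have "\<dots> = (LINT y|lborel. \<phi> y * u (\<lambda>x. a (1 *\<^sub>R x + (- y))))"
  proof (rule Bochner_Integration.integral_cong[OF refl])
    fix y
    have "(LINT x|lborel. f x * (\<phi> y * a (x - y))) = (LINT x|lborel. \<phi> y * (f x * a (x - y)))"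
      by (simp add: mult_ac)
    then show "(LINT x|lborel. f x * (\<phi> y * a (x - y))) = \<phi> y * u (\<lambda>x. a (1 *\<^sub>R x + (- y)))"
      by (simp only: G integral_mult_right_zero)
  qed
  finally show "u (conv a \<phi>) = (LINT y|lborel. \<phi> y * u (\<lambda>x. a (1 *\<^sub>R x + (- y))))" .
qed

text \<open>Both sides are continuous on the Schwartz space, the left one because u is tempered, the
  right one because of the growth of g; the error of truncating \<phi> is of size t for each of
  them.\<close>

lemma poly_growth_extend_schwartz:
  fixes g :: "real^'n::finite \<Rightarrow> complex"
  assumes u: "tempered u" and g: "poly_growth g"
    and test: "\<And>\<phi>. \<phi> \<in> test_functions UNIV \<Longrightarrow> u \<phi> = (LINT x|lborel. g x * \<phi> x)"
    and \<phi>: "\<phi> \<in> schwartz"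
  shows "u \<phi> = (LINT x|lborel. g x * \<phi> x)"
proof -
  obtain C N where C: "0 \<le> C" "\<And>\<phi>. \<phi> \<in> schwartz \<Longrightarrow> norm (u \<phi>) \<le> C * schwartz_norm N \<phi>"
    by (rule tempered_bound[OF u]) blast
  obtain D L where D: "0 \<le> D" "\<And>y. norm (g y) \<le> D * (1 + norm y) ^ L"
    using g by (auto simp: poly_growth_def)
  let ?L = "2 * CARD('n) + L"
  have [measurable]: "g \<in> borel_measurable borel" using g by (simp add: poly_growth_def)
  obtain M where M: "\<And>t (\<phi>::real^'n \<Rightarrow> complex). 0 < t \<Longrightarrow> t \<le> 1 \<Longrightarrow> \<phi> \<in> schwartz \<Longrightarrow>
    schwartz_norm N (\<lambda>x. (1 - cut \<Psi> t x) * \<phi> x) \<le> M * t ^ 1 * schwartz_norm (N + 1) \<phi>"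
    using schwartz_norm_cut_complement[OF \<Psi>, of N 1] by blast
  obtain M' where M': "\<And>t (\<phi>::real^'n \<Rightarrow> complex). 0 < t \<Longrightarrow> t \<le> 1 \<Longrightarrow> \<phi> \<in> schwartz \<Longrightarrow>
    schwartz_norm ?L (\<lambda>x. (1 - cut \<Psi> t x) * \<phi> x) \<le> M' * t ^ 1 * schwartz_norm (?L + 1) \<phi>"
    using schwartz_norm_cut_complement[OF \<Psi>, of ?L 1] by blast
  have "u \<phi> - (LINT x|lborel. g x * \<phi> x) = 0"
  proof (rule norm_le_all_epsilon[OF \<Psi>])
    fix t :: real assume t: "0 < t" "t \<le> 1"
    let ?c = "\<lambda>x. cut \<Psi> t x * \<phi> x" and ?d = "\<lambda>x. (1 - cut \<Psi> t x) * \<phi> x"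
    have ct: "?c \<in> test_functions UNIV" by (rule cut_mult_test[OF \<Psi> schwartzD[OF \<phi>] t(1)])
    have cS: "?c \<in> schwartz" by (rule test_functions_schwartz[OF ct])
    have dS: "?d \<in> schwartz"
      by (intro schwartz_mult slowly_growing_cut_complement[OF \<Psi>] t \<phi>)
    have split: "\<phi> = (\<lambda>x. ?c x + ?d x)" by (simp add: algebra_simps)
    have "u \<phi> = u ?c + u ?d" by (subst split) (rule tempered_add[OF u cS dS])
    moreover have "(LINT x|lborel. g x * \<phi> x) = (LINT x|lborel. g x * ?c x) + (LINT x|lborel. g x * ?d x)"
      by (subst split, subst distrib_left, rule Bochner_Integration.integral_add)
        (intro poly_growth_mult_integrable g cS dS)+
    ultimately have "u \<phi> - (LINT x|lborel. g x * \<phi> x) = u ?d - (LINT x|lborel. g x * ?d x)"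
      using test[OF ct] by simp
    also have "norm \<dots> \<le> norm (u ?d) + norm (LINT x|lborel. g x * ?d x)" by (rule norm_triangle_ineq4)
    also have "norm (u ?d) \<le> C * (M * t ^ 1 * schwartz_norm (N + 1) \<phi>)"
      by (rule order_trans[OF C(2)[OF dS] mult_left_mono[OF M[OF t \<phi>] C(1)]])
    also have "norm (LINT x|lborel. g x * ?d x) \<le> (LINT x|lborel. norm (g x * ?d x))"
      by (rule integral_norm_bound)
    also have "\<dots> \<le> D * schwartz_norm ?L ?d * decay_mass TYPE('n)"
    proof (rule integrable_decay_bound(2))
      show "(\<lambda>x. g x * ?d x) \<in> borel_measurable borel" using schwartz_measurable[OF dS] by measurable
      show "norm (g x * ?d x) \<le> D * schwartz_norm ?L ?d * decay x" for x
        by (rule slow_mult_decay[OF D dS])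
    qed
    also have "\<dots> \<le> D * (M' * t ^ 1 * schwartz_norm (?L + 1) \<phi>) * decay_mass TYPE('n)"
      by (intro mult_right_mono mult_left_mono M' t \<phi> D(1) decay_mass_nonneg)
    finally show "norm (u \<phi> - (LINT x|lborel. g x * \<phi> x))
        \<le> (C * M * schwartz_norm (N + 1) \<phi> + D * M' * schwartz_norm (?L + 1) \<phi> * decay_mass TYPE('n)) * t"
      by (simp add: algebra_simps)
  qed
  then show ?thesis by simp
qed

text \<open>Since u is unchanged by convolution with the kernel k of a bump equal to 1 near the
  spectrum, the candidate is g y = u(k(. - y)). The difficulty is to move u inside the convolution
  integral. This is done through the representative f for the truncated kernel \<open>kc t\<close>,
  and the error, caused by \<open>kd t\<close>, is of size t both in u and in g.\<close>

lemma band_limited_representation: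
  fixes u :: "'n::finite functional"
  assumes u: "tempered u" and f: "represents f u" and R: "0 < R"
    and supp: "dist_support (dist_fourier u) \<subseteq> {\<xi>. norm \<xi> \<le> R}"
  obtains g where "band_limited R g" "\<And>\<phi>. \<phi> \<in> schwartz \<Longrightarrow> u \<phi> = (LINT x|lborel. g x * \<phi> x)"
proof -
  define m where "m = (cut \<Psi> (1 / R) :: real^'n \<Rightarrow> complex)"
  define k where "k = kern m"
  have mS: "m \<in> schwartz" unfolding m_def using R by (intro cut_schwartz[OF \<Psi>]) auto
  have kS: "k \<in> schwartz" unfolding k_def by (rule kern_schwartz[OF mS])
  have uk: "u \<phi> = u (conv k \<phi>)" if "\<phi> \<in> schwartz" for \<phi>
  proof -
    have "u \<phi> = u (fourier (\<lambda>\<xi>. m \<xi> * inv_fourier \<phi> \<xi>))"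
    \<comment> \<open>The bump is 1 wherever |\<xi>| < 11/10 * R; the margin 1/10 makes the closed
      set where it may differ from 1 disjoint from the spectrum.\<close>
    proof (rule dist_fourier_mult_eq_self[OF u mS that, of "{\<xi>. 11/10 * R \<le> norm \<xi>}"])
      show "closed {\<xi>::real^'n. 11/10 * R \<le> norm \<xi>}" by (intro closed_Collect_le continuous_intros)
      show "m \<xi> = 1" if "\<xi> \<notin> {\<xi>. 11/10 * R \<le> norm \<xi>}" for \<xi>
        unfolding m_def using that R by (intro cut_eq_1[OF \<Psi>]) (simp add: field_simps)
      show "{\<xi>. 11/10 * R \<le> norm \<xi>} \<inter> dist_support (dist_fourier u) = {}" using supp R by auto
      show "slowly_growing (\<lambda>\<xi>. 1 - m \<xi>)"
        unfolding m_def using R by (intro slowly_growing_cut_complement[OF \<Psi>]) auto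
    qed
    then show ?thesis by (simp add: fourier_mult_inv_fourier_conv[OF mS that] k_def)
  qed
  obtain C N where C: "0 \<le> C" "\<And>\<phi>. \<phi> \<in> schwartz \<Longrightarrow> norm (u \<phi>) \<le> C * schwartz_norm N \<phi>"
    by (rule tempered_bound[OF u]) blast
  define g where "g = (\<lambda>y. u (\<lambda>x. k (1 *\<^sub>R x + (- y))))"
  have transl: "norm (u (\<lambda>x. a (1 *\<^sub>R x + (- y)))) \<le> C * (4 ^ N * schwartz_norm N a) * (1 + norm y) ^ N"
    if a: "a \<in> schwartz" for a y
  proof -
    have aS: "(\<lambda>x. a (1 *\<^sub>R x + (- y))) \<in> schwartz" by (rule schwartz_affine[OF a]) simp
    have "norm (u (\<lambda>x. a (1 *\<^sub>R x + (- y)))) \<le> C * schwartz_norm N (\<lambda>x. a (1 *\<^sub>R x + (- y)))" by (rule C(2)[OF aS])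
    also have "\<dots> \<le> C * (((1 + 1 / \<bar>1\<bar>) * (1 + norm (- y)) * (1 + \<bar>1\<bar>)) ^ N * schwartz_norm N a)"
      by (intro mult_left_mono schwartz_norm_affine a C(1)) simp
    also have "((1 + 1 / \<bar>1\<bar>) * (1 + norm (- y)) * (1 + \<bar>1\<bar>)) ^ N = 4 ^ N * (1 + norm y) ^ N"
      by (simp add: power_mult_distrib[symmetric])
    finally show ?thesis by (simp add: mult_ac)
  qed
  have gb: "norm (g y) \<le> C * (4 ^ N * schwartz_norm N k) * (1 + norm y) ^ N" for y
    unfolding g_def by (rule transl[OF kS])
  define kc where "kc = (\<lambda>t z. cut \<Psi> t z * k z)"
  define kd where "kd = (\<lambda>t z. (1 - cut \<Psi> t z) * k z)"
  have kct: "kc t \<in> test_functions UNIV" if "0 < t" for t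
    unfolding kc_def by (rule cut_mult_test[OF \<Psi> schwartzD[OF kS] that])
  have kcS: "kc t \<in> schwartz" if "0 < t" for t by (rule test_functions_schwartz[OF kct[OF that]])
  have kdS: "kd t \<in> schwartz" if "0 < t" for t
    unfolding kd_def by (intro schwartz_mult slowly_growing_cut_complement[OF \<Psi>] that kS)
  have ksplit: "k = (\<lambda>z. kc t z + kd t z)" for t by (simp add: kc_def kd_def algebra_simps)
  define G where "G = (\<lambda>t y. u (\<lambda>x. kc t (1 *\<^sub>R x + (- y))))"
  have gG: "g y - G t y = u (\<lambda>x. kd t (1 *\<^sub>R x + (- y)))" if t: "0 < t" for t y
  proof -
    have "g y = u (\<lambda>x. kc t (1 *\<^sub>R x + (- y)) + kd t (1 *\<^sub>R x + (- y)))"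
      unfolding g_def by (subst ksplit[of t]) (rule refl)
    also have "\<dots> = G t y + u (\<lambda>x. kd t (1 *\<^sub>R x + (- y)))"
      unfolding G_def by (intro tempered_add[OF u] schwartz_affine kcS kdS t) auto
    finally show ?thesis by simp
  qed
  obtain M where M: "\<And>t (\<phi>::real^'n \<Rightarrow> complex). 0 < t \<Longrightarrow> t \<le> 1 \<Longrightarrow> \<phi> \<in> schwartz \<Longrightarrow>
    schwartz_norm N (\<lambda>x. (1 - cut \<Psi> t x) * \<phi> x) \<le> M * t ^ 1 * schwartz_norm (N + 1) \<phi>"
    using schwartz_norm_cut_complement[OF \<Psi>, of N 1] by blast
  define E where "E = C * (4 ^ N * (M * schwartz_norm (N + 1) k))"
  have gGb: "norm (g y - G t y) \<le> (E * t) * (1 + norm y) ^ N" if t: "0 < t" "t \<le> 1" for t y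
  proof -
    have "norm (g y - G t y) \<le> C * (4 ^ N * schwartz_norm N (kd t)) * (1 + norm y) ^ N"
      unfolding gG[OF t(1)] by (rule transl[OF kdS[OF t(1)]])
    also have "\<dots> \<le> C * (4 ^ N * (M * t ^ 1 * schwartz_norm (N + 1) k)) * (1 + norm y) ^ N"
      unfolding kd_def by (intro mult_right_mono mult_left_mono M t kS C(1)) auto
    finally show ?thesis by (simp add: E_def mult_ac)
  qed
  have E0: "0 \<le> E"
  proof -
    have "0 \<le> norm (g 0 - G 1 0)" by simp
    also have "\<dots> \<le> E" using gGb[of 1 0] by simp
    finally show ?thesis .
  qed
  have Gm: "G t \<in> borel_measurable borel" if "0 < t" for t
    unfolding G_def by (rule represents_test_conv(2)[OF f kct[OF that] cut_test[OF \<Psi> zero_less_one]])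
  \<comment> \<open>Measurability is not visible from the definition of g through the functional u.
    It is inherited from the functions \<open>G t\<close>, which are integrals against f, by
    pointwise convergence.\<close>
  have gm: "g \<in> borel_measurable borel"
  proof (rule borel_measurable_LIMSEQ_metric)
    let ?t = "\<lambda>i. inverse (real (Suc i))"
    show "G (?t i) \<in> borel_measurable borel" for i by (rule Gm) simp
    fix y :: "real^'n"
    have "(\<lambda>i. (E * ?t i) * (1 + norm y) ^ N) \<longlonglongrightarrow> (E * 0) * (1 + norm y) ^ N"
      by (intro tendsto_intros LIMSEQ_inverse_real_of_nat)
    then have "(\<lambda>i. (E * ?t i) * (1 + norm y) ^ N) \<longlonglongrightarrow> 0" by simp
    moreover have "norm (G (?t i) y - g y) \<le> (E * ?t i) * (1 + norm y) ^ N" for i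
      using gGb[of "?t i" y] by (simp add: norm_minus_commute inverse_le_1_iff)
    ultimately have "(\<lambda>i. G (?t i) y - g y) \<longlonglongrightarrow> 0"
      by (intro Lim_null_comparison[of "\<lambda>i. G (?t i) y - g y"] always_eventually) auto
    then show "(\<lambda>i. G (?t i) y) \<longlonglongrightarrow> g y" by (simp add: LIM_zero_iff)
  qed
  have pg: "poly_growth g"
    unfolding poly_growth_def
    by (intro conjI gm exI[of _ "C * (4 ^ N * schwartz_norm N k)"] exI[of _ N] allI gb
        mult_nonneg_nonneg C(1) schwartz_norm_nonneg kS) simp
  have test: "u \<phi> = (LINT x|lborel. g x * \<phi> x)" if \<phi>: "\<phi> \<in> test_functions UNIV" for \<phi>
  proof -
    have \<phi>S: "\<phi> \<in> schwartz" by (rule test_functions_schwartz[OF \<phi>])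
    note [measurable] = schwartz_measurable[OF \<phi>S] gm
    obtain T where T: "schwartz_op T" "\<And>a. a \<in> schwartz \<Longrightarrow> conv a \<phi> = T a"
      by (rule conv_schwartz_op[OF \<phi>S]) blast
    obtain C' L where C': "0 \<le> C'" "\<And>\<phi>. \<phi> \<in> schwartz \<Longrightarrow> schwartz_norm N (T \<phi>) \<le> C' * schwartz_norm L \<phi>"
      using T(1) unfolding schwartz_op_def by blast
    obtain M' where M': "\<And>t (\<phi>::real^'n \<Rightarrow> complex). 0 < t \<Longrightarrow> t \<le> 1 \<Longrightarrow> \<phi> \<in> schwartz \<Longrightarrow>
      schwartz_norm L (\<lambda>x. (1 - cut \<Psi> t x) * \<phi> x) \<le> M' * t ^ 1 * schwartz_norm (L + 1) \<phi>"
      using schwartz_norm_cut_complement[OF \<Psi>, of L 1] by blast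
    have "u \<phi> - (LINT x|lborel. g x * \<phi> x) = 0"
    proof (rule norm_le_all_epsilon[OF \<Psi>])
      fix t :: real assume t: "0 < t" "t \<le> 1"
      note [measurable] = Gm[OF t(1)]
      let ?h = "\<lambda>x. g x - G t x"
      have Et: "0 \<le> E * t" using E0 t by simp
      have hg: "poly_growth ?h"
        unfolding poly_growth_def
        by (intro conjI exI[of _ "E * t"] exI[of _ N] allI gGb t Et) measurable
      have "u \<phi> = u (conv k \<phi>)" by (rule uk[OF \<phi>S])
      also have "conv k \<phi> = (\<lambda>x. conv (kc t) \<phi> x + conv (kd t) \<phi> x)"
        by (subst ksplit[of t]) (rule conv_add[OF kcS[OF t(1)] kdS[OF t(1)] \<phi>S])
      also have "u \<dots> = u (conv (kc t) \<phi>) + u (conv (kd t) \<phi>)"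
        by (intro tempered_add u conv_schwartz kcS kdS t \<phi>S)
      also have "u (conv (kc t) \<phi>) = (LINT y|lborel. \<phi> y * G t y)"
        unfolding G_def by (rule represents_test_conv(1)[OF f kct[OF t(1)] \<phi>])
      also have "\<dots> = (LINT y|lborel. g y * \<phi> y - ?h y * \<phi> y)"
        by (simp add: algebra_simps)
      also have "\<dots> = (LINT y|lborel. g y * \<phi> y) - (LINT y|lborel. ?h y * \<phi> y)"
        by (intro Bochner_Integration.integral_diff poly_growth_mult_integrable pg hg \<phi>S)
      finally have "u \<phi> - (LINT x|lborel. g x * \<phi> x) = u (conv (kd t) \<phi>) - (LINT y|lborel. ?h y * \<phi> y)"
        by simp
      also have "norm \<dots> \<le> norm (u (conv (kd t) \<phi>)) + norm (LINT y|lborel. ?h y * \<phi> y)"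
        by (rule norm_triangle_ineq4)
      also have "norm (u (conv (kd t) \<phi>)) \<le> C * (C' * (M' * t ^ 1 * schwartz_norm (L + 1) k))"
      proof -
        have "norm (u (conv (kd t) \<phi>)) \<le> C * schwartz_norm N (conv (kd t) \<phi>)"
          by (intro C(2) conv_schwartz kdS t \<phi>S)
        also have "schwartz_norm N (conv (kd t) \<phi>) \<le> C' * schwartz_norm L (kd t)"
          unfolding T(2)[OF kdS[OF t(1)]] by (rule C'(2)[OF kdS[OF t(1)]])
        also have "schwartz_norm L (kd t) \<le> M' * t ^ 1 * schwartz_norm (L + 1) k"
          unfolding kd_def by (rule M'[OF t kS])
        finally show ?thesis using C(1) C'(1) by (simp add: mult_left_mono)
      qed
      also have "norm (LINT y|lborel. ?h y * \<phi> y) \<le> (LINT y|lborel. norm (?h y * \<phi> y))"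
        by (rule integral_norm_bound)
      also have "\<dots> \<le> (E * t) * schwartz_norm (2 * CARD('n) + N) \<phi> * decay_mass TYPE('n)"
        by (rule integrable_decay_bound(2)[OF _ slow_mult_decay[OF Et gGb[OF t] \<phi>S]]) measurable
      finally show "norm (u \<phi> - (LINT x|lborel. g x * \<phi> x))
          \<le> (C * C' * M' * schwartz_norm (L + 1) k + E * schwartz_norm (2 * CARD('n) + N) \<phi> * decay_mass TYPE('n)) * t"
        by (simp add: algebra_simps)
    qed
    then show ?thesis by simp
  qed
  have all: "u \<phi> = (LINT x|lborel. g x * \<phi> x)" if "\<phi> \<in> schwartz" for \<phi>
    by (rule poly_growth_extend_schwartz[OF u pg test that])
  have "g y = (LINT x|lborel. g x * kern (cut \<Psi> (1 / R)) (x - y))" for y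
  proof -
    have "g y = (LINT x|lborel. g x * k (1 *\<^sub>R x + (- y)))"
      unfolding g_def using all[OF schwartz_affine[OF kS, of 1 "- y"]] by (simp add: g_def)
    then show ?thesis by (simp add: k_def m_def)
  qed
  then have "band_limited R g" using pg unfolding band_limited_def by blast
  then show ?thesis using all that by blast
qed

text \<open>The inequality 1 + |x| <= (1 + |x - y|)(1 + |y|) transfers the decay of the kernel from
  x - y to x at the price of polynomial growth in y. This bounds the new function, and it also
  dominates the double integral, because \<phi> absorbs the growth in y.\<close>

lemma fourier_multiplier_representation:
  fixes g :: "real^'n::finite \<Rightarrow> complex"
  assumes g: "poly_growth g" and u: "\<And>\<phi>. \<phi> \<in> schwartz \<Longrightarrow> u \<phi> = (LINT x|lborel. g x * \<phi> x)"
    and \<Phi>: "\<Phi> \<in> schwartz"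
  shows "poly_growth (\<lambda>y. LINT x|lborel. g x * kern \<Phi> (x - y))" (is ?P)
    and "\<phi> \<in> schwartz \<Longrightarrow> u (fourier (\<lambda>\<xi>. \<Phi> \<xi> * inv_fourier \<phi> \<xi>))
      = (LINT y|lborel. (LINT x|lborel. g x * kern \<Phi> (x - y)) * \<phi> y)"
proof -
  let ?k = "kern \<Phi>"
  have kS: "?k \<in> schwartz" by (rule kern_schwartz[OF \<Phi>])
  obtain C N where C: "0 \<le> C" "\<And>y. norm (g y) \<le> C * (1 + norm y) ^ N"
    using g by (auto simp: poly_growth_def)
  have [measurable]: "g \<in> borel_measurable borel" using g by (simp add: poly_growth_def)
  note [measurable] = schwartz_measurable[OF kS]
  let ?L = "2 * CARD('n) + N"
  let ?D = "C * schwartz_norm ?L ?k"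
  have D: "0 \<le> ?D" using C(1) schwartz_norm_nonneg[OF kS] by simp
  have le: "norm (g x * ?k (x - y)) \<le> ?D * (1 + norm y) ^ ?L * decay x" for x y
  proof -
    have p: "0 < (1 + norm z) ^ k" for z :: "real^'n" and k by (simp add: add_pos_nonneg)
    have "norm (g x * ?k (x - y)) \<le> (C * (1 + norm x) ^ N) * (schwartz_norm ?L ?k / (1 + norm (x - y)) ^ ?L)"
      unfolding norm_mult using schwartz_norm_bound[OF kS, of "[]"] C by (intro mult_mono) auto
    also have "1 / (1 + norm (x - y)) ^ ?L \<le> (1 + norm y) ^ ?L / (1 + norm x) ^ ?L"
    proof -
      have "(1 + norm x) ^ ?L \<le> ((1 + norm (x - y)) * (1 + norm y)) ^ ?L"
        by (intro power_mono one_plus_norm_diff_le) auto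
      also have "\<dots> = (1 + norm (x - y)) ^ ?L * (1 + norm y) ^ ?L" by (rule power_mult_distrib)
      finally show ?thesis using p[of x ?L] p[of "x - y" ?L] by (simp add: divide_simps mult.commute)
    qed
    then have "(C * (1 + norm x) ^ N) * (schwartz_norm ?L ?k / (1 + norm (x - y)) ^ ?L)
        \<le> (C * (1 + norm x) ^ N) * (schwartz_norm ?L ?k * ((1 + norm y) ^ ?L / (1 + norm x) ^ ?L))"
      using schwartz_norm_nonneg[OF kS, of ?L] C(1)
      by (intro mult_left_mono) (auto simp: divide_inverse dest: mult_left_mono)
    also have "\<dots> = ?D * (1 + norm y) ^ ?L * decay x"
      using p[of x N] p[of x 1] by (simp add: decay_def power_add)
    finally show ?thesis .
  qed
  have ii: "integrable lborel (\<lambda>x. g x * ?k (x - y))" for y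
    by (rule integrable_decay_bound(1)[OF _ le[of _ y]]) measurable
  have bd: "norm (LINT x|lborel. g x * ?k (x - y)) \<le> (?D * decay_mass TYPE('n)) * (1 + norm y) ^ ?L" for y
  proof -
    have "norm (LINT x|lborel. g x * ?k (x - y)) \<le> (LINT x|lborel. norm (g x * ?k (x - y)))"
      by (rule integral_norm_bound)
    also have "\<dots> \<le> ?D * (1 + norm y) ^ ?L * decay_mass TYPE('n)"
      by (rule integrable_decay_bound(2)[OF _ le[of _ y]]) measurable
    finally show ?thesis by (simp add: mult_ac)
  qed
  have "0 \<le> ?D * decay_mass TYPE('n)" by (intro mult_nonneg_nonneg[OF D] decay_mass_nonneg)
  moreover have "(\<lambda>y. LINT x|lborel. g x * ?k (x - y)) \<in> borel_measurable borel" by measurable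
  ultimately show ?P unfolding poly_growth_def using bd by blast
  show "u (fourier (\<lambda>\<xi>. \<Phi> \<xi> * inv_fourier \<phi> \<xi>)) = (LINT y|lborel. (LINT x|lborel. g x * ?k (x - y)) * \<phi> y)"
    if \<phi>: "\<phi> \<in> schwartz"
  proof -
    note [measurable] = schwartz_measurable[OF \<phi>]
    have "norm (complex_of_real ((1 + norm y) ^ ?L)) \<le> 1 * (1 + norm y) ^ ?L" for y :: "real^'n"
      unfolding norm_of_real by simp
    moreover have "(\<lambda>y::real^'n. complex_of_real ((1 + norm y) ^ ?L)) \<in> borel_measurable borel" by measurable
    ultimately have "poly_growth (\<lambda>y::real^'n. complex_of_real ((1 + norm y) ^ ?L))"
      unfolding poly_growth_def using zero_le_one by blast
    from poly_growth_mult_integrable[OF this \<phi>]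
    have b: "integrable lborel (\<lambda>y. ?D * norm (complex_of_real ((1 + norm y) ^ ?L) * \<phi> y))"
      by (intro integrable_mult_right integrable_norm)
    have "u (fourier (\<lambda>\<xi>. \<Phi> \<xi> * inv_fourier \<phi> \<xi>)) = (LINT x|lborel. LINT y|lborel. g x * (\<phi> y * ?k (x - y)))"
      unfolding fourier_mult_inv_fourier_conv[OF \<Phi> \<phi>] u[OF conv_schwartz[OF kS \<phi>]] by (simp add: conv_def)
    also have "\<dots> = (LINT y|lborel. LINT x|lborel. g x * (\<phi> y * ?k (x - y)))"
    proof (rule integral_fubini_dominated(1)[OF _ integrable_decay b])
      show "(\<lambda>(x, y). g x * (\<phi> y * ?k (x - y))) \<in> borel_measurable (borel \<Otimes>\<^sub>M borel)" by measurable
      fix x y :: "real^'n"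
      have "norm (g x * (\<phi> y * ?k (x - y))) = norm (g x * ?k (x - y)) * norm (\<phi> y)"
        by (simp add: norm_mult)
      also have "\<dots> \<le> (?D * (1 + norm y) ^ ?L * decay x) * norm (\<phi> y)" by (intro mult_right_mono le) simp
      also have "\<dots> = decay x * (?D * norm (complex_of_real ((1 + norm y) ^ ?L) * \<phi> y))"
        unfolding norm_mult norm_of_real by simp
      finally show "norm (g x * (\<phi> y * ?k (x - y))) \<le> decay x * (?D * norm (complex_of_real ((1 + norm y) ^ ?L) * \<phi> y))" .
    qed
    also have "\<dots> = (LINT y|lborel. (LINT x|lborel. g x * ?k (x - y)) * \<phi> y)"
    proof (rule Bochner_Integration.integral_cong[OF refl])
      fix y
      have "(LINT x|lborel. g x * (\<phi> y * ?k (x - y))) = (LINT x|lborel. (g x * ?k (x - y)) * \<phi> y)"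
        by (simp add: mult_ac)
      then show "(LINT x|lborel. g x * (\<phi> y * ?k (x - y))) = (LINT x|lborel. g x * ?k (x - y)) * \<phi> y"
        by (simp only: integral_mult_left_zero)
    qed
    finally show ?thesis .
  qed
qed

end

section \<open>Estimates for band-limited functions\<close>

definition wt :: "real \<Rightarrow> nat \<Rightarrow> real^'n::finite \<Rightarrow> real"
  where "wt t M z = 1 / (1 + t * norm z) ^ M"

lemma wt_pos: "0 < t \<Longrightarrow> 0 < wt t M z"
  by (simp add: wt_def add_pos_nonneg)

lemma wt_nonneg: "0 < t \<Longrightarrow> 0 \<le> wt t M z"
  by (rule less_imp_le[OF wt_pos])

lemma wt_le_1: "0 < t \<Longrightarrow> wt t M z \<le> 1"
  by (simp add: wt_def divide_le_eq_1 add_pos_nonneg)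

lemma wt_measurable [measurable]: "wt t M \<in> borel_measurable borel"
  unfolding wt_def by measurable

lemma wt_commute: "wt t M (x - y) = wt t M (y - x)"
  by (simp add: wt_def norm_minus_commute)

text \<open>The factor 1 + \<tau>|x - y| is at most (1 + \<tau>|x - z|)(1 + R|z - y|) since \<tau>
  <= R. This is where it matters that the multiplier lives at a frequency \<tau> not above the band
  R of the function.\<close>

lemma wt_submult:
  assumes "0 < \<tau>" "\<tau> \<le> R"
  shows "wt R M (z - y) * wt \<tau> M (x - z) \<le> wt \<tau> M (x - y)"
proof -
  let ?a = "1 + \<tau> * norm (x - y)" and ?b = "1 + \<tau> * norm (x - z)" and ?c = "1 + R * norm (z - y)"
  have p: "0 < ?a" "0 < ?b" "0 < ?c" using assms by (auto intro!: add_pos_nonneg)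
  have "\<tau> * norm (x - y) \<le> \<tau> * (norm (x - z) + norm (z - y))"
    using assms norm_triangle_ineq[of "x - z" "z - y"] by (intro mult_left_mono) auto
  moreover have "\<tau> * norm (z - y) \<le> R * norm (z - y)" using assms by (intro mult_right_mono) auto
  moreover have "0 \<le> (\<tau> * norm (x - z)) * (R * norm (z - y))" using assms by (intro mult_nonneg_nonneg) auto
  moreover have "?b * ?c = 1 + \<tau> * norm (x - z) + R * norm (z - y) + (\<tau> * norm (x - z)) * (R * norm (z - y))"
    by (simp add: algebra_simps)
  ultimately have "?a \<le> ?b * ?c" by (simp only: distrib_left)
  then have "?a ^ M \<le> ?b ^ M * ?c ^ M" using p by (subst power_mult_distrib[symmetric]) (intro power_mono, auto)
  then have "1 / (?b ^ M * ?c ^ M) \<le> 1 / ?a ^ M" using p by (intro divide_left_mono) auto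
  then show ?thesis by (simp add: wt_def mult.commute)
qed

lemma nn_integral_wt:
  fixes x :: "real^'n::finite"
  assumes t: "0 < t"
  shows "(\<integral>\<^sup>+ y. ennreal (wt t (2 * CARD('n)) (x - y)) \<partial>lborel) = ennreal ((1 / t) ^ CARD('n) * decay_mass TYPE('n))"
proof -
  have "(\<integral>\<^sup>+ y. ennreal (wt t (2 * CARD('n)) (x - y)) \<partial>lborel)
      = ennreal (\<bar>1 / t\<bar> ^ CARD('n)) * (\<integral>\<^sup>+ z. ennreal (wt t (2 * CARD('n)) (x - (x + (1 / t) *\<^sub>R z))) \<partial>lborel)"
    using t by (intro nn_integral_affine) auto
  also have "(\<lambda>z::real^'n. ennreal (wt t (2 * CARD('n)) (x - (x + (1 / t) *\<^sub>R z)))) = (\<lambda>z. ennreal (decay z))"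
    using t by (simp add: wt_def decay_def)
  finally show ?thesis using t decay_mass_nonneg[where 'n='n] by (simp add: nn_integral_decay ennreal_mult)
qed

text \<open>A weight exponent M with M p >= 2n leaves, after taking the power p, the integrable
  exponent 2n of \<open>decay\<close>.\<close>

lemma epowr_wt_le:
  fixes z :: "real^'n::finite"
  assumes "0 < t" "0 < p" "2 * real CARD('n) \<le> real M * p"
  shows "epowr (ennreal (wt t M z)) p \<le> ennreal (wt t (2 * CARD('n)) z)"
proof -
  have b: "1 \<le> 1 + t * norm z" "0 < 1 + t * norm z" using assms by (auto intro: add_pos_nonneg)
  have "wt t M z powr p = 1 / (1 + t * norm z) powr (real M * p)"
    using b by (simp add: wt_def powr_divide powr_powr flip: powr_realpow)
  also have "\<dots> \<le> 1 / (1 + t * norm z) powr real (2 * CARD('n))"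
    using assms b by (intro divide_left_mono powr_mono mult_pos_pos) (auto simp: powr_gt_zero)
  also have "\<dots> = wt t (2 * CARD('n)) z"
    using b by (simp only: wt_def) (subst powr_realpow, auto)
  finally show ?thesis using wt_pos[OF assms(1), of M z] by (simp add: epowr_ennreal ennreal_leI less_imp_le)
qed

lemma kern_scale_bound:
  fixes z :: "real^'n::finite"
  assumes \<Phi>: "\<Phi> \<in> schwartz" and t: "0 < t"
  shows "norm (kern (\<lambda>\<xi>. \<Phi> ((1 / t) *\<^sub>R \<xi>)) z) \<le> (schwartz_norm M (kern \<Phi>) * t ^ CARD('n)) * wt t M z"
proof -
  have "norm (kern (\<lambda>\<xi>. \<Phi> ((1 / t) *\<^sub>R \<xi>)) z) = t ^ CARD('n) * norm (kern \<Phi> (t *\<^sub>R z))"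
    using t by (simp add: kern_scale[OF \<Phi>] norm_mult norm_power)
  also have "norm (kern \<Phi> (t *\<^sub>R z)) \<le> schwartz_norm M (kern \<Phi>) * wt t M z"
    using schwartz_norm_bound[OF kern_schwartz[OF \<Phi>], of "[]" M "t *\<^sub>R z"] t by (simp add: wt_def)
  finally show ?thesis using t by (simp add: mult_ac)
qed

lemma ennreal_norm_integral_le:
  fixes g k :: "real^'n::finite \<Rightarrow> complex"
  assumes "\<And>x. norm (k x) \<le> c * w x" "0 \<le> c" "\<And>x. 0 \<le> w x" "w \<in> borel_measurable borel" "g \<in> borel_measurable borel"
  shows "ennreal (norm (LINT x|lborel. g x * k x)) \<le> ennreal c * (\<integral>\<^sup>+ x. ennreal (norm (g x) * w x) \<partial>lborel)"
proof (cases "integrable lborel (\<lambda>x. g x * k x)")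
  case True
  note [measurable] = assms(4,5)
  have "ennreal (norm (LINT x|lborel. g x * k x)) \<le> (\<integral>\<^sup>+ x. ennreal (norm (g x * k x)) \<partial>lborel)"
    by (rule integral_norm_bound_ennreal[OF True])
  also have "\<dots> \<le> (\<integral>\<^sup>+ x. ennreal c * ennreal (norm (g x) * w x) \<partial>lborel)"
  proof (rule nn_integral_mono)
    fix x
    have "norm (g x * k x) \<le> norm (g x) * (c * w x)" unfolding norm_mult by (intro mult_left_mono assms) auto
    then show "ennreal (norm (g x * k x)) \<le> ennreal c * ennreal (norm (g x) * w x)"
      using assms by (subst ennreal_mult[symmetric]) (auto intro!: ennreal_leI simp: mult_ac)
  qed
  also have "\<dots> = ennreal c * (\<integral>\<^sup>+ x. ennreal (norm (g x) * w x) \<partial>lborel)"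
    by (rule nn_integral_cmult) measurable
  finally show ?thesis .
\<comment> \<open>The Bochner integral of a non-integrable function is 0, so the bound also holds
  without integrability.\<close>
qed (simp add: not_integrable_integral_eq)

text \<open>The supremum of \<open>a z * wt \<tau> M (x - z)\<close> over \<open>z\<close>, a Peetre maximal function, reproduces
  itself through the hypothesis \<open>H\<close>; its finiteness is what allows the power \<open>1 - p\<close> of it to be
  cancelled.\<close>

lemma peetre_inequality:
  fixes a :: "real^'n::finite \<Rightarrow> real"
  assumes a: "\<And>z. 0 \<le> a z" and [measurable]: "a \<in> borel_measurable borel"
    and p: "0 < p" "p \<le> 1" and \<tau>: "0 < \<tau>" "\<tau> \<le> R" and K: "0 < K"
    and H: "\<And>z. ennreal (a z) \<le> ennreal K * (\<integral>\<^sup>+ y. ennreal (a y * wt R M (z - y)) \<partial>lborel)"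
    and bdd: "\<And>z. a z * wt \<tau> M (x - z) \<le> B"
  defines "I \<equiv> (\<integral>\<^sup>+ y. epowr (ennreal (a y * wt \<tau> M (x - y))) p \<partial>lborel)"
  shows "epowr (ennreal (a z * wt \<tau> M (x - z))) p \<le> ennreal K * I"
    and "epowr (\<integral>\<^sup>+ y. ennreal (a y * wt \<tau> M (x - y)) \<partial>lborel) p \<le> epowr (ennreal K) (1 - p) * I"
proof -
  define v where "v = (\<lambda>z. a z * wt \<tau> M (x - z))"
  have [measurable]: "v \<in> borel_measurable borel" unfolding v_def by measurable
  define f where "f = (SUP z. v z)"
  define J where "J = (\<integral>\<^sup>+ y. ennreal (v y) \<partial>lborel)"
  have v0: "0 \<le> v z" for z unfolding v_def by (intro mult_nonneg_nonneg a wt_nonneg \<tau>)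
  have bd: "bdd_above (range v)" using bdd by (auto simp: v_def intro!: bdd_aboveI[of _ B])
  have vf: "v z \<le> f" for z unfolding f_def by (rule cSUP_upper[OF _ bd]) simp
  have f0: "0 \<le> f" using v0[of 0] vf[of 0] by linarith
  \<comment> \<open>The power 1 - p of v is replaced by its supremum f and the power p is left in
    the integral.\<close>
  have JI: "J \<le> ennreal (f powr (1 - p)) * I"
  proof -
    have "J \<le> (\<integral>\<^sup>+ y. ennreal (f powr (1 - p)) * epowr (ennreal (v y)) p \<partial>lborel)"
      unfolding J_def
    proof (rule nn_integral_mono)
      fix y
      have "v y = v y powr (1 - p) * v y powr p"
        using v0[of y] by (cases "v y = 0") (simp_all flip: powr_add)
      also have "\<dots> \<le> f powr (1 - p) * v y powr p"
        using p v0[of y] vf[of y] by (intro mult_right_mono powr_mono2) auto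
      finally show "ennreal (v y) \<le> ennreal (f powr (1 - p)) * epowr (ennreal (v y)) p"
        using v0[of y] by (simp add: epowr_ennreal ennreal_leI flip: ennreal_mult)
    qed
    also have "\<dots> = ennreal (f powr (1 - p)) * I"
    proof -
      have "I = (\<integral>\<^sup>+ y. epowr (ennreal (v y)) p \<partial>lborel)" by (simp add: I_def v_def)
      then show ?thesis by (simp add: nn_integral_cmult)
    qed
    finally show ?thesis .
  qed
  \<comment> \<open>The hypothesis \<open>H\<close> is multiplied by the weight at x - z; by
    \<open>wt_submult\<close> the product of the two weights becomes the weight at x - y, so the
    right-hand side no longer depends on z.\<close>
  have fJ: "ennreal f \<le> ennreal K * J"
  proof -
    have "ennreal (v z) \<le> ennreal K * J" for z
    proof -
      have "ennreal (v z) = ennreal (a z) * ennreal (wt \<tau> M (x - z))"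
        unfolding v_def using a[of z] by (rule ennreal_mult') 
      also have "\<dots> \<le> (ennreal K * (\<integral>\<^sup>+ y. ennreal (a y * wt R M (z - y)) \<partial>lborel)) * ennreal (wt \<tau> M (x - z))"
        by (intro mult_right_mono H) auto
      also have "\<dots> = ennreal K * (\<integral>\<^sup>+ y. ennreal (a y * wt R M (z - y)) * ennreal (wt \<tau> M (x - z)) \<partial>lborel)"
        by (subst nn_integral_multc) (auto simp: mult.assoc)
      also have "\<dots> \<le> ennreal K * J"
        unfolding J_def
      proof (intro mult_left_mono nn_integral_mono)
        fix y
        have "a y * wt R M (z - y) * wt \<tau> M (x - z) \<le> v y"
          unfolding v_def mult.assoc by (intro mult_left_mono wt_submult \<tau> a)
        moreover have "0 \<le> a y * wt R M (z - y)" using a[of y] wt_pos[of R M "z - y"] \<tau> by simp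
        ultimately show "ennreal (a y * wt R M (z - y)) * ennreal (wt \<tau> M (x - z)) \<le> ennreal (v y)"
          by (subst ennreal_mult'[symmetric]) (auto intro: ennreal_leI)
      qed simp
      finally show ?thesis .
    qed
    note le = this
    show ?thesis
    proof (cases "ennreal K * J")
      case (real c)
      have "v z \<le> c" for z using le[of z] real by simp
      then have "f \<le> c" unfolding f_def by (intro cSUP_least) auto
      then show ?thesis using real by (simp add: ennreal_leI)
    qed simp
  qed
  \<comment> \<open>The two bounds give f <= K f^(1-p) I; the factor f^(1-p) is positive and finite,
    hence can be cancelled.\<close>
  have fp: "ennreal (f powr p) \<le> ennreal K * I"
  proof (cases "f = 0")
    case False
    then have f: "0 < f" using f0 by simp
    have "ennreal (f powr (1 - p)) * ennreal (f powr p) = ennreal f"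
      using f by (simp flip: ennreal_mult powr_add)
    also have "\<dots> \<le> ennreal K * (ennreal (f powr (1 - p)) * I)"
      by (rule order_trans[OF fJ mult_left_mono[OF JI]]) simp
    also have "\<dots> = ennreal (f powr (1 - p)) * (ennreal K * I)" by (simp add: mult_ac)
    finally show ?thesis using f by (subst (asm) ennreal_mult_le_mult_iff) auto
  qed simp
  have "epowr (ennreal (v z)) p \<le> ennreal (f powr p)"
    using vf[of z] v0[of z] p by (simp add: epowr_ennreal ennreal_leI powr_mono2)
  then show "epowr (ennreal (a z * wt \<tau> M (x - z))) p \<le> ennreal K * I"
    using fp unfolding v_def by (rule order_trans)
  \<comment> \<open>The bound on f^p just obtained is put back into J <= f^(1-p) I, raised to the
    power p.\<close>
  have "epowr J p \<le> epowr (ennreal (f powr (1 - p)) * I) p"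
    using p by (intro epowr_mono JI) auto
  also have "\<dots> = epowr (ennreal (f powr p)) (1 - p) * epowr I p"
    using f0 by (simp add: epowr_mult epowr_ennreal powr_powr mult.commute)
  also have "\<dots> \<le> epowr (ennreal K * I) (1 - p) * epowr I p"
    using p by (intro mult_right_mono epowr_mono fp) auto
  also have "\<dots> = epowr (ennreal K) (1 - p) * (epowr I (1 - p) * epowr I p)"
    by (simp add: epowr_mult mult.assoc)
  also have "epowr I (1 - p) * epowr I p = I" by (simp flip: epowr_add)
  finally show "epowr (\<integral>\<^sup>+ y. ennreal (a y * wt \<tau> M (x - y)) \<partial>lborel) p \<le> epowr (ennreal K) (1 - p) * I"
    unfolding J_def v_def .
qed

lemma recip_ennreal: "0 < r \<Longrightarrow> recip (ennreal r) = 1 / r"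
  by (simp add: recip_def divide_ennreal_def inverse_ennreal inverse_eq_divide)

lemma recip_top: "recip top = 0"
  by (simp add: recip_def)

section \<open>Boundedness, the Nikolskii inequality and multipliers for band-limited
  functions\<close>

context
  fixes \<Psi> :: "real \<Rightarrow> real"
  assumes \<Psi>: "besov_cutoff \<Psi>"
begin

definition band_const :: "'n::finite itself \<Rightarrow> nat \<Rightarrow> real"
  where "band_const _ M = schwartz_norm M (kern (cut \<Psi> 1) :: real^'n \<Rightarrow> complex) + 1"

lemma cut1_schwartz: "cut \<Psi> 1 \<in> schwartz"
  by (rule cut_schwartz[OF \<Psi>]) simp

lemma band_const_pos: "0 < band_const TYPE('n::finite) M"
  unfolding band_const_def
  using schwartz_norm_nonneg[OF kern_schwartz[OF cut1_schwartz], of M] by (rule add_nonneg_pos) simp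

lemma band_limited_poly_growth: "band_limited \<Psi> R g \<Longrightarrow> poly_growth g"
  unfolding band_limited_def[OF \<Psi>] by blast

lemma band_limited_reproduce:
  "band_limited \<Psi> R g \<Longrightarrow> (LINT x|lborel. g x * kern (cut \<Psi> (1 / R)) (x - y)) = g y"
  unfolding band_limited_def[OF \<Psi>] by metis

lemma band_limited_measurable: "band_limited \<Psi> R g \<Longrightarrow> g \<in> borel_measurable borel"
  using band_limited_poly_growth[of R g] by (simp add: poly_growth_def)

text \<open>The reproducing kernel for radius R is a dilate of the one for radius 1; dilation
  produces R^n and the weight at scale 1 / R. The result is the hypothesis \<open>H\<close> of
  \<open>peetre_inequality\<close>, available for every M.\<close>

lemma band_limited_bound:
  fixes g :: "real^'n::finite \<Rightarrow> complex"
  assumes g: "band_limited \<Psi> R g" and R: "0 < R"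
  shows "ennreal (norm (g z)) \<le> ennreal (band_const TYPE('n) M * R ^ CARD('n)) * (\<integral>\<^sup>+ y. ennreal (norm (g y) * wt R M (z - y)) \<partial>lborel)"
proof -
  have c: "cut \<Psi> (1 / R) = (\<lambda>\<xi>. cut \<Psi> 1 ((1 / R) *\<^sub>R \<xi>) :: complex)" for \<xi> :: "real^'n"
    using R by (auto simp: cut_def)
  have [measurable]: "g \<in> borel_measurable borel" by (rule band_limited_measurable[OF g])
  have "norm (kern (cut \<Psi> (1 / R)) (x - z)) \<le> (band_const TYPE('n) M * R ^ CARD('n)) * wt R M (z - x)" for x :: "real^'n"
  proof -
    have "norm (kern (cut \<Psi> (1 / R)) (x - z)) \<le> (schwartz_norm M (kern (cut \<Psi> 1) :: real^'n \<Rightarrow> complex) * R ^ CARD('n)) * wt R M (x - z)"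
      unfolding c by (rule kern_scale_bound[OF cut1_schwartz R])
    also have "\<dots> \<le> (band_const TYPE('n) M * R ^ CARD('n)) * wt R M (x - z)"
      using R wt_pos[OF R, of M "x - z"] by (intro mult_right_mono) (auto simp: band_const_def)
    finally show ?thesis by (simp add: wt_commute)
  qed
  then have "ennreal (norm (LINT x|lborel. g x * kern (cut \<Psi> (1 / R)) (x - z)))
      \<le> ennreal (band_const TYPE('n) M * R ^ CARD('n)) * (\<integral>\<^sup>+ y. ennreal (norm (g y) * wt R M (z - y)) \<partial>lborel)"
    using band_const_pos[of M, where 'n='n] R wt_nonneg[OF R, of M]
    by (intro ennreal_norm_integral_le band_limited_measurable[OF g]) auto
  also have "(LINT x|lborel. g x * kern (cut \<Psi> (1 / R)) (x - z)) = g z"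
    by (rule band_limited_reproduce[OF g])
  finally show ?thesis .
qed

text \<open>The weight exponent is the degree N of polynomial growth of g, so that the weighted
  supremum is finite; at z = x the weight is 1 and the maximal inequality bounds |g x|. The bound
  depends on N, hence on g. It serves only to justify finiteness in the later applications with
  other exponents M.\<close>

lemma band_limited_bounded:
  fixes g :: "real^'n::finite \<Rightarrow> complex"
  assumes g: "band_limited \<Psi> R g" and R: "0 < R" and p: "0 < p" "p \<le> 1"
    and fin: "(\<integral>\<^sup>+ x. epowr (ennreal (norm (g x))) p \<partial>lborel) < top"
  obtains A where "\<And>x. norm (g x) \<le> A"
proof -
  obtain C N where C: "0 \<le> C" "\<And>y. norm (g y) \<le> C * (1 + norm y) ^ N"
    using band_limited_poly_growth[OF g] by (auto simp: poly_growth_def)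
  have [measurable]: "g \<in> borel_measurable borel" by (rule band_limited_measurable[OF g])
  let ?Q = "\<integral>\<^sup>+ x. epowr (ennreal (norm (g x))) p \<partial>lborel"
  define K where "K = band_const TYPE('n) N * R ^ CARD('n)"
  have K: "0 < K" using band_const_pos[of N, where 'n='n] R by (simp add: K_def)
  have "epowr (ennreal (norm (g x))) p \<le> ennreal K * ?Q" for x
  proof -
    \<comment> \<open>This factor compares 1 + |x - z| with the dilated 1 + R|x - z|, also when R <
      1.\<close>
    define s where "s = max 1 (1 / R)"
    have bd: "norm (g z) * wt R N (x - z) \<le> C * (s * (1 + norm x)) ^ N" for z
    proof -
      have "1 + norm z \<le> (1 + norm (z - x)) * (1 + norm x)" by (rule one_plus_norm_diff_le)
      also have "1 + norm (z - x) \<le> s * (1 + R * norm (x - z))"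
      proof -
        have "1 \<le> s" "norm (x - z) \<le> s * (R * norm (x - z))"
          using R mult_right_mono[of "1 / R" s "R * norm (x - z)"] by (auto simp: s_def)
        then show ?thesis by (simp add: distrib_left norm_minus_commute)
      qed
      finally have le: "1 + norm z \<le> s * (1 + R * norm (x - z)) * (1 + norm x)"
        by (simp add: mult_right_mono)
      have "norm (g z) \<le> C * (1 + norm z) ^ N" by (rule C)
      also have "\<dots> \<le> C * (s * (1 + R * norm (x - z)) * (1 + norm x)) ^ N"
        using C(1) le by (intro mult_left_mono power_mono) auto
      also have "\<dots> = C * (s * (1 + norm x)) ^ N * (1 + R * norm (x - z)) ^ N"
        by (simp add: power_mult_distrib mult_ac)
      finally have "norm (g z) / (1 + R * norm (x - z)) ^ N \<le> C * (s * (1 + norm x)) ^ N"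
        using R by (subst pos_divide_le_eq) (auto intro!: zero_less_power add_pos_nonneg)
      then show ?thesis by (simp add: wt_def)
    qed
    have "epowr (ennreal (norm (g x) * wt R N (x - x))) p
        \<le> ennreal K * (\<integral>\<^sup>+ y. epowr (ennreal (norm (g y) * wt R N (x - y))) p \<partial>lborel)"
      by (rule peetre_inequality(1)[where B="C * (s * (1 + norm x)) ^ N", OF _ _ p R order_refl K])
        (use band_limited_bound[OF g R, of _ N] bd in \<open>auto simp: K_def\<close>)
    also have "\<dots> \<le> ennreal K * ?Q"
      using wt_le_1[OF R] p
      by (intro mult_left_mono nn_integral_mono epowr_mono ennreal_leI) (auto intro!: mult_left_le)
    finally show ?thesis by (simp add: wt_def)
  qed
  then have "ennreal (norm (g x)) \<le> epowr (ennreal K * ?Q) (1 / p)" for x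
    using p by (simp add: epowr_le_iff)
  moreover have "epowr (ennreal K * ?Q) (1 / p) < top" using fin by (simp add: ennreal_mult_less_top)
  ultimately have "norm (g x) \<le> enn2real (epowr (ennreal K * ?Q) (1 / p))" for x
    using enn2real_mono[of "ennreal (norm (g x))" "epowr (ennreal K * ?Q) (1 / p)"] by simp
  then show ?thesis by (rule that)
qed

text \<open>For M = 0 the weight is 1 and the maximal inequality reads |g|^p <= K Q, with Q the
  integral of |g|^p and K of order R^n. Writing |g|^r as |g|^(r-p) |g|^p and bounding the first
  factor gives the exponent 1/p - 1/r of K.\<close>

lemma nikolskii_inequality:
  fixes g :: "real^'n::finite \<Rightarrow> complex"
  assumes g: "band_limited \<Psi> R g" and R: "0 < R" and p: "0 < p" "p \<le> r" "r \<le> 1"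
  shows "Lnorm (ennreal r) (\<lambda>x. ennreal (norm (g x)))
    \<le> ennreal ((band_const TYPE('n) 0 * R ^ CARD('n)) powr (1 / p - 1 / r)) * Lnorm (ennreal p) (\<lambda>x. ennreal (norm (g x)))"
proof -
  have [measurable]: "g \<in> borel_measurable borel" by (rule band_limited_measurable[OF g])
  let ?G = "\<lambda>x. ennreal (norm (g x))"
  let ?Q = "\<integral>\<^sup>+ x. epowr (?G x) p \<partial>lborel"
  define K where "K = band_const TYPE('n) 0 * R ^ CARD('n)"
  have K: "0 < K" using band_const_pos[of 0, where 'n='n] R by (simp add: K_def)
  show ?thesis
  proof (cases "?Q < top")
    case True
    obtain A where A: "\<And>x. norm (g x) \<le> A"
      by (rule band_limited_bounded[OF g R p(1) _ True]) (use p in auto)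
    have sup: "epowr (?G x) p \<le> ennreal K * ?Q" for x
      using peetre_inequality(1)[of "\<lambda>x. norm (g x)" p R R K 0 x A x] p R K A band_limited_bound[OF g R, of _ 0]
      by (simp add: wt_def K_def)
    have "(\<integral>\<^sup>+ x. epowr (?G x) r \<partial>lborel) = (\<integral>\<^sup>+ x. epowr (epowr (?G x) p) ((r - p) / p) * epowr (?G x) p \<partial>lborel)"
      using p by (simp add: epowr_epowr flip: epowr_add)
    also have "\<dots> \<le> (\<integral>\<^sup>+ x. epowr (ennreal K * ?Q) ((r - p) / p) * epowr (?G x) p \<partial>lborel)"
      using p by (intro nn_integral_mono mult_right_mono epowr_mono sup) auto
    also have "\<dots> = epowr (ennreal K * ?Q) ((r - p) / p) * ?Q" by (rule nn_integral_cmult) measurable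
    finally have "epowr (\<integral>\<^sup>+ x. epowr (?G x) r \<partial>lborel) (1 / r) \<le> epowr (epowr (ennreal K * ?Q) ((r - p) / p) * ?Q) (1 / r)"
      using p by (intro epowr_mono) auto
    also have "\<dots> = epowr (ennreal K) ((r - p) / p * (1 / r)) * (epowr ?Q ((r - p) / p * (1 / r)) * epowr ?Q (1 / r))"
      by (simp add: epowr_mult epowr_epowr mult.assoc)
    also have "epowr ?Q ((r - p) / p * (1 / r)) * epowr ?Q (1 / r) = epowr ?Q (1 / p)"
      using p by (simp add: field_simps flip: epowr_add)
    also have "(r - p) / p * (1 / r) = 1 / p - 1 / r" using p by (simp add: field_simps)
    finally show ?thesis using p K by (simp add: Lnorm_ennreal epowr_ennreal K_def)
  next
    case False
    then have "Lnorm (ennreal p) ?G = top" using p by (simp add: Lnorm_ennreal less_top[symmetric])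
    moreover have "ennreal ((band_const TYPE('n) 0 * R ^ CARD('n)) powr (1 / p - 1 / r)) \<noteq> 0"
      using K unfolding K_def[symmetric] by simp
    ultimately show ?thesis by (simp only: ennreal_mult_top if_False top_greatest)
  qed
qed

text \<open>Commonly denoted sigma_p: both the loss of a multiplier acting below the band, and the
  smoothness above which a ball condition on the spectra suffices.\<close>

definition exponent_loss :: "'n::finite itself \<Rightarrow> ennreal \<Rightarrow> real"
  where "exponent_loss _ p = max 0 (real CARD('n) * recip p - real CARD('n))"

lemma exponent_loss_ge_1: "1 \<le> p \<Longrightarrow> exponent_loss TYPE('n::finite) p = 0"
proof (cases p)
  case (real r)
  assume "1 \<le> p"
  then have "1 \<le> r" using real by (simp add: ennreal_le_iff2 flip: ennreal_1)
  then have "real CARD('n) * (1 / r) \<le> real CARD('n) * 1" by (intro mult_left_mono) auto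
  then show ?thesis using real \<open>1 \<le> r\<close> by (simp add: exponent_loss_def recip_ennreal)
qed (simp add: exponent_loss_def recip_top)

text \<open>Young's inequality: the integral of the kernel is invariant under dilation, so one
  constant serves all \<tau>, for any measurable g.\<close>

lemma multiplier_bound_ge_1:
  fixes \<Phi> :: "real^'n::finite \<Rightarrow> complex"
  assumes p: "1 \<le> p" and \<Phi>: "\<Phi> \<in> schwartz"
  shows "\<exists>C>0. \<forall>g \<tau>. 0 < \<tau> \<and> g \<in> borel_measurable borel \<longrightarrow>
    Lnorm p (\<lambda>y. ennreal (norm (LINT x|lborel. g x * kern (\<lambda>\<xi>. \<Phi> ((1 / \<tau>) *\<^sub>R \<xi>)) (x - y))))
      \<le> ennreal C * Lnorm p (\<lambda>x. ennreal (norm (g x)))"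
proof -
  let ?M = "2 * CARD('n)"
  define D where "D = schwartz_norm ?M (kern \<Phi>)"
  have D: "0 \<le> D" unfolding D_def by (rule schwartz_norm_nonneg[OF kern_schwartz[OF \<Phi>]])
  define C where "C = D * decay_mass TYPE('n) + 1"
  have C: "0 < C" using D decay_mass_nonneg[where 'n='n] by (auto simp: C_def intro: add_nonneg_pos)
  have p0: "0 < p" by (rule less_le_trans[OF zero_less_one p])
  have "Lnorm p (\<lambda>y. ennreal (norm (LINT x|lborel. g x * kern (\<lambda>\<xi>. \<Phi> ((1 / \<tau>) *\<^sub>R \<xi>)) (x - y))))
      \<le> ennreal C * Lnorm p (\<lambda>x. ennreal (norm (g x)))"
    if \<tau>: "0 < \<tau>" and [measurable]: "g \<in> borel_measurable borel" for g \<tau>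
  proof -
    let ?k = "kern (\<lambda>\<xi>. \<Phi> ((1 / \<tau>) *\<^sub>R \<xi>))"
    have "(\<lambda>\<xi>. \<Phi> ((1 / \<tau>) *\<^sub>R \<xi> + 0)) \<in> schwartz" using \<tau> by (intro schwartz_affine[OF \<Phi>]) auto
    then have "?k \<in> schwartz" by (intro kern_schwartz) simp
    note [measurable] = schwartz_measurable[OF this]
    define w where "w = (\<lambda>x y :: real^'n. ennreal (D * \<tau> ^ CARD('n) * wt \<tau> ?M (x - y)))"
    have wi: "(\<integral>\<^sup>+ x. w y x \<partial>lborel) \<le> ennreal C" for y
    proof -
      have "(\<integral>\<^sup>+ x. w y x \<partial>lborel) = ennreal (D * \<tau> ^ CARD('n)) * (\<integral>\<^sup>+ x. ennreal (wt \<tau> ?M (y - x)) \<partial>lborel)"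
        unfolding w_def using D \<tau> wt_nonneg[OF \<tau>]
        by (subst nn_integral_cmult[symmetric]) (auto simp: less_imp_le intro!: nn_integral_cong ennreal_mult)
      also have "\<dots> = ennreal (D * \<tau> ^ CARD('n) * ((1 / \<tau>) ^ CARD('n) * decay_mass TYPE('n)))"
        unfolding nn_integral_wt[OF \<tau>] using D \<tau> decay_mass_nonneg[where 'n='n]
        by (subst ennreal_mult[symmetric]) auto
      also have "D * \<tau> ^ CARD('n) * ((1 / \<tau>) ^ CARD('n) * decay_mass TYPE('n)) = C - 1"
        using \<tau> by (simp add: C_def power_divide)
      finally show ?thesis by (simp add: ennreal_leI)
    qed
    have wc: "w x y = w y x" for x y by (simp add: w_def wt_commute)
    have "Lnorm p (\<lambda>y. ennreal (norm (LINT x|lborel. g x * ?k (x - y))))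
        \<le> Lnorm p (\<lambda>y. \<integral>\<^sup>+ x. w x y * ennreal (norm (g x)) \<partial>lborel)"
    proof (rule Lnorm_mono[OF p0])
      fix y
      have "ennreal (norm (LINT x|lborel. g x * ?k (x - y))) \<le> ennreal (D * \<tau> ^ CARD('n)) * (\<integral>\<^sup>+ x. ennreal (norm (g x) * wt \<tau> ?M (x - y)) \<partial>lborel)"
        using kern_scale_bound[OF \<Phi> \<tau>, of _ ?M] D \<tau> wt_nonneg[OF \<tau>]
        by (intro ennreal_norm_integral_le) (auto simp: D_def less_imp_le)
      also have "\<dots> = (\<integral>\<^sup>+ x. w x y * ennreal (norm (g x)) \<partial>lborel)"
      proof -
        have "w x y * ennreal (norm (g x)) = ennreal (D * \<tau> ^ CARD('n)) * ennreal (norm (g x) * wt \<tau> ?M (x - y))" for x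
          unfolding w_def using D \<tau> wt_nonneg[OF \<tau>, of ?M "x - y"] by (simp add: ennreal_mult mult_ac)
        then show ?thesis by (simp add: nn_integral_cmult)
      qed
      finally show "ennreal (norm (LINT x|lborel. g x * ?k (x - y))) \<le> (\<integral>\<^sup>+ x. w x y * ennreal (norm (g x)) \<partial>lborel)" .
    qed measurable
    also have "\<dots> \<le> ennreal C * Lnorm p (\<lambda>x. ennreal (norm (g x)))"
    proof (rule Lnorm_kernel_le[OF p])
      show "(\<lambda>(x, y). w x y) \<in> borel_measurable (borel \<Otimes>\<^sub>M borel)" unfolding w_def by measurable
    qed (use C wi wc in auto)
    finally show ?thesis .
  qed
  then show ?thesis using C by blast
qed

text \<open>The kernel bound gives D \<tau>^n times the weighted L_1 integral \<open>?J\<close>; the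
  maximal inequality turns its power p into K^(1-p) times the weighted L_p integral
  \<open>?I\<close>, whose integral over y is of order \<tau>^(-n) Q. With K of order R^n the powers
  combine to \<tau>^(np) R^(n(1-p)) \<tau>^(-n) = (R/\<tau>)^(n(1-p)), and the root of order p
  produces the exponent n/p - n.\<close>

lemma multiplier_bound_less_1:
  fixes \<Phi> :: "real^'n::finite \<Rightarrow> complex"
  assumes p: "0 < p" "p < 1" and \<Phi>: "\<Phi> \<in> schwartz"
  shows "\<exists>C>0. \<forall>g R \<tau>. 0 < \<tau> \<and> \<tau> \<le> R \<and> band_limited \<Psi> R g \<longrightarrow>
    Lnorm (ennreal p) (\<lambda>y. ennreal (norm (LINT x|lborel. g x * kern (\<lambda>\<xi>. \<Phi> ((1 / \<tau>) *\<^sub>R \<xi>)) (x - y))))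
      \<le> ennreal (C * (R / \<tau>) powr (real CARD('n) * (1 / p) - real CARD('n))) * Lnorm (ennreal p) (\<lambda>x. ennreal (norm (g x)))"
proof -
  let ?d = "real CARD('n)"
  \<comment> \<open>Large enough for the power p of the weight to be integrable; it depends on n and
    p alone, which makes the constants independent of g.\<close>
  define M where "M = nat \<lceil>2 * ?d / p\<rceil>"
  have "2 * ?d / p \<le> real M" unfolding M_def by (rule real_nat_ceiling_ge)
  then have M: "2 * ?d \<le> real M * p" using p by (simp add: divide_le_eq)
  define D where "D = schwartz_norm M (kern \<Phi>) + 1"
  have D: "0 < D" unfolding D_def using schwartz_norm_nonneg[OF kern_schwartz[OF \<Phi>], of M] by (rule add_nonneg_pos) simp
  define m where "m = decay_mass TYPE('n) + 1"
  have m: "0 < m" unfolding m_def using decay_mass_nonneg by (rule add_nonneg_pos) simp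
  define b where "b = band_const TYPE('n) M"
  have b: "0 < b" unfolding b_def by (rule band_const_pos)
  define C where "C = (D powr p * b powr (1 - p) * m) powr (1 / p)"
  have C: "0 < C" using D b m by (simp add: C_def)
  have "Lnorm (ennreal p) (\<lambda>y. ennreal (norm (LINT x|lborel. g x * kern (\<lambda>\<xi>. \<Phi> ((1 / \<tau>) *\<^sub>R \<xi>)) (x - y))))
      \<le> ennreal (C * (R / \<tau>) powr (?d * (1 / p) - ?d)) * Lnorm (ennreal p) (\<lambda>x. ennreal (norm (g x)))"
    if \<tau>: "0 < \<tau>" "\<tau> \<le> R" and g: "band_limited \<Psi> R g" for g R \<tau>
  proof -
    let ?k = "kern (\<lambda>\<xi>. \<Phi> ((1 / \<tau>) *\<^sub>R \<xi>))"
    let ?G = "\<lambda>x. ennreal (norm (g x))"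
    let ?Q = "\<integral>\<^sup>+ x. epowr (?G x) p \<partial>lborel"
    have R: "0 < R" using \<tau> by simp
    have [measurable]: "g \<in> borel_measurable borel" by (rule band_limited_measurable[OF g])
    have pos: "0 < C * (R / \<tau>) powr (?d * (1 / p) - ?d)" using C R \<tau> by simp
    show ?thesis
    proof (cases "?Q < top")
      case False
      then have "Lnorm (ennreal p) ?G = top" using p by (simp add: Lnorm_ennreal less_top[symmetric])
      moreover have "ennreal (C * (R / \<tau>) powr (?d * (1 / p) - ?d)) \<noteq> 0" using pos by (simp only: ennreal_eq_0_iff not_le)
      ultimately show ?thesis by (simp only: ennreal_mult_top if_False top_greatest)
    next
      case True
      obtain A where A: "\<And>x. norm (g x) \<le> A"
        by (rule band_limited_bounded[OF g R p(1) _ True]) (use p in auto)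
      define K where "K = b * R ^ CARD('n)"
      have K: "0 < K" using b R by (simp add: K_def)
      let ?I = "\<lambda>y. \<integral>\<^sup>+ x. epowr (ennreal (norm (g x) * wt \<tau> M (y - x))) p \<partial>lborel"
      let ?J = "\<lambda>y. \<integral>\<^sup>+ x. ennreal (norm (g x) * wt \<tau> M (y - x)) \<partial>lborel"
      have J: "epowr (?J y) p \<le> epowr (ennreal K) (1 - p) * ?I y" for y
      proof (rule peetre_inequality(2)[where B=A])
        show "norm (g z) * wt \<tau> M (y - z) \<le> A" for z
          using A[of z] wt_le_1[OF \<tau>(1), of M "y - z"] wt_pos[OF \<tau>(1), of M "y - z"]
            mult_left_le[of "wt \<tau> M (y - z)" "norm (g z)"] by auto
      qed (use p \<tau> K band_limited_bound[OF g R, of _ M] in \<open>auto simp: K_def b_def\<close>)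
      have I: "(\<integral>\<^sup>+ y. ?I y \<partial>lborel) \<le> ennreal ((1 / \<tau>) ^ CARD('n) * m) * ?Q"
      proof -
        have "(\<integral>\<^sup>+ y. ?I y \<partial>lborel) \<le> (\<integral>\<^sup>+ y. \<integral>\<^sup>+ x. epowr (?G x) p * ennreal (wt \<tau> (2 * CARD('n)) (x - y)) \<partial>lborel \<partial>lborel)"
        proof (intro nn_integral_mono)
          fix x y :: "real^'n"
          have "epowr (ennreal (norm (g x) * wt \<tau> M (y - x))) p = epowr (?G x) p * epowr (ennreal (wt \<tau> M (x - y))) p"
            by (simp add: ennreal_mult' epowr_mult wt_commute)
          also have "\<dots> \<le> epowr (?G x) p * ennreal (wt \<tau> (2 * CARD('n)) (x - y))"
            by (intro mult_left_mono epowr_wt_le \<tau> p M) simp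
          finally show "epowr (ennreal (norm (g x) * wt \<tau> M (y - x))) p \<le> epowr (?G x) p * ennreal (wt \<tau> (2 * CARD('n)) (x - y))" .
        qed
        also have "\<dots> = (\<integral>\<^sup>+ x. \<integral>\<^sup>+ y. epowr (?G x) p * ennreal (wt \<tau> (2 * CARD('n)) (x - y)) \<partial>lborel \<partial>lborel)"
          by (rule lborel_pair.Fubini') measurable
        also have "\<dots> = (\<integral>\<^sup>+ x. epowr (?G x) p * ennreal ((1 / \<tau>) ^ CARD('n) * decay_mass TYPE('n)) \<partial>lborel)"
          by (intro nn_integral_cong) (simp add: nn_integral_cmult nn_integral_wt[OF \<tau>(1)])
        also have "\<dots> = ?Q * ennreal ((1 / \<tau>) ^ CARD('n) * decay_mass TYPE('n))"
          by (rule nn_integral_multc) measurable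
        also have "\<dots> \<le> ?Q * ennreal ((1 / \<tau>) ^ CARD('n) * m)"
          using \<tau> by (intro mult_left_mono ennreal_leI) (auto simp: m_def)
        finally show ?thesis by (simp add: mult.commute)
      qed
      have [measurable]: "?I \<in> borel_measurable borel" by measurable
      let ?h = "\<lambda>y. ennreal (norm (LINT x|lborel. g x * ?k (x - y)))"
      have "(\<integral>\<^sup>+ y. epowr (?h y) p \<partial>lborel) \<le> (\<integral>\<^sup>+ y. (epowr (ennreal (D * \<tau> ^ CARD('n))) p * epowr (ennreal K) (1 - p)) * ?I y \<partial>lborel)"
      proof (rule nn_integral_mono)
        fix y
        have kb: "norm (?k (x - y)) \<le> (D * \<tau> ^ CARD('n)) * wt \<tau> M (y - x)" for x
        proof -
          have "norm (?k (x - y)) \<le> (schwartz_norm M (kern \<Phi>) * \<tau> ^ CARD('n)) * wt \<tau> M (x - y)"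
            by (rule kern_scale_bound[OF \<Phi> \<tau>(1)])
          also have "\<dots> \<le> (D * \<tau> ^ CARD('n)) * wt \<tau> M (x - y)"
            using \<tau> wt_pos[OF \<tau>(1), of M "x - y"] by (intro mult_right_mono) (auto simp: D_def)
          finally show ?thesis by (simp add: wt_commute)
        qed
        have "?h y \<le> ennreal (D * \<tau> ^ CARD('n)) * ?J y"
          using kb D \<tau> wt_nonneg[OF \<tau>(1)] by (intro ennreal_norm_integral_le) (auto simp: less_imp_le)
        then have "epowr (?h y) p \<le> epowr (ennreal (D * \<tau> ^ CARD('n)) * ?J y) p"
          using p by (intro epowr_mono) auto
        also have "\<dots> = epowr (ennreal (D * \<tau> ^ CARD('n))) p * epowr (?J y) p" by (rule epowr_mult)
        also have "\<dots> \<le> epowr (ennreal (D * \<tau> ^ CARD('n))) p * (epowr (ennreal K) (1 - p) * ?I y)"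
          by (intro mult_left_mono J) simp
        finally show "epowr (?h y) p \<le> (epowr (ennreal (D * \<tau> ^ CARD('n))) p * epowr (ennreal K) (1 - p)) * ?I y"
          by (simp add: mult.assoc)
      qed
      also have "\<dots> = (epowr (ennreal (D * \<tau> ^ CARD('n))) p * epowr (ennreal K) (1 - p)) * (\<integral>\<^sup>+ y. ?I y \<partial>lborel)"
        by (rule nn_integral_cmult) measurable
      also have "\<dots> \<le> (epowr (ennreal (D * \<tau> ^ CARD('n))) p * epowr (ennreal K) (1 - p)) * (ennreal ((1 / \<tau>) ^ CARD('n) * m) * ?Q)"
        by (intro mult_left_mono I) simp
      also have "\<dots> = ennreal ((D * \<tau> ^ CARD('n)) powr p * K powr (1 - p) * ((1 / \<tau>) ^ CARD('n) * m)) * ?Q"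
      proof -
        have e: "ennreal (A * (B * E)) = ennreal A * (ennreal B * ennreal E)" if "0 \<le> A" "0 \<le> B" "0 \<le> E" for A B E :: real
          using that by (simp add: ennreal_mult)
        have "epowr (ennreal (D * \<tau> ^ CARD('n))) p = ennreal ((D * \<tau> ^ CARD('n)) powr p)"
          "epowr (ennreal K) (1 - p) = ennreal (K powr (1 - p))"
          using D \<tau> K by (auto intro!: epowr_ennreal)
        moreover have "0 \<le> (1 / \<tau>) ^ CARD('n) * m" using \<tau> m by simp
        ultimately show ?thesis by (simp only: e powr_ge_zero mult.assoc)
      qed
      also have "(D * \<tau> ^ CARD('n)) powr p * K powr (1 - p) * ((1 / \<tau>) ^ CARD('n) * m)
          = (C * (R / \<tau>) powr (?d * (1 / p) - ?d)) powr p"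
      proof -
        have Cp: "C powr p = D powr p * b powr (1 - p) * m"
          using p D b m by (simp add: C_def powr_powr)
        have e: "(?d * (1 / p) - ?d) * p = ?d * (1 - p)" using p by (simp add: field_simps)
        have "\<tau> powr (?d * p) * \<tau> powr (- ?d) = \<tau> powr (- (?d * (1 - p)))"
          by (simp add: powr_add[symmetric] algebra_simps)
        moreover have "(R / \<tau>) powr (?d * (1 - p)) = R powr (?d * (1 - p)) / \<tau> powr (?d * (1 - p))"
          using R \<tau> by (simp add: powr_divide)
        ultimately have Rt: "(R / \<tau>) powr (?d * (1 - p)) = R powr (?d * (1 - p)) * (\<tau> powr (?d * p) * \<tau> powr (- ?d))"
          by (simp only: powr_minus divide_inverse)
        have "(C * (R / \<tau>) powr (?d * (1 / p) - ?d)) powr p = C powr p * (R / \<tau>) powr ((?d * (1 / p) - ?d) * p)"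
          using C R \<tau> by (simp add: powr_mult powr_powr)
        also have "\<dots> = D powr p * b powr (1 - p) * m * (R powr (?d * (1 - p)) * (\<tau> powr (?d * p) * \<tau> powr (- ?d)))"
          by (simp only: Cp e Rt)
        finally have *: "(C * (R / \<tau>) powr (?d * (1 / p) - ?d)) powr p
            = D powr p * b powr (1 - p) * m * (R powr (?d * (1 - p)) * (\<tau> powr (?d * p) * \<tau> powr (- ?d)))" .
        have t1: "(D * \<tau> ^ CARD('n)) powr p = D powr p * \<tau> powr (?d * p)"
          using D \<tau> by (simp add: powr_mult powr_powr flip: powr_realpow)
        have t2: "K powr (1 - p) = b powr (1 - p) * R powr (?d * (1 - p))"
          using b R by (simp add: K_def powr_mult powr_powr flip: powr_realpow)
        have t3: "(1 / \<tau>) ^ CARD('n) = \<tau> powr (- ?d)"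
          using \<tau> by (simp add: powr_minus powr_realpow power_one_over inverse_eq_divide)
        show ?thesis unfolding * t1 t2 t3 by (simp add: mult_ac)
      qed
      finally have "(\<integral>\<^sup>+ y. epowr (?h y) p \<partial>lborel) \<le> epowr (ennreal (C * (R / \<tau>) powr (?d * (1 / p) - ?d)) * Lnorm (ennreal p) ?G) p"
        using pos p by (simp add: epowr_mult epowr_Lnorm epowr_ennreal less_imp_le)
      then show ?thesis using p by (subst epowr_mono_iff[symmetric, OF p(1)]) (simp only: epowr_Lnorm)
    qed
  qed
  then show ?thesis using C by blast
qed

lemma multiplier_bound:
  fixes \<Phi> :: "real^'n::finite \<Rightarrow> complex"
  assumes p: "0 < p" and \<Phi>: "\<Phi> \<in> schwartz"
  shows "\<exists>C>0. \<forall>g R \<tau>. 0 < \<tau> \<and> \<tau> \<le> R \<and> band_limited \<Psi> R g \<longrightarrow>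
    Lnorm p (\<lambda>y. ennreal (norm (LINT x|lborel. g x * kern (\<lambda>\<xi>. \<Phi> ((1 / \<tau>) *\<^sub>R \<xi>)) (x - y))))
      \<le> ennreal (C * (R / \<tau>) powr exponent_loss TYPE('n) p) * Lnorm p (\<lambda>x. ennreal (norm (g x)))"
proof (cases "1 \<le> p")
  case True
  obtain C where C: "C > 0" "\<And>g \<tau>. 0 < \<tau> \<Longrightarrow> g \<in> borel_measurable borel \<Longrightarrow>
    Lnorm p (\<lambda>y. ennreal (norm (LINT x|lborel. g x * kern (\<lambda>\<xi>. \<Phi> ((1 / \<tau>) *\<^sub>R \<xi>)) (x - y))))
      \<le> ennreal C * Lnorm p (\<lambda>x. ennreal (norm (g x)))"
    using multiplier_bound_ge_1[OF True \<Phi>] by blast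
  show ?thesis
  proof (intro exI[of _ C] conjI allI impI C(1))
    fix g :: "real^'n \<Rightarrow> complex" and R \<tau> assume *: "0 < \<tau> \<and> \<tau> \<le> R \<and> band_limited \<Psi> R g"
    then have "(R / \<tau>) powr exponent_loss TYPE('n) p = 1" using True by (simp add: exponent_loss_ge_1)
    then show "Lnorm p (\<lambda>y. ennreal (norm (LINT x|lborel. g x * kern (\<lambda>\<xi>. \<Phi> ((1 / \<tau>) *\<^sub>R \<xi>)) (x - y))))
      \<le> ennreal (C * (R / \<tau>) powr exponent_loss TYPE('n) p) * Lnorm p (\<lambda>x. ennreal (norm (g x)))"
      using C(2)[of \<tau> g] band_limited_measurable[of R g] * by simp
  qed
next
  case False
  then obtain r where r: "p = ennreal r" "0 < r" "r < 1"
    using p by (cases p) (auto simp: not_le)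
  have "1 \<le> 1 / r" using r by (simp add: field_simps)
  then have "real CARD('n) * 1 \<le> real CARD('n) * (1 / r)" by (intro mult_left_mono) auto
  then have "exponent_loss TYPE('n) p = real CARD('n) * (1 / r) - real CARD('n)"
    using r by (simp add: exponent_loss_def recip_ennreal)
  then show ?thesis using multiplier_bound_less_1[OF r(2,3) \<Phi>] r(1) by simp
qed

end

section \<open>Series in \<open>L\<^sub>r\<close>\<close>

text \<open>Relative to the seminorm of order 2n, the L_1 norm of \<phi> is at most
  \<open>decay_mass\<close> and its supremum at most 1; their sum serves as a common bound for the
  weight |\<phi>|.\<close>

lemma Lr_pairing:
  fixes F \<phi> :: "real^'n::finite \<Rightarrow> complex"
  assumes r: "1 \<le> r" and F [measurable]: "F \<in> borel_measurable borel" and fin: "fun_Lp_norm r F < top"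
    and \<phi>: "\<phi> \<in> schwartz"
  shows "integrable lborel (\<lambda>x. F x * \<phi> x)"
    and "ennreal (norm (LINT x|lborel. F x * \<phi> x))
      \<le> ennreal (schwartz_norm (2 * CARD('n)) \<phi> * (decay_mass TYPE('n) + 1)) * fun_Lp_norm r F"
proof -
  let ?S = "schwartz_norm (2 * CARD('n)) \<phi>"
  let ?c = "?S * (decay_mass TYPE('n) + 1)"
  have S0: "0 \<le> ?S" by (rule schwartz_norm_nonneg[OF \<phi>])
  have m: "0 \<le> decay_mass TYPE('n)" by (rule decay_mass_nonneg)
  note [measurable] = schwartz_measurable[OF \<phi>]
  have nn: "(\<integral>\<^sup>+ x. ennreal (norm (F x * \<phi> x)) \<partial>lborel) \<le> ennreal ?c * fun_Lp_norm r F"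
  proof (cases "?S = 0")
    case True
    have "\<phi> x = 0" for x using schwartz_decay[OF \<phi>, of x] True by simp
    then show ?thesis by simp
  next
    case False
    then have c: "0 < ?c" using S0 m by (intro mult_pos_pos) auto
    have "(\<integral>\<^sup>+ x. ennreal (norm (F x * \<phi> x)) \<partial>lborel) = (\<integral>\<^sup>+ x. ennreal (norm (\<phi> x)) * ennreal (norm (F x)) \<partial>lborel)"
      by (simp add: norm_mult ennreal_mult mult.commute)
    also have "\<dots> \<le> ennreal ?c * Lnorm r (\<lambda>x. ennreal (norm (F x)))"
    proof (rule nn_integral_mult_le_Lnorm[OF r _ _ c])
      have "(\<integral>\<^sup>+ x. ennreal (norm (\<phi> x)) \<partial>lborel) = ennreal (LINT x|lborel. norm (\<phi> x))"
        by (intro nn_integral_eq_integral integrable_norm schwartz_integrable \<phi>) auto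
      also have "\<dots> \<le> ennreal ?c"
        using schwartz_integral_norm[OF \<phi>] S0 by (intro ennreal_leI) (auto simp: distrib_left)
      finally show "(\<integral>\<^sup>+ x. ennreal (norm (\<phi> x)) \<partial>lborel) \<le> ennreal ?c" .
      show "ennreal (norm (\<phi> x)) \<le> ennreal ?c" for x
      proof (rule ennreal_leI)
        have "norm (\<phi> x) \<le> ?S * decay x" by (rule schwartz_decay[OF \<phi>])
        also have "\<dots> \<le> ?S * 1" by (intro mult_left_mono decay_le_1 S0)
        also have "\<dots> \<le> ?c" using S0 m by (intro mult_left_mono) auto
        finally show "norm (\<phi> x) \<le> ?c" .
      qed
    qed measurable
    finally show ?thesis by (simp add: fun_Lp_norm_eq)
  qed
  show i: "integrable lborel (\<lambda>x. F x * \<phi> x)"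
  proof (rule integrableI_bounded)
    show "(\<integral>\<^sup>+ x. ennreal (norm (F x * \<phi> x)) \<partial>lborel) < \<infinity>"
      using fin by (intro le_less_trans[OF nn]) (simp add: ennreal_mult_less_top)
  qed measurable
  show "ennreal (norm (LINT x|lborel. F x * \<phi> x)) \<le> ennreal ?c * fun_Lp_norm r F"
    by (rule order_trans[OF integral_norm_bound_ennreal[OF i] nn])
qed

lemma Lr_set_integrable:
  fixes F :: "real^'n::finite \<Rightarrow> complex"
  assumes r: "1 \<le> r" and F [measurable]: "F \<in> borel_measurable borel" and fin: "fun_Lp_norm r F < top" and K: "compact K"
  shows "set_integrable lborel K F"
  unfolding set_integrable_def
proof (rule integrableI_bounded)
  have [measurable]: "K \<in> sets borel" using K by (simp add: borel_compact)
  have e: "emeasure lborel K < top" using emeasure_compact_finite[OF K] by (simp add: less_top)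
  define c where "c = measure lborel K + 1"
  have c: "0 < c" "1 \<le> c" by (auto simp: c_def add_nonneg_pos)
  have "(\<integral>\<^sup>+ x. ennreal (norm (indicator K x *\<^sub>R F x)) \<partial>lborel) = (\<integral>\<^sup>+ x. indicator K x * ennreal (norm (F x)) \<partial>lborel)"
    by (intro nn_integral_cong) (auto simp: indicator_def)
  also have "\<dots> \<le> ennreal c * Lnorm r (\<lambda>x. ennreal (norm (F x)))"
  proof (rule nn_integral_mult_le_Lnorm[OF r _ _ c(1)])
    have "(\<integral>\<^sup>+ x. indicator K x \<partial>lborel) = emeasure lborel K" by simp
    also have "\<dots> \<le> ennreal c"
      using e by (simp add: emeasure_eq_ennreal_measure less_top[symmetric] c_def ennreal_leI)
    finally show "(\<integral>\<^sup>+ x. indicator K x \<partial>lborel) \<le> ennreal c" .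
    show "indicator K x \<le> ennreal c" for x using c(2) by (auto simp: indicator_def simp flip: ennreal_1 intro: ennreal_leI)
  qed measurable
  also have "\<dots> < \<infinity>" using fin by (simp add: fun_Lp_norm_eq ennreal_mult_less_top)
  finally show "(\<integral>\<^sup>+ x. ennreal (norm (indicator K x *\<^sub>R F x)) \<partial>lborel) < \<infinity>" .
  show "(\<lambda>x. indicator K x *\<^sub>R F x) \<in> borel_measurable lborel" by measurable
qed

lemma Lr_tempered:
  fixes F :: "real^'n::finite \<Rightarrow> complex"
  assumes r: "1 \<le> r" and F: "F \<in> borel_measurable borel" and fin: "fun_Lp_norm r F < top"
  shows "tempered (\<lambda>\<phi>. LINT x|lborel. F x * \<phi> x)"
    and "represents F (\<lambda>\<phi>. LINT x|lborel. F x * \<phi> x)"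
proof -
  show "represents F (\<lambda>\<phi>. LINT x|lborel. F x * \<phi> x)"
    unfolding represents_def using F Lr_set_integrable[OF r F fin] by simp
  show "tempered (\<lambda>\<phi>. LINT x|lborel. F x * \<phi> x)"
    unfolding tempered_def
  proof (intro conjI ballI allI)
    fix \<phi> \<psi> :: "real^'n \<Rightarrow> complex" and a b assume *: "\<phi> \<in> schwartz" "\<psi> \<in> schwartz"
    have "(LINT x|lborel. F x * (a * \<phi> x + b * \<psi> x)) = (LINT x|lborel. a * (F x * \<phi> x) + b * (F x * \<psi> x))"
      by (simp add: algebra_simps)
    also have "\<dots> = (LINT x|lborel. a * (F x * \<phi> x)) + (LINT x|lborel. b * (F x * \<psi> x))"
      by (intro Bochner_Integration.integral_add integrable_mult_right Lr_pairing(1)[OF r F fin] *)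
    finally show "(LINT x|lborel. F x * (a * \<phi> x + b * \<psi> x)) = a * (LINT x|lborel. F x * \<phi> x) + b * (LINT x|lborel. F x * \<psi> x)"
      by simp
  next
    define C where "C = (decay_mass TYPE('n) + 1) * enn2real (fun_Lp_norm r F)"
    have "norm (LINT x|lborel. F x * \<phi> x) \<le> C * schwartz_norm (2 * CARD('n)) \<phi>" if \<phi>: "\<phi> \<in> schwartz" for \<phi>
    proof -
      have "fun_Lp_norm r F = ennreal (enn2real (fun_Lp_norm r F))" using fin by simp
      then have "ennreal (norm (LINT x|lborel. F x * \<phi> x))
          \<le> ennreal (schwartz_norm (2 * CARD('n)) \<phi> * (decay_mass TYPE('n) + 1)) * ennreal (enn2real (fun_Lp_norm r F))"
        using Lr_pairing(2)[OF r F fin \<phi>] by simp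
      also have "\<dots> = ennreal (C * schwartz_norm (2 * CARD('n)) \<phi>)"
        using decay_mass_nonneg[where 'n='n] schwartz_norm_nonneg[OF \<phi>, of "2 * CARD('n)"]
        by (subst ennreal_mult[symmetric]) (auto simp: C_def mult_ac)
      finally show ?thesis
        using decay_mass_nonneg[where 'n='n] schwartz_norm_nonneg[OF \<phi>, of "2 * CARD('n)"]
        by (subst (asm) ennreal_le_iff) (auto simp: C_def)
    qed
    then show "\<exists>C N. \<forall>\<phi>\<in>schwartz. norm (LINT x|lborel. F x * \<phi> x) \<le> C * schwartz_norm N \<phi>" by blast
  qed
qed

lemma ennreal_suminf_tail_tendsto_0:
  fixes a :: "nat \<Rightarrow> ennreal"
  assumes fin: "(\<Sum>j. a j) < top"
  shows "(\<lambda>N. \<Sum>j. a (j + N)) \<longlonglongrightarrow> 0"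
proof -
  define b where "b = (\<lambda>j. enn2real (a j))"
  have "a j < top" for j using fin ennreal_suminf_lessD by blast
  then have ab: "a = (\<lambda>j. ennreal (b j))" by (auto simp: b_def)
  have b0: "0 \<le> b j" for j by (simp add: b_def)
  have sb: "summable b"
    by (intro summable_suminf_not_top b0) (use fin in \<open>simp add: ab less_top\<close>)
  have "(\<Sum>j. a (j + N)) = ennreal (suminf b - (\<Sum>j<N. b j))" for N
  proof -
    have "(\<Sum>j. a (j + N)) = ennreal (\<Sum>j. b (j + N))"
      unfolding ab by (intro suminf_ennreal2 b0) (simp add: sb summable_iff_shift)
    then show ?thesis by (simp add: suminf_minus_initial_segment[OF sb])
  qed
  moreover have "(\<lambda>N. ennreal (suminf b - (\<Sum>j<N. b j))) \<longlonglongrightarrow> ennreal (suminf b - suminf b)"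
    by (intro tendsto_ennrealI tendsto_diff tendsto_const summable_LIMSEQ sb)
  ultimately show ?thesis by simp
qed

text \<open>By Minkowski's inequality the sum of the |f j| lies in L_r and so is finite almost
  everywhere. The pointwise series thus converges off a null set, where the value of
  \<open>suminf\<close> is irrelevant, and its tails are controlled by tails of the convergent
  series of norms.\<close>

lemma Lr_series:
  fixes f :: "nat \<Rightarrow> real^'n::finite \<Rightarrow> complex"
  assumes r: "1 \<le> r" and f [measurable]: "\<And>j. f j \<in> borel_measurable borel"
    and fin: "(\<Sum>j. fun_Lp_norm r (f j)) < top"
  defines "F \<equiv> \<lambda>x. \<Sum>j. f j x"
  shows "F \<in> borel_measurable borel"
    and "AE x in lborel. ennreal (norm (F x)) \<le> (\<Sum>j. ennreal (norm (f j x)))"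
    and "fun_Lp_norm r F \<le> (\<Sum>j. fun_Lp_norm r (f j))"
    and "(\<lambda>N. fun_Lp_norm r (\<lambda>x. (\<Sum>j<N. f j x) - F x)) \<longlonglongrightarrow> 0"
    and "\<And>\<phi>. \<phi> \<in> schwartz \<Longrightarrow> (\<lambda>j. LINT x|lborel. f j x * \<phi> x) sums (LINT x|lborel. F x * \<phi> x)"
proof -
  have r0: "0 < r" by (rule less_le_trans[OF zero_less_one r])
  show Fm [measurable]: "F \<in> borel_measurable borel" unfolding F_def by measurable
  have sumle: "Lnorm r (\<lambda>x. \<Sum>j. ennreal (norm (f (j + N) x))) \<le> (\<Sum>j. fun_Lp_norm r (f (j + N)))" for N
    unfolding fun_Lp_norm_eq by (rule Lnorm_suminf_le[OF r]) measurable
  have "AE x in lborel. (\<Sum>j. ennreal (norm (f j x))) < top"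
    by (rule Lnorm_AE_finite[OF r0]) (use sumle[of 0] fin in \<open>auto intro: le_less_trans\<close>)
  then have sm: "AE x in lborel. summable (\<lambda>j. norm (f j x))"
    by eventually_elim (intro summable_suminf_not_top, auto)
  \<comment> \<open>For N = 0 the partial sum is empty, so the same estimate also bounds F
    itself.\<close>
  have tail: "AE x in lborel. ennreal (norm ((\<Sum>j<N. f j x) - F x)) \<le> (\<Sum>j. ennreal (norm (f (j + N) x)))" for N
    using sm
  proof eventually_elim
    case (elim x)
    then have s: "summable (\<lambda>j. f j x)" by (rule summable_norm_cancel)
    have s': "summable (\<lambda>j. norm (f (j + N) x))" using elim by (simp add: summable_iff_shift[of "\<lambda>j. norm (f j x)"])
    have "(\<Sum>j<N. f j x) - F x = - (\<Sum>j. f (j + N) x)"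
      unfolding F_def by (simp add: suminf_minus_initial_segment[OF s])
    then have "norm ((\<Sum>j<N. f j x) - F x) \<le> (\<Sum>j. norm (f (j + N) x))"
      using summable_norm[OF s'] by simp
    then have "ennreal (norm ((\<Sum>j<N. f j x) - F x)) \<le> ennreal (\<Sum>j. norm (f (j + N) x))" by (rule ennreal_leI)
    also have "\<dots> = (\<Sum>j. ennreal (norm (f (j + N) x)))"
      by (intro suminf_ennreal2[symmetric] s') simp
    finally show ?case .
  qed
  show AEF: "AE x in lborel. ennreal (norm (F x)) \<le> (\<Sum>j. ennreal (norm (f j x)))"
    using tail[of 0] by simp
  have tailN: "fun_Lp_norm r (\<lambda>x. (\<Sum>j<N. f j x) - F x) \<le> (\<Sum>j. fun_Lp_norm r (f (j + N)))" for N
    unfolding fun_Lp_norm_eq[of r "\<lambda>x. (\<Sum>j<N. f j x) - F x"]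
    by (rule order_trans[OF Lnorm_mono_AE[OF r0 _ tail] sumle]) measurable
  show Fle: "fun_Lp_norm r F \<le> (\<Sum>j. fun_Lp_norm r (f j))"
    using tailN[of 0] by (simp add: fun_Lp_norm_eq)
  show lim: "(\<lambda>N. fun_Lp_norm r (\<lambda>x. (\<Sum>j<N. f j x) - F x)) \<longlonglongrightarrow> 0"
    by (rule tendsto_sandwich[OF always_eventually[OF allI[OF zero_le]] always_eventually[OF allI[OF tailN]]
          tendsto_const ennreal_suminf_tail_tendsto_0[OF fin]])
  fix \<phi> :: "real^'n \<Rightarrow> complex" assume \<phi>: "\<phi> \<in> schwartz"
  have fj: "fun_Lp_norm r (f j) < top" for j using fin ennreal_suminf_lessD by blast
  have Ff: "fun_Lp_norm r F < top" using Fle fin by (rule le_less_trans)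
  let ?c = "schwartz_norm (2 * CARD('n)) \<phi> * (decay_mass TYPE('n) + 1)"
  have B1: "ennreal (norm ((\<Sum>j<N. LINT x|lborel. f j x * \<phi> x) - (LINT x|lborel. F x * \<phi> x)))
      \<le> ennreal ?c * fun_Lp_norm r (\<lambda>x. (\<Sum>j<N. f j x) - F x)" for N
  proof -
    have "fun_Lp_norm r (\<lambda>x. (\<Sum>j<N. f j x) - F x) < top"
    proof (rule le_less_trans[OF tailN])
      show "(\<Sum>j. fun_Lp_norm r (f (j + N))) < top"
        using suminf_offset[of "\<lambda>j. fun_Lp_norm r (f j)" N] fin by (auto simp: less_top)
    qed
    moreover have "(\<lambda>x. (\<Sum>j<N. f j x) - F x) \<in> borel_measurable borel" by measurable
    ultimately have "ennreal (norm (LINT x|lborel. ((\<Sum>j<N. f j x) - F x) * \<phi> x)) \<le> ennreal ?c * fun_Lp_norm r (\<lambda>x. (\<Sum>j<N. f j x) - F x)"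
      using Lr_pairing(2)[OF r _ _ \<phi>] by blast
    moreover have "(LINT x|lborel. ((\<Sum>j<N. f j x) - F x) * \<phi> x) = (\<Sum>j<N. LINT x|lborel. f j x * \<phi> x) - (LINT x|lborel. F x * \<phi> x)"
      unfolding left_diff_distrib sum_distrib_right
      using Lr_pairing(1)[OF r f fj \<phi>] Lr_pairing(1)[OF r Fm Ff \<phi>] by simp
    ultimately show ?thesis by simp
  qed
  have B2: "(\<lambda>N. ennreal ?c * fun_Lp_norm r (\<lambda>x. (\<Sum>j<N. f j x) - F x)) \<longlonglongrightarrow> 0"
    using ennreal_tendsto_cmult[OF ennreal_less_top[of ?c] lim] by (simp only: mult_zero_right)
  have "(\<lambda>N. ennreal (norm ((\<Sum>j<N. LINT x|lborel. f j x * \<phi> x) - (LINT x|lborel. F x * \<phi> x)))) \<longlonglongrightarrow> 0"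
    by (rule tendsto_sandwich[OF always_eventually[OF allI[OF zero_le]] always_eventually[OF allI[OF B1]] tendsto_const B2])
  then have "(\<lambda>N. norm ((\<Sum>j<N. LINT x|lborel. f j x * \<phi> x) - (LINT x|lborel. F x * \<phi> x))) \<longlonglongrightarrow> 0"
    by (simp add: ennreal_tendsto_0_iff)
  then have "(\<lambda>N. (\<Sum>j<N. LINT x|lborel. f j x * \<phi> x) - (LINT x|lborel. F x * \<phi> x)) \<longlonglongrightarrow> 0"
    by (simp only: tendsto_norm_zero_iff)
  then show "(\<lambda>j. LINT x|lborel. f j x * \<phi> x) sums (LINT x|lborel. F x * \<phi> x)"
    unfolding sums_def by (rule LIM_zero_cancel)
qed

section \<open>Littlewood--Paley pieces of the sum\<close>

context
  fixes \<Psi> :: "real \<Rightarrow> real"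
  assumes \<Psi>: "besov_cutoff \<Psi>"
begin

lemma represents_integrable:
  "represents f u \<Longrightarrow> \<phi> \<in> test_functions UNIV \<Longrightarrow> integrable lborel (\<lambda>x. f x * \<phi> x)"
  by (rule set_integrable_test_mult[OF \<Psi>]) (simp_all add: represents_def)

lemma represents_sum_diff:
  fixes f :: "nat \<Rightarrow> real^'n::finite \<Rightarrow> complex"
  assumes f: "\<And>j. represents (f j) (u j)" and F: "represents F v"
  shows "represents (\<lambda>x. (\<Sum>j<N. f j x) - F x) (\<lambda>\<phi>. (\<Sum>j<N. u j \<phi>) - v \<phi>)"
  unfolding represents_def
proof (intro conjI allI impI ballI)
  have [measurable]: "f j \<in> borel_measurable borel" "F \<in> borel_measurable borel" for j
    using f F by (auto simp: represents_def)
  show "(\<lambda>x. (\<Sum>j<N. f j x) - F x) \<in> borel_measurable borel" by measurable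
  show "set_integrable lborel K (\<lambda>x. (\<Sum>j<N. f j x) - F x)" if "compact K" for K
  proof (rule set_integral_diff(1))
    have "set_integrable lborel K (f j)" for j using f that by (simp add: represents_def)
    then show "set_integrable lborel K (\<lambda>x. \<Sum>j<N. f j x)"
      unfolding set_integrable_def scaleR_sum_right by (intro Bochner_Integration.integrable_sum)
    show "set_integrable lborel K F" using F that by (simp add: represents_def)
  qed
  fix \<phi> :: "real^'n \<Rightarrow> complex" assume \<phi>: "\<phi> \<in> test_functions UNIV"
  have "u j \<phi> = (LINT x|lborel. f j x * \<phi> x)" for j using f[of j] \<phi> unfolding represents_def by blast
  moreover have "v \<phi> = (LINT x|lborel. F x * \<phi> x)" using F \<phi> unfolding represents_def by blast
  ultimately show "(\<Sum>j<N. u j \<phi>) - v \<phi> = (LINT x|lborel. ((\<Sum>j<N. f j x) - F x) * \<phi> x)"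
    unfolding left_diff_distrib sum_distrib_right
    using represents_integrable[OF f \<phi>] represents_integrable[OF F \<phi>] by simp
qed

lemma Lp_sums_series:
  fixes u :: "nat \<Rightarrow> 'n::finite functional"
  assumes r: "1 \<le> r" and u: "\<And>j. tempered (u j)" and f: "\<And>j. represents (f j) (u j)"
    and fin: "(\<Sum>j. Lp_norm r (u j)) < top"
  shows "Lp_sums r u (\<lambda>\<phi>. LINT x|lborel. (\<Sum>j. f j x) * \<phi> x)"
    and "Lp_norm r (\<lambda>\<phi>. LINT x|lborel. (\<Sum>j. f j x) * \<phi> x) \<le> (\<Sum>j. Lp_norm r (u j))"
proof -
  have r0: "0 < r" by (rule less_le_trans[OF zero_less_one r])
  have fm: "f j \<in> borel_measurable borel" for j by (rule represents_measurable[OF \<Psi> f])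
  have N: "Lp_norm r (u j) = fun_Lp_norm r (f j)" for j by (rule Lp_norm_eq[OF \<Psi> r0 f])
  have fin': "(\<Sum>j. fun_Lp_norm r (f j)) < top" using fin by (simp add: N)
  let ?F = "\<lambda>x. \<Sum>j. f j x"
  note S = Lr_series[OF r fm fin']
  have Ff: "fun_Lp_norm r ?F < top" using S(3) fin' by (rule le_less_trans)
  note T = Lr_tempered[OF r S(1) Ff]
  show le: "Lp_norm r (\<lambda>\<phi>. LINT x|lborel. ?F x * \<phi> x) \<le> (\<Sum>j. Lp_norm r (u j))"
    using Lp_norm_le[OF T(2), of r] S(3) by (simp add: N)
  show "Lp_sums r u (\<lambda>\<phi>. LINT x|lborel. ?F x * \<phi> x)"
    unfolding Lp_sums_def
  proof (intro conjI allI)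
    show "u j \<in> Lp_space r" for j
      using u fin ennreal_suminf_lessD[OF fin, of j] by (simp add: Lp_space_def)
    show "(\<lambda>\<phi>. LINT x|lborel. ?F x * \<phi> x) \<in> Lp_space r"
      using T(1) le fin by (auto simp: Lp_space_def intro: le_less_trans)
    have B: "Lp_norm r (\<lambda>\<phi>. (\<Sum>j<N. u j \<phi>) - (LINT x|lborel. ?F x * \<phi> x)) \<le> fun_Lp_norm r (\<lambda>x. (\<Sum>j<N. f j x) - ?F x)" for N
      by (rule Lp_norm_le[OF represents_sum_diff[OF f T(2)]])
    show "(\<lambda>N. Lp_norm r (\<lambda>\<phi>. (\<Sum>j<N. u j \<phi>) - (LINT x|lborel. ?F x * \<phi> x))) \<longlonglongrightarrow> 0"
      by (rule tendsto_sandwich[OF always_eventually[OF allI[OF zero_le]] always_eventually[OF allI[OF B]] tendsto_const S(4)])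
  qed
qed

text \<open>Up to the dilation by 2^k there are just two profiles, one for k = 0 and one for all k
  >= 1. Two multiplier constants therefore suffice for all shells.\<close>

definition lp_bump :: "nat \<Rightarrow> real^'n::finite \<Rightarrow> complex"
  where "lp_bump k = (if k = 0 then cut \<Psi> 1 else (\<lambda>\<xi>. cut \<Psi> 1 \<xi> - cut \<Psi> 2 \<xi>))"

lemma lp_bump_schwartz: "lp_bump k \<in> schwartz"
  by (auto simp: lp_bump_def intro!: schwartz_diff cut_schwartz[OF \<Psi>])

lemma dyadic_eq_lp_bump: "complex_of_real (dyadic \<Psi> k \<xi>) = lp_bump k ((1 / 2 ^ k) *\<^sub>R \<xi>)"
proof (cases k)
  case (Suc m)
  have "norm \<xi> / 2 ^ m = 2 * (norm \<xi> / 2 ^ Suc m)" by simp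
  then show ?thesis using Suc by (simp add: dyadic_def lp_bump_def cut_def)
qed (simp add: dyadic_def lp_bump_def cut_def)

lemma dyadic_piece:
  "dist_inv_fourier (dist_mult (dyadic \<Psi> k) (dist_fourier v)) \<phi>
    = v (fourier (\<lambda>\<xi>. lp_bump k ((1 / 2 ^ k) *\<^sub>R \<xi>) * inv_fourier \<phi> \<xi>))"
  by (simp add: dist_inv_fourier_def dist_mult_def dist_fourier_def dyadic_eq_lp_bump)

lemma lp_bump_scaled_schwartz: "(\<lambda>\<xi>. lp_bump k ((1 / 2 ^ k) *\<^sub>R \<xi>)) \<in> schwartz"
  using schwartz_affine[OF lp_bump_schwartz, of "1 / 2 ^ k" k 0] by simp

text \<open>The minimum of 1 and p: the power of the L_p quasi-norm that is subadditive. Every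
  estimate of a sum is made for this power.\<close>

definition sub_exponent :: "ennreal \<Rightarrow> real"
  where "sub_exponent p = (if p < 1 then enn2real p else 1)"

lemma Lnorm_suminf_sub_exponent:
  fixes F :: "nat \<Rightarrow> 'a::euclidean_space \<Rightarrow> ennreal"
  assumes p: "0 < p" and F: "\<And>j. F j \<in> borel_measurable borel"
  shows "epowr (Lnorm p (\<lambda>x. \<Sum>j. F j x)) (sub_exponent p) \<le> (\<Sum>j. epowr (Lnorm p (F j)) (sub_exponent p))"
proof (cases "p < 1")
  case True
  then obtain r where "p = ennreal r" "0 < r" "r < 1"
    using p by (cases p) auto
  then show ?thesis using Lnorm_powr_suminf_le[of r F] F by (simp add: sub_exponent_def)
next
  case False
  then show ?thesis using Lnorm_suminf_le[of p F] F by (simp add: sub_exponent_def not_less[symmetric])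
qed

lemma sub_exponent_pos: "0 < p \<Longrightarrow> 0 < sub_exponent p"
  by (auto simp: sub_exponent_def enn2real_positive_iff less_top[symmetric])

text \<open>The hypothesis \<open>2 ^ k \<le> A * 2 ^ j\<close> makes the band of \<open>g j\<close> at least as wide as the \<open>k\<close>-th shell.\<close>

lemma dyadic_piece_estimate:
  assumes p: "0 < p" and A: "0 < A"
  shows "\<exists>C>0. \<forall>(u :: nat \<Rightarrow> 'n::finite functional) g v J k.
    tempered_sums u v \<and> (\<forall>j. band_limited \<Psi> (A * 2 ^ j) (g j)) \<and>
    (\<forall>j. \<forall>\<phi>\<in>schwartz. u j \<phi> = (LINT x|lborel. g j x * \<phi> x)) \<and>
    (\<forall>j\<in>J. 2 ^ k \<le> A * 2 ^ j) \<and>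
    (\<forall>j. j \<notin> J \<longrightarrow> (\<forall>\<phi>\<in>schwartz. u j (fourier (\<lambda>\<xi>. lp_bump k ((1 / 2 ^ k) *\<^sub>R \<xi>) * inv_fourier \<phi> \<xi>)) = 0)) \<and>
    (\<Sum>j. if j \<in> J then fun_Lp_norm (max 1 p) (g j) else 0) < top \<longrightarrow>
    epowr (Lp_norm p (dist_inv_fourier (dist_mult (dyadic \<Psi> k) (dist_fourier v)))) (sub_exponent p)
      \<le> ennreal C * (\<Sum>j. if j \<in> J then epowr (ennreal (2 powr (exponent_loss TYPE('n) p * (real j - real k))) * Lp_norm p (u j)) (sub_exponent p) else 0)"
proof -
  let ?\<gamma> = "exponent_loss TYPE('n) p" and ?\<rho> = "sub_exponent p"
  let ?r = "max 1 p"
  have r: "1 \<le> ?r" by simp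
  have \<rho>: "0 < ?\<rho>" by (rule sub_exponent_pos[OF p])
  define K where "K = (\<lambda>k g y. LINT x|lborel. g x * kern (\<lambda>\<xi>. lp_bump k ((1 / 2 ^ k) *\<^sub>R \<xi>)) (x - y :: real^'n))"
  define P where "P = (\<lambda>i C. \<forall>g R \<tau>. 0 < \<tau> \<and> \<tau> \<le> R \<and> band_limited \<Psi> R g \<longrightarrow>
    Lnorm p (\<lambda>y. ennreal (norm (LINT x|lborel. g x * kern (\<lambda>\<xi>. (lp_bump i) ((1 / \<tau>) *\<^sub>R \<xi>)) (x - y :: real^'n))))
      \<le> ennreal (C * (R / \<tau>) powr ?\<gamma>) * Lnorm p (\<lambda>x. ennreal (norm (g x))))"
  have "\<exists>C. 0 < C \<and> P i C" for i
    unfolding P_def by (rule multiplier_bound[OF \<Psi> p lp_bump_schwartz])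
  then obtain c where cP: "\<forall>i. 0 < c i \<and> P i (c i)"
    using choice[of "\<lambda>i C. 0 < C \<and> P i C"] by blast
  then have c1: "0 < c i" and c2: "P i (c i)" for i by blast+
  note c = c1 c2[unfolded P_def, rule_format, OF conjI[OF _ conjI]]
  \<comment> \<open>The sum covers both profiles; the power of A comes from the quotient of the band
    A 2^j and the frequency 2^k.\<close>
  define C0 where "C0 = (c 0 + c 1) * A powr ?\<gamma>"
  have C0: "0 < C0" using c(1)[of 0] c(1)[of 1] A by (simp add: C0_def add_pos_pos)
  define C where "C = C0 powr ?\<rho>"
  have C: "0 < C" using C0 by (simp add: C_def)
  have cb: "lp_bump k = (lp_bump (min k 1) :: real^'n \<Rightarrow> complex)" for k
    by (cases k) (auto simp: lp_bump_def)
  have est: "fun_Lp_norm p (K k g) \<le> ennreal (C0 * 2 powr (?\<gamma> * (real j - real k))) * fun_Lp_norm p g"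
    if g: "band_limited \<Psi> (A * 2 ^ j) g" and jk: "2 ^ k \<le> A * 2 ^ j" for k j g
  proof -
    have "fun_Lp_norm p (K k g) \<le> ennreal (c (min k 1) * (A * 2 ^ j / 2 ^ k) powr ?\<gamma>) * fun_Lp_norm p g"
      using c(2)[OF _ jk g, of "min k 1"] unfolding K_def fun_Lp_norm_eq cb[of k] by simp
    also have "\<dots> \<le> ennreal (C0 * 2 powr (?\<gamma> * (real j - real k))) * fun_Lp_norm p g"
    proof (intro mult_right_mono ennreal_leI)
      have "A * 2 ^ j / 2 ^ k = A * 2 powr (real j - real k)"
        by (simp add: powr_diff powr_realpow)
      then have "(A * 2 ^ j / 2 ^ k) powr ?\<gamma> = A powr ?\<gamma> * 2 powr (?\<gamma> * (real j - real k))"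
        using A by (simp add: powr_mult powr_powr mult.commute)
      moreover have "c (min k 1) \<le> c 0 + c 1"
        using c(1)[of 0] c(1)[of 1] by (cases k) (auto simp: less_imp_le)
      then have "c (min k 1) * (A powr ?\<gamma> * 2 powr (?\<gamma> * (real j - real k))) \<le> (c 0 + c 1) * (A powr ?\<gamma> * 2 powr (?\<gamma> * (real j - real k)))"
        by (rule mult_right_mono) simp
      ultimately show "c (min k 1) * (A * 2 ^ j / 2 ^ k) powr ?\<gamma> \<le> C0 * 2 powr (?\<gamma> * (real j - real k))"
        by (simp add: C0_def mult.assoc)
    qed simp
    finally show ?thesis .
  qed
  have main: "epowr (Lp_norm p (dist_inv_fourier (dist_mult (dyadic \<Psi> k) (dist_fourier v)))) ?\<rho>
      \<le> ennreal C * (\<Sum>j. if j \<in> J then epowr (ennreal (2 powr (?\<gamma> * (real j - real k))) * Lp_norm p (u j)) ?\<rho> else 0)"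
    if sums: "tempered_sums u v" and band: "\<And>j. band_limited \<Psi> (A * 2 ^ j) (g j)"
      and ug: "\<And>j \<phi>. \<phi> \<in> schwartz \<Longrightarrow> u j \<phi> = (LINT x|lborel. g j x * \<phi> x)"
      and J: "\<And>j. j \<in> J \<Longrightarrow> 2 ^ k \<le> A * 2 ^ j"
      and J0: "\<And>j \<phi>. j \<notin> J \<Longrightarrow> \<phi> \<in> schwartz \<Longrightarrow> u j (fourier (\<lambda>\<xi>. lp_bump k ((1 / 2 ^ k) *\<^sub>R \<xi>) * inv_fourier \<phi> \<xi>)) = 0"
      and fin: "(\<Sum>j. if j \<in> J then fun_Lp_norm ?r (g j) else 0) < top"
    for u :: "nat \<Rightarrow> 'n functional" and g v J k
  proof -
    let ?\<Phi> = "\<lambda>\<xi>::real^'n. lp_bump k ((1 / 2 ^ k) *\<^sub>R \<xi>)"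
    \<comment> \<open>Terms outside J are annihilated by the multiplier as distributions, so 0
      represents them and no estimate is required there.\<close>
    define h where "h = (\<lambda>j. if j \<in> J then K k (g j) else (\<lambda>y. 0))"
    have pg: "poly_growth (g j)" for j by (rule band_limited_poly_growth[OF \<Psi> band])
    have \<Phi>S: "?\<Phi> \<in> schwartz" by (rule lp_bump_scaled_schwartz)
    have hpg: "poly_growth (K k (g j))" for j
      unfolding K_def by (rule fourier_multiplier_representation(1)[OF \<Psi> pg ug \<Phi>S])
    have uh: "u j (fourier (\<lambda>\<xi>. ?\<Phi> \<xi> * inv_fourier \<phi> \<xi>)) = (LINT y|lborel. h j y * \<phi> y)" if "\<phi> \<in> schwartz" for j \<phi>
      using fourier_multiplier_representation(2)[OF \<Psi> pg ug \<Phi>S that, of j] J0[of j, OF _ that]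
      by (auto simp: h_def K_def)
    have hm [measurable]: "h j \<in> borel_measurable borel" for j
      using hpg[of j] by (auto simp: h_def poly_growth_def)
    have ru: "represents (g j) (u j)" for j
      by (rule poly_growth_represents[OF pg ug]) (rule test_functions_schwartz)
    \<comment> \<open>This bound in L_r, with a constant that may depend on k, only ensures that the
      localised terms sum to a function; D does not enter the final estimate.\<close>
    obtain D where D: "0 < D" "\<And>g \<tau>. 0 < \<tau> \<Longrightarrow> g \<in> borel_measurable borel \<Longrightarrow>
      Lnorm ?r (\<lambda>y. ennreal (norm (LINT x|lborel. g x * kern (\<lambda>\<xi>. (lp_bump k) ((1 / \<tau>) *\<^sub>R \<xi>)) (x - y :: real^'n))))
      \<le> ennreal D * Lnorm ?r (\<lambda>x. ennreal (norm (g x)))"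
      using multiplier_bound_ge_1[OF \<Psi> r, of "lp_bump k :: real^'n \<Rightarrow> complex", OF lp_bump_schwartz] by blast
    have "(\<Sum>j. fun_Lp_norm ?r (h j)) \<le> (\<Sum>j. ennreal D * (if j \<in> J then fun_Lp_norm ?r (g j) else 0))"
    proof (intro suminf_le summableI)
      fix j
      have "fun_Lp_norm ?r (\<lambda>y::real^'n. 0) = 0"
        unfolding fun_Lp_norm_eq using Lnorm_zero[of ?r] by (simp add: less_max_iff_disj)
      moreover have "fun_Lp_norm ?r (K k (g j)) \<le> ennreal D * fun_Lp_norm ?r (g j)"
        using D(2)[of "2 ^ k" "g j"] band_limited_measurable[OF \<Psi> band[of j]]
        unfolding K_def fun_Lp_norm_eq by simp
      ultimately show "fun_Lp_norm ?r (h j) \<le> ennreal D * (if j \<in> J then fun_Lp_norm ?r (g j) else 0)"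
        by (simp add: h_def)
    qed
    also have "\<dots> < top" using fin by (simp add: ennreal_mult_less_top)
    finally have fin': "(\<Sum>j. fun_Lp_norm ?r (h j)) < top" .
    note S = Lr_series[OF r hm fin']
    let ?H = "\<lambda>x. \<Sum>j. h j x"
    have Hf: "fun_Lp_norm ?r ?H < top" using S(3) fin' by (rule le_less_trans)
    have rep: "represents ?H (dist_inv_fourier (dist_mult (dyadic \<Psi> k) (dist_fourier v)))"
      unfolding represents_def
    proof (intro conjI allI impI ballI S(1) Lr_set_integrable[OF r S(1) Hf])
      fix \<phi> :: "real^'n \<Rightarrow> complex" assume "\<phi> \<in> test_functions UNIV"
      then have \<phi>: "\<phi> \<in> schwartz" by (rule test_functions_schwartz)
      let ?\<theta> = "fourier (\<lambda>\<xi>. ?\<Phi> \<xi> * inv_fourier \<phi> \<xi>)"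
      have "?\<theta> \<in> schwartz"
        by (intro fourier_schwartz schwartz_mult schwartz_slowly_growing \<Phi>S inv_fourier_schwartz \<phi>)
      then have "(\<lambda>j. u j ?\<theta>) sums v ?\<theta>" using sums by (simp add: tempered_sums_def)
      then have "(\<lambda>j. LINT y|lborel. h j y * \<phi> y) sums v ?\<theta>" by (simp only: uh[OF \<phi>])
      then show "dist_inv_fourier (dist_mult (dyadic \<Psi> k) (dist_fourier v)) \<phi> = (LINT x|lborel. ?H x * \<phi> x)"
        unfolding dyadic_piece using S(5)[OF \<phi>] by (rule sums_unique2)
    qed
    have "epowr (Lp_norm p (dist_inv_fourier (dist_mult (dyadic \<Psi> k) (dist_fourier v)))) ?\<rho> \<le> epowr (fun_Lp_norm p ?H) ?\<rho>"
      using \<rho> by (intro epowr_mono Lp_norm_le rep) auto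
    also have "\<dots> \<le> epowr (Lnorm p (\<lambda>x. \<Sum>j. ennreal (norm (h j x)))) ?\<rho>"
      unfolding fun_Lp_norm_eq using \<rho> S(1)
      by (intro epowr_mono Lnorm_mono_AE[OF p _ S(2)]) auto
    also have "\<dots> \<le> (\<Sum>j. epowr (Lnorm p (\<lambda>x. ennreal (norm (h j x)))) ?\<rho>)"
      by (rule Lnorm_suminf_sub_exponent[OF p]) measurable
    also have "\<dots> \<le> (\<Sum>j. ennreal C * (if j \<in> J then epowr (ennreal (2 powr (?\<gamma> * (real j - real k))) * Lp_norm p (u j)) ?\<rho> else 0))"
    proof (intro suminf_le summableI)
      fix j
      show "epowr (Lnorm p (\<lambda>x. ennreal (norm (h j x)))) ?\<rho>
          \<le> ennreal C * (if j \<in> J then epowr (ennreal (2 powr (?\<gamma> * (real j - real k))) * Lp_norm p (u j)) ?\<rho> else 0)"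
      proof (cases "j \<in> J")
        case True
        have "epowr (fun_Lp_norm p (K k (g j))) ?\<rho> \<le> epowr (ennreal (C0 * 2 powr (?\<gamma> * (real j - real k))) * fun_Lp_norm p (g j)) ?\<rho>"
          using \<rho> by (intro epowr_mono est[OF band J[OF True]]) auto
        also have "\<dots> = ennreal C * epowr (ennreal (2 powr (?\<gamma> * (real j - real k))) * Lp_norm p (u j)) ?\<rho>"
          using C0 by (simp add: Lp_norm_eq[OF \<Psi> p ru] epowr_mult ennreal_mult epowr_ennreal C_def mult.assoc)
        finally show ?thesis using True by (simp add: h_def fun_Lp_norm_eq)
      next
        case False
        then show ?thesis using Lnorm_zero[OF p, where 'b="real^'n"] by (simp add: h_def)
      qed
    qed
    finally show ?thesis by simp
  qed
  show ?thesis
    by (intro exI[of _ C] conjI allI impI C, elim conjE, rule main) (assumption | blast)+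
qed

end

section \<open>Besov norms of the sum\<close>

lemma weighted_lq_finite_term:
  assumes "0 < q" "weighted_lq s q a < top" shows "a j < top"
proof -
  have "ennreal (2 powr (s * real j)) * a j < top"
    using weighted_lq_0_upper[OF assms(1), of "\<lambda>j. ennreal (2 powr (s * real j)) * a j" j] assms(2)
    unfolding weighted_lq_shift[OF assms(1), of s] by (rule le_less_trans)
  then show ?thesis by (auto simp: ennreal_mult_less_top)
qed

lemma weighted_lq_term_le:
  assumes "0 < q" shows "ennreal (2 powr (s * real j)) * a j \<le> weighted_lq s q a"
  unfolding weighted_lq_shift[OF assms, of s] by (rule weighted_lq_0_upper[OF assms])

text \<open>On J k the combined exponent of 2, made of the multiplier loss and the change of weight
  from k to j, is assumed to be at most D minus a multiple of the distance of j and k. This single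
  condition covers both a one-sided range of j with \<gamma> < s and a strip around the diagonal
  with any s.\<close>

lemma weighted_lq_pieces_le:
  assumes q: "0 < q" and \<rho>: "0 < \<rho>" and \<delta>: "0 < \<delta>" and C: "0 < C"
  shows "\<exists>c. \<forall>U W. (\<forall>k. epowr (W k) \<rho> \<le> ennreal C * (\<Sum>j. if j \<in> J k then epowr (ennreal (2 powr (\<gamma> * (real j - real k))) * U j) \<rho> else 0))
      \<and> (\<forall>k. \<forall>j\<in>J k. (\<gamma> - s) * \<rho> * (real j - real k) \<le> D - \<delta> * \<bar>real j - real k\<bar>)
    \<longrightarrow> weighted_lq s q W \<le> ennreal c * weighted_lq s q U"
proof -
  define E where "E = C * 2 powr D"
  have E: "0 < E" using C by (simp add: E_def)
  obtain c where c: "\<And>a b. (\<And>k. epowr (a k) \<rho> \<le> ennreal E * (\<Sum>j. ennreal (2 powr (- \<delta> * \<bar>real j - real k\<bar>)) * epowr (b j) \<rho>))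
    \<Longrightarrow> weighted_lq 0 q a \<le> ennreal c * weighted_lq 0 q b"
    using weighted_lq_convolution_le[OF q \<rho> \<delta> E] by blast
  have main: "weighted_lq s q W \<le> ennreal c * weighted_lq s q U"
    if W: "\<And>k. epowr (W k) \<rho> \<le> ennreal C * (\<Sum>j. if j \<in> J k then epowr (ennreal (2 powr (\<gamma> * (real j - real k))) * U j) \<rho> else 0)"
      and J: "\<And>k j. j \<in> J k \<Longrightarrow> (\<gamma> - s) * \<rho> * (real j - real k) \<le> D - \<delta> * \<bar>real j - real k\<bar>" for U W
    unfolding weighted_lq_shift[OF q, of s]
  proof (rule c)
    fix k
    have p2: "epowr (ennreal (2 powr x)) \<rho> = ennreal (2 powr (x * \<rho>))" for x
      by (simp add: epowr_ennreal powr_powr)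
    have "epowr (ennreal (2 powr (s * real k)) * W k) \<rho> = ennreal (2 powr (s * real k * \<rho>)) * epowr (W k) \<rho>"
      by (simp only: epowr_mult p2)
    also have "\<dots> \<le> ennreal (2 powr (s * real k * \<rho>)) * (ennreal C * (\<Sum>j. if j \<in> J k then epowr (ennreal (2 powr (\<gamma> * (real j - real k))) * U j) \<rho> else 0))"
      by (rule mult_left_mono[OF W]) simp
    also have "\<dots> = ennreal C * (\<Sum>j. ennreal (2 powr (s * real k * \<rho>)) * (if j \<in> J k then epowr (ennreal (2 powr (\<gamma> * (real j - real k))) * U j) \<rho> else 0))"
      by (simp add: mult.left_commute)
    also have "\<dots> \<le> ennreal C * (\<Sum>j. ennreal (2 powr D) * (ennreal (2 powr (- \<delta> * \<bar>real j - real k\<bar>)) * epowr (ennreal (2 powr (s * real j)) * U j) \<rho>))"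
    proof (intro mult_left_mono suminf_le summableI)
      fix j
      show "ennreal (2 powr (s * real k * \<rho>)) * (if j \<in> J k then epowr (ennreal (2 powr (\<gamma> * (real j - real k))) * U j) \<rho> else 0)
          \<le> ennreal (2 powr D) * (ennreal (2 powr (- \<delta> * \<bar>real j - real k\<bar>)) * epowr (ennreal (2 powr (s * real j)) * U j) \<rho>)"
      proof (cases "j \<in> J k")
        case True
        have "ennreal (2 powr (s * real k * \<rho>)) * epowr (ennreal (2 powr (\<gamma> * (real j - real k))) * U j) \<rho>
            = ennreal (2 powr (s * real k * \<rho> + \<gamma> * (real j - real k) * \<rho>)) * epowr (U j) \<rho>"
          unfolding epowr_mult p2 by (simp add: powr_add ennreal_mult mult.assoc)
        also have "\<dots> \<le> ennreal (2 powr (D + - \<delta> * \<bar>real j - real k\<bar> + s * real j * \<rho>)) * epowr (U j) \<rho>"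
        proof (intro mult_right_mono ennreal_leI powr_mono)
          have "s * real k * \<rho> + \<gamma> * (real j - real k) * \<rho> = (\<gamma> - s) * \<rho> * (real j - real k) + s * real j * \<rho>"
            by (simp add: algebra_simps)
          then show "s * real k * \<rho> + \<gamma> * (real j - real k) * \<rho> \<le> D + - \<delta> * \<bar>real j - real k\<bar> + s * real j * \<rho>"
            using J[OF True] by simp
        qed auto
        also have "\<dots> = ennreal (2 powr D) * (ennreal (2 powr (- \<delta> * \<bar>real j - real k\<bar>)) * epowr (ennreal (2 powr (s * real j)) * U j) \<rho>)"
          unfolding epowr_mult p2 powr_add by (simp add: ennreal_mult mult.assoc)
        finally show ?thesis using True by simp
      qed simp
    qed simp
    also have "\<dots> = ennreal E * (\<Sum>j. ennreal (2 powr (- \<delta> * \<bar>real j - real k\<bar>)) * epowr (ennreal (2 powr (s * real j)) * U j) \<rho>)"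
      using C by (simp add: E_def ennreal_mult mult.assoc)
    finally show "epowr (ennreal (2 powr (s * real k)) * W k) \<rho>
        \<le> ennreal E * (\<Sum>j. ennreal (2 powr (- \<delta> * \<bar>real j - real k\<bar>)) * epowr (ennreal (2 powr (s * real j)) * U j) \<rho>)" .
  qed
  show ?thesis by (intro exI[of _ c] allI impI, elim conjE, rule main) blast+
qed

lemma ex_power2_ge: "\<exists>h::nat. (x::real) \<le> 2 ^ h \<and> 1 \<le> h"
proof -
  obtain n :: nat where "x < 2 ^ n" using real_arch_pow[of 2 x] by auto
  moreover have "(2::real) ^ n \<le> 2 ^ Suc n" by simp
  ultimately have "x \<le> 2 ^ Suc n" by linarith
  then show ?thesis by (intro exI[of _ "Suc n"]) simp
qed

section \<open>Band-limited representatives and pieces that vanish by spectral separation\<close>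

context
  fixes \<Psi> :: "real \<Rightarrow> real"
  assumes \<Psi>: "besov_cutoff \<Psi>"
begin

text \<open>Finiteness of the quasi-norms supplies the locally integrable representatives from which
  the construction starts. The bands may be declared wider than the spectra, A' instead of A, so
  that they reach up to all shells that still have to be estimated.\<close>

lemma band_limited_family:
  fixes u :: "nat \<Rightarrow> 'n::finite functional"
  assumes u: "\<And>j. tempered (u j)" and supp: "\<And>j. dist_support (dist_fourier (u j)) \<subseteq> {\<xi>. norm \<xi> \<le> A * 2 ^ j}"
    and A: "0 < A" "A \<le> A'" and fin: "\<And>j. Lp_norm p (u j) < top"
  obtains g where "\<And>j. band_limited \<Psi> (A' * 2 ^ j) (g j)"
    "\<And>j \<phi>. \<phi> \<in> schwartz \<Longrightarrow> u j \<phi> = (LINT x|lborel. g j x * \<phi> x)"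
proof -
  have "\<exists>g. band_limited \<Psi> (A' * 2 ^ j) g \<and> (\<forall>\<phi>\<in>schwartz. u j \<phi> = (LINT x|lborel. g x * \<phi> x))" for j
  proof -
    obtain f where f: "represents f (u j)"
      by (rule Lp_norm_finite_represents[of p "u j"]) (use fin[of j] in auto)
    have pos: "0 < A' * 2 ^ j" using A by simp
    have sub: "{\<xi>::real^'n. norm \<xi> \<le> A * 2 ^ j} \<subseteq> {\<xi>. norm \<xi> \<le> A' * 2 ^ j}"
    proof (rule Collect_mono, rule impI)
      fix \<xi> :: "real^'n" assume "norm \<xi> \<le> A * 2 ^ j"
      also have "\<dots> \<le> A' * 2 ^ j" using A by (intro mult_right_mono) auto
      finally show "norm \<xi> \<le> A' * 2 ^ j" .
    qed
    show ?thesis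
    proof (rule band_limited_representation[OF \<Psi> u f pos order_trans[OF supp sub]])
      fix g assume g: "band_limited \<Psi> (A' * 2 ^ j) g" "\<And>\<phi>. \<phi> \<in> schwartz \<Longrightarrow> u j \<phi> = (LINT x|lborel. g x * \<phi> x)"
      show ?thesis by (intro exI[of _ g] conjI ballI g)
    qed
  qed
  from choice[OF allI, OF this] show ?thesis
  proof (rule exE)
    fix g assume "\<forall>j. band_limited \<Psi> (A' * 2 ^ j) (g j) \<and> (\<forall>\<phi>\<in>schwartz. u j \<phi> = (LINT x|lborel. g j x * \<phi> x))"
    then show ?thesis by (intro that[of g]) auto
  qed
qed

lemma band_represents:
  "band_limited \<Psi> R g \<Longrightarrow> (\<And>\<phi>. \<phi> \<in> schwartz \<Longrightarrow> u \<phi> = (LINT x|lborel. g x * \<phi> x)) \<Longrightarrow> represents g u"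
  by (rule poly_growth_represents[OF band_limited_poly_growth[OF \<Psi>]]) (auto dest: test_functions_schwartz)

lemma nikolskii_dyadic:
  assumes A: "0 < A" and p: "0 < p" "p \<le> t" "t \<le> 1"
  shows "\<exists>c>0. \<forall>j g. band_limited \<Psi> (A * 2 ^ j) (g :: real^'n::finite \<Rightarrow> complex) \<longrightarrow>
    fun_Lp_norm (ennreal t) g \<le> ennreal (c * 2 powr ((real CARD('n) * (1 / p) - real CARD('n) * (1 / t)) * real j)) * fun_Lp_norm (ennreal p) g"
proof -
  define b where "b = band_const \<Psi> TYPE('n) 0 * A ^ CARD('n)"
  have b: "0 < b" using band_const_pos[OF \<Psi>, of 0, where 'n='n] A by (simp add: b_def)
  define e where "e = 1 / p - 1 / t"
  have "(band_const \<Psi> TYPE('n) 0 * (A * 2 ^ j) ^ CARD('n)) powr e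
      = b powr e * 2 powr ((real CARD('n) * (1 / p) - real CARD('n) * (1 / t)) * real j)" for j
  proof -
    have "band_const \<Psi> TYPE('n) 0 * (A * 2 ^ j) ^ CARD('n) = b * 2 powr (real j * real CARD('n))"
      by (simp add: b_def power_mult_distrib powr_realpow[symmetric] powr_powr)
    moreover have "real j * real CARD('n) * e = (real CARD('n) * (1 / p) - real CARD('n) * (1 / t)) * real j"
      by (simp add: e_def algebra_simps)
    ultimately show ?thesis using b by (simp only: powr_mult powr_powr)
  qed
  then have "fun_Lp_norm (ennreal t) g \<le> ennreal (b powr e * 2 powr ((real CARD('n) * (1 / p) - real CARD('n) * (1 / t)) * real j)) * fun_Lp_norm (ennreal p) g"
    if "band_limited \<Psi> (A * 2 ^ j) g" for j and g :: "real^'n \<Rightarrow> complex"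
    using nikolskii_inequality[OF \<Psi> that _ p] A by (simp add: fun_Lp_norm_eq e_def)
  then show ?thesis using b by (intro exI[of _ "b powr e"]) auto
qed

lemma exponent_loss_less_1:
  assumes "0 < r" "r \<le> 1"
  shows "exponent_loss TYPE('n::finite) (ennreal r) = real CARD('n) * (1 / r) - real CARD('n)"
proof -
  have "1 \<le> 1 / r" using assms by (simp add: field_simps)
  then have "real CARD('n) * 1 \<le> real CARD('n) * (1 / r)" by (intro mult_left_mono) auto
  then show ?thesis using assms by (simp add: exponent_loss_def[OF \<Psi>] recip_ennreal)
qed

lemma Lp_norm_max_1_dyadic:
  assumes A: "0 < A" and p: "0 < p"
  shows "\<exists>c>0. \<forall>j g. band_limited \<Psi> (A * 2 ^ j) (g :: real^'n::finite \<Rightarrow> complex) \<longrightarrow>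
    fun_Lp_norm (max 1 p) g \<le> ennreal (c * 2 powr (exponent_loss TYPE('n) p * real j)) * fun_Lp_norm p g"
proof (cases "1 \<le> p")
  case True
  then show ?thesis by (intro exI[of _ 1]) (auto simp: exponent_loss_ge_1[OF \<Psi>] max_def)
next
  case False
  then obtain r where r: "p = ennreal r" "0 < r" "r < 1" using p by (cases p) (auto simp: not_le)
  have m: "max 1 p = ennreal 1" using False by (simp add: max_def)
  show ?thesis
    using nikolskii_dyadic[OF A r(2), of 1, where 'n='n] r
    unfolding m r(1) by (simp add: exponent_loss_less_1)
qed

text \<open>For k > 0 both cut-offs in the k-th bump equal 1 when |\<xi>| < 11/20 * 2^k, so the bump
  vanishes there. From 2A <= 2^h and j + h + 1 <= k it follows that A 2^j <= 2^k / 4, which lies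
  strictly inside that ball.\<close>

lemma dyadic_piece_low_eq_0:
  fixes u :: "'n::finite functional"
  assumes u: "tempered u" and supp: "dist_support (dist_fourier u) \<subseteq> {\<xi>. norm \<xi> \<le> A * 2 ^ j}"
    and h: "2 * A \<le> 2 ^ h" and k: "j + h < k" and \<phi>: "\<phi> \<in> schwartz"
  shows "u (fourier (\<lambda>\<xi>. lp_bump \<Psi> k ((1 / 2 ^ k) *\<^sub>R \<xi>) * inv_fourier \<phi> \<xi>)) = 0"
proof (rule dist_fourier_mult_eq_0[OF \<Psi> u _ \<phi>, of _ "{\<xi>. 11/20 * 2 ^ k \<le> norm \<xi>}"])
  show "slowly_growing (\<lambda>\<xi>::real^'n. lp_bump \<Psi> k ((1 / 2 ^ k) *\<^sub>R \<xi>))"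
    by (intro schwartz_slowly_growing lp_bump_scaled_schwartz[OF \<Psi>])
  show "closed {\<xi>::real^'n. 11/20 * 2 ^ k \<le> norm \<xi>}" by (intro closed_Collect_le continuous_intros)
  show "lp_bump \<Psi> k ((1 / 2 ^ k) *\<^sub>R \<xi>) = 0" if "\<xi> \<notin> {\<xi>. 11/20 * 2 ^ k \<le> norm \<xi>}" for \<xi> :: "real^'n"
  proof -
    have n: "norm \<xi> / 2 ^ k < 11/20" using that by (simp add: divide_less_eq)
    have e: "norm ((1 / 2 ^ k) *\<^sub>R \<xi>) = norm \<xi> / 2 ^ k" by simp
    have "0 \<le> norm \<xi> / 2 ^ k" by simp
    then have "1 * norm ((1 / 2 ^ k) *\<^sub>R \<xi>) < 11/10" "2 * norm ((1 / 2 ^ k) *\<^sub>R \<xi>) < 11/10"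
      using n unfolding e by linarith+
    then have "cut \<Psi> 1 ((1 / 2 ^ k) *\<^sub>R \<xi>) = 1" "cut \<Psi> 2 ((1 / 2 ^ k) *\<^sub>R \<xi>) = 1"
      by (auto intro: cut_eq_1[OF \<Psi>])
    then show ?thesis using k by (simp add: lp_bump_def[OF \<Psi>])
  qed
  have "A * 2 ^ j < 11/20 * 2 ^ k"
  proof -
    have "2 * (A * 2 ^ j) \<le> 2 ^ h * 2 ^ j" using mult_right_mono[OF h, of "2 ^ j"] by simp
    also have "\<dots> = 2 ^ (j + h)" by (simp add: power_add)
    finally have "2 * (2 * (A * 2 ^ j)) \<le> 2 ^ Suc (j + h)" by simp
    also have "(2::real) ^ Suc (j + h) \<le> 2 ^ k" using k by (intro power_increasing) auto
    finally show ?thesis using zero_less_power[of "2::real" k] by linarith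
  qed
  then show "{\<xi>. 11/20 * 2 ^ k \<le> norm \<xi>} \<inter> dist_support (dist_fourier u) = {}" using supp by fastforce
qed

text \<open>The k-th bump vanishes for |\<xi>| > 13/10 * 2^k, whereas 2A <= 2^h and k + h < j push
  the spectrum beyond 2 * 2^k.\<close>

lemma dyadic_piece_high_eq_0:
  fixes u :: "'n::finite functional"
  assumes u: "tempered u" and supp: "dist_support (dist_fourier u) \<subseteq> {\<xi>. 1 / A * 2 ^ j \<le> norm \<xi>}"
    and h: "2 * A \<le> 2 ^ h" and A: "0 < A" and j: "k + h < j" and \<phi>: "\<phi> \<in> schwartz"
  shows "u (fourier (\<lambda>\<xi>. lp_bump \<Psi> k ((1 / 2 ^ k) *\<^sub>R \<xi>) * inv_fourier \<phi> \<xi>)) = 0"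
proof (rule dist_fourier_mult_eq_0[OF \<Psi> u _ \<phi>, of _ "{\<xi>. norm \<xi> \<le> 13/10 * 2 ^ k}"])
  show "slowly_growing (\<lambda>\<xi>::real^'n. lp_bump \<Psi> k ((1 / 2 ^ k) *\<^sub>R \<xi>))"
    by (intro schwartz_slowly_growing lp_bump_scaled_schwartz[OF \<Psi>])
  show "closed {\<xi>::real^'n. norm \<xi> \<le> 13/10 * 2 ^ k}" by (intro closed_Collect_le continuous_intros)
  show "lp_bump \<Psi> k ((1 / 2 ^ k) *\<^sub>R \<xi>) = 0" if "\<xi> \<notin> {\<xi>. norm \<xi> \<le> 13/10 * 2 ^ k}" for \<xi> :: "real^'n"
  proof -
    have n: "13/10 < norm \<xi> / 2 ^ k" using that by (simp add: less_divide_eq)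
    have e: "norm ((1 / 2 ^ k) *\<^sub>R \<xi>) = norm \<xi> / 2 ^ k" by simp
    have "1 * norm ((1 / 2 ^ k) *\<^sub>R \<xi>) > 13/10" "2 * norm ((1 / 2 ^ k) *\<^sub>R \<xi>) > 13/10"
      using n unfolding e by linarith+
    note c = this[THEN cut_eq_0[OF \<Psi>]]
    show ?thesis
    proof (cases "k = 0")
      case True
      then have "lp_bump \<Psi> k = (cut \<Psi> 1 :: real^'n \<Rightarrow> complex)" by (simp add: lp_bump_def[OF \<Psi>])
      then show ?thesis using c(1) by (simp only:)
    next
      case False
      then have "lp_bump \<Psi> k = (\<lambda>\<xi>::real^'n. cut \<Psi> 1 \<xi> - cut \<Psi> 2 \<xi>)" by (simp add: lp_bump_def[OF \<Psi>])
      then show ?thesis using c by (simp only: diff_zero)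
    qed
  qed
  have "13/10 * 2 ^ k < 1 / A * 2 ^ j"
  proof -
    have "2 * A * 2 ^ k \<le> 2 ^ h * 2 ^ k" by (rule mult_right_mono[OF h]) simp
    also have "\<dots> = 2 ^ (k + h)" by (simp add: power_add)
    also have "\<dots> \<le> (2::real) ^ j" using j by (intro power_increasing) auto
    finally have "2 * 2 ^ k \<le> 1 / A * 2 ^ j" using A by (simp add: field_simps)
    then show ?thesis using zero_less_power[of "2::real" k] by linarith
  qed
  then have "\<not> 1 / A * 2 ^ j \<le> norm \<xi>" if "norm \<xi> \<le> 13/10 * 2 ^ k" for \<xi> :: "real^'n"
    using that by linarith
  then show "{\<xi>. norm \<xi> \<le> 13/10 * 2 ^ k} \<inter> dist_support (dist_fourier u) = {}" using supp by blast
qed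

end

section \<open>Convergence and Besov bounds under a ball condition on the spectra\<close>

context
  fixes \<Psi> :: "real \<Rightarrow> real"
  assumes \<Psi>: "besov_cutoff \<Psi>"
begin

lemma series_bound_finite_term:
  assumes "0 < q" "series_bound s p q u < top" shows "Lp_norm p (u j) < top"
  using assms weighted_lq_finite_term[of q s "\<lambda>j. Lp_norm p (u j)" j] by (simp add: series_bound_def)

text \<open>For q <= 1 the l_q quasi-norm dominates the l_1 norm, so the series converges absolutely
  in L_p.\<close>

lemma Lp_sums_of_series_bound:
  fixes u :: "nat \<Rightarrow> 'n::finite functional"
  assumes p: "1 \<le> p" and q: "0 < q" "q \<le> 1" and u: "\<And>j. tempered (u j)" and fin: "series_bound 0 p q u < top"
  shows "\<exists>v. Lp_sums p u v \<and> Lp_norm p v \<le> series_bound 0 p q u"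
proof -
  have le: "(\<Sum>j. Lp_norm p (u j)) \<le> series_bound 0 p q u"
    using suminf_le_weighted_lq[of q 1 "\<lambda>j. Lp_norm p (u j)"] q by (simp add: series_bound_def)
  have "\<exists>f. represents f (u j)" for j
    by (rule Lp_norm_finite_represents[of p "u j"]) (use series_bound_finite_term[OF q(1) fin, of j] in auto)
  from choice[OF allI, OF this] show ?thesis
  proof (rule exE)
    fix f assume "\<forall>j. represents (f j) (u j)"
    then have f: "represents (f j) (u j)" for j by simp
    note S = Lp_sums_series[OF \<Psi> p u f le_less_trans[OF le fin]]
    show ?thesis by (rule exI, rule conjI, rule S(1), rule order_trans[OF S(2) le])
  qed
qed

text \<open>\<open>J k\<close> collects the terms that can meet the k-th shell. The finiteness of
  their sum in L_r, r = max 1 p, is qualitative: it makes the pieces of the sum functions and does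
  not influence c, which is fixed before the series is given.\<close>

lemma besov_sum_le:
  assumes p: "0 < p" and q: "0 < q" and A: "0 < A" and \<delta>: "0 < \<delta>"
    and J: "\<forall>k. \<forall>j\<in>J k. 2 ^ k \<le> A * 2 ^ j"
    and D: "\<forall>k. \<forall>j\<in>J k.
      (exponent_loss TYPE('n) p - s) * sub_exponent p * (real j - real k) \<le> D - \<delta> * \<bar>real j - real k\<bar>"
  shows "\<exists>c. \<forall>(u :: nat \<Rightarrow> 'n::finite functional) g v.
    tempered_sums u v \<and> (\<forall>j. band_limited \<Psi> (A * 2 ^ j) (g j)) \<and>
    (\<forall>j. \<forall>\<phi>\<in>schwartz. u j \<phi> = (LINT x|lborel. g j x * \<phi> x)) \<and>
    (\<forall>k j. j \<notin> J k \<longrightarrow> (\<forall>\<phi>\<in>schwartz. u j (fourier (\<lambda>\<xi>. lp_bump \<Psi> k ((1 / 2 ^ k) *\<^sub>R \<xi>) * inv_fourier \<phi> \<xi>)) = 0)) \<and>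
    (\<forall>k. (\<Sum>j. if j \<in> J k then fun_Lp_norm (max 1 p) (g j) else 0) < top) \<longrightarrow>
    besov_norm \<Psi> s p q v \<le> ennreal c * series_bound s p q u"
proof -
  let ?\<gamma> = "exponent_loss TYPE('n) p" and ?\<rho> = "sub_exponent p"
  have \<rho>: "0 < ?\<rho>" by (rule sub_exponent_pos[OF \<Psi> p])
  from dyadic_piece_estimate[OF \<Psi> p A, where 'n='n] show ?thesis
  proof (elim exE conjE)
    fix C :: real assume C: "0 < C" and est: "\<forall>(u :: nat \<Rightarrow> 'n functional) g v J k.
      tempered_sums u v \<and> (\<forall>j. band_limited \<Psi> (A * 2 ^ j) (g j)) \<and>
      (\<forall>j. \<forall>\<phi>\<in>schwartz. u j \<phi> = (LINT x|lborel. g j x * \<phi> x)) \<and>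
      (\<forall>j\<in>J. 2 ^ k \<le> A * 2 ^ j) \<and>
      (\<forall>j. j \<notin> J \<longrightarrow> (\<forall>\<phi>\<in>schwartz. u j (fourier (\<lambda>\<xi>. lp_bump \<Psi> k ((1 / 2 ^ k) *\<^sub>R \<xi>) * inv_fourier \<phi> \<xi>)) = 0)) \<and>
      (\<Sum>j. if j \<in> J then fun_Lp_norm (max 1 p) (g j) else 0) < top \<longrightarrow>
      epowr (Lp_norm p (dist_inv_fourier (dist_mult (dyadic \<Psi> k) (dist_fourier v)))) ?\<rho>
        \<le> ennreal C * (\<Sum>j. if j \<in> J then epowr (ennreal (2 powr (?\<gamma> * (real j - real k))) * Lp_norm p (u j)) ?\<rho> else 0)"
    from weighted_lq_pieces_le[OF q \<rho> \<delta> C, of J ?\<gamma> s D] show ?thesis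
    proof (elim exE)
      fix c assume c: "\<forall>U W. (\<forall>k. epowr (W k) ?\<rho> \<le> ennreal C * (\<Sum>j. if j \<in> J k then epowr (ennreal (2 powr (?\<gamma> * (real j - real k))) * U j) ?\<rho> else 0))
        \<and> (\<forall>k. \<forall>j\<in>J k. (?\<gamma> - s) * ?\<rho> * (real j - real k) \<le> D - \<delta> * \<bar>real j - real k\<bar>)
        \<longrightarrow> weighted_lq s q W \<le> ennreal c * weighted_lq s q U"
      show ?thesis
        unfolding besov_norm_def series_bound_def
        by (intro exI[of _ c] allI impI, elim conjE, rule c[rule_format], intro conjI D allI,
            rule est[rule_format], intro conjI) (auto simp: J)
    qed
  qed
qed

text \<open>The Nikolskii loss against the weight contained in B leaves a geometric factor. It is
  summable when s exceeds the loss, which gives convergence under the ball condition; otherwise it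
  is an exponential growth in j, which the ring condition has to beat.\<close>

lemma band_sum_norm_dyadic:
  assumes A: "0 < A" and p: "0 < p" and q: "0 < q"
  shows "\<exists>c>0. \<forall>(u :: nat \<Rightarrow> 'n::finite functional) g j s.
    band_limited \<Psi> (A * 2 ^ j) (g j) \<and> (\<forall>\<phi>\<in>schwartz. u j \<phi> = (LINT x|lborel. g j x * \<phi> x)) \<longrightarrow>
    fun_Lp_norm (max 1 p) (g j)
      \<le> ennreal c * series_bound s p q u * ennreal (2 powr ((exponent_loss TYPE('n) p - s) * real j))"
proof -
  let ?\<gamma> = "exponent_loss TYPE('n) p"
  from Lp_norm_max_1_dyadic[OF \<Psi> A p, where 'n='n] show ?thesis
  proof (elim exE conjE)
    fix e :: real assume e: "0 < e" "\<forall>j g. band_limited \<Psi> (A * 2 ^ j) (g :: real^'n \<Rightarrow> complex) \<longrightarrow>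
      fun_Lp_norm (max 1 p) g \<le> ennreal (e * 2 powr (?\<gamma> * real j)) * fun_Lp_norm p g"
    have main: "fun_Lp_norm (max 1 p) (g j) \<le> ennreal e * series_bound s p q u * ennreal (2 powr ((?\<gamma> - s) * real j))"
      if g: "band_limited \<Psi> (A * 2 ^ j) (g j)" and ug: "\<And>\<phi>. \<phi> \<in> schwartz \<Longrightarrow> u j \<phi> = (LINT x|lborel. g j x * \<phi> x)"
      for u :: "nat \<Rightarrow> 'n functional" and g :: "nat \<Rightarrow> real^'n \<Rightarrow> complex" and j s
    proof -
      have "fun_Lp_norm (max 1 p) (g j) \<le> ennreal (e * 2 powr (?\<gamma> * real j)) * Lp_norm p (u j)"
      proof -
        have "represents (g j) (u j)" by (rule band_represents[OF \<Psi> g ug])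
        then have "Lp_norm p (u j) = fun_Lp_norm p (g j)" by (rule Lp_norm_eq[OF \<Psi> p])
        then show ?thesis using e(2) g by simp
      qed
      also have "\<dots> = ennreal e * (ennreal (2 powr (s * real j)) * Lp_norm p (u j)) * ennreal (2 powr ((?\<gamma> - s) * real j))"
      proof -
        have "2 powr (?\<gamma> * real j) = 2 powr (s * real j) * 2 powr ((?\<gamma> - s) * real j)"
          by (simp add: algebra_simps flip: powr_add)
        then show ?thesis using e(1) by (simp add: ennreal_mult mult_ac)
      qed
      also have "\<dots> \<le> ennreal e * series_bound s p q u * ennreal (2 powr ((?\<gamma> - s) * real j))"
        unfolding series_bound_def by (intro mult_right_mono mult_left_mono weighted_lq_term_le q) auto
      finally show ?thesis .
    qed
    show ?thesis
      by (intro exI[of _ e] conjI allI impI e(1), elim conjE, rule main) auto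
  qed
qed

lemma band_sums_besov:
  assumes p: "0 < p" and q: "0 < q" and A: "0 < A" and s: "exponent_loss TYPE('n::finite) p < s"
  shows "\<exists>c. \<forall>u :: nat \<Rightarrow> 'n functional. (\<forall>j. tempered (u j)) \<and>
    (\<forall>j. dist_support (dist_fourier (u j)) \<subseteq> {\<xi>. norm \<xi> \<le> A * 2 ^ j}) \<and> series_bound s p q u < \<infinity> \<longrightarrow>
    (\<exists>v. tempered_sums u v \<and> v \<in> besov \<Psi> s p q \<and> besov_norm \<Psi> s p q v \<le> ennreal c * series_bound s p q u)"
proof -
  let ?\<gamma> = "exponent_loss TYPE('n) p" and ?\<rho> = "sub_exponent p" and ?r = "max 1 p"
  have r: "1 \<le> ?r" by simp
  have \<rho>: "0 < ?\<rho>" by (rule sub_exponent_pos[OF \<Psi> p])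
  obtain h where h: "2 * A \<le> 2 ^ h" using ex_power2_ge[of "2 * A"] by blast
  \<comment> \<open>The terms with j >= k - h survive in the k-th piece; the widened band guarantees
    2^k <= A' 2^j for all of them, as the multiplier bound demands.\<close>
  define A' where "A' = max A (2 ^ h)"
  have A': "0 < A'" "A \<le> A'" "2 ^ h \<le> A'" using A by (auto simp: A'_def)
  define J where "J = (\<lambda>k. {j. k \<le> j + h})"
  define \<delta> where "\<delta> = (s - ?\<gamma>) * ?\<rho>"
  have \<delta>: "0 < \<delta>" using s \<rho> by (simp add: \<delta>_def)
  \<comment> \<open>For j >= k - h the distance |j - k| exceeds j - k by at most 2h. So the
    one-sided decay in j - k becomes two-sided at the cost of this constant.\<close>
  define D where "D = 2 * \<delta> * real h"
  have J: "\<forall>k. \<forall>j\<in>J k. 2 ^ k \<le> A' * 2 ^ j"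
  proof (intro allI ballI)
    fix k j assume that: "j \<in> J k"
    have "(2::real) ^ k \<le> 2 ^ (h + j)" using that by (intro power_increasing) (auto simp: J_def)
    also have "\<dots> \<le> A' * 2 ^ j" unfolding power_add by (intro mult_right_mono A') auto
    finally show "2 ^ k \<le> A' * 2 ^ j" .
  qed
  have Jc: "\<forall>k. \<forall>j\<in>J k. (?\<gamma> - s) * ?\<rho> * (real j - real k) \<le> D - \<delta> * \<bar>real j - real k\<bar>"
  proof (intro allI ballI)
    fix k j assume "j \<in> J k"
    then have "real k - real j \<le> real h" by (simp add: J_def)
    then have "\<bar>real j - real k\<bar> - (real j - real k) \<le> 2 * real h" by auto
    from mult_left_mono[OF this less_imp_le[OF \<delta>]] show "(?\<gamma> - s) * ?\<rho> * (real j - real k) \<le> D - \<delta> * \<bar>real j - real k\<bar>"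
      by (simp add: D_def \<delta>_def algebra_simps)
  qed
  from besov_sum_le[OF p q A'(1) \<delta> J Jc] show ?thesis
  proof (elim exE)
    fix c assume c: "\<forall>(u :: nat \<Rightarrow> 'n functional) g v.
      tempered_sums u v \<and> (\<forall>j. band_limited \<Psi> (A' * 2 ^ j) (g j)) \<and>
      (\<forall>j. \<forall>\<phi>\<in>schwartz. u j \<phi> = (LINT x|lborel. g j x * \<phi> x)) \<and>
      (\<forall>k j. j \<notin> J k \<longrightarrow> (\<forall>\<phi>\<in>schwartz. u j (fourier (\<lambda>\<xi>. lp_bump \<Psi> k ((1 / 2 ^ k) *\<^sub>R \<xi>) * inv_fourier \<phi> \<xi>)) = 0)) \<and>
      (\<forall>k. (\<Sum>j. if j \<in> J k then fun_Lp_norm ?r (g j) else 0) < top) \<longrightarrow>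
      besov_norm \<Psi> s p q v \<le> ennreal c * series_bound s p q u"
    have main: "\<exists>v. tempered_sums u v \<and> v \<in> besov \<Psi> s p q \<and> besov_norm \<Psi> s p q v \<le> ennreal c * series_bound s p q u"
      if u: "\<And>j. tempered (u j)" and supp: "\<And>j. dist_support (dist_fourier (u j)) \<subseteq> {\<xi>. norm \<xi> \<le> A * 2 ^ j}"
        and fin: "series_bound s p q u < top" for u :: "nat \<Rightarrow> 'n functional"
    proof (rule band_limited_family[OF \<Psi> u supp A A'(2) series_bound_finite_term[OF q fin]])
      fix g assume g: "\<And>j. band_limited \<Psi> (A' * 2 ^ j) (g j)"
        and ug: "\<And>j \<phi>. \<phi> \<in> schwartz \<Longrightarrow> u j \<phi> = (LINT x|lborel. g j x * \<phi> x)"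
      have gm: "g j \<in> borel_measurable borel" for j by (rule band_limited_measurable[OF \<Psi> g])
      have finr: "(\<Sum>j. fun_Lp_norm ?r (g j)) < top"
      proof -
        let ?x = "\<lambda>j. 2 powr ((?\<gamma> - s) * real j)"
        have x: "?x j = (2 powr (?\<gamma> - s)) ^ j" for j by (simp add: powr_powr flip: powr_realpow)
        have "2 powr (?\<gamma> - s) < 1" using s by (simp add: powr_less_one)
        then have sx: "summable ?x" unfolding x by (intro summable_geometric) simp
        from band_sum_norm_dyadic[OF A'(1) p q, where 'n='n] show ?thesis
        proof (elim exE conjE)
          fix e :: real assume e: "\<forall>(u :: nat \<Rightarrow> 'n functional) g j s.
            band_limited \<Psi> (A' * 2 ^ j) (g j) \<and> (\<forall>\<phi>\<in>schwartz. u j \<phi> = (LINT x|lborel. g j x * \<phi> x)) \<longrightarrow>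
            fun_Lp_norm ?r (g j) \<le> ennreal e * series_bound s p q u * ennreal (2 powr ((?\<gamma> - s) * real j))"
          have le: "(\<Sum>j. fun_Lp_norm ?r (g j)) \<le> (\<Sum>j. (ennreal e * series_bound s p q u) * ennreal (?x j))"
          proof (intro suminf_le summableI)
            fix j
            have "\<forall>\<phi>\<in>schwartz. u j \<phi> = (LINT x|lborel. g j x * \<phi> x)" using ug by simp
            with g[of j] show "fun_Lp_norm ?r (g j) \<le> (ennreal e * series_bound s p q u) * ennreal (?x j)"
              by (intro e[THEN spec[of _ u], THEN spec[of _ g], THEN spec[of _ j], THEN spec[of _ s], THEN mp] conjI)
          qed
          have "ennreal e * series_bound s p q u < top" unfolding ennreal_mult_less_top using fin by (intro disjI2 conjI ennreal_less_top)
          moreover have "(\<Sum>j. ennreal (?x j)) < top" unfolding less_top[symmetric] by (rule ennreal_suminf_neq_top[OF sx]) simp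
          ultimately have "(ennreal e * series_bound s p q u) * (\<Sum>j. ennreal (?x j)) < top"
            by (simp only: ennreal_mult_less_top simp_thms)
          with le show ?thesis unfolding ennreal_suminf_cmult by (rule le_less_trans)
        qed
      qed
      note S = Lr_series[OF r gm finr]
      define v where "v = (\<lambda>\<phi>. LINT x|lborel. (\<Sum>j. g j x) * \<phi> x)"
      have tv: "tempered v" unfolding v_def by (rule Lr_tempered(1)[OF r S(1) le_less_trans[OF S(3) finr]])
      have sums: "tempered_sums u v" unfolding tempered_sums_def v_def using S(5) ug by simp
      have bn: "besov_norm \<Psi> s p q v \<le> ennreal c * series_bound s p q u"
      proof (rule c[THEN spec[of _ u], THEN spec[of _ g], THEN spec[of _ v], THEN mp], intro conjI allI ballI impI sums g ug)
        show "u j (fourier (\<lambda>\<xi>. lp_bump \<Psi> k ((1 / 2 ^ k) *\<^sub>R \<xi>) * inv_fourier \<phi> \<xi>)) = 0"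
          if "j \<notin> J k" "\<phi> \<in> schwartz" for j k \<phi>
          by (rule dyadic_piece_low_eq_0[OF \<Psi> u supp h _ that(2)]) (use that(1) in \<open>simp add: J_def\<close>)
        have "(\<Sum>j. if j \<in> J k then fun_Lp_norm ?r (g j) else 0) \<le> (\<Sum>j. fun_Lp_norm ?r (g j))" for k
          by (intro suminf_le summableI) auto
        then show "(\<Sum>j. if j \<in> J k then fun_Lp_norm ?r (g j) else 0) < top" for k using finr by (rule le_less_trans)
      qed
      also have "\<dots> < top" using fin by (simp add: ennreal_mult_less_top)
      finally have "v \<in> besov \<Psi> s p q" using tv by (simp add: besov_def)
      then show ?thesis using sums bn by blast
    qed
    show ?thesis
      by (intro exI[of _ c] allI impI, elim conjE, rule main) auto
  qed
qed

end

text \<open>One seminorm bounds all terms, with geometrically decreasing constants; the limit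
  inherits that seminorm, and its temperedness follows without a uniform boundedness
  principle.\<close>

lemma tempered_sums_of_geometric_bound:
  fixes u :: "nat \<Rightarrow> 'n::finite functional"
  assumes u: "\<And>j. tempered (u j)"
    and C: "\<And>j \<phi>. \<phi> \<in> schwartz \<Longrightarrow> norm (u j \<phi>) \<le> C * (1 / 2) ^ j * schwartz_norm N \<phi>"
  shows "\<exists>v. tempered v \<and> tempered_sums u v"
proof -
  define v where "v = (\<lambda>\<phi>. \<Sum>j. u j \<phi>)"
  have geo: "(\<lambda>j. C * (1 / 2) ^ j * schwartz_norm N \<phi>) sums (C * 2 * schwartz_norm N \<phi>)" for \<phi> :: "real^'n \<Rightarrow> complex"
    using geometric_sums[of "1 / 2 :: real"] by (intro sums_mult2 sums_mult) simp
  have sm: "summable (\<lambda>j. norm (u j \<phi>))" if "\<phi> \<in> schwartz" for \<phi>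
    by (rule summable_comparison_test'[OF sums_summable[OF geo[of \<phi>]], of 0]) (use C[OF that] in simp)
  have us: "(\<lambda>j. u j \<phi>) sums v \<phi>" if "\<phi> \<in> schwartz" for \<phi>
    unfolding v_def by (rule summable_sums[OF summable_norm_cancel[OF sm[OF that]]])
  have "tempered v"
    unfolding tempered_def
  proof (intro conjI ballI allI exI)
    fix \<phi> \<psi> :: "real^'n \<Rightarrow> complex" and a b assume \<phi>: "\<phi> \<in> schwartz" and \<psi>: "\<psi> \<in> schwartz"
    have "(\<lambda>j. a * u j \<phi> + b * u j \<psi>) sums (a * v \<phi> + b * v \<psi>)"
      by (intro sums_add sums_mult us \<phi> \<psi>)
    then have "(\<lambda>j. u j (\<lambda>x. a * \<phi> x + b * \<psi> x)) sums (a * v \<phi> + b * v \<psi>)"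
      using tempered_linear[OF u \<phi> \<psi>] by simp
    then show "v (\<lambda>x. a * \<phi> x + b * \<psi> x) = a * v \<phi> + b * v \<psi>"
      unfolding v_def by (rule sums_unique[symmetric])
  next
    fix \<phi> :: "real^'n \<Rightarrow> complex" assume \<phi>: "\<phi> \<in> schwartz"
    have "norm (v \<phi>) \<le> (\<Sum>j. norm (u j \<phi>))" unfolding v_def by (rule summable_norm[OF sm[OF \<phi>]])
    also have "\<dots> \<le> C * 2 * schwartz_norm N \<phi>"
      using suminf_le[OF C[OF \<phi>] sm[OF \<phi>] sums_summable[OF geo]] sums_unique[OF geo, of \<phi>] by simp
    finally show "norm (v \<phi>) \<le> C * 2 * schwartz_norm N \<phi>" .
  qed
  moreover have "tempered_sums u v" unfolding tempered_sums_def using us by simp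
  ultimately show ?thesis by (intro exI[of _ v] conjI)
qed

section \<open>Weak convergence for spectra in dyadic rings\<close>

context
  fixes \<Psi> :: "real \<Rightarrow> real"
  assumes \<Psi>: "besov_cutoff \<Psi>"
begin

text \<open>On a distribution whose spectrum avoids a ball, a Schwartz function acts through the part of
  its Fourier transform outside the ball, which is small of any order in the radius.\<close>

lemma high_frequency_pairing:
  "\<exists>C N. \<forall>(u :: 'n::finite functional) K R \<phi>. tempered u \<and> 2 \<le> R \<and> 0 \<le> K \<and>
    dist_support (dist_fourier u) \<subseteq> {\<xi>. R \<le> norm \<xi>} \<and>
    (\<forall>\<phi>\<in>schwartz. norm (u \<phi>) \<le> K * schwartz_norm M \<phi>) \<and> \<phi> \<in> schwartz \<longrightarrow>
    norm (u \<phi>) \<le> C * K * (2 / R) ^ L * schwartz_norm N \<phi>"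
proof -
  obtain C1 N1 where C1: "0 \<le> C1" "\<forall>\<phi>\<in>schwartz. schwartz_norm M (fourier (\<phi> :: real^'n \<Rightarrow> complex)) \<le> C1 * schwartz_norm N1 \<phi>"
    using fourier_schwartz_op unfolding schwartz_op_def by blast
  obtain C2 where C2: "0 \<le> C2" "\<forall>t (\<phi>::real^'n \<Rightarrow> complex). 0 < t \<longrightarrow> t \<le> 1 \<longrightarrow> \<phi> \<in> schwartz \<longrightarrow>
    schwartz_norm N1 (\<lambda>x. (1 - cut \<Psi> t x) * \<phi> x) \<le> C2 * t ^ L * schwartz_norm (N1 + L) \<phi>"
    using schwartz_norm_cut_complement[OF \<Psi>, of N1 L, where 'n='n] by blast
  obtain C3 N3 where C3: "0 \<le> C3" "\<forall>\<phi>\<in>schwartz. schwartz_norm (N1 + L) (inv_fourier (\<phi> :: real^'n \<Rightarrow> complex)) \<le> C3 * schwartz_norm N3 \<phi>"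
    using inv_fourier_schwartz_op unfolding schwartz_op_def by blast
  have main: "norm (u \<phi>) \<le> (C1 * C2 * C3) * K * (2 / R) ^ L * schwartz_norm N3 \<phi>"
    if u: "tempered u" and R: "2 \<le> R" and K: "0 \<le> K" and supp: "dist_support (dist_fourier u) \<subseteq> {\<xi>. R \<le> norm \<xi>}"
      and b: "\<forall>\<phi>\<in>schwartz. norm (u \<phi>) \<le> K * schwartz_norm M \<phi>" and \<phi>: "\<phi> \<in> schwartz"
    for u :: "'n functional" and R K \<phi>
  proof -
    \<comment> \<open>Then \<open>cut \<Psi> t\<close> lives on |\<xi>| <= 13/20 * R, strictly
      inside the ball avoided by the spectrum, and R >= 2 gives t <= 1.\<close>
    define t where "t = 2 / R"
    have t: "0 < t" "t \<le> 1" using R by (auto simp: t_def)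
    let ?\<psi> = "inv_fourier \<phi>"
    have \<psi>: "?\<psi> \<in> schwartz" by (rule inv_fourier_schwartz[OF \<phi>])
    have sc: "(\<lambda>\<xi>. cut \<Psi> t \<xi> * ?\<psi> \<xi>) \<in> schwartz"
      by (intro schwartz_mult schwartz_slowly_growing cut_schwartz[OF \<Psi>] t \<psi>)
    have sd: "(\<lambda>\<xi>. (1 - cut \<Psi> t \<xi>) * ?\<psi> \<xi>) \<in> schwartz"
      by (intro schwartz_mult slowly_growing_cut_complement[OF \<Psi>] t \<psi>)
    let ?\<eta> = "fourier (\<lambda>\<xi>. (1 - cut \<Psi> t \<xi>) * ?\<psi> \<xi>)"
    have low: "u (fourier (\<lambda>\<xi>. cut \<Psi> t \<xi> * ?\<psi> \<xi>)) = 0"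
    proof (rule dist_fourier_mult_eq_0[OF \<Psi> u _ \<phi>, of _ "{\<xi>. norm \<xi> \<le> 13/20 * R}"])
      show "slowly_growing (cut \<Psi> t :: real^'n \<Rightarrow> complex)" by (intro schwartz_slowly_growing cut_schwartz[OF \<Psi>] t)
      show "closed {\<xi>::real^'n. norm \<xi> \<le> 13/20 * R}" by (intro closed_Collect_le continuous_intros)
      show "cut \<Psi> t \<xi> = 0" if "\<xi> \<notin> {\<xi>. norm \<xi> \<le> 13/20 * R}" for \<xi> :: "real^'n"
        by (rule cut_eq_0[OF \<Psi>]) (use that R in \<open>simp add: t_def field_simps\<close>)
      have "\<not> R \<le> norm \<xi>" if "norm \<xi> \<le> 13/20 * R" for \<xi> :: "real^'n" using that R by linarith
      then show "{\<xi>. norm \<xi> \<le> 13/20 * R} \<inter> dist_support (dist_fourier u) = {}" using supp by blast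
    qed
    have split: "\<phi> = (\<lambda>x. fourier (\<lambda>\<xi>. cut \<Psi> t \<xi> * ?\<psi> \<xi>) x + ?\<eta> x)"
    proof -
      have "(\<lambda>x. fourier (\<lambda>\<xi>. cut \<Psi> t \<xi> * ?\<psi> \<xi>) x + ?\<eta> x) = fourier (\<lambda>\<xi>. cut \<Psi> t \<xi> * ?\<psi> \<xi> + (1 - cut \<Psi> t \<xi>) * ?\<psi> \<xi>)"
        by (rule ext) (simp only: fourier_add[OF schwartz_integrable[OF sc] schwartz_integrable[OF sd]])
      also have "\<dots> = fourier ?\<psi>" by (simp add: algebra_simps)
      finally show ?thesis using fourier_inversion[OF \<phi>] by simp
    qed
    have add: "u (\<lambda>x. fourier (\<lambda>\<xi>. cut \<Psi> t \<xi> * ?\<psi> \<xi>) x + ?\<eta> x) = u (fourier (\<lambda>\<xi>. cut \<Psi> t \<xi> * ?\<psi> \<xi>)) + u ?\<eta>"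
      by (rule tempered_add[OF u fourier_schwartz[OF sc] fourier_schwartz[OF sd]])
    have "u \<phi> = u ?\<eta>" by (rule trans[OF arg_cong[OF split, of u]]) (simp only: add low add_0)
    then have "norm (u \<phi>) \<le> K * schwartz_norm M ?\<eta>" using b fourier_schwartz[OF sd] by simp
    also have "\<dots> \<le> K * (C1 * schwartz_norm N1 (\<lambda>\<xi>. (1 - cut \<Psi> t \<xi>) * ?\<psi> \<xi>))"
      by (intro mult_left_mono K C1(2)[rule_format] sd)
    also have "\<dots> \<le> K * (C1 * (C2 * t ^ L * schwartz_norm (N1 + L) ?\<psi>))"
      by (intro mult_left_mono K C1(1) C2(2)[rule_format] t \<psi>)
    also have "\<dots> \<le> K * (C1 * (C2 * t ^ L * (C3 * schwartz_norm N3 \<phi>)))"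
      using t by (intro mult_left_mono K C1(1) C3(2)[rule_format] \<phi> mult_nonneg_nonneg C2(1)) auto
    also have "\<dots> = (C1 * C2 * C3) * K * (2 / R) ^ L * schwartz_norm N3 \<phi>" by (simp only: t_def mult_ac)
    finally show ?thesis .
  qed
  show ?thesis
    by (intro exI[of _ "C1 * C2 * C3"] exI[of _ N3] allI impI, elim conjE, rule main) auto
qed

text \<open>The bound for the pairing with u j may grow like 2^(\<tau> j), but in a fixed seminorm
  of the test function. Once the ring lies outside the ball of radius 2, the pairing gains (2 / R)^L
  with R of order 2^j, and a large L turns growth into decay.\<close>

lemma ring_sums_tempered:
  fixes u :: "nat \<Rightarrow> 'n::finite functional"
  assumes A: "0 < A" and p: "0 < p" and q: "0 < q" and A': "0 < A'" and u: "\<And>j. tempered (u j)"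
    and ring: "\<And>j. 0 < j \<Longrightarrow> dist_support (dist_fourier (u j)) \<subseteq> {\<xi>. 1 / A * 2 ^ j \<le> norm \<xi>}"
    and fin: "series_bound s p q u < top" and g: "\<And>j. band_limited \<Psi> (A' * 2 ^ j) (g j)"
    and ug: "\<And>j \<phi>. \<phi> \<in> schwartz \<Longrightarrow> u j \<phi> = (LINT x|lborel. g j x * \<phi> x)"
  shows "\<exists>v. tempered v \<and> tempered_sums u v"
proof -
  let ?\<gamma> = "exponent_loss TYPE('n) p" and ?r = "max 1 p" and ?M = "2 * CARD('n)"
  have r: "1 \<le> ?r" by simp
  define b where "b = enn2real (series_bound s p q u)"
  have b: "series_bound s p q u = ennreal b" "0 \<le> b" using fin by (auto simp: b_def)
  define \<tau> where "\<tau> = ?\<gamma> - s"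
  obtain e where e: "0 < e" "\<forall>(u :: nat \<Rightarrow> 'n functional) g j s.
      band_limited \<Psi> (A' * 2 ^ j) (g j) \<and> (\<forall>\<phi>\<in>schwartz. u j \<phi> = (LINT x|lborel. g j x * \<phi> x)) \<longrightarrow>
      fun_Lp_norm ?r (g j) \<le> ennreal e * series_bound s p q u * ennreal (2 powr ((?\<gamma> - s) * real j))"
    using band_sum_norm_dyadic[OF \<Psi> A' p q, where 'n='n] by (elim exE conjE) (rule that)
  have gj: "fun_Lp_norm ?r (g j) \<le> ennreal (e * b * 2 powr (\<tau> * real j))" for j
  proof -
    have "\<forall>\<phi>\<in>schwartz. u j \<phi> = (LINT x|lborel. g j x * \<phi> x)" using ug by simp
    with g[of j] have "fun_Lp_norm ?r (g j) \<le> ennreal e * series_bound s p q u * ennreal (2 powr ((?\<gamma> - s) * real j))"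
      by (intro e(2)[THEN spec[of _ u], THEN spec[of _ g], THEN spec[of _ j], THEN spec[of _ s], THEN mp] conjI)
    then show ?thesis using e(1) b(2) by (simp add: b(1) \<tau>_def ennreal_mult)
  qed
  define m where "m = (decay_mass TYPE('n) + 1) * (e * b)"
  have m: "0 \<le> m" using decay_mass_nonneg[where 'n='n] e(1) b(2) by (simp add: m_def)
  have direct: "norm (u j \<phi>) \<le> (m * 2 powr (\<tau> * real j)) * schwartz_norm ?M \<phi>" if \<phi>: "\<phi> \<in> schwartz" for j \<phi>
  proof -
    have gf: "fun_Lp_norm ?r (g j) < top" using gj[of j] ennreal_less_top by (rule le_less_trans)
    have "ennreal (norm (u j \<phi>)) \<le> ennreal (schwartz_norm ?M \<phi> * (decay_mass TYPE('n) + 1)) * fun_Lp_norm ?r (g j)"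
      unfolding ug[OF \<phi>] by (rule Lr_pairing(2)[OF r band_limited_measurable[OF \<Psi> g] gf \<phi>])
    also have "\<dots> \<le> ennreal (schwartz_norm ?M \<phi> * (decay_mass TYPE('n) + 1)) * ennreal (e * b * 2 powr (\<tau> * real j))"
      by (intro mult_left_mono gj) simp
    also have "\<dots> = ennreal ((m * 2 powr (\<tau> * real j)) * schwartz_norm ?M \<phi>)"
      using e(1) b(2) decay_mass_nonneg[where 'n='n] schwartz_norm_nonneg[OF \<phi>]
      by (simp add: m_def mult_ac flip: ennreal_mult)
    finally show ?thesis using m schwartz_norm_nonneg[OF \<phi>] by (subst (asm) ennreal_le_iff) auto
  qed
  \<comment> \<open>The gain 2^(- L j) has to beat the growth 2^(\<tau> j) and leave the summable
    factor 2^(- j).\<close>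
  define L where "L = nat \<lceil>\<tau> + 1\<rceil>"
  have L: "\<tau> + 1 \<le> real L" unfolding L_def by (rule real_nat_ceiling_ge)
  obtain C N where CN: "\<forall>(u :: 'n functional) K R \<phi>. tempered u \<and> 2 \<le> R \<and> 0 \<le> K \<and>
    dist_support (dist_fourier u) \<subseteq> {\<xi>. R \<le> norm \<xi>} \<and>
    (\<forall>\<phi>\<in>schwartz. norm (u \<phi>) \<le> K * schwartz_norm ?M \<phi>) \<and> \<phi> \<in> schwartz \<longrightarrow>
    norm (u \<phi>) \<le> C * K * (2 / R) ^ L * schwartz_norm N \<phi>"
    using high_frequency_pairing[of ?M L, where 'n='n] by (elim exE) (rule that)
  \<comment> \<open>From j >= h on, the inner radius 2^j / A is at least 2, and 1 <= h ensures j >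
    0, where the ring condition is available.\<close>
  obtain h where h: "2 * A \<le> 2 ^ h" "1 \<le> h" using ex_power2_ge[of "2 * A"] by blast
  \<comment> \<open>The first summand serves j >= h; the second serves the finitely many j < h,
    where 2^h (1/2)^j >= 1 brings the direct bound into geometric form.\<close>
  define E where "E = \<bar>C\<bar> * m * (2 * A) ^ L + m * 2 powr (\<bar>\<tau>\<bar> * real h) * 2 ^ h"
  have E1: "0 \<le> \<bar>C\<bar> * m * (2 * A) ^ L" and E2: "0 \<le> m * 2 powr (\<bar>\<tau>\<bar> * real h) * 2 ^ h" using m A by auto
  have "norm (u j \<phi>) \<le> E * (1 / 2) ^ j * schwartz_norm (max N ?M) \<phi>" if \<phi>: "\<phi> \<in> schwartz" for j \<phi>
  proof (cases "h \<le> j")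
    case True
    define R where "R = 1 / A * 2 ^ j"
    have "2 * A \<le> 2 ^ j" by (rule order_trans[OF h(1) power_increasing[OF True]]) simp
    then have R: "2 \<le> R" using A by (simp add: R_def field_simps)
    have "norm (u j \<phi>) \<le> C * (m * 2 powr (\<tau> * real j)) * (2 / R) ^ L * schwartz_norm N \<phi>"
    proof (rule CN[rule_format], intro conjI ballI)
      show "dist_support (dist_fourier (u j)) \<subseteq> {\<xi>. R \<le> norm \<xi>}" unfolding R_def using True h(2) by (intro ring) simp
    qed (use u R m direct \<phi> in auto)
    also have "\<dots> \<le> \<bar>C\<bar> * (m * 2 powr (\<tau> * real j)) * (2 / R) ^ L * schwartz_norm N \<phi>"
      using m R schwartz_norm_nonneg[OF \<phi>] by (intro mult_right_mono) auto
    also have "\<dots> = (\<bar>C\<bar> * m * (2 * A) ^ L) * 2 powr (\<tau> * real j - real L * real j) * schwartz_norm N \<phi>"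
      by (simp add: R_def powr_diff power_divide power_mult_distrib powr_realpow[symmetric] powr_powr mult_ac)
    also have "\<dots> \<le> (\<bar>C\<bar> * m * (2 * A) ^ L) * (1 / 2) ^ j * schwartz_norm (max N ?M) \<phi>"
    proof (intro mult_mono mult_nonneg_nonneg E1 mult_left_mono schwartz_norm_mono \<phi> schwartz_norm_nonneg)
      have "(\<tau> + 1) * real j \<le> real L * real j" by (intro mult_right_mono L) simp
      then have "2 powr (\<tau> * real j - real L * real j) \<le> 2 powr (- real j)" by (intro powr_mono) (auto simp: distrib_right)
      also have "\<dots> = (1 / 2) ^ j" by (simp add: powr_minus_divide powr_realpow power_one_over)
      finally show "2 powr (\<tau> * real j - real L * real j) \<le> (1 / 2) ^ j" .
    qed (use m A in auto)
    also have "\<dots> \<le> E * (1 / 2) ^ j * schwartz_norm (max N ?M) \<phi>"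
      using E2 by (intro mult_right_mono schwartz_norm_nonneg \<phi>) (auto simp: E_def)
    finally show ?thesis .
  next
    case False
    have "\<tau> * real j \<le> \<bar>\<tau>\<bar> * real j" by (intro mult_right_mono) auto
    also have "\<dots> \<le> \<bar>\<tau>\<bar> * real h" using False by (intro mult_left_mono) auto
    finally have le: "2 powr (\<tau> * real j) \<le> 2 powr (\<bar>\<tau>\<bar> * real h)" by (rule powr_mono) simp
    have "norm (u j \<phi>) \<le> (m * 2 powr (\<tau> * real j)) * schwartz_norm ?M \<phi>" by (rule direct[OF \<phi>])
    also have "\<dots> \<le> (m * 2 powr (\<bar>\<tau>\<bar> * real h)) * schwartz_norm (max N ?M) \<phi>"
      by (intro mult_mono le schwartz_norm_mono \<phi> schwartz_norm_nonneg) (use m in auto)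
    also have "\<dots> \<le> (m * 2 powr (\<bar>\<tau>\<bar> * real h)) * (2 ^ h * (1 / 2) ^ j) * schwartz_norm (max N ?M) \<phi>"
    proof -
      have "1 \<le> (2::real) ^ h * (1 / 2) ^ j"
        using power_increasing[of j h "2::real"] False by (simp add: power_one_over field_simps)
      then have "(m * 2 powr (\<bar>\<tau>\<bar> * real h)) * 1 \<le> (m * 2 powr (\<bar>\<tau>\<bar> * real h)) * (2 ^ h * (1 / 2) ^ j)"
        using m by (intro mult_left_mono) auto
      then show ?thesis by (intro mult_right_mono schwartz_norm_nonneg \<phi>) simp
    qed
    also have "\<dots> = (m * 2 powr (\<bar>\<tau>\<bar> * real h) * 2 ^ h) * (1 / 2) ^ j * schwartz_norm (max N ?M) \<phi>"
      by (simp only: mult.assoc)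
    also have "\<dots> \<le> E * (1 / 2) ^ j * schwartz_norm (max N ?M) \<phi>"
      using E1 by (intro mult_right_mono schwartz_norm_nonneg \<phi>) (auto simp: E_def)
    finally show ?thesis .
  qed
  then show ?thesis by (rule tempered_sums_of_geometric_bound[OF u])
qed

end

section \<open>Besov bounds for spectra in rings and in the limiting case\<close>

context
  fixes \<Psi> :: "real \<Rightarrow> real"
  assumes \<Psi>: "besov_cutoff \<Psi>"
begin

lemma ring_sums_besov:
  assumes p: "0 < p" and q: "0 < q" and A: "0 < A"
  shows "\<exists>c. \<forall>u :: nat \<Rightarrow> 'n::finite functional. (\<forall>j. tempered (u j)) \<and>
    (\<forall>j. dist_support (dist_fourier (u j)) \<subseteq> {\<xi>. norm \<xi> \<le> A * 2 ^ j}) \<and>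
    (\<forall>j>0. dist_support (dist_fourier (u j)) \<subseteq> {\<xi>. 1 / A * 2 ^ j \<le> norm \<xi> \<and> norm \<xi> \<le> A * 2 ^ j}) \<and>
    series_bound s p q u < \<infinity> \<longrightarrow>
    (\<exists>v. tempered_sums u v \<and> v \<in> besov \<Psi> s p q \<and> besov_norm \<Psi> s p q v \<le> ennreal c * series_bound s p q u)"
proof -
  let ?\<gamma> = "exponent_loss TYPE('n) p" and ?\<rho> = "sub_exponent p" and ?r = "max 1 p"
  have \<rho>: "0 < ?\<rho>" by (rule sub_exponent_pos[OF \<Psi> p])
  obtain h where h: "2 * A \<le> 2 ^ h" using ex_power2_ge[of "2 * A"] by blast
  define A' where "A' = max A (2 ^ h)"
  have A': "0 < A'" "A \<le> A'" "2 ^ h \<le> A'" using A by (auto simp: A'_def)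
  define J where "J = (\<lambda>k. {j. k \<le> j + h \<and> j \<le> k + h})"
  \<comment> \<open>Only |j - k| <= h occurs, so the exponent is bounded whatever the sign of
    \<gamma> - s; D absorbs it together with a decay of rate 1, chosen for convenience.\<close>
  define D where "D = (\<bar>?\<gamma> - s\<bar> * ?\<rho> + 1) * real h"
  have J: "\<forall>k. \<forall>j\<in>J k. 2 ^ k \<le> A' * 2 ^ j"
  proof (intro allI ballI)
    fix k j assume that: "j \<in> J k"
    have "(2::real) ^ k \<le> 2 ^ (h + j)" using that by (intro power_increasing) (auto simp: J_def)
    also have "\<dots> \<le> A' * 2 ^ j" unfolding power_add by (intro mult_right_mono A') auto
    finally show "2 ^ k \<le> A' * 2 ^ j" .
  qed
  have Jc: "\<forall>k. \<forall>j\<in>J k. (?\<gamma> - s) * ?\<rho> * (real j - real k) \<le> D - 1 * \<bar>real j - real k\<bar>"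
  proof (intro allI ballI)
    fix k j assume "j \<in> J k"
    then have d: "\<bar>real j - real k\<bar> \<le> real h" by (auto simp: J_def)
    have "(?\<gamma> - s) * ?\<rho> * (real j - real k) \<le> \<bar>(?\<gamma> - s) * ?\<rho> * (real j - real k)\<bar>" by (rule abs_ge_self)
    also have "\<dots> = \<bar>?\<gamma> - s\<bar> * ?\<rho> * \<bar>real j - real k\<bar>" using \<rho> by (simp add: abs_mult)
    also have "\<dots> \<le> \<bar>?\<gamma> - s\<bar> * ?\<rho> * real h" using \<rho> d by (intro mult_left_mono) auto
    finally have "(?\<gamma> - s) * ?\<rho> * (real j - real k) \<le> \<bar>?\<gamma> - s\<bar> * ?\<rho> * real h" .
    from add_mono[OF this d] show "(?\<gamma> - s) * ?\<rho> * (real j - real k) \<le> D - 1 * \<bar>real j - real k\<bar>"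
      by (simp only: D_def distrib_right mult_1 le_diff_eq)
  qed
  from besov_sum_le[OF \<Psi> p q A'(1) zero_less_one J Jc] show ?thesis
  proof (elim exE)
    fix c assume c: "\<forall>(u :: nat \<Rightarrow> 'n functional) g v.
      tempered_sums u v \<and> (\<forall>j. band_limited \<Psi> (A' * 2 ^ j) (g j)) \<and>
      (\<forall>j. \<forall>\<phi>\<in>schwartz. u j \<phi> = (LINT x|lborel. g j x * \<phi> x)) \<and>
      (\<forall>k j. j \<notin> J k \<longrightarrow> (\<forall>\<phi>\<in>schwartz. u j (fourier (\<lambda>\<xi>. lp_bump \<Psi> k ((1 / 2 ^ k) *\<^sub>R \<xi>) * inv_fourier \<phi> \<xi>)) = 0)) \<and>
      (\<forall>k. (\<Sum>j. if j \<in> J k then fun_Lp_norm ?r (g j) else 0) < top) \<longrightarrow>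
      besov_norm \<Psi> s p q v \<le> ennreal c * series_bound s p q u"
    have main: "\<exists>v. tempered_sums u v \<and> v \<in> besov \<Psi> s p q \<and> besov_norm \<Psi> s p q v \<le> ennreal c * series_bound s p q u"
      if u: "\<And>j. tempered (u j)" and supp: "\<And>j. dist_support (dist_fourier (u j)) \<subseteq> {\<xi>. norm \<xi> \<le> A * 2 ^ j}"
        and ring: "\<And>j. 0 < j \<Longrightarrow> dist_support (dist_fourier (u j)) \<subseteq> {\<xi>. 1 / A * 2 ^ j \<le> norm \<xi>}"
        and fin: "series_bound s p q u < top" for u :: "nat \<Rightarrow> 'n functional"
    proof (rule band_limited_family[OF \<Psi> u supp A A'(2) series_bound_finite_term[OF \<Psi> q fin]])
      fix g assume g: "\<And>j. band_limited \<Psi> (A' * 2 ^ j) (g j)"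
        and ug: "\<And>j \<phi>. \<phi> \<in> schwartz \<Longrightarrow> u j \<phi> = (LINT x|lborel. g j x * \<phi> x)"
      have "\<exists>v. tempered v \<and> tempered_sums u v"
        by (rule ring_sums_tempered[OF \<Psi> A p q A'(1) u ring fin g ug])
      then obtain v where tv: "tempered v" and sums: "tempered_sums u v" by blast
      have gf: "fun_Lp_norm ?r (g j) < top" for j
      proof -
        obtain e where e: "\<forall>j (g :: real^'n \<Rightarrow> complex). band_limited \<Psi> (A' * 2 ^ j) g \<longrightarrow>
          fun_Lp_norm ?r g \<le> ennreal (e * 2 powr (?\<gamma> * real j)) * fun_Lp_norm p g"
          using Lp_norm_max_1_dyadic[OF \<Psi> A'(1) p, where 'n='n] by (elim exE conjE) (rule that)
        have "represents (g j) (u j)" by (rule band_represents[OF \<Psi> g ug])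
        then have "Lp_norm p (u j) = fun_Lp_norm p (g j)" by (rule Lp_norm_eq[OF \<Psi> p])
        then have "fun_Lp_norm ?r (g j) \<le> ennreal (e * 2 powr (?\<gamma> * real j)) * Lp_norm p (u j)" using e g by simp
        also have "\<dots> < top" using series_bound_finite_term[OF \<Psi> q fin, of j] by (simp add: ennreal_mult_less_top)
        finally show ?thesis .
      qed
      have bn: "besov_norm \<Psi> s p q v \<le> ennreal c * series_bound s p q u"
      proof (rule c[THEN spec[of _ u], THEN spec[of _ g], THEN spec[of _ v], THEN mp], intro conjI allI ballI impI sums g ug)
        show "u j (fourier (\<lambda>\<xi>. lp_bump \<Psi> k ((1 / 2 ^ k) *\<^sub>R \<xi>) * inv_fourier \<phi> \<xi>)) = 0"
          if "j \<notin> J k" and \<phi>: "\<phi> \<in> schwartz" for j k \<phi>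
        proof (cases "k \<le> j + h")
          case False
          then show ?thesis by (intro dyadic_piece_low_eq_0[OF \<Psi> u supp h _ \<phi>]) simp
        next
          case True
          then have "k + h < j" using that(1) by (simp add: J_def)
          then show ?thesis by (intro dyadic_piece_high_eq_0[OF \<Psi> u ring h A _ \<phi>]) auto
        qed
        \<comment> \<open>The sum is finite because \<open>J k\<close> contains only j <= k + h;
          convergence of the full series in L_r is not claimed here.\<close>
        show "(\<Sum>j. if j \<in> J k then fun_Lp_norm ?r (g j) else 0) < top" for k
        proof -
          have "(\<Sum>j. if j \<in> J k then fun_Lp_norm ?r (g j) else 0) = (\<Sum>j\<le>k + h. if j \<in> J k then fun_Lp_norm ?r (g j) else 0)"
            by (rule suminf_finite) (auto simp: J_def)
          also have "\<dots> < top" using gf by (simp add: less_top[symmetric])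
          finally show ?thesis .
        qed
      qed
      have "ennreal c * series_bound s p q u < top" unfolding ennreal_mult_less_top using fin by (intro disjI2 conjI ennreal_less_top)
      with bn have "besov_norm \<Psi> s p q v < top" by (rule le_less_trans)
      then have "v \<in> besov \<Psi> s p q" using tv by (simp add: besov_def)
      then show ?thesis using sums bn by blast
    qed
    show ?thesis
    proof (intro exI[of _ c] allI impI, elim conjE, rule main)
      fix u :: "nat \<Rightarrow> 'n functional" and j :: nat
      assume "\<forall>j>0. dist_support (dist_fourier (u j)) \<subseteq> {\<xi>. 1 / A * 2 ^ j \<le> norm \<xi> \<and> norm \<xi> \<le> A * 2 ^ j}" "0 < j"
      then show "dist_support (dist_fourier (u j)) \<subseteq> {\<xi>. 1 / A * 2 ^ j \<le> norm \<xi>}" by blast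
    qed auto
  qed
qed

text \<open>The smoothness \<gamma> = n/t - n equals the multiplier loss in L_t, so the weight
  2^(\<gamma> k) and the loss 2^(\<gamma> (j - k)) multiply to 2^(\<gamma> j), without a trace of k.
  Each piece is bounded by the l_t sum of the 2^(\<gamma> j)-weighted L_t quasi-norms, which the
  Nikolskii inequality and the embedding of l_q into l_t reduce to B.\<close>

lemma besov_sum_top_le:
  fixes p t :: real
  assumes p: "0 < p" "p \<le> t" and t: "t \<le> 1" and q: "0 < q" "q \<le> ennreal t" and A: "0 < A"
    and J: "\<forall>k. \<forall>j\<in>J k. 2 ^ k \<le> A * 2 ^ j"
  shows "\<exists>c. \<forall>(u :: nat \<Rightarrow> 'n::finite functional) g v.
    tempered_sums u v \<and> (\<forall>j. band_limited \<Psi> (A * 2 ^ j) (g j)) \<and>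
    (\<forall>j. \<forall>\<phi>\<in>schwartz. u j \<phi> = (LINT x|lborel. g j x * \<phi> x)) \<and>
    (\<forall>k j. j \<notin> J k \<longrightarrow> (\<forall>\<phi>\<in>schwartz. u j (fourier (\<lambda>\<xi>. lp_bump \<Psi> k ((1 / 2 ^ k) *\<^sub>R \<xi>) * inv_fourier \<phi> \<xi>)) = 0)) \<and>
    (\<Sum>j. fun_Lp_norm 1 (g j)) < top \<longrightarrow>
    besov_norm \<Psi> (real CARD('n) * (1 / t) - real CARD('n)) (ennreal t) top v
      \<le> ennreal c * series_bound (real CARD('n) * (1 / p) - real CARD('n)) (ennreal p) q u"
proof -
  define \<gamma> where "\<gamma> = real CARD('n) * (1 / t) - real CARD('n)"
  define \<sigma> where "\<sigma> = real CARD('n) * (1 / p) - real CARD('n)"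
  have t0: "0 < t" using p by simp
  have \<gamma>: "exponent_loss TYPE('n) (ennreal t) = \<gamma>" unfolding \<gamma>_def by (rule exponent_loss_less_1[OF \<Psi> t0 t])
  have \<rho>: "sub_exponent (ennreal t) = t" using t0 t by (auto simp: sub_exponent_def[OF \<Psi>])
  have m: "max 1 (ennreal t) = 1" using t by (simp add: max_def)
  have pt: "0 < ennreal t" "0 < ennreal p" using t0 p by auto
  obtain C where C: "0 < C" and est: "\<forall>(u :: nat \<Rightarrow> 'n functional) g v J k.
      tempered_sums u v \<and> (\<forall>j. band_limited \<Psi> (A * 2 ^ j) (g j)) \<and>
      (\<forall>j. \<forall>\<phi>\<in>schwartz. u j \<phi> = (LINT x|lborel. g j x * \<phi> x)) \<and>
      (\<forall>j\<in>J. 2 ^ k \<le> A * 2 ^ j) \<and>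
      (\<forall>j. j \<notin> J \<longrightarrow> (\<forall>\<phi>\<in>schwartz. u j (fourier (\<lambda>\<xi>. lp_bump \<Psi> k ((1 / 2 ^ k) *\<^sub>R \<xi>) * inv_fourier \<phi> \<xi>)) = 0)) \<and>
      (\<Sum>j. if j \<in> J then fun_Lp_norm 1 (g j) else 0) < top \<longrightarrow>
      epowr (Lp_norm (ennreal t) (dist_inv_fourier (dist_mult (dyadic \<Psi> k) (dist_fourier v)))) t
        \<le> ennreal C * (\<Sum>j. if j \<in> J then epowr (ennreal (2 powr (\<gamma> * (real j - real k))) * Lp_norm (ennreal t) (u j)) t else 0)"
    using dyadic_piece_estimate[OF \<Psi> pt(1) A, where 'n='n] unfolding \<gamma> \<rho> m by (elim exE conjE) (rule that)
  obtain c where c: "0 < c" "\<forall>j g. band_limited \<Psi> (A * 2 ^ j) (g :: real^'n \<Rightarrow> complex) \<longrightarrow>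
    fun_Lp_norm (ennreal t) g \<le> ennreal (c * 2 powr ((real CARD('n) * (1 / p) - real CARD('n) * (1 / t)) * real j)) * fun_Lp_norm (ennreal p) g"
    using nikolskii_dyadic[OF \<Psi> A p t, where 'n='n] by (elim exE conjE) (rule that)
  have main: "besov_norm \<Psi> \<gamma> (ennreal t) top v \<le> ennreal (C powr (1 / t) * c) * series_bound \<sigma> (ennreal p) q u"
    if sums: "tempered_sums u v" and g: "\<forall>j. band_limited \<Psi> (A * 2 ^ j) (g j)"
      and ug: "\<forall>j. \<forall>\<phi>\<in>schwartz. u j \<phi> = (LINT x|lborel. g j x * \<phi> x)"
      and van: "\<forall>k j. j \<notin> J k \<longrightarrow> (\<forall>\<phi>\<in>schwartz. u j (fourier (\<lambda>\<xi>. lp_bump \<Psi> k ((1 / 2 ^ k) *\<^sub>R \<xi>) * inv_fourier \<phi> \<xi>)) = 0)"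
      and fin: "(\<Sum>j. fun_Lp_norm 1 (g j)) < top"
    for u :: "nat \<Rightarrow> 'n functional" and g v
  proof -
    let ?U = "\<lambda>j. Lp_norm (ennreal t) (u j)" and ?V = "\<lambda>j. ennreal (2 powr (\<sigma> * real j)) * Lp_norm (ennreal p) (u j)"
    define W where "W = (\<lambda>k. Lp_norm (ennreal t) (dist_inv_fourier (dist_mult (dyadic \<Psi> k) (dist_fourier v))))"
    have B: "series_bound \<sigma> (ennreal p) q u = weighted_lq 0 q ?V"
      unfolding series_bound_def by (rule weighted_lq_shift[OF q(1)])
    \<comment> \<open>Passing from L_p to L_t costs 2^((n/p - n/t) j), which is exactly the gap
      between the smoothness \<gamma> and the smoothness \<sigma> = n/p - n of the weights in
      B.\<close>
    have UV: "ennreal (2 powr (\<gamma> * real j)) * ?U j \<le> ennreal c * ?V j" for j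
    proof -
      have "represents (g j) (u j)" by (rule band_represents[OF \<Psi>]) (use g ug in auto)
      note L = Lp_norm_eq[OF \<Psi> pt(1) this] Lp_norm_eq[OF \<Psi> pt(2) this]
      let ?x = "(real CARD('n) * (1 / p) - real CARD('n) * (1 / t)) * real j"
      have "?U j \<le> ennreal (c * 2 powr ?x) * Lp_norm (ennreal p) (u j)" unfolding L using c(2) g by simp
      from mult_left_mono[OF this, of "ennreal (2 powr (\<gamma> * real j))"]
      have "ennreal (2 powr (\<gamma> * real j)) * ?U j \<le> ennreal (2 powr (\<gamma> * real j)) * (ennreal (c * 2 powr ?x) * Lp_norm (ennreal p) (u j))"
        by simp
      also have "\<dots> = ennreal c * (ennreal (2 powr (\<gamma> * real j) * 2 powr ?x) * Lp_norm (ennreal p) (u j))"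
        using c(1) by (simp add: ennreal_mult mult_ac)
      also have "2 powr (\<gamma> * real j) * 2 powr ?x = 2 powr (\<sigma> * real j)"
        unfolding powr_add[symmetric] by (simp add: \<gamma>_def \<sigma>_def algebra_simps)
      finally show ?thesis .
    qed
    have bound: "ennreal (2 powr (\<gamma> * real k)) * W k \<le> ennreal (C powr (1 / t) * c) * series_bound \<sigma> (ennreal p) q u" for k
    proof -
      have fk: "(\<Sum>j. if j \<in> J k then fun_Lp_norm 1 (g j) else 0) < top"
      proof -
        have "(\<Sum>j. if j \<in> J k then fun_Lp_norm 1 (g j) else 0) \<le> (\<Sum>j. fun_Lp_norm 1 (g j))"
          by (intro suminf_le summableI) auto
        then show ?thesis using fin by (rule le_less_trans)
      qed
      have "epowr (W k) t \<le> ennreal C * (\<Sum>j. if j \<in> J k then epowr (ennreal (2 powr (\<gamma> * (real j - real k))) * ?U j) t else 0)"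
        unfolding W_def
        by (rule est[THEN spec[of _ u], THEN spec[of _ g], THEN spec[of _ v], THEN spec[of _ "J k"], THEN spec[of _ k], THEN mp])
          (use sums g ug van fk J in auto)
      from mult_left_mono[OF this, of "epowr (ennreal (2 powr (\<gamma> * real k))) t"]
      have "epowr (ennreal (2 powr (\<gamma> * real k)) * W k) t
          \<le> epowr (ennreal (2 powr (\<gamma> * real k))) t * (ennreal C * (\<Sum>j. if j \<in> J k then epowr (ennreal (2 powr (\<gamma> * (real j - real k))) * ?U j) t else 0))"
        by (simp add: epowr_mult)
      also have "\<dots> = ennreal C * (\<Sum>j. epowr (ennreal (2 powr (\<gamma> * real k))) t * (if j \<in> J k then epowr (ennreal (2 powr (\<gamma> * (real j - real k))) * ?U j) t else 0))"
        by (simp add: mult.left_commute)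
      also have "\<dots> \<le> ennreal C * (\<Sum>j. epowr (ennreal c) t * epowr (?V j) t)"
      proof (intro mult_left_mono suminf_le summableI)
        fix j
        have "epowr (ennreal (2 powr (\<gamma> * real k))) t * epowr (ennreal (2 powr (\<gamma> * (real j - real k))) * ?U j) t
            = epowr (ennreal (2 powr (\<gamma> * real j)) * ?U j) t"
        proof -
          have "2 powr (\<gamma> * real k) * 2 powr (\<gamma> * (real j - real k)) = 2 powr (\<gamma> * real j)"
            unfolding powr_add[symmetric] by (simp add: algebra_simps)
          then have "ennreal (2 powr (\<gamma> * real j)) = ennreal (2 powr (\<gamma> * real k)) * ennreal (2 powr (\<gamma> * (real j - real k)))"
            by (simp flip: ennreal_mult)
          then show ?thesis by (simp only: epowr_mult mult.assoc)
        qed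
        also have "\<dots> \<le> epowr (ennreal c * ?V j) t" using t0 by (intro epowr_mono UV) simp
        also have "\<dots> = epowr (ennreal c) t * epowr (?V j) t" by (rule epowr_mult)
        finally show "epowr (ennreal (2 powr (\<gamma> * real k))) t * (if j \<in> J k then epowr (ennreal (2 powr (\<gamma> * (real j - real k))) * ?U j) t else 0)
            \<le> epowr (ennreal c) t * epowr (?V j) t" by simp
      qed simp
      also have "\<dots> = ennreal C * (epowr (ennreal c) t * (\<Sum>j. epowr (?V j) t))" unfolding ennreal_suminf_cmult ..
      also have "\<dots> \<le> ennreal C * (epowr (ennreal c) t * epowr (series_bound \<sigma> (ennreal p) q u) t)"
        unfolding B by (intro mult_left_mono suminf_le_weighted_lq q t0) auto
      also have "\<dots> = epowr (ennreal (C powr (1 / t) * c) * series_bound \<sigma> (ennreal p) q u) t"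
      proof -
        have "epowr (ennreal (C powr (1 / t))) t = ennreal C"
          using C t0 by (simp add: epowr_ennreal powr_powr)
        then show ?thesis using c(1) by (simp add: epowr_mult ennreal_mult mult.assoc)
      qed
      finally show ?thesis by (simp only: epowr_mono_iff[OF t0])
    qed
    have "besov_norm \<Psi> \<gamma> (ennreal t) top v = (SUP k. ennreal (2 powr (\<gamma> * real k)) * W k)"
      unfolding besov_norm_def W_def weighted_lq_def infinity_ennreal_def by simp
    also have "\<dots> \<le> ennreal (C powr (1 / t) * c) * series_bound \<sigma> (ennreal p) q u" by (rule SUP_least[OF bound])
    finally show ?thesis .
  qed
  show ?thesis
    unfolding \<gamma>_def[symmetric] \<sigma>_def[symmetric]
    by (intro exI[of _ "C powr (1 / t) * c"] allI impI, elim conjE, rule main)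
qed

end

section \<open>Convergence in L_1 in the limiting case\<close>

context
  fixes \<Psi> :: "real \<Rightarrow> real"
  assumes \<Psi>: "besov_cutoff \<Psi>"
begin

text \<open>The weight 2^(\<sigma> j) in B is precisely the Nikolskii cost of passing from L_p to
  L_1, and q <= 1 makes the weighted quasi-norms summable; hence absolute convergence in L_1. The
  parameter t concerns only the Besov claim.\<close>

lemma band_sums_L1:
  fixes p t :: real
  assumes p: "0 < p" "p < 1" "p \<le> t" and t: "t \<le> 1" and q: "0 < q" "q \<le> ennreal t" and A: "0 < A"
  shows "\<exists>c c'. \<forall>u :: nat \<Rightarrow> 'n::finite functional. (\<forall>j. tempered (u j)) \<and>
    (\<forall>j. dist_support (dist_fourier (u j)) \<subseteq> {\<xi>. norm \<xi> \<le> A * 2 ^ j}) \<and>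
    series_bound (real CARD('n) * (1 / p) - real CARD('n)) (ennreal p) q u < \<infinity> \<longrightarrow>
    (\<exists>v. Lp_sums 1 u v \<and> Lp_norm 1 v \<le> ennreal c * series_bound (real CARD('n) * (1 / p) - real CARD('n)) (ennreal p) q u \<and>
      v \<in> besov \<Psi> (real CARD('n) * (1 / t) - real CARD('n)) (ennreal t) \<infinity> \<and>
      besov_norm \<Psi> (real CARD('n) * (1 / t) - real CARD('n)) (ennreal t) \<infinity> v
        \<le> ennreal c' * series_bound (real CARD('n) * (1 / p) - real CARD('n)) (ennreal p) q u)"
proof -
  define \<gamma> where "\<gamma> = real CARD('n) * (1 / t) - real CARD('n)"
  define \<sigma> where "\<sigma> = real CARD('n) * (1 / p) - real CARD('n)"
  have \<sigma>: "exponent_loss TYPE('n) (ennreal p) = \<sigma>"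
    unfolding \<sigma>_def by (rule exponent_loss_less_1[OF \<Psi> p(1) less_imp_le[OF p(2)]])
  have m: "max 1 (ennreal p) = 1" using p by (simp add: max_def)
  have p0: "0 < ennreal p" using p by simp
  obtain h where h: "2 * A \<le> 2 ^ h" using ex_power2_ge[of "2 * A"] by blast
  define A' where "A' = max A (2 ^ h)"
  have A': "0 < A'" "A \<le> A'" "2 ^ h \<le> A'" using A by (auto simp: A'_def)
  define J where "J = (\<lambda>k. {j. k \<le> j + h})"
  have J: "\<forall>k. \<forall>j\<in>J k. 2 ^ k \<le> A' * 2 ^ j"
  proof (intro allI ballI)
    fix k j assume that: "j \<in> J k"
    have "(2::real) ^ k \<le> 2 ^ (h + j)" using that by (intro power_increasing) (auto simp: J_def)
    also have "\<dots> \<le> A' * 2 ^ j" unfolding power_add by (intro mult_right_mono A') auto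
    finally show "2 ^ k \<le> A' * 2 ^ j" .
  qed
  obtain e where e: "\<forall>j g. band_limited \<Psi> (A' * 2 ^ j) (g :: real^'n \<Rightarrow> complex) \<longrightarrow>
    fun_Lp_norm 1 g \<le> ennreal (e * 2 powr (\<sigma> * real j)) * fun_Lp_norm (ennreal p) g" "0 < e"
    using Lp_norm_max_1_dyadic[OF \<Psi> A'(1) p0, where 'n='n] unfolding \<sigma> m by (elim exE conjE) (rule that)
  obtain c' where c': "\<forall>(u :: nat \<Rightarrow> 'n functional) g v.
    tempered_sums u v \<and> (\<forall>j. band_limited \<Psi> (A' * 2 ^ j) (g j)) \<and>
    (\<forall>j. \<forall>\<phi>\<in>schwartz. u j \<phi> = (LINT x|lborel. g j x * \<phi> x)) \<and>
    (\<forall>k j. j \<notin> J k \<longrightarrow> (\<forall>\<phi>\<in>schwartz. u j (fourier (\<lambda>\<xi>. lp_bump \<Psi> k ((1 / 2 ^ k) *\<^sub>R \<xi>) * inv_fourier \<phi> \<xi>)) = 0)) \<and>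
    (\<Sum>j. fun_Lp_norm 1 (g j)) < top \<longrightarrow>
    besov_norm \<Psi> \<gamma> (ennreal t) top v \<le> ennreal c' * series_bound \<sigma> (ennreal p) q u"
    using besov_sum_top_le[OF \<Psi> p(1) p(3) t q A'(1) J, where 'n='n] unfolding \<gamma>_def[symmetric] \<sigma>_def[symmetric] by (elim exE) (rule that)
  have main: "\<exists>v. Lp_sums 1 u v \<and> Lp_norm 1 v \<le> ennreal e * series_bound \<sigma> (ennreal p) q u \<and>
      v \<in> besov \<Psi> \<gamma> (ennreal t) top \<and> besov_norm \<Psi> \<gamma> (ennreal t) top v \<le> ennreal c' * series_bound \<sigma> (ennreal p) q u"
    if u: "\<And>j. tempered (u j)" and supp: "\<And>j. dist_support (dist_fourier (u j)) \<subseteq> {\<xi>. norm \<xi> \<le> A * 2 ^ j}"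
      and fin: "series_bound \<sigma> (ennreal p) q u < top" for u :: "nat \<Rightarrow> 'n functional"
  proof (rule band_limited_family[OF \<Psi> u supp A A'(2) series_bound_finite_term[OF \<Psi> q(1) fin]])
    fix g assume g: "\<And>j. band_limited \<Psi> (A' * 2 ^ j) (g j)"
      and ug: "\<And>j \<phi>. \<phi> \<in> schwartz \<Longrightarrow> u j \<phi> = (LINT x|lborel. g j x * \<phi> x)"
    let ?B = "series_bound \<sigma> (ennreal p) q u"
    let ?V = "\<lambda>j. ennreal (2 powr (\<sigma> * real j)) * Lp_norm (ennreal p) (u j)"
    have gm: "g j \<in> borel_measurable borel" for j by (rule band_limited_measurable[OF \<Psi> g])
    have rep: "represents (g j) (u j)" for j by (rule band_represents[OF \<Psi> g ug])
    have L1: "Lp_norm 1 (u j) = fun_Lp_norm 1 (g j)" for j by (rule Lp_norm_eq[OF \<Psi> _ rep]) simp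
    have Lp: "Lp_norm (ennreal p) (u j) = fun_Lp_norm (ennreal p) (g j)" for j by (rule Lp_norm_eq[OF \<Psi> p0 rep])
    have term_le: "fun_Lp_norm 1 (g j) \<le> ennreal e * ?V j" for j
    proof -
      have "fun_Lp_norm 1 (g j) \<le> ennreal (e * 2 powr (\<sigma> * real j)) * Lp_norm (ennreal p) (u j)"
        unfolding Lp using e(1) g by simp
      then show ?thesis using e(2) by (simp add: ennreal_mult mult.assoc)
    qed
    have V: "(\<Sum>j. ?V j) \<le> ?B"
    proof -
      have "q \<le> ennreal 1" using q(2) ennreal_leI[OF t] by (rule order_trans)
      from suminf_le_weighted_lq[OF q(1) this, of ?V] show ?thesis
        unfolding series_bound_def weighted_lq_shift[OF q(1), of \<sigma>] by simp
    qed
    have le: "(\<Sum>j. fun_Lp_norm 1 (g j)) \<le> ennreal e * ?B"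
    proof -
      have "(\<Sum>j. fun_Lp_norm 1 (g j)) \<le> (\<Sum>j. ennreal e * ?V j)" by (intro suminf_le summableI term_le)
      also have "\<dots> = ennreal e * (\<Sum>j. ?V j)" by (rule ennreal_suminf_cmult)
      also have "\<dots> \<le> ennreal e * ?B" by (intro mult_left_mono V) simp
      finally show ?thesis .
    qed
    have "ennreal e * ?B < top" unfolding ennreal_mult_less_top using fin by (intro disjI2 conjI ennreal_less_top)
    with le have finr: "(\<Sum>j. fun_Lp_norm 1 (g j)) < top" by (rule le_less_trans)
    then have finL: "(\<Sum>j. Lp_norm 1 (u j)) < top" unfolding L1 .
    note S = Lr_series[OF order_refl gm finr]
    define v where "v = (\<lambda>\<phi>. LINT x|lborel. (\<Sum>j. g j x) * \<phi> x)"
    note Lv = Lp_sums_series[OF \<Psi> order_refl u rep finL, folded v_def]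
    have tv: "tempered v" unfolding v_def by (rule Lr_tempered(1)[OF order_refl S(1) le_less_trans[OF S(3) finr]])
    have sums: "tempered_sums u v" unfolding tempered_sums_def v_def using S(5) ug by simp
    have n1: "Lp_norm 1 v \<le> ennreal e * ?B" using Lv(2) le unfolding L1 by (rule order_trans)
    have bn: "besov_norm \<Psi> \<gamma> (ennreal t) top v \<le> ennreal c' * ?B"
    proof (rule c'[THEN spec[of _ u], THEN spec[of _ g], THEN spec[of _ v], THEN mp], intro conjI allI ballI impI sums g ug finr)
      show "u j (fourier (\<lambda>\<xi>. lp_bump \<Psi> k ((1 / 2 ^ k) *\<^sub>R \<xi>) * inv_fourier \<phi> \<xi>)) = 0"
        if "j \<notin> J k" "\<phi> \<in> schwartz" for j k \<phi>
        by (rule dyadic_piece_low_eq_0[OF \<Psi> u supp h _ that(2)]) (use that(1) in \<open>simp add: J_def\<close>)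
    qed
    have "ennreal c' * ?B < top" unfolding ennreal_mult_less_top using fin by (intro disjI2 conjI ennreal_less_top)
    with bn have "besov_norm \<Psi> \<gamma> (ennreal t) top v < top" by (rule le_less_trans)
    then have "v \<in> besov \<Psi> \<gamma> (ennreal t) top" using tv by (simp add: besov_def)
    then show ?thesis using Lv(1) n1 bn by blast
  qed
  show ?thesis
    unfolding \<gamma>_def[symmetric] \<sigma>_def[symmetric] infinity_ennreal_def
    by (intro exI[of _ e] exI[of _ c'] allI impI, elim conjE, rule main) auto
qed

end

theorem theorem3p1:
  fixes \<Psi> :: "real \<Rightarrow> real" and s :: real and p q :: ennreal
  assumes "besov_cutoff \<Psi>" and "0 < p" and "0 < q"
  shows
    "(s = 0 \<and> 1 \<le> p \<and> q \<le> 1 \<longrightarrow>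
        (\<forall>u :: nat \<Rightarrow> 'n::finite functional. (\<forall>j. tempered (u j)) \<and> series_bound s p q u < \<infinity> \<longrightarrow>
          (\<exists>v. Lp_sums p u v \<and> Lp_norm p v \<le> series_bound s p q u)))
     \<and>
     (\<forall>A>0. s > max 0 (real CARD('n) * recip p - real CARD('n)) \<longrightarrow>
        (\<exists>c. \<forall>u :: nat \<Rightarrow> 'n functional.
          (\<forall>j. tempered (u j)) \<and>
          (\<forall>j. dist_support (dist_fourier (u j)) \<subseteq> {\<xi>. norm \<xi> \<le> A * 2 ^ j}) \<and>
          series_bound s p q u < \<infinity> \<longrightarrow>
          (\<exists>v. tempered_sums u v \<and> v \<in> besov \<Psi> s p q \<and>
               besov_norm \<Psi> s p q v \<le> ennreal c * series_bound s p q u)))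
     \<and>
     (\<forall>A>0. s = real CARD('n) * recip p - real CARD('n) \<and> p < 1 \<and> q \<le> 1 \<longrightarrow>
        (\<exists>c c'. \<forall>u :: nat \<Rightarrow> 'n functional.
          (\<forall>j. tempered (u j)) \<and>
          (\<forall>j. dist_support (dist_fourier (u j)) \<subseteq> {\<xi>. norm \<xi> \<le> A * 2 ^ j}) \<and>
          series_bound s p q u < \<infinity> \<longrightarrow>
          (\<exists>v. Lp_sums 1 u v \<and> Lp_norm 1 v \<le> ennreal c * series_bound s p q u \<and>
               (q \<le> p \<longrightarrow>
                  v \<in> besov \<Psi> (real CARD('n) * recip p - real CARD('n)) p \<infinity> \<and>
                  besov_norm \<Psi> (real CARD('n) * recip p - real CARD('n)) p \<infinity> v \<le> ennreal c' * series_bound s p q u) \<and>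
               (p < q \<longrightarrow>
                  v \<in> besov \<Psi> (real CARD('n) * recip q - real CARD('n)) q \<infinity> \<and>
                  besov_norm \<Psi> (real CARD('n) * recip q - real CARD('n)) q \<infinity> v \<le> ennreal c' * series_bound s p q u))))
     \<and>
     (\<forall>A>0. \<exists>c. \<forall>u :: nat \<Rightarrow> 'n functional.
        (\<forall>j. tempered (u j)) \<and>
        (\<forall>j. dist_support (dist_fourier (u j)) \<subseteq> {\<xi>. norm \<xi> \<le> A * 2 ^ j}) \<and>
        (\<forall>j>0. dist_support (dist_fourier (u j)) \<subseteq> {\<xi>. 1 / A * 2 ^ j \<le> norm \<xi> \<and> norm \<xi> \<le> A * 2 ^ j}) \<and>
        series_bound s p q u < \<infinity> \<longrightarrow>
        (\<exists>v. tempered_sums u v \<and> v \<in> besov \<Psi> s p q \<and>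
             besov_norm \<Psi> s p q v \<le> ennreal c * series_bound s p q u))"
proof (intro conjI impI allI)
  let ?d = "real CARD('n)"
  note \<Psi> = assms(1) and p = assms(2) and q = assms(3)
  show "\<exists>v. Lp_sums p u v \<and> Lp_norm p v \<le> series_bound s p q u"
    if h: "s = 0 \<and> 1 \<le> p \<and> q \<le> 1" and u: "(\<forall>j. tempered (u j)) \<and> series_bound s p q u < \<infinity>"
    for u :: "nat \<Rightarrow> 'n functional"
    using Lp_sums_of_series_bound[OF \<Psi>, of p q u] h u q by simp
  show "\<exists>c. \<forall>u :: nat \<Rightarrow> 'n functional.
      (\<forall>j. tempered (u j)) \<and>
      (\<forall>j. dist_support (dist_fourier (u j)) \<subseteq> {\<xi>. norm \<xi> \<le> A * 2 ^ j}) \<and>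
      series_bound s p q u < \<infinity> \<longrightarrow>
      (\<exists>v. tempered_sums u v \<and> v \<in> besov \<Psi> s p q \<and>
           besov_norm \<Psi> s p q v \<le> ennreal c * series_bound s p q u)"
    if "0 < A" "s > max 0 (?d * recip p - ?d)" for A
    by (rule band_sums_besov[OF \<Psi> p q that(1)]) (use that(2) in \<open>simp add: exponent_loss_def[OF \<Psi>]\<close>)
  show "\<exists>c. \<forall>u :: nat \<Rightarrow> 'n functional.
        (\<forall>j. tempered (u j)) \<and>
        (\<forall>j. dist_support (dist_fourier (u j)) \<subseteq> {\<xi>. norm \<xi> \<le> A * 2 ^ j}) \<and>
        (\<forall>j>0. dist_support (dist_fourier (u j)) \<subseteq> {\<xi>. 1 / A * 2 ^ j \<le> norm \<xi> \<and> norm \<xi> \<le> A * 2 ^ j}) \<and>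
        series_bound s p q u < \<infinity> \<longrightarrow>
        (\<exists>v. tempered_sums u v \<and> v \<in> besov \<Psi> s p q \<and>
             besov_norm \<Psi> s p q v \<le> ennreal c * series_bound s p q u)" if "0 < A" for A
    by (rule ring_sums_besov[OF \<Psi> p q that])
  fix A :: real assume A: "0 < A" and h: "s = ?d * recip p - ?d \<and> p < 1 \<and> q \<le> 1"
  obtain r where r: "p = ennreal r" "0 < r" "r < 1" using p h by (cases p) auto
  obtain t where t: "q = ennreal t" "0 < t" "t \<le> 1" using q h by (cases q) (auto simp: top_unique)
  have s: "s = ?d * (1 / r) - ?d" using h r by (simp add: recip_ennreal)
  show "\<exists>c c'. \<forall>u :: nat \<Rightarrow> 'n functional.
          (\<forall>j. tempered (u j)) \<and>
          (\<forall>j. dist_support (dist_fourier (u j)) \<subseteq> {\<xi>. norm \<xi> \<le> A * 2 ^ j}) \<and>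
          series_bound s p q u < \<infinity> \<longrightarrow>
          (\<exists>v. Lp_sums 1 u v \<and> Lp_norm 1 v \<le> ennreal c * series_bound s p q u \<and>
               (q \<le> p \<longrightarrow>
                  v \<in> besov \<Psi> (?d * recip p - ?d) p \<infinity> \<and>
                  besov_norm \<Psi> (?d * recip p - ?d) p \<infinity> v \<le> ennreal c' * series_bound s p q u) \<and>
               (p < q \<longrightarrow>
                  v \<in> besov \<Psi> (?d * recip q - ?d) q \<infinity> \<and>
                  besov_norm \<Psi> (?d * recip q - ?d) q \<infinity> v \<le> ennreal c' * series_bound s p q u))"
  \<comment> \<open>The auxiliary exponent t is p in the first case and q in the second, so that p
    <= t, q <= t and t <= 1 hold in both; the other implication in the conclusion is then
    vacuous.\<close>
  proof (cases "q \<le> p")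
    case True
    have np: "\<not> p < q" using True by simp
    show ?thesis
      using band_sums_L1[OF \<Psi> r(2,3) order_refl less_imp_le[OF r(3)] q True[unfolded r(1)] A, where 'n='n] np True
      unfolding s r(1) recip_ennreal[OF r(2)] by (simp only: simp_thms)
  next
    case False
    then have pq: "p < q" by simp
    then have rt: "r \<le> t" using r t by (simp add: ennreal_less_iff)
    show ?thesis
      using band_sums_L1[OF \<Psi> r(2,3) rt t(3) q eq_refl[OF t(1)] A, where 'n='n] pq False
      unfolding s r(1) t(1) recip_ennreal[OF r(2)] recip_ennreal[OF t(2)] by (simp only: simp_thms)
  qed
qed

end
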